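(* Let $Q(z,u,\alpha_0,\alpha_1,\alpha_2)$ be a polynomial with non-negative coefficients which is linear in $(\alpha_0,\alpha_1,\alpha_2)$, and let $M(z,u)=\sum_{i\ge 0}M_i(z)u^i$ be the unique formal power series solution of \[ M(z,u) = zQ\bigl(z,u,M(z,u),\Delta M(z,u),\Delta^{(2)}M(z,u)\bigr), \] where $\Delta M(z,u)=\frac{M(z,u)-M_0(z)}{u}$ and $\Delta^{(2)}M(z,u)=\frac{M(z,u)-M_0(z)-uM_1(z)}{u^2}$. Suppose that the dependency graph of the infinite system $M_i(z)=[u^i]\,zQ(z,u,M(z,u),\Delta M(z,u),\Delta^{(2)}M(z,u))$, $i\ge 0$, is strongly connected. Then $M_0(z)$ and $M_1(z)$ have a common radius of convergence $z_0$ and a square root singularity at $z_0$. Furthermore, there exist an integer $d\ge 1$, a non-empty set $J\subseteq\{0,1,\dots,d-1\}$ of residue classes modulo $d$ and constants $c_j>0$ ($j\in J$) such that for $j\in J$ \[ M_n:=[z^n]\,M_0(z) = c_j\, n^{-3/2} z_0^{-n}\left(1+O\left(\tfrac1n\right)\right),\qquad (n\equiv j \bmod d,\ n\to\infty), \] and if $n\equiv j\bmod d$ with $j\notin J$, then either $M_n=0$ or $M_n=O(n^{-5/2}z_0^{-n})$. An analogous statement holds for the coefficients $[z^n]\,M_1(z)$.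
   Context: Dependency graph: regarding the infinite system as equations $M_i(z)=Q_i(z,M_0(z),M_1(z),\dots)$ with $Q_i$ power series with non-negative coefficients, the dependency graph is the digraph with vertex set $\{M_0,M_1,\dots\}$ and an edge $(M_i,M_j)$ iff $Q_j$ depends on $M_i$ (i.e. $\partial Q_j/\partial M_i\ne 0$); the system is strongly connected if this digraph is strongly connected. An algebraic function $f$ has a square root singularity at $z_0$ if its Puiseux expansion at $z_0$ is $f(z)=f_0+f_1(z-z_0)^{1/2}+f_2(z-z_0)+f_3(z-z_0)^{3/2}+\cdots$ with $f_1\neq 0$.
   Formalization: The solution M(z,u) is assumed to be nonzero; otherwise, e.g. for Q = uα_0 + α_1, the system is strongly connected but M = 0 has no finite radius of convergence and no singularity. *)

theory Defs
  imports
    "HOL-Analysis.Analysis"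
    "HOL-Library.Poly_Mapping"
    "HOL-Library.Landau_Symbols"
    "HOL-Computational_Algebra.Computational_Algebra"
begin

text \<open>
  A polynomial in the variables z, u, alpha0, alpha1, alpha2; the key (i, j, a, b, c) stands
  for the monomial with exponents i, j, a, b, c of these variables, in this order.
\<close>

type_synonym poly5 = "(nat \<times> nat \<times> nat \<times> nat \<times> nat) \<Rightarrow>\<^sub>0 real"

definition nonneg_coeffs :: "poly5 \<Rightarrow> bool" where
  "nonneg_coeffs Q \<longleftrightarrow> (\<forall>m. Poly_Mapping.lookup Q m \<ge> 0)"

text \<open>
  Linear means of total degree at most one in the alphas: a part free of the alphas is allowed,
  since a homogeneous linear Q only has the solution M = 0.
\<close>

definition linear_in_alphas :: "poly5 \<Rightarrow> bool" where
  "linear_in_alphas Q \<longleftrightarrow> (\<forall>(i, j, a, b, c) \<in> Poly_Mapping.keys Q. a + b + c \<le> 1)"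

text \<open>
  The right-hand side z Q(z, u, M, Delta M, Delta2 M) as a power series in u over a commutative
  ring, where h maps the real coefficients of Q into that ring and z is an element of it.
  Since the shift of a series by k discards the first k coefficients and divides by the k-th
  power of u, the shifts by 1 and 2 are the operators Delta and Delta2.
\<close>

definition catalytic_rhs ::
    "(real \<Rightarrow> 'r) \<Rightarrow> 'r \<Rightarrow> poly5 \<Rightarrow> 'r::comm_ring_1 fps \<Rightarrow> 'r fps" where
  "catalytic_rhs h z Q M =
     fps_const z *
     (\<Sum>(i, j, a, b, c) \<in> Poly_Mapping.keys Q.
        fps_const (h (Poly_Mapping.lookup Q (i, j, a, b, c)) * z ^ i) * fps_X ^ j *
        M ^ a * fps_shift 1 M ^ b * fps_shift 2 M ^ c)"

text \<open>
  The series M(z,u) is a power series in u whose coefficients are power series in z.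
\<close>

definition solves_catalytic :: "poly5 \<Rightarrow> real fps fps \<Rightarrow> bool" where
  "solves_catalytic Q M \<longleftrightarrow> M = catalytic_rhs fps_const fps_X Q M"

text \<open>
  Polynomials over the power series in z, in infinitely many indeterminates; the i-th one
  stands for the unknown series with index i. A monomial is its finitely supported exponent
  function.
\<close>

type_synonym mpoly_z = "(nat \<Rightarrow>\<^sub>0 nat) \<Rightarrow>\<^sub>0 real fps"

definition unknown :: "nat \<Rightarrow> mpoly_z" where
  "unknown i = Poly_Mapping.single (Poly_Mapping.single i 1) 1"

definition mpoly_const :: "real fps \<Rightarrow> mpoly_z" where
  "mpoly_const f = Poly_Mapping.single 0 f"

text \<open>
  The right-hand side of the i-th equation of the infinite system: the coefficient of the i-th
  power of u in the right-hand side, evaluated at the generic series.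
\<close>

definition system_rhs :: "poly5 \<Rightarrow> nat \<Rightarrow> mpoly_z" where
  "system_rhs Q i =
     fps_nth (catalytic_rhs (\<lambda>r. mpoly_const (fps_const r)) (mpoly_const fps_X) Q
                (Abs_fps unknown)) i"

text \<open>
  The formal partial derivative. The truncated subtraction of exponents is harmless, as the
  coefficient vanishes whenever it truncates.
\<close>

definition partial_deriv :: "nat \<Rightarrow> mpoly_z \<Rightarrow> mpoly_z" where
  "partial_deriv i p =
     (\<Sum>m \<in> Poly_Mapping.keys p.
        Poly_Mapping.single (m - Poly_Mapping.single i 1)
          (of_nat (Poly_Mapping.lookup m i) * Poly_Mapping.lookup p m))"

definition dependency_graph :: "poly5 \<Rightarrow> (nat \<times> nat) set" where
  "dependency_graph Q = {(i, j). partial_deriv i (system_rhs Q j) \<noteq> 0}"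

definition strongly_connected_system :: "poly5 \<Rightarrow> bool" where
  "strongly_connected_system Q \<longleftrightarrow> (\<forall>i j. (i, j) \<in> (dependency_graph Q)\<^sup>*)"

definition algebraic_fps :: "'a::field fps \<Rightarrow> bool" where
  "algebraic_fps f \<longleftrightarrow> (\<exists>P :: 'a poly poly. P \<noteq> 0 \<and> poly (map_poly fps_of_poly P) f = 0)"

text \<open>
  A square root singularity, on the circle of convergence, of an algebraic function given by
  its Taylor series at 0. The function s is a branch of the square root of z - z0 on the part
  D of the disc of convergence near z0; being a half-disc-like lens, D does not wind around z0.
  (The principal branch would be discontinuous on the segment from 0 to z0 if z0 is positive.)
  The numbers a k are the coefficients of the Puiseux expansion at z0.
\<close>

definition sqrt_singularity :: "complex fps \<Rightarrow> complex \<Rightarrow> bool" where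
  "sqrt_singularity f z0 \<longleftrightarrow>
     algebraic_fps f \<and> z0 \<noteq> 0 \<and> fps_conv_radius f = ereal (norm z0) \<and>
     (\<exists>(a :: nat \<Rightarrow> complex) (s :: complex \<Rightarrow> complex) r. r > 0 \<and> a 1 \<noteq> 0 \<and>
        (let D = ball z0 r \<inter> eball 0 (fps_conv_radius f)
         in continuous_on D s \<and>
            (\<forall>z\<in>D. s z ^ 2 = z - z0 \<and> (\<lambda>k. a k * s z ^ k) sums eval_fps f z)))"

definition complex_fps :: "real fps \<Rightarrow> complex fps" where
  "complex_fps f = Abs_fps (\<lambda>n. complex_of_real (fps_nth f n))"

definition residue_filter :: "nat \<Rightarrow> nat \<Rightarrow> nat filter" where
  "residue_filter d j = inf at_top (principal {n. n mod d = j})"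

definition periodic_coeff_asymptotics :: "(nat \<Rightarrow> real) \<Rightarrow> real \<Rightarrow> bool" where
  "periodic_coeff_asymptotics A z0 \<longleftrightarrow>
     (\<exists>(d::nat) (J::nat set) (c :: nat \<Rightarrow> real).
        d \<ge> 1 \<and> J \<noteq> {} \<and> J \<subseteq> {0..<d} \<and>
        (\<forall>j\<in>J. c j > 0 \<and>
           (\<exists>\<epsilon> :: nat \<Rightarrow> real. \<epsilon> \<in> O[residue_filter d j](\<lambda>n. 1 / real n) \<and>
              (\<forall>\<^sub>F n in residue_filter d j.
                 A n = c j * real n powr (-3/2) * z0 powi (- int n) * (1 + \<epsilon> n)))) \<and>
        (\<forall>j\<in>{0..<d} - J.
           (\<forall>n. n mod d = j \<longrightarrow> A n = 0) \<or>
           A \<in> O[residue_filter d j](\<lambda>n. real n powr (-5/2) * z0 powi (- int n))))"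

end

theory Submission
  imports Defs "HOL-Complex_Analysis.Complex_Analysis" "HOL-Real_Asymp.Real_Asymp"
begin

text \<open>
  Each monomial of Q that contains an alpha is a step of a walk on the levels l: the coefficient
  [z^n] M_l is a sum of positive multiples of coefficients [z^n'] M_l' with n' < n and l' \<le> l + 2.
  Strong connectivity makes the walk irreducible and aperiodic. Let P(z,u) be the step
  polynomial, and z0 the largest positive z for which P(z,u) \<le> 1 for some u > 0, attained at
  u = tau; after rescaling z and u by z0 and tau the weights of the steps form
  a probability distribution with mean drift zero.

  Write K(z,u) = u^2 (1 - P(z,u)). The kernel equation K L = sigma - M_0 b_0 - M_1 b_1, where L is
  the generating function of the levels l \<ge> 2, is divided by K and integrated over circles in u. This
  gives linear equations for M_0 and M_1, which have full rank for |z| < 1 and are holomorphic near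
  every boundary point where K has no zero on the unit circle; a bounded quotient of
  holomorphic functions extends. At the other boundary points, which are roots of unity, two roots
  of K meet, and one of them is holomorphic in s = (1 - z)^(1/2); replacing one equation by
  evaluation of the kernel equation at this root shows that M_0 and M_1 are holomorphic in s.

  If the linear coefficient in s vanished at z = 1, the masses M_l(1) would have a finite first
  moment, which a strictly convex test function excludes. The coefficient asymptotics follow
  by subtracting the singular terms, and the algebraic equation comes from the two small roots
  of K, which for small z > 0 determine M_0 and M_1 by Cramer's rule.
\<close>

section \<open>Tools from complex analysis\<close>

text \<open>Contour integrals stand in for the small roots of the kernel because roots may collide
  inside the disc and have no global labelling, whereas the integrals are holomorphic as long as no
  root lies on the circle of integration. The price is that full rank is not visible from a formula:
  a kernel vector is read as boundary data of a bounded solution of the homogeneous system, which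
  the contraction by |z| kills. At a singular point the unit circle is pinched between a root inside
  and a root outside. A smaller radius \<rho> frees the contour but loses the information carried by
  the inner root, and evaluation there gives it back. Only z = 1 has to be analysed: at any other
  singular point \<zeta> all steps are aligned with some unit \<omega>, and multiplying level l by
  \<omega>^l carries the system at \<zeta> z to the same walk at z. The singular points other than 1
  produce the periodicity: the contributions form a function of n mod d, whose values have one sign
  because the coefficients are nonnegative, and whose sum over the residues is d times the
  contribution of z = 1 alone; this makes J nonempty.\<close>

lemma implicit_function_holomorphic:
  fixes G G' :: "complex \<Rightarrow> complex \<Rightarrow> complex" and v0 :: complex
  assumes R: "R > 0"
    and der: "\<And>s v. s \<in> ball 0 R \<Longrightarrow> v \<in> ball v0 R \<Longrightarrow> (G s has_field_derivative G' s v) (at v)"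
    and cont': "isCont (\<lambda>(s, v). G' s v) (0, v0)"
    and cont: "isCont (\<lambda>s. G s v0) 0"
    and hol: "\<And>V r. r \<le> R \<Longrightarrow> V holomorphic_on ball 0 r \<Longrightarrow> V ` ball 0 r \<subseteq> ball v0 R
                 \<Longrightarrow> (\<lambda>s. G s (V s)) holomorphic_on ball 0 r"
    and zero: "G 0 v0 = 0" and nz: "G' 0 v0 \<noteq> 0"
  obtains r V where "r > 0" "r \<le> R" "V holomorphic_on ball 0 r" "V 0 = v0"
    "\<And>s. s \<in> ball 0 r \<Longrightarrow> G s (V s) = 0"
proof -
  define a where "a = G' 0 v0"
  have a: "a \<noteq> 0" using nz a_def by simp
  have "isCont (\<lambda>p. (case p of (s, v) \<Rightarrow> G' s v) / a) (0, v0)"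
    using cont' a by (intro continuous_intros) auto
  then obtain e0 where e0: "e0 > 0"
    "\<And>p. dist p (0, v0) < e0 \<Longrightarrow> dist ((case p of (s, v) \<Rightarrow> G' s v) / a) (G' 0 v0 / a) < 1/2"
    unfolding continuous_at_eps_delta by (metis case_prod_conv half_gt_zero zero_less_one)
  define e where "e = min (e0/4) (R/2)"
  have e: "e > 0" "e < R" using e0 R by (auto simp: e_def)
  have close: "norm (G' s v / a - 1) \<le> 1/2" if "norm s < e" "v \<in> cball v0 e" for s v
  proof -
    have "dist (s, v) (0, v0) \<le> dist s 0 + dist v v0"
      unfolding dist_Pair_Pair by (rule sqrt_sum_squares_le_sum) auto
    also have "\<dots> < e0" using that e0(1) by (auto simp: e_def dist_commute)
    finally show ?thesis using e0(2)[of "(s, v)"] a by (simp add: a_def dist_norm)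
  qed
  have "isCont (\<lambda>s. G s v0 / a) 0" using cont a by (intro continuous_intros) auto
  then obtain r0 where r0: "r0 > 0" "\<And>s. dist s 0 < r0 \<Longrightarrow> dist (G s v0 / a) (G 0 v0 / a) < e/2"
    unfolding continuous_at_eps_delta using e(1) by (metis half_gt_zero)
  define r where "r = min r0 e"
  have r: "r > 0" "r \<le> e" "r \<le> R" using r0 e by (auto simp: r_def)
  \<comment> \<open>Newton iteration with the slope frozen at its value \<open>a\<close> at the base
    point: since \<open>G' s v / a\<close> stays within 1/2 of 1, \<open>T s\<close> contracts with
    factor 1/2 for all s at once, and its fixed points are the zeros of \<open>G s\<close>.\<close>
  define T where "T = (\<lambda>s v. v - G s v / a)"
  have Tlip: "norm (T s v - T s w) \<le> 1/2 * norm (v - w)"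
    if s: "s \<in> ball 0 r" and v: "v \<in> cball v0 e" and w: "w \<in> cball v0 e" for s v w
  proof (rule field_differentiable_bound[of "cball v0 e" _ "\<lambda>v. 1 - G' s v / a"])
    fix x assume x: "x \<in> cball v0 e"
    show "(T s has_field_derivative 1 - G' s x / a) (at x within cball v0 e)"
      unfolding T_def using der[of s x] s x e r a
      by (auto intro!: derivative_eq_intros intro: has_field_derivative_at_within)
    show "norm (1 - G' s x / a) \<le> 1/2"
      using close[of s x] s x r by (auto simp: norm_minus_commute)
  qed (use v w in auto)
  have T0: "norm (T s v0 - v0) \<le> e/2" if "s \<in> ball 0 r" for s
    using r0(2)[of s] that zero by (auto simp: T_def r_def)
  have Tmap: "T s v \<in> cball v0 e" if s: "s \<in> ball 0 r" and v: "v \<in> cball v0 e" for s v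
  proof -
    have "norm (T s v - v0) \<le> norm (T s v - T s v0) + norm (T s v0 - v0)"
      using norm_triangle_ineq[of "T s v - T s v0" "T s v0 - v0"] by simp
    also have "\<dots> \<le> 1/2 * norm (v - v0) + e/2"
      using Tlip[OF s v, of v0] T0[OF s] e by (intro add_mono) auto
    also have "\<dots> \<le> e" using v by (simp add: dist_norm norm_minus_commute)
    finally show ?thesis by (simp add: dist_norm norm_minus_commute)
  qed
  define W where "W = (\<lambda>n s. (T s ^^ n) v0)"
  have W0: "W 0 s = v0" and WS: "W (Suc n) s = T s (W n s)" for n s by (auto simp: W_def)
  have Wc: "W n s \<in> cball v0 e" if "s \<in> ball 0 r" for n s
    using that e by (induction n) (auto simp: W0 WS simp del: mem_cball intro: Tmap)
  have Whol: "W n holomorphic_on ball 0 r" for n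
  proof (induction n)
    case 0 show ?case by (simp add: W_def)
  next
    case (Suc n)
    have "W n s \<in> ball v0 R" if "s \<in> ball 0 r" for s using Wc[OF that, of n] e(2) by simp
    then have "W n ` ball 0 r \<subseteq> ball v0 R" by blast
    \<comment> \<open>The assumption on compositions with holomorphic functions takes the place of
      joint holomorphy of \<open>G\<close>; it makes every iterate holomorphic.\<close>
    then have "(\<lambda>s. W n s - G s (W n s) / a) holomorphic_on ball 0 r"
      using Suc a r by (intro holomorphic_intros hol) auto
    then show ?case by (simp add: WS[abs_def] T_def)
  qed
  have Wd: "norm (W (Suc n) s - W n s) \<le> (1/2)^n * e" if s: "s \<in> ball 0 r" for n s
  proof (induction n)
    case 0 show ?case using T0[OF s] e by (simp add: W0 WS)
  next
    case (Suc n)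
    have "norm (W (Suc (Suc n)) s - W (Suc n) s) \<le> 1/2 * norm (W (Suc n) s - W n s)"
      unfolding WS[of "Suc n"] using Tlip[OF s Wc[OF s, of "Suc n"] Wc[OF s, of n]] by (simp only: WS)
    then show ?case using Suc by simp
  qed
  define V where "V = (\<lambda>s. v0 + (suminf (\<lambda>n. W (Suc n) s - W n s)))"
  have "uniform_limit (ball 0 r) (\<lambda>n s. \<Sum>i<n. W (Suc i) s - W i s) (\<lambda>s. suminf (\<lambda>n. W (Suc n) s - W n s)) sequentially"
    by (rule Weierstrass_m_test[where M = "\<lambda>n. (1/2)^n * e"])
      (use Wd in \<open>auto intro!: summable_mult2 summable_geometric\<close>)
  then have "uniform_limit (ball 0 r) (\<lambda>n s. v0 + (\<Sum>i<n. W (Suc i) s - W i s)) V sequentially"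
    unfolding V_def by (intro uniform_limit_intros)
  moreover have "(\<lambda>n s. v0 + (\<Sum>i<n. W (Suc i) s - W i s)) = W"
    using sum_lessThan_telescope[of "\<lambda>n. W n s" for s] by (intro ext) (simp add: W0)
  ultimately have ul: "uniform_limit (ball 0 r) W V sequentially" by simp
  have Vhol: "V holomorphic_on ball 0 r"
  proof (rule holomorphic_uniform_sequence[OF _ Whol])
    fix x :: complex assume "x \<in> ball 0 r"
    then obtain d where "d > 0" "cball x d \<subseteq> ball 0 r" using open_contains_cball open_ball by blast
    then show "\<exists>d>0. cball x d \<subseteq> ball 0 r \<and> uniform_limit (cball x d) W V sequentially"
      using uniform_limit_on_subset[OF ul] by blast
  qed simp
  have lim: "(\<lambda>n. W n s) \<longlonglongrightarrow> V s" if "s \<in> ball 0 r" for s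
    using tendsto_uniform_limitI[OF ul that] .
  have Gz: "G s (V s) = 0" if s: "s \<in> ball 0 r" for s
  proof -
    have Vc: "V s \<in> cball v0 e"
      by (rule closed_sequentially[OF _ _ lim[OF s]]) (use Wc[OF s] in auto)
    then have "isCont (G s) (V s)" using der[of s "V s"] s r e by (intro DERIV_isCont) auto
    then have "(\<lambda>n. T s (W n s)) \<longlonglongrightarrow> T s (V s)"
      unfolding T_def using lim[OF s] a by (intro tendsto_intros isCont_tendsto_compose[of _ "G s"])
    moreover have "(\<lambda>n. T s (W n s)) \<longlonglongrightarrow> V s"
      using LIMSEQ_Suc[OF lim[OF s]] by (simp add: WS)
    ultimately have "T s (V s) = V s" by (rule LIMSEQ_unique)
    then show ?thesis using a by (simp add: T_def)
  qed
  have "W n 0 = v0" for n by (induction n) (auto simp: W0 WS T_def zero)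
  then have "V 0 = v0" using lim[of 0] r by (simp add: LIMSEQ_const_iff)
  with that[of r V] r Vhol Gz show ?thesis by blast
qed

lemma holomorphic_divide_by_zero:
  fixes h :: "complex \<Rightarrow> complex"
  assumes "h holomorphic_on ball 0 r" "h 0 = 0"
  obtains h1 where "h1 holomorphic_on ball 0 r" "\<And>s. s \<in> ball 0 r \<Longrightarrow> h s = s * h1 s"
proof -
  have "(\<lambda>s. if s = 0 then deriv h 0 else (h s - h 0) / (s - 0)) holomorphic_on ball 0 r"
    using pole_theorem_open_0[where S = "ball 0 r" and f = "\<lambda>s. if s = 0 then deriv h 0 else (h s - h 0) / (s - 0)"
       and g = h and a = 0]
    using assms pole_lemma_open by blast
  then show ?thesis
    by (rule that) (use assms in auto)
qed

text \<open>A function that is bounded on a segment cannot have a pole at its end point.\<close>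

lemma bounded_quotient:
  fixes f :: "real \<Rightarrow> complex"
  assumes r: "r > 0" and num: "num holomorphic_on ball 0 r" and den: "den holomorphic_on ball 0 r"
    and bd: "\<And>s. 0 < s \<Longrightarrow> s < r \<Longrightarrow> norm (f s) \<le> B"
    and eq: "\<And>s. 0 < s \<Longrightarrow> s < r \<Longrightarrow> f s * den (of_real s) = num (of_real s)"
    and nz: "\<exists>s\<in>ball 0 r. den s \<noteq> 0"
  obtains r' \<Phi> where "0 < r'" "r' \<le> r" "\<Phi> holomorphic_on ball 0 r'"
    "\<And>s. 0 < s \<Longrightarrow> s < r' \<Longrightarrow> f s = \<Phi> (of_real s)"
proof -
  have "\<exists>r1>0. cball 0 r1 \<subseteq> ball (0::complex) r \<and> zor_poly den 0 holomorphic_on cball 0 r1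
      \<and> (\<forall>w\<in>cball 0 r1. den w = zor_poly den 0 w * (w - 0) ^ nat (zorder den 0) \<and> zor_poly den 0 w \<noteq> 0)"
    using zorder_exist_zero[OF den open_ball connected_ball centre_in_ball[THEN iffD2, OF r] nz] by blast
  then obtain r1 g n where r1: "r1 > 0" "cball 0 r1 \<subseteq> ball (0::complex) r" "g holomorphic_on cball 0 r1"
     and g: "\<And>w. w \<in> cball 0 r1 \<Longrightarrow> den w = g w * w ^ n \<and> g w \<noteq> 0"
    by (metis diff_zero)
  have r1r: "r1 \<le> r"
  proof -
    have "of_real r1 \<in> cball (0::complex) r1" using r1 by auto
    then have "of_real r1 \<in> ball (0::complex) r" using r1(2) by blast
    then show ?thesis using r1(1) by simp
  qed
  \<comment> \<open>Induction on the order n of the zero of \<open>den\<close> at 0: boundedness of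
    f forces \<open>h 0 = 0\<close> as long as n is positive, so one factor s cancels on both
    sides.\<close>
  have *: "\<exists>\<Phi>. \<Phi> holomorphic_on ball 0 r1 \<and> (\<forall>s. 0 < s \<longrightarrow> s < r1 \<longrightarrow> f s = \<Phi> (of_real s))"
    if "h holomorphic_on ball 0 r1" "\<And>s. 0 < s \<Longrightarrow> s < r1 \<Longrightarrow> f s * of_real s ^ n = h (of_real s)" for h n
    using that
  proof (induction n arbitrary: h)
    case 0 then show ?case by auto
  next
    case (Suc n)
    have "isCont h 0"
      using Suc.prems(1) r1(1) by (meson centre_in_ball continuous_on_eq_continuous_at holomorphic_on_imp_continuous_on open_ball)
    then have "((\<lambda>s. h (of_real s)) \<longlongrightarrow> h (of_real 0)) (at_right 0)"
      by (intro isCont_tendsto_compose[of _ h] tendsto_intros) auto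
    moreover have "((\<lambda>s. h (of_real s)) \<longlongrightarrow> 0) (at_right (0::real))"
    proof (rule Lim_null_comparison)
      show "eventually (\<lambda>s. norm (h (of_real s)) \<le> B * s ^ Suc n) (at_right 0)"
        unfolding eventually_at_right_field
      proof (intro exI[of _ r1] conjI allI impI)
        fix s :: real assume s: "0 < s" "s < r1"
        then have "norm (h (of_real s)) = norm (f s) * s ^ Suc n"
          by (simp add: Suc.prems(2)[symmetric] norm_mult norm_power)
        also have "\<dots> \<le> B * s ^ Suc n" using bd[of s] s r1r by (intro mult_right_mono) auto
        finally show "norm (h (of_real s)) \<le> B * s ^ Suc n" .
      qed (use r1 in auto)
      have "((\<lambda>s. B * s ^ Suc n) \<longlongrightarrow> B * 0 ^ Suc n) (at_right (0::real))"
        by (intro tendsto_intros)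
      then show "((\<lambda>s. B * s ^ Suc n) \<longlongrightarrow> 0) (at_right (0::real))" by simp
    qed
    ultimately have "h 0 = 0" using tendsto_unique trivial_limit_at_right_real of_real_0 by metis
    then obtain h1 where h1: "h1 holomorphic_on ball 0 r1" "\<And>s. s \<in> ball 0 r1 \<Longrightarrow> h s = s * h1 s"
      using holomorphic_divide_by_zero[OF Suc.prems(1)] by blast
    show ?case
    proof (rule Suc.IH[OF h1(1)])
      fix s :: real assume s: "0 < s" "s < r1"
      have "of_real s * (f s * of_real s ^ n) = of_real s * h1 (of_real s)"
        using Suc.prems(2)[of s] h1(2)[of "of_real s"] s by (simp add: mult_ac)
      then show "f s * of_real s ^ n = h1 (of_real s)" using s by simp
    qed
  qed
  obtain \<Phi> where "\<Phi> holomorphic_on ball 0 r1" "\<forall>s. 0 < s \<longrightarrow> s < r1 \<longrightarrow> f s = \<Phi> (of_real s)"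
    using *[of "\<lambda>s. num s / g s" n]
  proof -
    have "(\<lambda>s. num s / g s) holomorphic_on ball 0 r1"
      using r1 g by (intro holomorphic_intros holomorphic_on_subset[OF num] holomorphic_on_subset[OF r1(3)]) auto
    moreover have "f s * of_real s ^ n = num (of_real s) / g (of_real s)" if "0 < s" "s < r1" for s
      using eq[of s] g[of "of_real s"] that r1r by (auto simp: field_simps)
    ultimately show ?thesis using *[of "\<lambda>s. num s / g s" n] that by blast
  qed
  then show ?thesis using that[of r1 \<Phi>] r1 r1r by auto
qed

text \<open>Differentiation under the integral sign. Numerator and denominator are kept apart since
  in the applications both are entire in z, and only the nonvanishing of K on the circle has to be
  checked.\<close>

lemma holomorphic_on_contour_integral_circlepath:
  fixes N K N' K' :: "complex \<Rightarrow> complex \<Rightarrow> complex"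
  assumes U: "convex U" "open U" and \<rho>: "\<rho> \<ge> 0"
    and N: "\<And>z u. z \<in> U \<Longrightarrow> u \<in> sphere 0 \<rho> \<Longrightarrow> ((\<lambda>z. N z u) has_field_derivative N' z u) (at z)"
    and K: "\<And>z u. z \<in> U \<Longrightarrow> u \<in> sphere 0 \<rho> \<Longrightarrow> ((\<lambda>z. K z u) has_field_derivative K' z u) (at z)"
    and cont: "continuous_on (U \<times> sphere 0 \<rho>) (\<lambda>(z,u). N z u)" "continuous_on (U \<times> sphere 0 \<rho>) (\<lambda>(z,u). K z u)"
      "continuous_on (U \<times> sphere 0 \<rho>) (\<lambda>(z,u). N' z u)" "continuous_on (U \<times> sphere 0 \<rho>) (\<lambda>(z,u). K' z u)"
    and nz: "\<And>z u. z \<in> U \<Longrightarrow> u \<in> sphere 0 \<rho> \<Longrightarrow> K z u \<noteq> 0"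
  shows "(\<lambda>z. contour_integral (circlepath 0 \<rho>) (\<lambda>u. N z u / K z u)) holomorphic_on U"
proof -
  let ?g = "circlepath 0 \<rho>"
  define F where "F = (\<lambda>z t. N z (?g t) / K z (?g t) * vector_derivative ?g (at t))"
  have g: "?g t \<in> sphere 0 \<rho>" for t
    using \<rho> by (simp add: circlepath norm_mult)
  have gc: "continuous_on A ?g" for A
    by (auto simp: circlepath intro!: continuous_intros)
  have vd: "vector_derivative ?g (at t) = 2 * pi * \<i> * \<rho> * exp (2 * of_real pi * \<i> * t)"
    if "t \<in> {0..1}" for t
    using that by (subst vector_derivative_circlepath) auto
  have vdc: "continuous_on {0..1} (\<lambda>t. vector_derivative ?g (at t))"
  proof -
    have "continuous_on {0..1} (\<lambda>t::real. 2 * pi * \<i> * \<rho> * exp (2 * of_real pi * \<i> * t))"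
      by (intro continuous_intros)
    then show ?thesis by (rule continuous_on_eq) (use vd in auto)
  qed
  define F' where "F' = (\<lambda>z t. (N' z (?g t) * K z (?g t) - N z (?g t) * K' z (?g t)) / (K z (?g t) * K z (?g t))
                * vector_derivative ?g (at t))"
  have comp: "continuous_on (U \<times> {0..1}) (\<lambda>p. H (fst p) (?g (snd p)))"
    if "continuous_on (U \<times> sphere 0 \<rho>) (\<lambda>(z,u). H z u)" for H :: "complex \<Rightarrow> complex \<Rightarrow> complex"
  proof -
    have "continuous_on (U \<times> {0..1}) (\<lambda>p. (case (fst p, ?g (snd p)) of (z, u) \<Rightarrow> H z u))"
    proof (rule continuous_on_compose2[OF that])
      show "continuous_on (U \<times> {0..1}) (\<lambda>p. (fst p, ?g (snd p)))"
        by (intro continuous_intros continuous_on_compose2[OF gc[of UNIV]]) auto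
    qed (use g in auto)
    then show ?thesis by simp
  qed
  note comps = cont[THEN comp]
  have vdc2: "continuous_on (U \<times> {0..1}) (\<lambda>p. vector_derivative ?g (at (snd p)))"
    by (intro continuous_on_compose2[OF vdc] continuous_intros) auto
  have "(\<lambda>z. integral (cbox 0 1) (F z)) holomorphic_on U"
  proof (rule leibniz_rule_holomorphic[where fx = F'])
    show "((\<lambda>z. F z t) has_field_derivative F' z t) (at z within U)" if "z \<in> U" "t \<in> cbox 0 1" for z t
      unfolding F_def F'_def
      using N[OF that(1) g[of t]] K[OF that(1) g[of t]] nz[OF that(1) g[of t]]
      by (intro DERIV_cmult_right DERIV_divide has_field_derivative_at_within[where s = U]) auto
    have "continuous_on (U \<times> {0..1}) (\<lambda>p. F (fst p) (snd p))"
      unfolding F_def using nz g by (intro continuous_intros comps vdc2) auto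
    then have "continuous_on {0..1} (\<lambda>t. (\<lambda>p. F (fst p) (snd p)) (z, t))" if "z \<in> U" for z
      using that by (intro continuous_on_compose2[where g = "\<lambda>p. F (fst p) (snd p)" and f = "\<lambda>t. (z, t)"] continuous_intros) auto
    then show "F z integrable_on cbox 0 1" if "z \<in> U" for z
      using that integrable_continuous_real[of 0 1 "F z"] by simp
    have "continuous_on (U \<times> {0..1}) (\<lambda>p. F' (fst p) (snd p))"
      unfolding F'_def using nz g by (intro continuous_intros comps vdc2) auto
    then show "continuous_on (U \<times> cbox 0 1) (\<lambda>(x, t). F' x t)" by (simp add: case_prod_beta')
  qed (use U in auto)
  then show ?thesis by (simp add: contour_integral_integral F_def)
qed

lemma contour_integral_powi_circlepath:
  assumes "\<rho> > 0"
  shows "((\<lambda>u. u powi k) has_contour_integral (if k = -1 then 2 * pi * \<i> else 0)) (circlepath 0 \<rho>)"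
proof (cases "k = -1")
  case True
  have "((\<lambda>u. 1 / (u - 0)) has_contour_integral 2 * pi * \<i> * 1) (circlepath 0 \<rho>)"
    using Cauchy_integral_circlepath_simple[of "\<lambda>_. 1" 0 \<rho> 0] assms by simp
  then show ?thesis using True by (simp add: power_int_minus inverse_eq_divide)
next
  case False
  have "((\<lambda>u. u powi k) has_contour_integral 0) (circlepath 0 \<rho>)"
  proof (rule Cauchy_theorem_primitive[of "-{0}" "\<lambda>u. u powi (k+1) / of_int (k+1)"])
    fix u :: complex assume u: "u \<in> -{0}"
    have ne: "(of_int (k + 1) :: complex) \<noteq> 0" using False by (metis add_eq_0_iff2 of_int_eq_0_iff)
    have "((\<lambda>u. u powi (k+1)) has_field_derivative of_int (k+1) * u powi (k+1-1)) (at u within -{0})"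
      using has_derivative_power_int'[of u "k+1" "-{0}"] u unfolding has_field_derivative_def
      by (simp add: mult_commute_abs del: of_int_add)
    from DERIV_cdivide[OF this, of "of_int (k+1)"]
    show "((\<lambda>u. u powi (k+1) / of_int (k+1)) has_field_derivative u powi k) (at u within -{0})"
      using ne by (simp del: of_int_add)
  qed (use assms in auto)
  then show ?thesis using False by simp
qed

lemma contour_integral_circlepath_annulus:
  fixes f :: "complex \<Rightarrow> complex"
  assumes "open S" "f holomorphic_on S" and sub: "\<And>u. \<rho> \<le> norm u \<Longrightarrow> norm u \<le> \<rho>' \<Longrightarrow> u \<in> S"
    and \<rho>: "0 < \<rho>" "\<rho> \<le> \<rho>'"
  shows "contour_integral (circlepath 0 \<rho>) f = contour_integral (circlepath 0 \<rho>') f"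
proof (rule Cauchy_theorem_homotopic_loops[OF _ assms(1,2)])
  show "homotopic_loops S (circlepath 0 \<rho>) (circlepath 0 \<rho>')"
  proof (rule homotopic_loops_linear)
    fix t :: real
    show "closed_segment (circlepath 0 \<rho> t) (circlepath 0 \<rho>' t) \<subseteq> S"
    proof
      fix u assume "u \<in> closed_segment (circlepath 0 \<rho> t) (circlepath 0 \<rho>' t)"
      then obtain x where x: "0 \<le> x" "x \<le> 1"
        "u = (1 - x) *\<^sub>R circlepath 0 \<rho> t + x *\<^sub>R circlepath 0 \<rho>' t" by (auto simp: in_segment)
      have u: "u = of_real ((1 - x) * \<rho> + x * \<rho>') * exp (2 * of_real pi * \<i> * t)"
        unfolding x(3) by (simp add: circlepath scaleR_conv_of_real algebra_simps)
      have ge: "(1 - x) * \<rho> + x * \<rho>' \<ge> \<rho>" and le: "(1 - x) * \<rho> + x * \<rho>' \<le> \<rho>'"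
        using x \<rho> mult_left_mono[of \<rho> \<rho>' x] mult_left_mono[of \<rho> \<rho>' "1-x"] by (auto simp: algebra_simps)
      have "norm u = (1 - x) * \<rho> + x * \<rho>'"
        unfolding u norm_mult norm_of_real using ge \<rho> by simp
      then show "u \<in> S" using ge le by (intro sub) auto
    qed
  qed auto
qed auto

section \<open>The critical walk and its kernel\<close>

text \<open>The last hypothesis improves any uniform bound C to q C, so the bound B can be iterated
  down to q^m B for every m.\<close>

lemma contraction_imp_zero:
  fixes g :: "'b \<Rightarrow> complex"
  assumes "\<And>n. norm (g n) \<le> B" "0 \<le> q" "q < 1"
    and "\<And>C n. (\<And>k. norm (g k) \<le> C) \<Longrightarrow> norm (g n) \<le> q * C"
  shows "g n = 0"
proof -
  have "norm (g n) \<le> q ^ m * B" for m n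
  proof (induction m arbitrary: n)
    case 0 then show ?case using assms(1) by simp
  next
    case (Suc m) then show ?case using assms(4)[of "q ^ m * B" n] by (simp add: mult.assoc)
  qed
  moreover have "(\<lambda>m. q ^ m * B) \<longlonglongrightarrow> 0 * B"
    using assms(2,3) by (intro tendsto_intros LIMSEQ_power_zero) auto
  ultimately have "norm (g n) \<le> 0 * B"
    by (intro LIMSEQ_le_const[of "\<lambda>m. q ^ m * B"]) auto
  then show ?thesis by simp
qed

lemma continuous_on_if_zero [continuous_intros]:
  "continuous_on A f \<Longrightarrow> continuous_on A (\<lambda>x. if P then f x else 0)"
  by (cases P) auto

lemma sums_shift_if:
  fixes h :: "nat \<Rightarrow> 'a::real_normed_vector"
  assumes "h sums s"
  shows "(\<lambda>l. if k \<le> l then h (l - k) else 0) sums s"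
  using assms sums_zero_iff_shift[of k "\<lambda>l. if k \<le> l then h (l - k) else 0" s] by simp

lemma summable_coeff_shift:
  fixes f :: "nat \<Rightarrow> 'a::{real_normed_field,banach}"
  assumes "summable (\<lambda>l. norm (f l * u ^ l))"
  shows "summable (\<lambda>l. norm (f (l + k) * u ^ l))"
proof (cases "u = 0")
  case True
  have "summable (\<lambda>l. if l = 0 then norm (f k) else 0)" by (rule summable_single)
  also have "(\<lambda>l. if l = 0 then norm (f k) else 0) = (\<lambda>l. norm (f (l + k) * u ^ l))"
    using True by auto
  finally show ?thesis .
next
  case False
  have "summable (\<lambda>l. norm (f (l + k) * u ^ (l + k)) / norm (u ^ k))"
    by (intro summable_divide summable_ignore_initial_segment[OF assms])
  then show ?thesis using False by (simp add: norm_mult norm_power power_add)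
qed

text \<open>
  A step of weight p i takes dz i units of time and leads from level l - up i + dn i to level
  l \<ge> up i. Since dn i \<le> 2, only the two lowest levels act as boundary values.
\<close>

locale critical_walk =
  fixes I :: "'i set" and p :: "'i \<Rightarrow> real" and dz up dn :: "'i \<Rightarrow> nat"
  assumes fin: "finite I"
    and p_pos: "i \<in> I \<Longrightarrow> p i > 0"
    and dz_pos: "i \<in> I \<Longrightarrow> dz i \<ge> 1"
    and dn_le: "i \<in> I \<Longrightarrow> dn i \<le> 2"
    and total: "(\<Sum>i\<in>I. p i) = 1"
    and drift: "(\<Sum>i\<in>I. p i * (real (up i) - real (dn i))) = 0"
    and descend: "\<exists>i\<in>I. up i < dn i"
    and ascend: "\<exists>i\<in>I. dn i < up i"
    and aperiodic: "\<And>w::complex. norm w = 1 \<Longrightarrow> (\<And>i. i \<in> I \<Longrightarrow> w ^ up i = w ^ dn i) \<Longrightarrow> w = 1"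
begin

text \<open>The exponent of u in a step after multiplication of the kernel by u^2. The subtraction
  does not truncate on \<open>I\<close>, because \<open>dn i \<le> 2\<close> there.\<close>

definition ex where "ex i = up i + 2 - dn i"

definition kern :: "'a \<Rightarrow> 'a \<Rightarrow> 'a::real_normed_field" where
  "kern z u = u ^ 2 - (\<Sum>i\<in>I. of_real (p i) * z ^ dz i * u ^ ex i)"

text \<open>Factors of the boundary values in the kernel equation: level k enters with u^k minus the
  terms of the steps that can start at level k, that is, those with \<open>dn i \<le> k\<close>.
  Here k = 0, and k = 1 in \<open>b1\<close>.\<close>

definition b0 :: "'a \<Rightarrow> 'a \<Rightarrow> 'a::real_normed_field" where
  "b0 z u = 1 - (\<Sum>i\<in>I. if dn i = 0 then of_real (p i) * z ^ dz i * u ^ up i else 0)"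

definition b1 :: "'a \<Rightarrow> 'a \<Rightarrow> 'a::real_normed_field" where
  "b1 z u = u - (\<Sum>i\<in>I. if dn i = 0 then of_real (p i) * z ^ dz i * u ^ (up i + 1) else 0)
              - (\<Sum>i\<in>I. if dn i = 1 then of_real (p i) * z ^ dz i * u ^ up i else 0)"

text \<open>The source is a parameter, so that the homogeneous system and the twisted systems at the
  other singular points are covered too.\<close>

definition is_sol :: "'a::real_normed_field \<Rightarrow> (nat \<Rightarrow> 'a) \<Rightarrow> (nat \<Rightarrow> 'a) \<Rightarrow> bool" where
  "is_sol z \<sigma> f \<longleftrightarrow> (\<forall>l. f l = \<sigma> l +
      (\<Sum>i\<in>I. if up i \<le> l then of_real (p i) * z ^ dz i * f (l - up i + dn i) else 0))"

text \<open>Weights of total 1 and at least one factor z per step give a contraction by the norm of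
  z. Both the absence of kernel zeros on the unit circle and the uniqueness of bounded solutions
  rest on this.\<close>

lemma norm_step_sum_le:
  fixes z :: "'a::real_normed_field"
  assumes "norm z \<le> 1" "\<And>i. i \<in> I \<Longrightarrow> norm (x i) \<le> C"
  shows "norm (\<Sum>i\<in>I. of_real (p i) * z ^ dz i * x i) \<le> norm z * C"
proof (cases "I = {}")
  case True
  then show ?thesis using total by simp
next
  case False
  then have C: "C \<ge> 0" using assms(2) norm_ge_zero order_trans by blast
  have "norm (\<Sum>i\<in>I. of_real (p i) * z ^ dz i * x i) \<le> (\<Sum>i\<in>I. p i * norm z * C)"
  proof (rule sum_norm_le)
    fix i assume i: "i \<in> I"
    have "norm z ^ dz i \<le> norm z ^ 1" using dz_pos[OF i] assms(1) by (intro power_decreasing) auto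
    then have "p i * norm z ^ dz i * norm (x i) \<le> p i * norm z * C"
      using p_pos[OF i] assms(2)[OF i] C by (intro mult_mono) auto
    then show "norm (of_real (p i) * z ^ dz i * x i) \<le> p i * norm z * C"
      using p_pos[OF i] by (simp add: norm_mult norm_power)
  qed
  also have "\<dots> = norm z * C"
    using total by (simp add: sum_distrib_right[symmetric] mult.assoc)
  finally show ?thesis .
qed

lemma kern_nonzero:
  fixes z u :: "'a::real_normed_field"
  assumes "norm z < 1" "norm u = 1"
  shows "kern z u \<noteq> 0"
proof
  assume "kern z u = 0"
  then have "norm (u ^ 2) = norm (\<Sum>i\<in>I. of_real (p i) * z ^ dz i * u ^ ex i)"
    by (simp add: kern_def)
  also have "\<dots> \<le> norm z * 1"
    using assms by (intro norm_step_sum_le) (auto simp: norm_power)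
  finally show False using assms by (simp add: norm_power)
qed

lemma bounded_homogeneous_sol:
  fixes f :: "nat \<Rightarrow> complex"
  assumes "norm z < 1" "is_sol z (\<lambda>_. 0) f" "\<And>l. norm (f l) \<le> B"
  shows "f l = 0"
proof (rule contraction_imp_zero[of f B "norm z"])
  fix C n assume C: "\<And>k. norm (f k) \<le> C"
  then have C0: "C \<ge> 0" using norm_ge_zero order_trans by blast
  have "f n = (\<Sum>i\<in>I. of_real (p i) * z ^ dz i * (if up i \<le> n then f (n - up i + dn i) else 0))"
    using assms(2) unfolding is_sol_def by (auto intro!: sum.cong)
  also have "norm \<dots> \<le> norm z * C"
    using assms(1) C C0 by (intro norm_step_sum_le) auto
  finally show "norm (f n) \<le> norm z * C" .
qed (use assms in auto)

text \<open>Multiply the equation of level l by u^l and sum. A step with \<open>dn i = k\<close>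
  then acts on the series of the levels from k on, divided by u^k, and as
  \<open>dn i \<le> 2\<close> each of these is a power of u times \<open>D 2\<close> plus boundary
  terms.\<close>

lemma kernel_equation:
  fixes f \<sigma> :: "nat \<Rightarrow> 'a::{real_normed_field,banach}"
  assumes sol: "is_sol z \<sigma> f" and \<sigma>: "\<And>l. l > S \<Longrightarrow> \<sigma> l = 0"
    and sm: "summable (\<lambda>l. norm (f l * u ^ l))"
  shows "kern z u * (suminf (\<lambda>l. f (l + 2) * u ^ l)) = (\<Sum>l\<le>S. \<sigma> l * u ^ l) - f 0 * b0 z u - f 1 * b1 z u"
proof -
  define D where "D = (\<lambda>k. suminf (\<lambda>l. f (l + k) * u ^ l))"
  have Ds: "(\<lambda>l. f (l + k) * u ^ l) sums D k" for k
    unfolding D_def using summable_norm_cancel[OF summable_coeff_shift[OF sm]] by (rule summable_sums)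
  have D1: "D 1 = f 1 + u * D 2"
  proof -
    have "(\<lambda>l. f (l + 1) * u ^ l) sums (u * D 2 + f (0 + 1) * u ^ 0)"
      using sums_mult[OF Ds[of 2], of u] by (intro sums_Suc) (simp add: mult_ac)
    then show ?thesis using Ds[of 1] sums_unique2 by fastforce
  qed
  have D0: "D 0 = f 0 + u * f 1 + u ^ 2 * D 2"
  proof -
    have "(\<lambda>l. f (l + 0) * u ^ l) sums (u * D 1 + f (0 + 0) * u ^ 0)"
      using sums_mult[OF Ds[of 1], of u] by (intro sums_Suc) (simp add: mult_ac)
    then have "D 0 = u * D 1 + f 0" using Ds[of 0] sums_unique2 by fastforce
    then show ?thesis by (simp add: D1[simplified] algebra_simps power2_eq_square)
  qed
  have "(\<lambda>l. \<sigma> l * u ^ l + (\<Sum>i\<in>I. of_real (p i) * z ^ dz i * u ^ up i *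
           (if up i \<le> l then f (l - up i + dn i) * u ^ (l - up i) else 0)))
        sums ((\<Sum>l\<le>S. \<sigma> l * u ^ l) + (\<Sum>i\<in>I. of_real (p i) * z ^ dz i * u ^ up i * D (dn i)))"
    by (intro sums_add sums_sum sums_mult sums_shift_if[OF Ds, simplified] sums_finite)
       (use \<sigma> in auto)
  moreover have "\<sigma> l * u ^ l + (\<Sum>i\<in>I. of_real (p i) * z ^ dz i * u ^ up i *
           (if up i \<le> l then f (l - up i + dn i) * u ^ (l - up i) else 0)) = f (l + 0) * u ^ l" for l
  proof -
    have "f l * u ^ l = \<sigma> l * u ^ l + (\<Sum>i\<in>I. (if up i \<le> l then of_real (p i) * z ^ dz i * f (l - up i + dn i) else 0) * u ^ l)"
    proof -
      have "f l = \<sigma> l + (\<Sum>i\<in>I. if up i \<le> l then of_real (p i) * z ^ dz i * f (l - up i + dn i) else 0)"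
        using sol unfolding is_sol_def by blast
      then have "f l * u ^ l = (\<sigma> l + (\<Sum>i\<in>I. if up i \<le> l then of_real (p i) * z ^ dz i * f (l - up i + dn i) else 0)) * u ^ l"
        by (rule arg_cong)
      then show ?thesis by (simp only: distrib_right sum_distrib_right)
    qed
    also have "(\<Sum>i\<in>I. (if up i \<le> l then of_real (p i) * z ^ dz i * f (l - up i + dn i) else 0) * u ^ l)
        = (\<Sum>i\<in>I. of_real (p i) * z ^ dz i * u ^ up i *
           (if up i \<le> l then f (l - up i + dn i) * u ^ (l - up i) else 0))"
    proof (intro sum.cong refl)
      fix i
      have "u ^ l = u ^ up i * u ^ (l - up i)" if "up i \<le> l" using that by (simp add: power_add[symmetric])
      then show "(if up i \<le> l then of_real (p i) * z ^ dz i * f (l - up i + dn i) else 0) * u ^ l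
        = of_real (p i) * z ^ dz i * u ^ up i * (if up i \<le> l then f (l - up i + dn i) * u ^ (l - up i) else 0)"
        by simp
    qed
    finally show ?thesis by simp
  qed
  ultimately have M: "D 0 = (\<Sum>l\<le>S. \<sigma> l * u ^ l) + (\<Sum>i\<in>I. of_real (p i) * z ^ dz i * u ^ up i * D (dn i))"
    using Ds[of 0] sums_unique2 by fastforce
  have "of_real (p i) * z ^ dz i * u ^ up i * D (dn i) =
     of_real (p i) * z ^ dz i * u ^ ex i * D 2
     + f 0 * (if dn i = 0 then of_real (p i) * z ^ dz i * u ^ up i else 0)
     + f 1 * (if dn i = 0 then of_real (p i) * z ^ dz i * u ^ (up i + 1) else 0)
     + f 1 * (if dn i = 1 then of_real (p i) * z ^ dz i * u ^ up i else 0)" if "i \<in> I" for i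
  proof -
    from dn_le[OF that] consider "dn i = 0" | "dn i = 1" | "dn i = 2" by linarith
    then show ?thesis
    proof cases
      case 1 then show ?thesis by (simp add: ex_def D0 algebra_simps power_add power2_eq_square)
    next
      case 2 then show ?thesis by (simp add: ex_def D1[simplified] algebra_simps)
    next
      case 3 then show ?thesis by (simp add: ex_def)
    qed
  qed
  then have "(\<Sum>i\<in>I. of_real (p i) * z ^ dz i * u ^ up i * D (dn i)) =
     (\<Sum>i\<in>I. of_real (p i) * z ^ dz i * u ^ ex i * D 2
     + f 0 * (if dn i = 0 then of_real (p i) * z ^ dz i * u ^ up i else 0)
     + f 1 * (if dn i = 0 then of_real (p i) * z ^ dz i * u ^ (up i + 1) else 0)
     + f 1 * (if dn i = 1 then of_real (p i) * z ^ dz i * u ^ up i else 0))"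
    by (intro sum.cong refl)
  also have "\<dots> = (u ^ 2 - kern z u) * D 2 + f 0 * (1 - b0 z u) + f 1 * (u - b1 z u)"
    by (simp only: sum.distrib sum_distrib_left[symmetric] sum_distrib_right[symmetric])
      (simp add: kern_def b0_def b1_def ring_distribs)
  finally have "kern z u * D 2 = (\<Sum>l\<le>S. \<sigma> l * u ^ l) - f 0 * b0 z u - f 1 * b1 z u"
    using M D0 by (simp add: algebra_simps)
  then show ?thesis by (simp only: D_def)
qed

text \<open>
  The conditions say that two Laurent coefficients of negative index vanish. Comparing
  coefficients, all of them vanish, and the remaining ones form a bounded solution
  of the homogeneous system, which is zero.
\<close>

lemma contour_unique:
  fixes x0 x1 z :: complex
  assumes z: "norm z < 1"
    and c: "contour_integral (circlepath 0 1) (\<lambda>u. (x0 * b0 z u + x1 * b1 z u) / kern z u) = 0"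
      "contour_integral (circlepath 0 1) (\<lambda>u. (x0 * b0 z u + x1 * b1 z u) * u / kern z u) = 0"
  shows "x0 = 0 \<and> x1 = 0"
proof -
  define F where "F = (\<lambda>u. (x0 * b0 z u + x1 * b1 z u) / kern z u)"
  \<comment> \<open>Up to the factor \<open>t\<close>, \<open>c k\<close> is the Laurent coefficient
    of \<open>F\<close> of index -k-1 on the unit circle, so \<open>c 0\<close> and
    \<open>c 1\<close> are the two quantities assumed to vanish.\<close>
  define c where "c = (\<lambda>k. contour_integral (circlepath 0 1) (\<lambda>u. F u * u powi k))"
  define t :: complex where "t = 2 * pi * \<i>"
  define e where "e = (\<lambda>k::int. if k = -1 then t else 0)"
  have t: "t \<noteq> 0" by (simp add: t_def)
  have pii: "((\<lambda>u. u powi k) has_contour_integral e k) (circlepath 0 1)" for k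
    using contour_integral_powi_circlepath[of 1 k] by (cases "k = -1") (simp_all add: e_def t_def)
  have Fc: "continuous_on (sphere 0 1) F"
    unfolding F_def using kern_nonzero[OF z] by (auto simp: b0_def b1_def kern_def intro!: continuous_intros)
  have ci: "((\<lambda>u. F u * u powi k) has_contour_integral c k) (circlepath 0 1)" for k
    unfolding c_def
    by (intro has_contour_integral_integral contour_integrable_continuous_circlepath continuous_intros)
       (use Fc in auto)
  have "compact (F ` sphere 0 1)" by (intro compact_continuous_image Fc) auto
  then have "bounded (F ` sphere 0 1)" by (rule compact_imp_bounded)
  then obtain B where "\<forall>x\<in>F ` sphere 0 1. norm x \<le> B" unfolding bounded_iff by blast
  then have B: "norm (F u) \<le> B" if "u \<in> sphere 0 1" for u using that by blast
  have B0: "B \<ge> 0" using order_trans[OF norm_ge_zero B[of 1]] by simp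
  have cb: "norm (c k) \<le> B * (2 * pi)" for k
  proof -
    have "norm (c k) \<le> B * (2 * pi * 1)"
      by (rule has_contour_integral_bound_circlepath[OF ci]) (use B B0 in \<open>auto simp: norm_mult norm_power_int\<close>)
    then show ?thesis by simp
  qed
  \<comment> \<open>The same functional applied to \<open>u powi k\<close> times the numerator of
    \<open>F\<close>; multiplying \<open>F\<close> by the kernel becomes the linear recurrence
    \<open>rel\<close> for \<open>c\<close>.\<close>
  define hc where "hc = (\<lambda>k. x0 * e k + x1 * e (k+1)
     - (\<Sum>i\<in>I. if dn i = 0 then of_real (p i) * z ^ dz i * (x0 * e (k + up i) + x1 * e (k + up i + 1)) else 0)
     - (\<Sum>i\<in>I. if dn i = 1 then of_real (p i) * z ^ dz i * (x1 * e (k + up i)) else 0))"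
  have rel: "c (k + 2) - (\<Sum>i\<in>I. of_real (p i) * z ^ dz i * c (k + ex i)) = hc k" for k
  proof -
    have 1: "((\<lambda>u. F u * u powi (k+2) - (\<Sum>i\<in>I. of_real (p i) * z ^ dz i * (F u * u powi (k + ex i))))
        has_contour_integral c (k + 2) - (\<Sum>i\<in>I. of_real (p i) * z ^ dz i * c (k + ex i))) (circlepath 0 1)"
      by (intro has_contour_integral_diff has_contour_integral_sum has_contour_integral_lmul ci fin)
    have 2: "((\<lambda>u. x0 * u powi k + x1 * u powi (k+1)
       - (\<Sum>i\<in>I. if dn i = 0 then of_real (p i) * z ^ dz i * (x0 * u powi (k + up i) + x1 * u powi (k + up i + 1)) else 0)
       - (\<Sum>i\<in>I. if dn i = 1 then of_real (p i) * z ^ dz i * (x1 * u powi (k + up i)) else 0))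
        has_contour_integral hc k) (circlepath 0 1)"
    proof -
      have if_int: "((\<lambda>u. if P then f u else 0) has_contour_integral (if P then y else 0)) (circlepath 0 1)"
        if "(f has_contour_integral y) (circlepath 0 1)" for P f y
        using that by (cases P) (auto intro: has_contour_integral_0)
      show ?thesis unfolding hc_def
        by (intro has_contour_integral_diff has_contour_integral_sum has_contour_integral_lmul
              has_contour_integral_add pii fin if_int)
    qed
    have 3: "x0 * u powi k + x1 * u powi (k+1)
       - (\<Sum>i\<in>I. if dn i = 0 then of_real (p i) * z ^ dz i * (x0 * u powi (k + up i) + x1 * u powi (k + up i + 1)) else 0)
       - (\<Sum>i\<in>I. if dn i = 1 then of_real (p i) * z ^ dz i * (x1 * u powi (k + up i)) else 0)
       = F u * u powi (k+2) - (\<Sum>i\<in>I. of_real (p i) * z ^ dz i * (F u * u powi (k + ex i)))"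
      if "u \<in> path_image (circlepath 0 1)" for u
    proof -
      from that have u: "norm u = 1" "u \<noteq> 0" by auto
      have P: "u powi (k + int n) = u powi k * u ^ n" for n using u(2) by (simp add: power_int_add)
      have P': "u powi (k + int n + 1) = u powi k * u ^ n * u" for n using u(2) by (simp add: power_int_add)
      have P1: "u powi (k+1) = u powi k * u" "u powi (k+2) = u powi k * u\<^sup>2"
        using u(2) by (simp_all add: power_int_add)
      have "F u * u powi (k+2) - (\<Sum>i\<in>I. of_real (p i) * z ^ dz i * (F u * u powi (k + ex i)))
          = F u * kern z u * u powi k"
        unfolding kern_def P P1 by (simp add: algebra_simps sum_distrib_left sum_distrib_right)
      also have "\<dots> = (x0 * b0 z u + x1 * b1 z u) * u powi k"
        using kern_nonzero[OF z u(1)] by (simp add: F_def)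
      also have "\<dots> = x0 * u powi k + x1 * u powi (k+1)
       - (\<Sum>i\<in>I. if dn i = 0 then of_real (p i) * z ^ dz i * (x0 * u powi (k + up i) + x1 * u powi (k + up i + 1)) else 0)
       - (\<Sum>i\<in>I. if dn i = 1 then of_real (p i) * z ^ dz i * (x1 * u powi (k + up i)) else 0)"
      proof -
        have A: "(\<Sum>i\<in>I. if dn i = 0 then of_real (p i) * z ^ dz i * (x0 * u powi (k + up i) + x1 * u powi (k + up i + 1)) else 0)
          = x0 * u powi k * (\<Sum>i\<in>I. if dn i = 0 then of_real (p i) * z ^ dz i * u ^ up i else 0)
            + x1 * u powi k * (\<Sum>i\<in>I. if dn i = 0 then of_real (p i) * z ^ dz i * u ^ (up i + 1) else 0)"
          unfolding sum_distrib_left sum.distrib[symmetric] P P'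
          by (intro sum.cong refl) (auto simp: algebra_simps)
        have A': "(\<Sum>i\<in>I. if dn i = 1 then of_real (p i) * z ^ dz i * (x1 * u powi (k + up i)) else 0)
          = x1 * u powi k * (\<Sum>i\<in>I. if dn i = 1 then of_real (p i) * z ^ dz i * u ^ up i else 0)"
          unfolding sum_distrib_left P
          by (intro sum.cong refl) (auto simp: algebra_simps)
        show ?thesis unfolding A A' b0_def b1_def P1 by (simp add: algebra_simps)
      qed
      finally show ?thesis by simp
    qed
    show ?thesis
      using has_contour_integral_unique[OF has_contour_integral_eq[OF 2 3] 1] by simp
  qed
  have c01: "c 0 = 0" "c 1 = 0" using assms(2,3) by (simp_all add: c_def F_def mult.commute)
  \<comment> \<open>For n \<ge> 2 the right-hand side of \<open>rel\<close> at k = n - 2 vanishes,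
    as the numerator is a polynomial. The recurrence then expresses \<open>c n\<close> by
    coefficients of nonnegative argument with total weight at most |z|.\<close>
  have cnat: "c (int n) = 0" for n
  proof (rule contraction_imp_zero[of "\<lambda>n. c (int n)" "B * (2 * pi)" "norm z"])
    fix C and n :: nat assume C: "\<And>k. norm (c (int k)) \<le> C"
    then have C0: "C \<ge> 0" using norm_ge_zero order_trans by blast
    consider "n = 0" | "n = 1" | m where "n = m + 2" using that(3)[of "n - 2"] by (cases "n \<ge> 2") linarith+
    then show "norm (c (int n)) \<le> norm z * C"
    proof cases
      case 3
      have "e k = 0" if "k \<ge> 0" for k using that by (simp add: e_def)
      then have "hc (int m) = 0" by (simp add: hc_def cong: if_cong)
      then have "c (int n) = (\<Sum>i\<in>I. of_real (p i) * z ^ dz i * c (int (m + ex i)))"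
        using rel[of "int m"] 3 by (simp add: add.commute)
      also have "norm \<dots> \<le> norm z * C"
        using z by (intro norm_step_sum_le C) auto
      finally show ?thesis .
    qed (use C0 c01 in auto)
  qed (use cb z in auto)
  have cpos: "c k = 0" if "k \<ge> 0" for k
    using cnat[of "nat k"] that by simp
  \<comment> \<open>Without source the kernel equation reads L = - F, and the coefficient of u^(l-2)
    in - F is \<open>- c (1 - l) / t\<close>. For l = 0 and l = 1 these terms are multiples of
    \<open>c 1\<close> and \<open>c 0\<close>, which vanish, so the boundary values are x0 and
    x1.\<close>
  define f where "f = (\<lambda>l. (if l = 0 then x0 else 0) + (if l = 1 then x1 else 0) - c (1 - int l) / t)"
  have "is_sol z (\<lambda>_. 0) f"
    unfolding is_sol_def
  proof (intro allI)
    fix l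
    have "f l * t = (if l = 0 then x0 * t else 0) + (if l = 1 then x1 * t else 0) - c (1 - int l)"
      using t by (simp add: f_def algebra_simps)
    also have "c (1 - int l) = hc (- int l - 1) + (\<Sum>i\<in>I. of_real (p i) * z ^ dz i * c (- int l - 1 + ex i))"
      using rel[of "- int l - 1"] by (simp add: algebra_simps)
    also have "(if l = 0 then x0 * t else 0) + (if l = 1 then x1 * t else 0) -
       (hc (- int l - 1) + (\<Sum>i\<in>I. of_real (p i) * z ^ dz i * c (- int l - 1 + ex i)))
      = (\<Sum>i\<in>I. (if dn i = 0 then of_real (p i) * z ^ dz i * (x0 * e (- int l - 1 + up i) + x1 * e (- int l - 1 + up i + 1)) else 0)
           + (if dn i = 1 then of_real (p i) * z ^ dz i * (x1 * e (- int l - 1 + up i)) else 0)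
           - of_real (p i) * z ^ dz i * c (- int l - 1 + ex i))"
      unfolding hc_def sum.distrib sum_subtractf by (auto simp: e_def)
    also have "\<dots> = (\<Sum>i\<in>I. (if up i \<le> l then of_real (p i) * z ^ dz i * f (l - up i + dn i) else 0) * t)"
    proof (intro sum.cong refl)
      fix i assume i: "i \<in> I"
      have ee: "- int l - 1 + int (ex i) = 1 - (int l - int (up i) + int (dn i))"
        using dn_le[OF i] by (simp add: ex_def)
      show "(if dn i = 0 then of_real (p i) * z ^ dz i * (x0 * e (- int l - 1 + up i) + x1 * e (- int l - 1 + up i + 1)) else 0)
           + (if dn i = 1 then of_real (p i) * z ^ dz i * (x1 * e (- int l - 1 + up i)) else 0)
           - of_real (p i) * z ^ dz i * c (- int l - 1 + ex i) =
          (if up i \<le> l then of_real (p i) * z ^ dz i * f (l - up i + dn i) else 0) * t"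
      proof (cases "up i \<le> l")
        case False
        then have "c (- int l - 1 + ex i) = 0" using dn_le[OF i] unfolding ee by (intro cpos) auto
        with False show ?thesis by (auto simp: e_def)
      next
        case True
        then have ce: "1 - (int l - int (up i) + int (dn i)) = 1 - int (l - up i + dn i)" by simp
        have ft: "f (l - up i + dn i) * t = (if l - up i + dn i = 0 then x0 * t else 0)
             + (if l - up i + dn i = 1 then x1 * t else 0) - c (1 - int (l - up i + dn i))"
          using t by (simp add: f_def algebra_simps)
        have e1: "e (- int l - 1 + up i) = (if l - up i = 0 then t else 0)"
          using True by (auto simp: e_def)
        have e2: "e (- int l - 1 + up i + 1) = (if l - up i = 1 then t else 0)"
          using True by (auto simp: e_def)
        have "(if up i \<le> l then of_real (p i) * z ^ dz i * f (l - up i + dn i) else 0) * t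
            = of_real (p i) * z ^ dz i * (f (l - up i + dn i) * t)" using True by simp
        also have "\<dots> = (if dn i = 0 then of_real (p i) * z ^ dz i * (x0 * e (- int l - 1 + up i) + x1 * e (- int l - 1 + up i + 1)) else 0)
           + (if dn i = 1 then of_real (p i) * z ^ dz i * (x1 * e (- int l - 1 + up i)) else 0)
           - of_real (p i) * z ^ dz i * c (- int l - 1 + ex i)"
          unfolding ft ee ce e1 e2 using dn_le[OF i] by (auto simp: algebra_simps)
        finally show ?thesis ..
      qed
    qed
    finally have "f l * t = (\<Sum>i\<in>I. if up i \<le> l then of_real (p i) * z ^ dz i * f (l - up i + dn i) else 0) * t"
      by (simp add: sum_distrib_right)
    then show "f l = 0 + (\<Sum>i\<in>I. if up i \<le> l then of_real (p i) * z ^ dz i * f (l - up i + dn i) else 0)"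
      using t by simp
  qed
  moreover have "norm (f l) \<le> norm x0 + norm x1 + B * (2 * pi) / norm t" for l
  proof -
    have "norm (f l) \<le> norm (if l = 0 then x0 else 0) + norm (if l = 1 then x1 else 0) + norm (c (1 - int l) / t)"
      unfolding f_def by (intro order_trans[OF norm_triangle_ineq4] add_mono norm_triangle_ineq) auto
    also have "\<dots> \<le> norm x0 + norm x1 + B * (2 * pi) / norm t"
      using cb t by (intro add_mono) (auto simp: norm_divide divide_right_mono)
    finally show ?thesis .
  qed
  ultimately have "f l = 0" for l using bounded_homogeneous_sol[OF z] by blast
  from this[of 0] this[of 1] show ?thesis using c01 by (simp add: f_def)
qed

end

section \<open>Regular boundary points\<close>

text \<open>Integrands whose contour integrals depend holomorphically on the parameter z.\<close>

definition C1_family :: "(complex \<Rightarrow> complex \<Rightarrow> complex) \<Rightarrow> bool" where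
  "C1_family N \<longleftrightarrow> continuous_on UNIV (\<lambda>(z,u). N z u) \<and>
     (\<exists>N'. continuous_on UNIV (\<lambda>(z,u). N' z u) \<and> (\<forall>z u. ((\<lambda>z. N z u) has_field_derivative N' z u) (at z)))"

named_theorems C1_family_intros

lemma C1_family_const [C1_family_intros]: "C1_family (\<lambda>z u. c u)" if "continuous_on UNIV c"
  unfolding C1_family_def case_prod_beta'
  by (intro conjI exI[of _ "\<lambda>_ _. 0"] continuous_intros continuous_on_compose2[OF that] allI) auto

lemma C1_family_holomorphic [C1_family_intros]:
  assumes "g holomorphic_on UNIV" shows "C1_family (\<lambda>z u. g z)"
proof -
  have c: "continuous_on UNIV g" "continuous_on UNIV (deriv g)"
    using assms holomorphic_deriv[OF assms] by (auto intro: holomorphic_on_imp_continuous_on)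
  show ?thesis
    unfolding C1_family_def case_prod_beta'
    by (intro conjI exI[of _ "\<lambda>z _. deriv g z"] continuous_intros continuous_on_compose2[OF c(1)]
          continuous_on_compose2[OF c(2)] allI holomorphic_derivI[OF assms]) auto
qed

lemma C1_family_add [C1_family_intros]:
  assumes "C1_family M" "C1_family N" shows "C1_family (\<lambda>z u. M z u + N z u)"
proof -
  obtain M' N' where *: "continuous_on UNIV (\<lambda>(z,u). M z u)" "continuous_on UNIV (\<lambda>(z,u). N z u)"
    "continuous_on UNIV (\<lambda>(z,u). M' z u)" "continuous_on UNIV (\<lambda>(z,u). N' z u)"
    "\<And>z u. ((\<lambda>z. M z u) has_field_derivative M' z u) (at z)" "\<And>z u. ((\<lambda>z. N z u) has_field_derivative N' z u) (at z)"
    using assms unfolding C1_family_def by blast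
  then show ?thesis unfolding C1_family_def case_prod_beta'
    by (intro conjI exI[of _ "\<lambda>z u. M' z u + N' z u"] continuous_intros allI derivative_intros) auto
qed

lemma C1_family_mult [C1_family_intros]:
  assumes "C1_family M" "C1_family N" shows "C1_family (\<lambda>z u. M z u * N z u)"
proof -
  obtain M' N' where *: "continuous_on UNIV (\<lambda>(z,u). M z u)" "continuous_on UNIV (\<lambda>(z,u). N z u)"
    "continuous_on UNIV (\<lambda>(z,u). M' z u)" "continuous_on UNIV (\<lambda>(z,u). N' z u)"
    "\<And>z u. ((\<lambda>z. M z u) has_field_derivative M' z u) (at z)" "\<And>z u. ((\<lambda>z. N z u) has_field_derivative N' z u) (at z)"
    using assms unfolding C1_family_def by blast
  then show ?thesis unfolding C1_family_def case_prod_beta'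
    by (intro conjI exI[of _ "\<lambda>z u. M' z u * N z u + N' z u * M z u"] continuous_intros allI DERIV_mult) auto
qed

lemma C1_family_diff [C1_family_intros]:
  assumes "C1_family M" "C1_family N" shows "C1_family (\<lambda>z u. M z u - N z u)"
proof -
  have "C1_family (\<lambda>z u. M z u + (-1) * N z u)"
    by (intro C1_family_intros assms continuous_intros)
  then show ?thesis by simp
qed

lemma C1_family_sum [C1_family_intros]:
  assumes "\<And>i. i \<in> A \<Longrightarrow> C1_family (N i)" shows "C1_family (\<lambda>z u. \<Sum>i\<in>A. N i z u)"
  using assms
proof (induction A rule: infinite_finite_induct)
  case (insert x F)
  then show ?case by (simp add: C1_family_add)
qed (use C1_family_const[of "\<lambda>_. 0"] in auto)

lemma C1_family_if [C1_family_intros]: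
  assumes "C1_family N" shows "C1_family (\<lambda>z u. if P then N z u else 0)"
  using assms C1_family_const[of "\<lambda>_. 0"] by (cases P) auto

lemma C1_family_contour_integral:
  assumes "C1_family N" "C1_family K" "convex U" "open U" "\<rho> \<ge> 0"
    and "\<And>z u. z \<in> U \<Longrightarrow> norm u = \<rho> \<Longrightarrow> K z u \<noteq> 0"
  shows "(\<lambda>z. contour_integral (circlepath 0 \<rho>) (\<lambda>u. N z u / K z u)) holomorphic_on U"
proof -
  obtain N' K' where *: "continuous_on UNIV (\<lambda>(z,u). K z u)" "continuous_on UNIV (\<lambda>(z,u). N z u)"
    "continuous_on UNIV (\<lambda>(z,u). K' z u)" "continuous_on UNIV (\<lambda>(z,u). N' z u)"
    "\<And>z u. ((\<lambda>z. K z u) has_field_derivative K' z u) (at z)" "\<And>z u. ((\<lambda>z. N z u) has_field_derivative N' z u) (at z)"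
    using assms(1,2) unfolding C1_family_def by blast
  show ?thesis
    by (rule holomorphic_on_contour_integral_circlepath[OF assms(3-5) *(6) *(5)
           *(2)[THEN continuous_on_subset] *(1)[THEN continuous_on_subset]
           *(4)[THEN continuous_on_subset] *(3)[THEN continuous_on_subset]])
      (use assms(6) in auto)
qed

lemma nonzero_tube:
  fixes g :: "complex \<Rightarrow> complex \<Rightarrow> complex"
  assumes "continuous_on UNIV (\<lambda>(z,u). g z u)" "compact C" "\<And>u. u \<in> C \<Longrightarrow> g a u \<noteq> 0"
  obtains r where "r > 0" "\<And>z u. z \<in> ball a r \<Longrightarrow> u \<in> C \<Longrightarrow> g z u \<noteq> 0"
proof -
  let ?U = "{p. (case p of (z,u) \<Rightarrow> g z u) \<noteq> 0}"
  have "open ?U" using assms(1) by (intro open_Collect_neq continuous_intros)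
  moreover have "{a} \<times> C \<subseteq> ?U" using assms(3) by auto
  ultimately obtain e where e: "e > 0" "(\<Union>x\<in>{a} \<times> C. ball x e) \<subseteq> ?U"
    using compact_subset_open_imp_ball_epsilon_subset[OF compact_Times[OF compact_sing assms(2)]] by metis
  show ?thesis
  proof (rule that[OF e(1)])
    fix z u assume "z \<in> ball a e" "u \<in> C"
    then have "(z, u) \<in> ball (a, u) e" by (simp add: dist_Pair_Pair)
    then have "(z, u) \<in> (\<Union>x\<in>{a} \<times> C. ball x e)" using \<open>u \<in> C\<close> by (intro UN_I[of "(a, u)"]) auto
    then have "(z, u) \<in> ?U" using e(2) by (rule rev_subsetD)
    then show "g z u \<noteq> 0" by simp
  qed
qed

text \<open>If all 2 x 2 minors vanish, a nonzero row (a i, b i) yields the kernel vector (b i, - a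
  i). Two rows are treated by padding with a zero row.\<close>

lemma rank_deficient_kernel:
  fixes a b :: "nat \<Rightarrow> 'a::field"
  assumes "a 0 * b 1 = a 1 * b 0" "a 0 * b 2 = a 2 * b 0" "a 1 * b 2 = a 2 * b 1"
  obtains x y where "(x, y) \<noteq> (0, 0)" "x * a 0 + y * b 0 = 0" "x * a 1 + y * b 1 = 0" "x * a 2 + y * b 2 = 0"
proof -
  show ?thesis
  proof (cases "\<exists>i\<in>{0,1,2}. (a i, b i) \<noteq> (0, 0)")
    case True
    then obtain i where i: "i \<in> {0,1,2}" "(a i, b i) \<noteq> (0, 0)" by blast
    have "a i * b j = a j * b i" if "j \<in> {0,1,2}" for j
      using i(1) that assms by (auto simp: mult.commute)
    then show ?thesis
      using i(2) by (intro that[of "b i" "- a i"]) (auto simp: algebra_simps)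
  next
    case False
    then show ?thesis by (intro that[of 1 0]) auto
  qed
qed

text \<open>Absolute summability is given only up to the unit circle, so Cauchy's theorem is applied
  to a function continuous on the closed disc and holomorphic inside; this admits \<rho> =
  1.\<close>

lemma power_series_contour_zero:
  fixes a :: "nat \<Rightarrow> complex"
  assumes "summable (\<lambda>l. norm (a l))" "0 < \<rho>" "\<rho> \<le> 1"
  shows "((\<lambda>u. suminf (\<lambda>l. a l * u ^ l) * u ^ k) has_contour_integral 0) (circlepath 0 \<rho>)"
proof -
  let ?L = "\<lambda>u. suminf (\<lambda>l. a l * u ^ l)"
  have ul: "uniform_limit (cball 0 1) (\<lambda>n u. \<Sum>l<n. a l * u ^ l) ?L sequentially"
  proof (rule Weierstrass_m_test[where M = "\<lambda>l. norm (a l)"])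
    fix n and x :: complex assume "x \<in> cball 0 1"
    then have "norm x ^ n \<le> 1" by (intro power_le_one) auto
    then show "norm (a n * x ^ n) \<le> norm (a n)"
      by (simp add: norm_mult norm_power mult_left_le)
  qed (use assms in auto)
  have "continuous_on (cball 0 1) ?L \<and> ?L holomorphic_on ball 0 1"
    by (rule holomorphic_uniform_limit[OF _ ul]) (auto intro!: always_eventually continuous_intros holomorphic_intros)
  then have c: "continuous_on (cball 0 1) (\<lambda>u. ?L u * u ^ k)" and h: "(\<lambda>u. ?L u * u ^ k) holomorphic_on ball 0 1"
    by (auto intro!: continuous_intros holomorphic_intros)
  show ?thesis
    by (rule Cauchy_theorem_convex[OF c, where K = "{}"])
       (use h assms in \<open>auto simp: interior_cball holomorphic_on_imp_differentiable_at\<close>)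
qed

context critical_walk
begin

lemma C1_family_kern [C1_family_intros]: "C1_family kern"
  and C1_family_b0 [C1_family_intros]: "C1_family b0"
  and C1_family_b1 [C1_family_intros]: "C1_family b1"
proof -
  have 1: "C1_family (\<lambda>z u. kern z u)" unfolding kern_def by (intro C1_family_intros continuous_intros holomorphic_intros)
  have 2: "C1_family (\<lambda>z u. b0 z u)" unfolding b0_def by (intro C1_family_intros continuous_intros holomorphic_intros)
  have 3: "C1_family (\<lambda>z u. b1 z u)" unfolding b1_def by (intro C1_family_intros continuous_intros holomorphic_intros)
  from 1 2 3 show "C1_family kern" "C1_family b0" "C1_family b1" by simp_all
qed

lemma C1_family_continuous: "C1_family N \<Longrightarrow> continuous_on UNIV (\<lambda>(z,u). N z u)"
  by (simp add: C1_family_def)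

lemma C1_family_continuous_snd:
  assumes "C1_family N" shows "continuous_on A (\<lambda>u. N z u)"
proof -
  have "continuous_on A (\<lambda>u. (z, u))" by (intro continuous_on_Pair continuous_on_const continuous_on_id)
  from continuous_on_compose2[OF C1_family_continuous[OF assms] this] show ?thesis by simp
qed

lemma continuous_kern: "continuous_on A (\<lambda>u. kern (z::complex) u)"
  and continuous_b0: "continuous_on A (\<lambda>u. b0 (z::complex) u)"
  and continuous_b1: "continuous_on A (\<lambda>u. b1 (z::complex) u)"
  by (intro C1_family_continuous_snd C1_family_intros)+

definition src_gf :: "nat \<Rightarrow> (complex \<Rightarrow> nat \<Rightarrow> complex) \<Rightarrow> complex \<Rightarrow> complex \<Rightarrow> complex" where
  "src_gf S \<sigma> z u = (\<Sum>l\<le>S. \<sigma> z l * u ^ l)"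

lemma C1_family_src_gf [C1_family_intros]:
  assumes "\<And>l. (\<lambda>z. \<sigma> z l) holomorphic_on UNIV" shows "C1_family (src_gf S \<sigma>)"
proof -
  have "C1_family (\<lambda>z u. src_gf S \<sigma> z u)" unfolding src_gf_def using assms by (intro C1_family_intros continuous_intros)
  then show ?thesis by simp
qed

text \<open>Dividing the kernel equation by the kernel leaves a power series in u, which integration
  against u^k annihilates. The remaining terms give one linear equation for levels 0 and 1, and
  \<open>row\<close> is its entry for the function N.\<close>

definition row :: "real \<Rightarrow> nat \<Rightarrow> (complex \<Rightarrow> complex \<Rightarrow> complex) \<Rightarrow> complex \<Rightarrow> complex" where
  "row \<rho> k N z = contour_integral (circlepath 0 \<rho>) (\<lambda>u. N z u * u ^ k / kern z u)"

lemma row_holomorphic: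
  assumes "C1_family N" "convex U" "open U" "\<rho> \<ge> 0" "\<And>z u. z \<in> U \<Longrightarrow> norm u = \<rho> \<Longrightarrow> kern z u \<noteq> 0"
  shows "row \<rho> k N holomorphic_on U"
proof -
  have "(\<lambda>z. row \<rho> k N z) holomorphic_on U"
    unfolding row_def using assms
    by (intro C1_family_contour_integral C1_family_intros continuous_intros) auto
  then show ?thesis by simp
qed

lemma row_has_contour_integral:
  assumes "C1_family N" "\<rho> \<ge> 0" "\<And>u. norm u = \<rho> \<Longrightarrow> kern z u \<noteq> 0"
  shows "((\<lambda>u. N z u * u ^ k / kern z u) has_contour_integral row \<rho> k N z) (circlepath 0 \<rho>)"
  unfolding row_def
  by (intro has_contour_integral_integral contour_integrable_continuous_circlepath continuous_intros
        C1_family_continuous_snd C1_family_intros)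
     (use assms in auto)

lemma row_equation:
  assumes sol: "is_sol z (\<sigma> z) f" and \<sigma>: "\<And>l. l > S \<Longrightarrow> \<sigma> z l = 0"
    and hol: "\<And>l. (\<lambda>z. \<sigma> z l) holomorphic_on UNIV"
    and sm: "summable (\<lambda>l. norm (f l))" and \<rho>: "0 < \<rho>" "\<rho> \<le> 1"
    and nz: "\<And>u. norm u = \<rho> \<Longrightarrow> kern z u \<noteq> 0"
  shows "f 0 * row \<rho> k b0 z + f 1 * row \<rho> k b1 z = row \<rho> k (src_gf S \<sigma>) z"
proof -
  let ?L = "\<lambda>u. suminf (\<lambda>l. f (l + 2) * u ^ l)"
  have 1: "((\<lambda>u. src_gf S \<sigma> z u * u ^ k / kern z u - f 0 * (b0 z u * u ^ k / kern z u) - f 1 * (b1 z u * u ^ k / kern z u))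
     has_contour_integral row \<rho> k (src_gf S \<sigma>) z - f 0 * row \<rho> k b0 z - f 1 * row \<rho> k b1 z) (circlepath 0 \<rho>)"
    using hol \<rho> nz
    by (intro has_contour_integral_diff has_contour_integral_lmul row_has_contour_integral C1_family_intros) auto
  have 2: "((\<lambda>u. ?L u * u ^ k) has_contour_integral 0) (circlepath 0 \<rho>)"
    by (rule power_series_contour_zero[OF _ \<rho>]) (rule summable_ignore_initial_segment[OF sm])
  have 3: "?L u * u ^ k = src_gf S \<sigma> z u * u ^ k / kern z u - f 0 * (b0 z u * u ^ k / kern z u) - f 1 * (b1 z u * u ^ k / kern z u)"
    if "u \<in> path_image (circlepath 0 \<rho>)" for u
  proof -
    have u: "norm u = \<rho>" using that \<rho> by auto
    have "summable (\<lambda>l. norm (f l * u ^ l))"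
    proof (rule summable_comparison_test'[OF sm, of 0])
      fix n :: nat
      have "\<rho> ^ n \<le> 1" using \<rho> by (intro power_le_one) auto
      then show "norm (norm (f n * u ^ n)) \<le> norm (f n)" using \<rho> by (simp add: norm_mult norm_power u mult_left_le)
    qed
    from kernel_equation[OF sol _ this, of S] \<sigma>
    have "kern z u * ?L u = src_gf S \<sigma> z u - f 0 * b0 z u - f 1 * b1 z u" by (simp add: src_gf_def)
    then have "?L u = (src_gf S \<sigma> z u - f 0 * b0 z u - f 1 * b1 z u) / kern z u"
      using nz[OF u] by (simp add: nonzero_eq_divide_eq mult.commute)
    then show ?thesis by (simp only:) (use nz[OF u] in \<open>simp add: field_simps\<close>)
  qed
  have "row \<rho> k (src_gf S \<sigma>) z - f 0 * row \<rho> k b0 z - f 1 * row \<rho> k b1 z = 0"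
    using has_contour_integral_unique[OF has_contour_integral_eq[OF 2 3] 1] by simp
  then show ?thesis by (simp add: algebra_simps)
qed

lemma row_linear:
  assumes "\<rho> \<ge> 0" "\<And>u. norm u = \<rho> \<Longrightarrow> kern z u \<noteq> 0"
  shows "((\<lambda>u. (x0 * b0 z u + x1 * b1 z u) * u ^ k / kern z u) has_contour_integral
     x0 * row \<rho> k b0 z + x1 * row \<rho> k b1 z) (circlepath 0 \<rho>)"
proof -
  have "((\<lambda>u. x0 * (b0 z u * u ^ k / kern z u) + x1 * (b1 z u * u ^ k / kern z u)) has_contour_integral
     x0 * row \<rho> k b0 z + x1 * row \<rho> k b1 z) (circlepath 0 \<rho>)"
    using assms by (intro has_contour_integral_add has_contour_integral_lmul row_has_contour_integral C1_family_intros) auto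
  then show ?thesis
    by (rule has_contour_integral_eq) (simp add: algebra_simps add_divide_distrib)
qed

text \<open>A vanishing determinant would give a nonzero vector (x, y) satisfying both conditions of
  \<open>contour_unique\<close>.\<close>

lemma regular_det_nonzero:
  assumes z: "norm z < 1"
  shows "row 1 0 b0 z * row 1 1 b1 z - row 1 1 b0 z * row 1 0 b1 z \<noteq> 0"
proof
  assume D: "row 1 0 b0 z * row 1 1 b1 z - row 1 1 b0 z * row 1 0 b1 z = 0"
  obtain x y where xy: "(x, y) \<noteq> (0, 0)" "x * row 1 0 b0 z + y * row 1 0 b1 z = 0" "x * row 1 1 b0 z + y * row 1 1 b1 z = 0"
    using rank_deficient_kernel[of "\<lambda>i. if i = 0 then row 1 0 b0 z else if i = 1 then row 1 1 b0 z else 0"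
       "\<lambda>i. if i = 0 then row 1 0 b1 z else if i = 1 then row 1 1 b1 z else 0"] D by auto
  have "contour_integral (circlepath 0 1) (\<lambda>u. (x * b0 z u + y * b1 z u) * u ^ k / kern z u) = x * row 1 k b0 z + y * row 1 k b1 z" for k
    using row_linear[of 1 z x y k] kern_nonzero[OF z] by (simp add: contour_integral_unique)
  from this[of 0] this[of 1] xy contour_unique[OF z, of x y] show False by simp
qed

text \<open>Cramer's rule on the rows k = 0, 1. The determinant is nonzero inside the disc but may
  vanish at \<zeta>; the bound on f removes the resulting pole. The claim concerns the radius to
  \<zeta>, and the identity theorem later spreads it over a neighbourhood.\<close>

theorem regular_boundary_point:
  fixes f \<sigma> :: "complex \<Rightarrow> nat \<Rightarrow> complex"
  assumes sol: "\<And>z. norm z < 1 \<Longrightarrow> is_sol z (\<sigma> z) (f z)"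
    and sm: "\<And>z. norm z < 1 \<Longrightarrow> summable (\<lambda>l. norm (f z l))"
    and \<sigma>: "\<And>z l. l > S \<Longrightarrow> \<sigma> z l = 0" and hol: "\<And>l. (\<lambda>z. \<sigma> z l) holomorphic_on UNIV"
    and bd: "\<And>z. norm z < 1 \<Longrightarrow> norm (f z i) \<le> B" and i: "i < 2"
    and \<zeta>: "norm \<zeta> = 1" and nz: "\<And>u. norm u = 1 \<Longrightarrow> kern \<zeta> u \<noteq> 0"
  obtains r \<Phi> where "r > 0" "\<Phi> holomorphic_on ball 0 r"
    "\<And>s. 0 < s \<Longrightarrow> s < r \<Longrightarrow> f (\<zeta> * of_real (1 - s)) i = \<Phi> (of_real s)"
proof -
  obtain r0 where r0: "r0 > 0" "\<And>z u. z \<in> ball \<zeta> r0 \<Longrightarrow> u \<in> sphere 0 1 \<Longrightarrow> kern z u \<noteq> 0"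
    using nonzero_tube[OF C1_family_continuous[OF C1_family_kern], of "sphere 0 1" \<zeta>] nz by auto
  define r where "r = min r0 1"
  have r: "r > 0" "r \<le> r0" "r \<le> 1" using r0 by (auto simp: r_def)
  have Z: "\<zeta> * (1 - s) \<in> ball \<zeta> r0" if "s \<in> ball 0 r" for s
    using that r \<zeta> by (simp add: dist_norm algebra_simps norm_mult)
  have Zr: "norm (\<zeta> * (1 - of_real s)) < 1" if "0 < s" "s < r" for s
  proof -
    have "1 - of_real s = (of_real (1 - s) :: complex)" by simp
    then show ?thesis using that r \<zeta> by (simp only: norm_mult norm_of_real) simp
  qed
  define w where "w = (\<lambda>k N s. row 1 k N (\<zeta> * (1 - s)))"
  have hw: "w k N holomorphic_on ball 0 r" if "C1_family N" for k N
  proof -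
    have "row 1 k N holomorphic_on ball \<zeta> r0"
      by (rule row_holomorphic[OF that]) (use r0 in auto)
    moreover have "(\<lambda>s. \<zeta> * (1 - s)) holomorphic_on ball 0 r" by (intro holomorphic_intros)
    moreover have "(\<lambda>s. \<zeta> * (1 - s)) ` ball 0 r \<subseteq> ball \<zeta> r0" using Z by blast
    ultimately show ?thesis
      using holomorphic_on_compose_gen[of "\<lambda>s. \<zeta> * (1 - s)" "ball 0 r" "row 1 k N" "ball \<zeta> r0"]
      by (simp add: w_def o_def)
  qed
  note hws = hw[OF C1_family_b0] hw[OF C1_family_b1] hw[OF C1_family_src_gf[OF hol]]
  define num where "num = (\<lambda>s. if i = 0 then w 0 (src_gf S \<sigma>) s * w 1 b1 s - w 1 (src_gf S \<sigma>) s * w 0 b1 s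
                                else w 0 b0 s * w 1 (src_gf S \<sigma>) s - w 1 b0 s * w 0 (src_gf S \<sigma>) s)"
  define den where "den = (\<lambda>s. w 0 b0 s * w 1 b1 s - w 1 b0 s * w 0 b1 s)"
  have "num holomorphic_on ball 0 r" unfolding num_def by (cases "i = 0") (auto intro!: holomorphic_intros hws)
  moreover have "den holomorphic_on ball 0 r" unfolding den_def by (auto intro!: holomorphic_intros hws)
  moreover have "f (\<zeta> * of_real (1 - s)) i * den (of_real s) = num (of_real s)" if s: "0 < s" "s < r" for s
  proof -
    let ?z = "\<zeta> * (1 - of_real s)"
    have E: "f ?z 0 * row 1 k b0 ?z + f ?z 1 * row 1 k b1 ?z = row 1 k (src_gf S \<sigma>) ?z" for k
      using sol[OF Zr[OF s]] \<sigma> hol sm[OF Zr[OF s]] kern_nonzero[OF Zr[OF s]] by (intro row_equation) auto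
    have "i = 0 \<or> i = 1" using i by auto
    then show ?thesis
      unfolding den_def num_def w_def E[of 0, symmetric] E[of 1, symmetric]
      by (auto simp: algebra_simps)
  qed
  moreover have "\<exists>s\<in>ball 0 r. den s \<noteq> 0"
    using regular_det_nonzero[OF Zr[of "r/2"]] r
    by (intro bexI[of _ "of_real (r/2)"]) (auto simp: den_def w_def)
  moreover have "norm (f (\<zeta> * of_real (1 - s)) i) \<le> B" if s: "0 < s" "s < r" for s
    using bd[OF Zr[OF s]] by simp
  ultimately obtain r' \<Phi> where "0 < r'" "r' \<le> r" "\<Phi> holomorphic_on ball 0 r'"
    "\<And>s. 0 < s \<Longrightarrow> s < r' \<Longrightarrow> f (\<zeta> * of_real (1 - s)) i = \<Phi> (of_real s)"
    using bounded_quotient[of r num den "\<lambda>s. f (\<zeta> * of_real (1 - s)) i" B] r(1) by blast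
  with that show ?thesis by blast
qed

end

section \<open>Roots of the kernel at the critical point\<close>

text \<open>First and second divided differences of the monomials.\<close>

primrec dd1 :: "nat \<Rightarrow> 'a::comm_ring_1 \<Rightarrow> 'a \<Rightarrow> 'a" where
  "dd1 0 a b = 0"
| "dd1 (Suc q) a b = a ^ q + b * dd1 q a b"

primrec dd2 :: "nat \<Rightarrow> 'a::comm_ring_1 \<Rightarrow> 'a \<Rightarrow> 'a \<Rightarrow> 'a" where
  "dd2 0 u a b = 0"
| "dd2 (Suc q) u a b = dd1 q a b + u * dd2 q u a b"

lemma dd1_diff: "(a - b) * dd1 q a b = a ^ q - b ^ q"
proof (induction q)
  case (Suc q)
  have "(a - b) * dd1 (Suc q) a b = (a - b) * a ^ q + b * ((a - b) * dd1 q a b)"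
    by (simp add: algebra_simps)
  then show ?case by (simp only: Suc) (simp add: algebra_simps)
qed simp

lemma dd1_commute: "dd1 q a b = dd1 q b (a::'a::comm_ring_1)"
proof (induction q)
  case (Suc q)
  have "dd1 (Suc q) a b - dd1 (Suc q) b a = (a ^ q - b ^ q) - (a - b) * dd1 q a b"
    by (simp add: algebra_simps Suc)
  then show ?case by (simp only: dd1_diff) simp
qed simp

lemma dd2_diff: "(u - b) * dd2 q u a b = dd1 q u a - dd1 q b (a::'a::comm_ring_1)"
proof (induction q)
  case (Suc q)
  have "(u - b) * dd2 (Suc q) u a b = (u - b) * dd1 q a b + u * (dd1 q u a - dd1 q b a)"
    by (simp add: algebra_simps Suc[symmetric])
  also have "\<dots> = (u - a) * dd1 q u a + (a - b) * dd1 q a b + a * dd1 q u a - a * dd1 q b a"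
    by (simp add: dd1_commute[of q b a] algebra_simps)
  also have "\<dots> = dd1 (Suc q) u a - dd1 (Suc q) b a"
    by (simp only: dd1_diff) (simp add: algebra_simps)
  finally show ?case .
qed simp

lemma dd1_1_1: "dd1 q 1 1 = (of_nat q :: 'a::comm_ring_1)"
  by (induction q) (simp_all add: algebra_simps)

lemma dd2_1_1: "2 * dd2 q 1 1 1 = (of_nat q * (of_nat q - 1) :: 'a::comm_ring_1)"
  by (induction q) (simp_all add: dd1_1_1 algebra_simps)

text \<open>Taylor expansion at 1 with exact remainder; the polynomial cofactor is what allows
  division by the square of u - 1 at the critical point.\<close>

lemma power_expand2: "u ^ q = 1 + of_nat q * (u - 1) + (u - 1)\<^sup>2 * dd2 q u 1 (1::'a::comm_ring_1)"
proof -
  have "(u - 1)\<^sup>2 * dd2 q u 1 1 = (u - 1) * (dd1 q u 1 - of_nat q)"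
    by (simp add: power2_eq_square mult.assoc dd2_diff dd1_1_1)
  also have "\<dots> = u ^ q - 1 - of_nat q * (u - 1)"
    using dd1_diff[of u 1 q] by (simp add: algebra_simps)
  finally show ?thesis by simp
qed

lemma continuous_on_dd1 [continuous_intros]:
  fixes f g :: "'b::topological_space \<Rightarrow> 'a::{comm_ring_1,real_normed_algebra_1}"
  assumes "continuous_on A f" "continuous_on A g" shows "continuous_on A (\<lambda>x. dd1 q (f x) (g x))"
  using assms by (induction q) (auto intro!: continuous_intros)

lemma continuous_on_dd2 [continuous_intros]:
  fixes f g h :: "'b::topological_space \<Rightarrow> 'a::{comm_ring_1,real_normed_algebra_1}"
  assumes "continuous_on A f" "continuous_on A g" "continuous_on A h"
  shows "continuous_on A (\<lambda>x. dd2 q (f x) (g x) (h x))"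
  using assms by (induction q) (auto intro!: continuous_intros)

lemma holomorphic_on_dd1 [holomorphic_intros]:
  "f holomorphic_on A \<Longrightarrow> g holomorphic_on A \<Longrightarrow> (\<lambda>x. dd1 q (f x) (g x)) holomorphic_on A"
  by (induction q) (auto intro!: holomorphic_intros)

lemma holomorphic_on_dd2 [holomorphic_intros]:
  "f holomorphic_on A \<Longrightarrow> g holomorphic_on A \<Longrightarrow> h holomorphic_on A
   \<Longrightarrow> (\<lambda>x. dd2 q (f x) (g x) (h x)) holomorphic_on A"
  by (induction q) (auto intro!: holomorphic_intros)

primrec dd2' :: "nat \<Rightarrow> complex \<Rightarrow> complex" where
  "dd2' 0 u = 0"
| "dd2' (Suc q) u = dd2 q u 1 1 + u * dd2' q u"

lemma has_field_derivative_dd2: "((\<lambda>u. dd2 q u 1 1) has_field_derivative dd2' q u) (at u)"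
  by (induction q) (auto intro!: derivative_eq_intros)

lemma continuous_on_dd2' [continuous_intros]:
  "continuous_on A f \<Longrightarrow> continuous_on A (\<lambda>x. dd2' q (f x))"
  by (induction q) (auto intro!: continuous_intros)

context critical_walk
begin

text \<open>The drift is zero, so this is the variance of the displacement of a step;
  \<open>clock\<close> is its mean duration. Together they determine the quadratic
  \<open>blow 0\<close>.\<close>

definition var where "var = (\<Sum>i\<in>I. p i * (real (up i) - real (dn i))\<^sup>2)"
definition clock where "clock = (\<Sum>i\<in>I. p i * real (dz i))"

lemma var_pos: "var > 0"
proof -
  obtain i where i: "i \<in> I" "up i < dn i" using descend by blast
  show ?thesis unfolding var_def
    by (rule sum_pos2[OF fin i(1)]) (use i p_pos less_imp_le[OF p_pos] in auto)
qed

lemma clock_pos: "clock > 0"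
proof -
  obtain i where i: "i \<in> I" "up i < dn i" using descend by blast
  have "0 < dz i" using dz_pos[OF i(1)] by simp
  then show ?thesis unfolding clock_def
    by (intro sum_pos2[OF fin i(1)]) (use i p_pos less_imp_le[OF p_pos] in auto)
qed

lemma real_ex: "i \<in> I \<Longrightarrow> real (ex i) = real (up i) + 2 - real (dn i)"
  using dn_le[of i] by (simp add: ex_def of_nat_diff)

lemma sum_p_ex: "(\<Sum>i\<in>I. p i * real (ex i)) = 2"
proof -
  have "(\<Sum>i\<in>I. p i * real (ex i)) = (\<Sum>i\<in>I. p i * (real (up i) - real (dn i)) + 2 * p i)"
    by (intro sum.cong refl) (simp add: real_ex algebra_simps)
  then show ?thesis using drift total by (simp add: sum.distrib sum_distrib_left[symmetric])
qed

lemma sum_p_ex2: "(\<Sum>i\<in>I. p i * (real (ex i) * (real (ex i) - 1))) = var + 2"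
proof -
  have "(\<Sum>i\<in>I. p i * (real (ex i) * (real (ex i) - 1)))
     = (\<Sum>i\<in>I. p i * (real (up i) - real (dn i))\<^sup>2 + 3 * (p i * (real (up i) - real (dn i))) + 2 * p i)"
    by (intro sum.cong refl) (simp add: real_ex algebra_simps power2_eq_square)
  then show ?thesis using drift total by (simp add: sum.distrib sum_distrib_left[symmetric] var_def)
qed

text \<open>
  The critical point is blown up by z = 1 - s^2 and u = 1 + s v. The divided differences keep the
  quotient of the kernel by s^2 defined at s = 0, where it is a nondegenerate quadratic in v.
\<close>

definition blow :: "complex \<Rightarrow> complex \<Rightarrow> complex" where
  "blow s v = v\<^sup>2 - (\<Sum>i\<in>I. of_real (p i) * (v\<^sup>2 * dd2 (ex i) (1 + s * v) 1 1
      - dd1 (dz i) (1 - s\<^sup>2) 1 * (1 + s * v) ^ ex i))"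

definition blow' :: "complex \<Rightarrow> complex \<Rightarrow> complex" where
  "blow' s v = 2 * v - (\<Sum>i\<in>I. of_real (p i) * (2 * v * dd2 (ex i) (1 + s * v) 1 1 + v\<^sup>2 * (dd2' (ex i) (1 + s * v) * s)
      - dd1 (dz i) (1 - s\<^sup>2) 1 * (of_nat (ex i) * (1 + s * v) ^ (ex i - 1) * s)))"

text \<open>Total weight 1 removes the constant term and zero drift removes the term linear in s,
  which leaves the factor s^2.\<close>

lemma kern_blow: "kern (1 - s\<^sup>2) (1 + s * v) = s\<^sup>2 * blow s v"
proof -
  have A: "(1 - s\<^sup>2) ^ n = 1 - s\<^sup>2 * dd1 n (1 - s\<^sup>2) 1" for n
    using dd1_diff[of "1 - s\<^sup>2" 1 n] by (simp add: algebra_simps)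
  have B: "(1 + s * v) ^ n = 1 + of_nat n * (s * v) + s\<^sup>2 * v\<^sup>2 * dd2 n (1 + s * v) 1 1" for n
    using power_expand2[of "1 + s * v" n] by (simp add: power_mult_distrib)
  have expand: "(1 - s\<^sup>2) ^ m * (1 + s * v) ^ n = 1 + of_nat n * (s * v)
     + s\<^sup>2 * (v\<^sup>2 * dd2 n (1 + s * v) 1 1 - dd1 m (1 - s\<^sup>2) 1 * (1 + s * v) ^ n)" for m n
  proof -
    have "(1 - s\<^sup>2) ^ m * (1 + s * v) ^ n = (1 + s * v) ^ n - s\<^sup>2 * (dd1 m (1 - s\<^sup>2) 1 * (1 + s * v) ^ n)"
      by (simp only: A[of m]) (simp add: algebra_simps)
    also have "\<dots> = (1 + of_nat n * (s * v) + s\<^sup>2 * v\<^sup>2 * dd2 n (1 + s * v) 1 1) - s\<^sup>2 * (dd1 m (1 - s\<^sup>2) 1 * (1 + s * v) ^ n)"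
      using B[of n] by simp
    finally show ?thesis by (simp add: algebra_simps)
  qed
  have "(\<Sum>i\<in>I. of_real (p i) * (1 - s\<^sup>2) ^ dz i * (1 + s * v) ^ ex i)
     = (\<Sum>i\<in>I. of_real (p i) + (s * v) * of_real (p i * real (ex i))
        + s\<^sup>2 * (of_real (p i) * (v\<^sup>2 * dd2 (ex i) (1 + s * v) 1 1 - dd1 (dz i) (1 - s\<^sup>2) 1 * (1 + s * v) ^ ex i)))"
    by (intro sum.cong refl) (simp only: mult.assoc expand, simp add: algebra_simps)
  also have "\<dots> = 1 + s * v * 2 + s\<^sup>2 * (v\<^sup>2 - blow s v)"
  proof -
    have 1: "(\<Sum>i\<in>I. of_real (p i)) = (1::complex)" by (metis total of_real_1 of_real_sum)
    have 2: "(\<Sum>i\<in>I. of_real (p i * real (ex i))) = (2::complex)"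
      by (metis sum_p_ex of_real_numeral of_real_sum)
    show ?thesis
      by (simp only: sum.distrib sum_distrib_left[symmetric] 1 2) (simp add: blow_def)
  qed
  finally show ?thesis unfolding kern_def by (simp add: power2_eq_square algebra_simps)
qed

lemma blow_0: "blow 0 v = of_real clock - of_real (var / 2) * v\<^sup>2"
proof -
  have "(\<Sum>i\<in>I. of_real (p i) * (v\<^sup>2 * dd2 (ex i) 1 1 1 - dd1 (dz i) 1 1)) =
     (\<Sum>i\<in>I. v\<^sup>2 / 2 * of_real (p i * (real (ex i) * (real (ex i) - 1))) - of_real (p i * real (dz i)))"
  proof (intro sum.cong refl)
    fix i
    have d: "dd2 (ex i) 1 1 1 = of_real (real (ex i) * (real (ex i) - 1)) / (2::complex)"
      using dd2_1_1[of "ex i", where ?'a = complex] by (simp add: field_simps)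
    show "of_real (p i) * (v\<^sup>2 * dd2 (ex i) 1 1 1 - dd1 (dz i) 1 1) =
       v\<^sup>2 / 2 * of_real (p i * (real (ex i) * (real (ex i) - 1))) - of_real (p i * real (dz i))"
      unfolding d dd1_1_1 by (simp add: field_simps)
  qed
  also have "\<dots> = v\<^sup>2 / 2 * of_real (var + 2) - of_real clock"
    by (simp only: sum_subtractf sum_distrib_left[symmetric] of_real_sum[symmetric] sum_p_ex2 clock_def)
  finally show ?thesis by (simp add: blow_def field_simps)
qed

lemma blow'_0: "blow' 0 v = - of_real var * v"
proof -
  have "(\<Sum>i\<in>I. of_real (p i) * (2 * v * dd2 (ex i) 1 1 1)) =
     (\<Sum>i\<in>I. v * of_real (p i * (real (ex i) * (real (ex i) - 1))))"
  proof (intro sum.cong refl)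
    fix i
    have "2 * dd2 (ex i) 1 1 1 = (of_real (real (ex i) * (real (ex i) - 1)) :: complex)"
      using dd2_1_1[of "ex i", where ?'a = complex] by simp
    then show "of_real (p i) * (2 * v * dd2 (ex i) 1 1 1) = v * of_real (p i * (real (ex i) * (real (ex i) - 1)))"
      by (metis (no_types, opaque_lifting) mult.assoc mult.left_commute of_real_mult)
  qed
  also have "\<dots> = v * of_real (var + 2)"
    by (simp only: sum_distrib_left[symmetric] of_real_sum[symmetric] sum_p_ex2)
  finally show ?thesis by (simp add: blow'_def algebra_simps)
qed

lemma has_field_derivative_blow: "(blow s has_field_derivative blow' s v) (at v)"
proof -
  have "((\<lambda>v. dd2 n (1 + s * v) 1 1) has_field_derivative dd2' n (1 + s * v) * s) (at v)" for n
    by (rule DERIV_chain2[OF has_field_derivative_dd2]) (auto intro!: derivative_eq_intros)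
  note [derivative_intros] = this
  have "((\<lambda>v. blow s v) has_field_derivative blow' s v) (at v)"
    unfolding blow_def blow'_def
    by (rule derivative_eq_intros refl | simp)+ (auto simp: algebra_simps)
  then show ?thesis by simp
qed

text \<open>\<open>blow 0\<close> has simple zeros at plus and minus sqrt (2 clock / var). The
  negative one is continued, because then 1 + s V(s) moves into the unit disc for s > 0.\<close>

lemma branch_exists:
  obtains r V v0 where "r > 0" "V holomorphic_on ball 0 r" "V 0 = of_real (- v0)" "v0 > (0::real)"
    "\<And>s. s \<in> ball 0 r \<Longrightarrow> kern (1 - s\<^sup>2) (1 + s * V s) = 0"
proof -
  define v0 where "v0 = sqrt (2 * clock / var)"
  have v0: "v0 > 0" "v0\<^sup>2 = 2 * clock / var" using clock_pos var_pos by (auto simp: v0_def)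
  have cont': "continuous_on UNIV (\<lambda>p. blow' (fst p) (snd p))"
    unfolding blow'_def by (intro continuous_intros)
  have cont: "continuous_on UNIV (\<lambda>s. blow s (of_real (- v0)))"
    unfolding blow_def by (intro continuous_intros)
  obtain r V where "r > 0" "r \<le> 1" "V holomorphic_on ball 0 r" "V 0 = of_real (- v0)"
    "\<And>s. s \<in> ball 0 r \<Longrightarrow> blow s (V s) = 0"
  proof (rule implicit_function_holomorphic[of 1 "of_real (- v0)" blow blow'])
    show "isCont (\<lambda>(s, v). blow' s v) (0, of_real (- v0))"
      using cont' by (auto simp: case_prod_beta' continuous_on_eq_continuous_at)
    show "isCont (\<lambda>s. blow s (of_real (- v0))) 0" using cont by (auto simp: continuous_on_eq_continuous_at)
    show "(\<lambda>s. blow s (V s)) holomorphic_on ball 0 r" if "V holomorphic_on ball 0 r" for V r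
      unfolding blow_def by (intro holomorphic_intros that)
    have "of_real (var / 2) * of_real (v0\<^sup>2) = (of_real clock :: complex)"
      unfolding of_real_mult[symmetric] v0(2) using var_pos by (simp add: field_simps)
    then show "blow 0 (of_real (- v0)) = 0" by (simp add: blow_0)
    show "blow' 0 (of_real (- v0)) \<noteq> 0" using v0 var_pos by (simp add: blow'_0)
  qed (auto intro: has_field_derivative_blow)
  then show ?thesis using v0 by (intro that[of r V v0]) (auto simp: kern_blow)
qed

text \<open>The second divided difference of \<open>kern z\<close> at u, a, b. If a and b are
  different roots it is the cofactor of (u - a) (u - b), and it keeps its meaning when they
  merge.\<close>

definition kern2 :: "complex \<Rightarrow> complex \<Rightarrow> complex \<Rightarrow> complex \<Rightarrow> complex" where
  "kern2 z u a b = 1 - (\<Sum>i\<in>I. of_real (p i) * z ^ dz i * dd2 (ex i) u a b)"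

lemma kern2_1: "kern2 1 1 1 1 = - of_real (var / 2)"
proof -
  have "(\<Sum>i\<in>I. of_real (p i) * dd2 (ex i) 1 1 1) = (\<Sum>i\<in>I. of_real (p i * (real (ex i) * (real (ex i) - 1)))) / (2::complex)"
    unfolding sum_divide_distrib
  proof (intro sum.cong refl)
    fix i
    have "dd2 (ex i) 1 1 1 = of_real (real (ex i) * (real (ex i) - 1)) / (2::complex)"
      using dd2_1_1[of "ex i", where ?'a = complex] by (simp add: field_simps)
    then show "of_real (p i) * dd2 (ex i) 1 1 1 = of_real (p i * (real (ex i) * (real (ex i) - 1))) / (2::complex)" by simp
  qed
  then show ?thesis by (simp only: of_real_sum[symmetric] sum_p_ex2 kern2_def) (simp add: field_simps)
qed

lemma kern_factor:
  fixes z u a b :: complex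
  assumes "kern z a = 0" "kern z b = 0" "a \<noteq> b"
  shows "kern z u = (u - a) * (u - b) * kern2 z u a b"
proof -
  define K1 where "K1 = (\<lambda>u. u + a - (\<Sum>i\<in>I. of_real (p i) * z ^ dz i * dd1 (ex i) u a))"
  have 1: "kern z u - kern z a = (u - a) * K1 u" for u
  proof -
    have "(u - a) * K1 u = (u - a) * (u + a) - (\<Sum>i\<in>I. of_real (p i) * z ^ dz i * ((u - a) * dd1 (ex i) u a))"
      unfolding K1_def by (simp add: right_diff_distrib sum_distrib_left mult_ac)
    then show ?thesis unfolding dd1_diff kern_def
      by (simp add: right_diff_distrib sum_subtractf power2_eq_square algebra_simps)
  qed
  have 2: "K1 u - K1 b = (u - b) * kern2 z u a b" for u
  proof -
    have "(u - b) * kern2 z u a b = (u - b) - (\<Sum>i\<in>I. of_real (p i) * z ^ dz i * ((u - b) * dd2 (ex i) u a b))"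
      unfolding kern2_def by (simp add: right_diff_distrib sum_distrib_left mult_ac)
    then show ?thesis unfolding dd2_diff K1_def
      by (simp add: right_diff_distrib sum_subtractf algebra_simps)
  qed
  have "K1 b = 0" using 1[of b] assms by simp
  then show ?thesis using 1[of u] 2[of u] assms by simp
qed

lemma kern_factor_critical: "kern 1 u = (u - 1)\<^sup>2 * kern2 1 u 1 1"
proof -
  have 1: "(\<Sum>i\<in>I. of_real (p i)) = (1::complex)" by (metis total of_real_1 of_real_sum)
  have 2: "(\<Sum>i\<in>I. of_real (p i) * of_nat (ex i)) = (2::complex)"
    using arg_cong[OF sum_p_ex, of "of_real :: real \<Rightarrow> complex"] by simp
  have "(\<Sum>i\<in>I. of_real (p i) * u ^ ex i) = (\<Sum>i\<in>I. of_real (p i) + (u - 1) * (of_real (p i) * of_nat (ex i))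
      + (u - 1)\<^sup>2 * (of_real (p i) * dd2 (ex i) u 1 1))"
    by (intro sum.cong refl, subst power_expand2) (simp add: algebra_simps)
  also have "\<dots> = 1 + (u - 1) * 2 + (u - 1)\<^sup>2 * (\<Sum>i\<in>I. of_real (p i) * dd2 (ex i) u 1 1)"
    by (simp only: sum.distrib sum_distrib_left[symmetric] 1 2)
  finally show ?thesis by (simp add: kern_def kern2_def power2_eq_square algebra_simps)
qed

text \<open>Equality in the triangle inequality forces all the steps to be aligned.\<close>

lemma aligned_steps:
  fixes z u :: complex
  assumes z: "norm z = 1" and u: "norm u = 1" and K: "kern z u = 0" and i: "i \<in> I"
  shows "z ^ dz i * u ^ up i = u ^ dn i"
proof -
  define x where "x = (\<lambda>i. z ^ dz i * u ^ ex i / u\<^sup>2)"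
  have nx: "norm (x i) = 1" for i using z u by (simp add: x_def norm_mult norm_divide norm_power)
  have u0: "u \<noteq> 0" using u by auto
  have "(\<Sum>i\<in>I. of_real (p i) * x i) = (\<Sum>i\<in>I. of_real (p i) * z ^ dz i * u ^ ex i) / u\<^sup>2"
    by (simp add: x_def sum_divide_distrib mult.assoc)
  also have "(\<Sum>i\<in>I. of_real (p i) * z ^ dz i * u ^ ex i) = u\<^sup>2" using K by (simp add: kern_def)
  also have "u\<^sup>2 / u\<^sup>2 = 1" using u0 by simp
  finally have "Re (\<Sum>i\<in>I. of_real (p i) * x i) = 1" by simp
  then have "(\<Sum>i\<in>I. p i * (1 - Re (x i))) = 0"
    using total by (simp add: right_diff_distrib sum_subtractf)
  moreover have "p i * (1 - Re (x i)) \<ge> 0" if "i \<in> I" for i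
    using p_pos[OF that] complex_Re_le_cmod[of "x i"] nx[of i] by simp
  ultimately have "p i * (1 - Re (x i)) = 0"
    using sum_nonneg_eq_0_iff[OF fin, of "\<lambda>i. p i * (1 - Re (x i))"] i by blast
  then have re: "Re (x i) = 1" using p_pos[OF i] by simp
  have "(Re (x i))\<^sup>2 + (Im (x i))\<^sup>2 = 1" using nx[of i] cmod_power2[of "x i"] by simp
  then have "x i = 1" using re by (simp add: complex_eq_iff)
  then have "z ^ dz i * u ^ ex i = u\<^sup>2" using u0 by (simp add: x_def)
  then have "z ^ dz i * (u ^ ex i * u ^ dn i) = u\<^sup>2 * u ^ dn i" by (metis mult.assoc)
  also have "u ^ ex i * u ^ dn i = u\<^sup>2 * u ^ up i"
    using dn_le[OF i] by (simp add: ex_def power_add[symmetric])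
  finally show ?thesis using u0 by simp
qed

text \<open>This is where aperiodicity enters: at z = 1 the alignment of the steps reads
  \<open>u ^ up i = u ^ dn i\<close>.\<close>

lemma kern_critical_nonzero:
  fixes u :: complex
  assumes "norm u = 1" "u \<noteq> 1" shows "kern 1 u \<noteq> 0"
  using aligned_steps[of 1 u] aperiodic[of u] assms by auto

text \<open>For z = 1 - s^2 the double root 1 splits into U(s) and U(-s), for small s > 0 one inside
  and one outside the unit circle. The radius \<rho> is so close to 1 that U(s) is the only root in
  the closed annulus between \<rho> and 1; the cofactor \<open>K1\<close> records this.\<close>

lemma critical_root_structure:
  obtains \<rho> r U where "0 < \<rho>" "\<rho> < 1" "0 < r" "U holomorphic_on ball 0 r" "U 0 = 1" "deriv U 0 \<noteq> 0"
    "\<And>s. s \<in> ball 0 r \<Longrightarrow> kern (1 - s\<^sup>2) (U s) = 0"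
    "\<And>s u::complex. s \<in> ball 0 r \<Longrightarrow> norm u = \<rho> \<Longrightarrow> kern (1 - s\<^sup>2) u \<noteq> 0"
    "\<And>s. 0 < s \<Longrightarrow> s < r \<Longrightarrow> norm (U (of_real s)) < 1"
    "\<And>s. 0 < s \<Longrightarrow> s < r \<Longrightarrow> \<exists>K1. continuous_on UNIV K1 \<and> K1 holomorphic_on UNIV \<and>
        (\<forall>u. kern (1 - (of_real s)\<^sup>2) u = (u - U (of_real s)) * K1 u) \<and>
        (\<forall>u. \<rho> \<le> norm u \<and> norm u \<le> 1 \<longrightarrow> K1 u \<noteq> 0)"
proof -
  obtain r1 V v0 where V: "r1 > 0" "V holomorphic_on ball 0 r1" "V 0 = of_real (- v0)" "v0 > (0::real)"
    "\<And>s. s \<in> ball 0 r1 \<Longrightarrow> kern (1 - s\<^sup>2) (1 + s * V s) = 0"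
    by (rule branch_exists) (rule that)
  define U where "U = (\<lambda>s. 1 + s * V s)"
  have Uhol: "U holomorphic_on ball 0 r1" unfolding U_def by (intro holomorphic_intros V(2))
  have dU: "deriv U 0 = of_real (- v0)"
  proof (rule DERIV_imp_deriv)
    have "V field_differentiable at 0" using V by (auto intro: holomorphic_on_imp_differentiable_at)
    then obtain V' where "(V has_field_derivative V') (at 0)" by (auto simp: field_differentiable_def)
    then show "(U has_field_derivative of_real (- v0)) (at 0)"
      unfolding U_def using V(3) by (auto intro!: derivative_eq_intros)
  qed
  have "V field_differentiable at 0" using V by (auto intro: holomorphic_on_imp_differentiable_at)
  then have Vc: "isCont V 0" by (rule field_differentiable_imp_continuous_at)
  \<comment> \<open>near 0 the branch enters the unit disc for positive and leaves it for negative parameters\<close>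
  obtain r2 where r2: "r2 > 0" "r2 \<le> r1" "\<And>s. norm s < r2 \<Longrightarrow> norm (V s - of_real (- v0)) < v0 / 2"
  proof -
    obtain d where "d > 0" "\<And>s. dist s 0 < d \<Longrightarrow> dist (V s) (V 0) < v0 / 2"
      using Vc V(4) unfolding continuous_at_eps_delta by (metis half_gt_zero)
    then show ?thesis using V(1,3) by (intro that[of "min d r1"]) (auto simp: dist_norm)
  qed
  have ReV: "Re (V s) < - v0 / 2" "norm (V s) < 2 * v0" if "norm s < r2" for s
  proof -
    have "\<bar>Re (V s - of_real (- v0))\<bar> < v0 / 2" using r2(3)[OF that] abs_Re_le_cmod le_less_trans by blast
    then show "Re (V s) < - v0 / 2" by (simp add: abs_if split: if_splits)
    have "norm (V s) \<le> norm (V s - of_real (- v0)) + norm (of_real (- v0) :: complex)"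
      using norm_triangle_ineq[of "V s - of_real (- v0)" "of_real (- v0)"] by simp
    then show "norm (V s) < 2 * v0" using r2(3)[OF that] V(4) by simp
  qed
  have nU: "(norm (U (of_real s)))\<^sup>2 = 1 + 2 * s * Re (V (of_real s)) + s\<^sup>2 * (norm (V (of_real s)))\<^sup>2" for s :: real
    unfolding U_def cmod_power2 by (simp add: power2_eq_square algebra_simps)
  \<comment> \<open>Below 1 / (4 v0) the linear term 2 s Re V, which is less than - s v0, outweighs
    s^2 |V|^2, since |V| < 2 v0.\<close>
  define r3 where "r3 = min r2 (1 / (4 * v0))"
  have r3: "r3 > 0" "r3 \<le> r2" using r2 V by (auto simp: r3_def)
  have Uin: "norm (U (of_real s)) < 1" if s: "0 < s" "s < r3" for s
  proof -
    have s': "norm (of_real s :: complex) < r2" using s r3 by simp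
    have "s * (norm (V (of_real s)))\<^sup>2 < 1 / (4 * v0) * (2 * v0)\<^sup>2"
      using ReV(2)[OF s'] s V(4) by (intro mult_strict_mono power_strict_mono) (auto simp: r3_def)
    also have "\<dots> = v0" using V(4) by (simp add: power2_eq_square)
    finally have "s * (norm (V (of_real s)))\<^sup>2 + 2 * Re (V (of_real s)) < 0" using ReV(1)[OF s'] by simp
    then have "s * (s * (norm (V (of_real s)))\<^sup>2 + 2 * Re (V (of_real s))) < 0" using s by (intro mult_pos_neg) auto
    then have "(norm (U (of_real s)))\<^sup>2 < 1" unfolding nU by (simp add: power2_eq_square algebra_simps)
    then show ?thesis by (simp add: power_less_one_iff abs_square_less_1)
  qed
  have Uout: "norm (U (- of_real s)) > 1" if s: "0 < s" "s < r3" for s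
  proof -
    have s': "norm (of_real (- s) :: complex) < r2" using s r3 by simp
    have "0 < 2 * (- s) * Re (V (of_real (- s)))"
      using ReV(1)[OF s'] s V(4) by (simp add: mult_pos_neg)
    then have "1 < (norm (U (of_real (- s))))\<^sup>2" unfolding nU
      by (smt (verit) mult_nonneg_nonneg zero_le_power2)
    then show ?thesis using power_le_one[of "norm (U (of_real (- s)))" 2] by fastforce
  qed
  have cU: "continuous_on (ball 0 r1) U" using Uhol by (rule holomorphic_on_imp_continuous_on)
  \<comment> \<open>The cofactor of the two merging roots equals \<open>- var / 2\<close> at the
    critical point, so it has no zeros nearby: no third root comes close.\<close>
  obtain \<epsilon> where \<epsilon>: "\<epsilon> > 0" "\<epsilon> \<le> r3" "\<And>s u. norm s < \<epsilon> \<Longrightarrow> norm (u - 1) < \<epsilon> \<Longrightarrow> kern2 (1 - s\<^sup>2) u (U s) (U (- s)) \<noteq> 0"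
  proof -
    let ?A = "ball 0 r1 \<times> (UNIV :: complex set)"
    let ?h = "\<lambda>p. kern2 (1 - (fst p)\<^sup>2) (snd p) (U (fst p)) (U (- fst p))"
    have "continuous_on ?A ?h"
      unfolding kern2_def by (intro continuous_intros continuous_on_compose2[OF cU]) auto
    then have "isCont ?h (0, 1)"
      using V(1) by (subst (asm) continuous_on_eq_continuous_at) (auto intro: open_Times)
    moreover have "?h (0, 1) \<noteq> 0" using kern2_1 var_pos by (simp add: U_def)
    ultimately obtain e where e: "e > 0" "\<And>p. dist (0, 1) p < e \<Longrightarrow> ?h p \<noteq> 0"
      using continuous_at_avoid[of "(0,1)" ?h 0] by blast
    show ?thesis
    proof (rule that[of "min (e/2) r3"])
      fix s u :: complex assume s: "norm s < min (e/2) r3" "norm (u - 1) < min (e/2) r3"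
      have "dist (0, 1) (s, u) \<le> dist 0 s + dist 1 u"
        unfolding dist_Pair_Pair by (rule sqrt_sum_squares_le_sum) auto
      also have "\<dots> < e" using s by (auto simp: dist_norm norm_minus_commute)
      finally show "kern2 (1 - s\<^sup>2) u (U s) (U (- s)) \<noteq> 0" using e(2)[of "(s, u)"] by simp
    qed (use e r3 in auto)
  qed
  obtain \<rho> where \<rho>: "0 < \<rho>" "\<rho> < 1" "\<And>u::complex. \<rho> \<le> norm u \<Longrightarrow> norm u \<le> 1 \<Longrightarrow> \<epsilon> \<le> norm (u - 1) \<Longrightarrow> kern 1 u \<noteq> 0"
  proof -
    \<comment> \<open>The kernel roots at z = 1 in the closed disc away from 1. This set is compact
      and lies strictly inside, so \<rho> can be placed halfway between its largest modulus and
      1.\<close>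
    define C where "C = {u\<in>cball 0 1. \<epsilon> \<le> norm (u - 1)} \<inter> {u. kern 1 u = (0::complex)}"
    have "closed {u. kern 1 u = (0::complex)}"
      using continuous_closed_preimage_constant[OF continuous_kern[of UNIV 1] closed_UNIV, of 0] by simp
    moreover have "closed {u\<in>cball 0 1. \<epsilon> \<le> norm (u - 1 :: complex)}"
    proof -
      have "closed {u::complex. \<epsilon> \<le> norm (u - 1)}" by (intro closed_Collect_le continuous_intros)
      then have "closed (cball 0 1 \<inter> {u::complex. \<epsilon> \<le> norm (u - 1)})" by (intro closed_Int) auto
      then show ?thesis by (simp add: Int_def)
    qed
    ultimately have "closed C" unfolding C_def by (rule closed_Int[rotated])
    moreover have "bounded C" using bounded_cball[of "0::complex" 1] unfolding C_def
      by (rule bounded_subset) auto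
    ultimately have C: "compact C" by (simp add: compact_eq_bounded_closed)
    have C1: "norm u < 1" if "u \<in> C" for u
    proof -
      have "u \<noteq> 1" using that \<epsilon>(1) by (auto simp: C_def)
      then have "norm u \<noteq> 1" using kern_critical_nonzero[of u] that by (auto simp: C_def)
      then show ?thesis using that by (auto simp: C_def)
    qed
    show ?thesis
    proof (cases "C = {}")
      case True
      then show ?thesis by (intro that[of "1/2"]) (auto simp: C_def)
    next
      case False
      then obtain c where c: "c \<in> C" "\<And>u. u \<in> C \<Longrightarrow> norm u \<le> norm c"
        using continuous_attains_sup[OF C, of norm] by (metis continuous_on_norm_id)
      show ?thesis
      proof (rule that[of "(1 + norm c) / 2"])
        fix u :: complex assume u: "(1 + norm c) / 2 \<le> norm u" "norm u \<le> 1" "\<epsilon> \<le> norm (u - 1)"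
        show "kern 1 u \<noteq> 0"
        proof
          assume "kern 1 u = 0"
          then have "u \<in> C" using u by (auto simp: C_def)
          then show False using c(2)[of u] u(1) C1[OF c(1)] by simp
        qed
      qed (use C1[OF c(1)] in \<open>auto intro: add_pos_nonneg\<close>)
    qed
  qed
  have \<rho>K: "kern 1 u \<noteq> 0" if "norm u = \<rho>" for u :: complex
  proof (cases "\<epsilon> \<le> norm (u - 1)")
    case True then show ?thesis using \<rho> that by auto
  next
    case False
    then have "kern2 1 u 1 1 \<noteq> 0" using \<epsilon>(3)[of 0 u] \<epsilon>(1) by (simp add: U_def)
    moreover have "u \<noteq> 1" using that \<rho> by auto
    ultimately show ?thesis by (simp add: kern_factor_critical)
  qed
  \<comment> \<open>The part of the annulus where roots are excluded by compactness: away from 1,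
    and the whole circle of radius \<rho>. Near 1 the factorization by U(s) and U(-s) takes
    over.\<close>
  define C' where "C' = {u. \<rho> \<le> norm u \<and> norm u \<le> 1 \<and> (\<epsilon> \<le> norm (u - 1 :: complex) \<or> norm u = \<rho>)}"
  have "closed C'" unfolding C'_def
    by (intro closed_Collect_conj closed_Collect_disj closed_Collect_le closed_Collect_eq continuous_intros)
  moreover have "bounded C'" using bounded_cball[of "0::complex" 1] unfolding C'_def
    by (rule bounded_subset) auto
  ultimately have "compact C'" by (simp add: compact_eq_bounded_closed)
  moreover have "kern 1 u \<noteq> 0" if "u \<in> C'" for u using that \<rho>(3) \<rho>K by (auto simp: C'_def)
  ultimately obtain r4 where r4: "r4 > 0" "\<And>z u. z \<in> ball 1 r4 \<Longrightarrow> u \<in> C' \<Longrightarrow> kern z u \<noteq> 0"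
    using nonzero_tube[OF C1_family_continuous[OF C1_family_kern], of C' 1] by blast
  define r where "r = min \<epsilon> (min 1 r4)"
  have r: "r > 0" "r \<le> \<epsilon>" "r \<le> 1" "r \<le> r4" "r \<le> r3" "r \<le> r1" using \<epsilon> r4 r3 r2 by (auto simp: r_def)
  have zb: "1 - s\<^sup>2 \<in> ball 1 r4" if "s \<in> ball 0 r" for s :: complex
  proof -
    have "norm s * norm s \<le> norm s * 1" using that r by (intro mult_left_mono) auto
    then show ?thesis using that r by (simp add: dist_norm norm_power power2_eq_square norm_mult)
  qed
  show ?thesis
  proof (rule that[OF \<rho>(1,2) r(1)])
    show "U holomorphic_on ball 0 r" using Uhol by (rule holomorphic_on_subset) (use r in auto)
    show "U 0 = 1" by (simp add: U_def)
    show "deriv U 0 \<noteq> 0" using dU V(4) by simp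
    show "kern (1 - s\<^sup>2) (U s) = 0" if "s \<in> ball 0 r" for s
      using V(5)[of s] that r by (simp add: U_def)
    show "kern (1 - s\<^sup>2) u \<noteq> 0" if "s \<in> ball 0 r" "norm u = \<rho>" for s u :: complex
      using r4(2)[OF zb[OF that(1)]] that \<rho> by (auto simp: C'_def)
    show "norm (U (of_real s)) < 1" if "0 < s" "s < r" for s
      using Uin that r by auto
    fix s :: real assume s: "0 < s" "s < r"
    let ?s = "of_real s :: complex"
    define K1 where "K1 = (\<lambda>u. (u - U (- ?s)) * kern2 (1 - ?s\<^sup>2) u (U ?s) (U (- ?s)))"
    have sb: "?s \<in> ball 0 r" "- ?s \<in> ball 0 r" using s by auto
    have ne: "U ?s \<noteq> U (- ?s)" using Uin[of s] Uout[of s] s r by force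
    have z0: "kern (1 - ?s\<^sup>2) (U ?s) = 0" "kern (1 - ?s\<^sup>2) (U (- ?s)) = 0"
      using V(5)[of ?s] V(5)[of "- ?s"] sb r by (auto simp: U_def)
    have fac: "kern (1 - ?s\<^sup>2) u = (u - U ?s) * K1 u" for u
      using kern_factor[OF z0 ne, of u] by (simp add: K1_def)
    have h: "K1 holomorphic_on UNIV" unfolding K1_def kern2_def by (intro holomorphic_intros)
    have "K1 u \<noteq> 0" if u: "\<rho> \<le> norm u" "norm u \<le> 1" for u
    proof (cases "\<epsilon> \<le> norm (u - 1)")
      case True
      then have "kern (1 - ?s\<^sup>2) u \<noteq> 0" using r4(2)[OF zb[OF sb(1)]] u by (auto simp: C'_def)
      then show ?thesis using fac by auto
    next
      case False
      then have "kern2 (1 - ?s\<^sup>2) u (U ?s) (U (- ?s)) \<noteq> 0" using \<epsilon>(3)[of ?s u] s r by auto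
      moreover have "u \<noteq> U (- ?s)" using Uout[of s] s r u by auto
      ultimately show ?thesis by (simp add: K1_def)
    qed
    then show "\<exists>K1. continuous_on UNIV K1 \<and> K1 holomorphic_on UNIV \<and>
        (\<forall>u. kern (1 - ?s\<^sup>2) u = (u - U ?s) * K1 u) \<and> (\<forall>u. \<rho> \<le> norm u \<and> norm u \<le> 1 \<longrightarrow> K1 u \<noteq> 0)"
      using fac h holomorphic_on_imp_continuous_on by blast
  qed
qed

end

section \<open>Singular boundary points\<close>

lemma holomorphic_on_if_zero [holomorphic_intros]:
  "g holomorphic_on A \<Longrightarrow> (\<lambda>s. if P then g s else 0) holomorphic_on A"
  by (cases P) auto

context critical_walk
begin

text \<open>If the combination x b0 + y b1 vanishes at the root U, the factor u - U cancels and the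
  integrand has no pole between the circles. Moving the contour from \<rho> to 1 then gives the
  conditions of \<open>contour_unique\<close>.\<close>

lemma critical_rows_independent:
  fixes z U :: complex and K1 :: "complex \<Rightarrow> complex"
  assumes z: "norm z < 1" and \<rho>: "0 < \<rho>" "\<rho> < 1"
    and K1: "continuous_on UNIV K1" "K1 holomorphic_on UNIV" "\<And>u. kern z u = (u - U) * K1 u"
      "\<And>u. \<rho> \<le> norm u \<Longrightarrow> norm u \<le> 1 \<Longrightarrow> K1 u \<noteq> 0"
    and nz: "\<And>u. norm u = \<rho> \<Longrightarrow> kern z u \<noteq> 0"
    and xy: "x * b0 z U + y * b1 z U = 0"
      "x * row \<rho> 0 b0 z + y * row \<rho> 0 b1 z = 0" "x * row \<rho> 1 b0 z + y * row \<rho> 1 b1 z = 0"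
  shows "x = 0 \<and> y = 0"
proof -
  define h where "h = (\<lambda>u. x * b0 z u + y * b1 z u)"
  define h1 where "h1 = (\<lambda>u. if u = U then deriv h U else (h u - h U) / (u - U))"
  have "h holomorphic_on UNIV" unfolding h_def b0_def b1_def
    by (intro holomorphic_intros)
  then have h1: "h1 holomorphic_on UNIV" unfolding h1_def by (intro pole_lemma_open) auto
  have hh1: "h u = (u - U) * h1 u" for u using xy(1) by (auto simp: h1_def h_def)
  define S where "S = {u. K1 u \<noteq> 0}"
  have "open S" unfolding S_def using K1(1) by (intro open_Collect_neq continuous_intros)
  have eq: "contour_integral (circlepath 0 \<rho>') (\<lambda>u. h u * u ^ k / kern z u) = contour_integral (circlepath 0 \<rho>') (\<lambda>u. h1 u * u ^ k / K1 u)"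
    if "\<rho>' = \<rho> \<or> \<rho>' = 1" for \<rho>' k
  proof (rule contour_integral_eq)
    fix u assume "u \<in> path_image (circlepath 0 \<rho>')"
    then have "norm u = \<rho>'" using that \<rho> by auto
    then have "kern z u \<noteq> 0" using that nz kern_nonzero[OF z] by auto
    then show "h u * u ^ k / kern z u = h1 u * u ^ k / K1 u" unfolding hh1 K1(3) by simp
  qed
  have "contour_integral (circlepath 0 \<rho>) (\<lambda>u. h1 u * u ^ k / K1 u) = contour_integral (circlepath 0 1) (\<lambda>u. h1 u * u ^ k / K1 u)" for k
  proof (rule contour_integral_circlepath_annulus[OF \<open>open S\<close>])
    show "(\<lambda>u. h1 u * u ^ k / K1 u) holomorphic_on S"
      by (intro holomorphic_intros holomorphic_on_subset[OF h1] holomorphic_on_subset[OF K1(2)]) (auto simp: S_def)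
  qed (use K1(4) \<rho> in \<open>auto simp: S_def\<close>)
  then have *: "contour_integral (circlepath 0 1) (\<lambda>u. h u * u ^ k / kern z u) = x * row \<rho> k b0 z + y * row \<rho> k b1 z" for k
    using eq[of \<rho> k] eq[of 1 k] contour_integral_unique[OF row_linear[of \<rho> z x y k]] nz \<rho> by (simp add: h_def)
  show ?thesis
    using contour_unique[OF z, of x y] *[of 0] *[of 1] xy by (simp add: h_def)
qed

text \<open>The equations are evaluation at the root U(s) and two contour integrals over the circle
  of radius \<rho>, all holomorphic in s. \<open>critical_rows_independent\<close> says only that
  their rank is 2, so the pair used in Cramer's rule is selected at one point s0.\<close>

theorem singular_boundary_point:
  fixes f \<sigma> :: "complex \<Rightarrow> nat \<Rightarrow> complex"
  assumes sol: "\<And>z. norm z < 1 \<Longrightarrow> is_sol z (\<sigma> z) (f z)"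
    and sm: "\<And>z. norm z < 1 \<Longrightarrow> summable (\<lambda>l. norm (f z l))"
    and \<sigma>: "\<And>z l. l > S \<Longrightarrow> \<sigma> z l = 0" and hol: "\<And>l. (\<lambda>z. \<sigma> z l) holomorphic_on UNIV"
    and bd: "\<And>z. norm z < 1 \<Longrightarrow> norm (f z i) \<le> B" and i: "i < 2"
  obtains r \<Phi> where "r > 0" "\<Phi> holomorphic_on ball 0 r"
    "\<And>s. 0 < s \<Longrightarrow> s < r \<Longrightarrow> f (of_real (1 - s\<^sup>2)) i = \<Phi> (of_real s)"
proof -
  obtain \<rho> r0 U where \<rho>: "0 < \<rho>" "\<rho> < 1" and r0: "0 < r0" and U: "U holomorphic_on ball 0 r0"
    "\<And>s. s \<in> ball 0 r0 \<Longrightarrow> kern (1 - s\<^sup>2) (U s) = 0"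
    "\<And>s u::complex. s \<in> ball 0 r0 \<Longrightarrow> norm u = \<rho> \<Longrightarrow> kern (1 - s\<^sup>2) u \<noteq> 0"
    "\<And>s. 0 < s \<Longrightarrow> s < r0 \<Longrightarrow> norm (U (of_real s)) < 1"
    "\<And>s. 0 < s \<Longrightarrow> s < r0 \<Longrightarrow> \<exists>K1. continuous_on UNIV K1 \<and> K1 holomorphic_on UNIV \<and>
        (\<forall>u. kern (1 - (of_real s)\<^sup>2) u = (u - U (of_real s)) * K1 u) \<and>
        (\<forall>u. \<rho> \<le> norm u \<and> norm u \<le> 1 \<longrightarrow> K1 u \<noteq> 0)"
    by (rule critical_root_structure) (rule that)
  define r where "r = min r0 1"
  have r: "r > 0" "r \<le> r0" "r \<le> 1" using r0 by (auto simp: r_def)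
  have Zr: "norm (1 - (of_real s)\<^sup>2 :: complex) < 1" if "0 < s" "s < r" for s
  proof -
    have e: "1 - (of_real s)\<^sup>2 = (of_real (1 - s\<^sup>2) :: complex)" by simp
    have "0 < s\<^sup>2" "s\<^sup>2 < 1" using that r by (auto simp: power_less_one_iff abs_square_less_1)
    then show ?thesis unfolding e norm_of_real by simp
  qed
  have Uhol: "U holomorphic_on ball 0 r" using U(1) by (rule holomorphic_on_subset) (use r in auto)
  define R where "R = (\<lambda>n N s. if n = 0 then N (1 - s\<^sup>2) (U s) else row \<rho> (n - 1) N (1 - s\<^sup>2))"
  have hR: "R n N holomorphic_on ball 0 r" if N: "C1_family N" "(\<lambda>s. N (1 - s\<^sup>2) (U s)) holomorphic_on ball 0 r" for n N
  proof (cases "n = 0")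
    case True then show ?thesis using N(2) by (simp add: R_def)
  next
    case False
    define W where "W = ball (0::complex) r"
    have "continuous_on UNIV (\<lambda>(z,u). kern (z::complex) u)" by (rule C1_family_continuous[OF C1_family_kern])
    \<comment> \<open>Row integrals are holomorphic on balls free of kernel zeros on the circle;
      covering by such balls yields the whole open set into which s is mapped by 1 - s^2.\<close>
    have "row \<rho> (n - 1) N holomorphic_on {z::complex. \<forall>u\<in>sphere 0 \<rho>. kern z u \<noteq> 0}"
    proof -
      have "row \<rho> (n - 1) N field_differentiable at a" if a: "\<forall>u\<in>sphere 0 \<rho>. kern a u \<noteq> 0" for a
      proof -
        obtain e where "e > 0" "\<And>z u. z \<in> ball a e \<Longrightarrow> u \<in> sphere 0 \<rho> \<Longrightarrow> kern z u \<noteq> 0"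
          using nonzero_tube[OF C1_family_continuous[OF C1_family_kern], of "sphere 0 \<rho>" a] a by auto
        then have "row \<rho> (n - 1) N holomorphic_on ball a e" using N(1) \<rho> by (intro row_holomorphic) auto
        then show ?thesis using \<open>e > 0\<close> by (auto intro: holomorphic_on_imp_differentiable_at)
      qed
      then show ?thesis by (auto simp: holomorphic_on_def intro: field_differentiable_at_within)
    qed
    moreover have "(\<lambda>s. 1 - s\<^sup>2) ` ball 0 r \<subseteq> {z::complex. \<forall>u\<in>sphere 0 \<rho>. kern z u \<noteq> 0}"
      using U(3) r by (auto simp: image_subset_iff)
    moreover have "(\<lambda>s. 1 - s\<^sup>2) holomorphic_on ball 0 r" by (intro holomorphic_intros)
    ultimately show ?thesis
      using False holomorphic_on_compose_gen[of "\<lambda>s. 1 - s\<^sup>2" "ball 0 r" "row \<rho> (n - 1) N" "{z::complex. \<forall>u\<in>sphere 0 \<rho>. kern z u \<noteq> 0}"]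
      by (simp add: R_def o_def)
  qed
  have hb: "R n b0 holomorphic_on ball 0 r" "R n b1 holomorphic_on ball 0 r" "R n (src_gf S \<sigma>) holomorphic_on ball 0 r" for n
  proof -
    show "R n b0 holomorphic_on ball 0 r"
      by (rule hR[OF C1_family_b0]) (unfold b0_def, intro holomorphic_intros Uhol)
    show "R n b1 holomorphic_on ball 0 r"
      by (rule hR[OF C1_family_b1]) (unfold b1_def, intro holomorphic_intros Uhol)
    have "(\<lambda>s. \<sigma> (1 - s\<^sup>2) l) holomorphic_on ball 0 r" for l
    proof -
      have "(\<lambda>s. 1 - s\<^sup>2) holomorphic_on ball (0::complex) r" by (intro holomorphic_intros)
      from holomorphic_on_compose_gen[OF this hol[of l]] show ?thesis by (simp add: o_def)
    qed
    then show "R n (src_gf S \<sigma>) holomorphic_on ball 0 r"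
      by (intro hR C1_family_intros hol) (unfold src_gf_def, intro holomorphic_intros Uhol)
  qed
  have E: "f (1 - (of_real s)\<^sup>2) 0 * R n b0 (of_real s) + f (1 - (of_real s)\<^sup>2) 1 * R n b1 (of_real s) = R n (src_gf S \<sigma>) (of_real s)"
    if s: "0 < s" "s < r" for s n
  proof (cases "n = 0")
    case True
    have u: "norm (U (of_real s)) < 1" "kern (1 - (of_real s)\<^sup>2) (U (of_real s)) = 0" using U(4)[of s] U(2)[of "of_real s"] s r by auto
    have "summable (\<lambda>l. norm (f (1 - (of_real s)\<^sup>2) l * U (of_real s) ^ l))"
    proof (rule summable_comparison_test'[OF sm[OF Zr[OF s]], of 0])
      fix n :: nat
      have "norm (U (of_real s)) ^ n \<le> 1" using u(1) by (intro power_le_one) auto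
      then show "norm (norm (f (1 - (of_real s)\<^sup>2) n * U (of_real s) ^ n)) \<le> norm (f (1 - (of_real s)\<^sup>2) n)"
        by (simp add: norm_mult norm_power mult_left_le)
    qed
    from kernel_equation[OF sol[OF Zr[OF s]] _ this, of S] \<sigma> u(2) True
    show ?thesis by (simp add: R_def src_gf_def algebra_simps)
  next
    case False
    have nz: "kern (1 - (of_real s)\<^sup>2) u \<noteq> 0" if "norm u = \<rho>" for u :: complex
      using U(3)[of "of_real s" u] that s r by auto
    from False show ?thesis
      using row_equation[OF sol[OF Zr[OF s]] \<sigma> hol sm[OF Zr[OF s]] \<rho>(1) less_imp_le[OF \<rho>(2)] nz, of S "n - 1"]
      by (simp add: R_def)
  qed
  define s0 where "s0 = r / 2"
  have s0: "0 < s0" "s0 < r" using r by (auto simp: s0_def)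
  obtain j k where jk: "R j b0 (of_real s0) * R k b1 (of_real s0) - R k b0 (of_real s0) * R j b1 (of_real s0) \<noteq> 0"
  proof (rule ccontr)
    assume "\<not> thesis"
    with that have Z: "R j b0 (of_real s0) * R k b1 (of_real s0) = R k b0 (of_real s0) * R j b1 (of_real s0)" for j k
      by (metis eq_iff_diff_eq_0)
    obtain x y where xy: "(x, y) \<noteq> (0, 0)" "x * R 0 b0 (of_real s0) + y * R 0 b1 (of_real s0) = 0"
      "x * R 1 b0 (of_real s0) + y * R 1 b1 (of_real s0) = 0" "x * R 2 b0 (of_real s0) + y * R 2 b1 (of_real s0) = 0"
      by (rule rank_deficient_kernel[of "\<lambda>n. R n b0 (of_real s0)" "\<lambda>n. R n b1 (of_real s0)"]) (rule Z | rule that)+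
    obtain K1 where "continuous_on UNIV K1" "K1 holomorphic_on UNIV"
        "\<And>u. kern (1 - (of_real s0)\<^sup>2) u = (u - U (of_real s0)) * K1 u"
        "\<And>u. \<rho> \<le> norm u \<Longrightarrow> norm u \<le> 1 \<Longrightarrow> K1 u \<noteq> 0"
      using U(5)[of s0] s0 r by auto
    then have "x = 0 \<and> y = 0"
      by (rule critical_rows_independent[OF Zr[OF s0] \<rho>])
        (use xy U(3)[of "of_real s0"] s0 r in \<open>auto simp: R_def\<close>)
    then show False using xy(1) by simp
  qed
  define num where "num = (\<lambda>s. if i = 0 then R j (src_gf S \<sigma>) s * R k b1 s - R k (src_gf S \<sigma>) s * R j b1 s
                                else R j b0 s * R k (src_gf S \<sigma>) s - R k b0 s * R j (src_gf S \<sigma>) s)"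
  define den where "den = (\<lambda>s. R j b0 s * R k b1 s - R k b0 s * R j b1 s)"
  have "num holomorphic_on ball 0 r" unfolding num_def by (cases "i = 0") (auto intro!: holomorphic_intros hb)
  moreover have "den holomorphic_on ball 0 r" unfolding den_def by (auto intro!: holomorphic_intros hb)
  moreover have "f (of_real (1 - s\<^sup>2)) i * den (of_real s) = num (of_real s)" if s: "0 < s" "s < r" for s
  proof -
    have "i = 0 \<or> i = 1" using i by auto
    then show ?thesis
      unfolding den_def num_def E[OF s, of j, symmetric] E[OF s, of k, symmetric]
      by (auto simp: algebra_simps)
  qed
  moreover have "\<exists>s\<in>ball 0 r. den s \<noteq> 0"
    using jk s0 by (intro bexI[of _ "of_real s0"]) (auto simp: den_def)
  moreover have "norm (f (of_real (1 - s\<^sup>2)) i) \<le> B" if s: "0 < s" "s < r" for s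
    using bd[OF Zr[OF s]] by simp
  ultimately obtain r' \<Phi> where "0 < r'" "r' \<le> r" "\<Phi> holomorphic_on ball 0 r'"
    "\<And>s. 0 < s \<Longrightarrow> s < r' \<Longrightarrow> f (of_real (1 - s\<^sup>2)) i = \<Phi> (of_real s)"
    using bounded_quotient[of r num den "\<lambda>s. f (of_real (1 - s\<^sup>2)) i" B] r(1) by blast
  with that show ?thesis by blast
qed

end

section \<open>Nonnegative solutions at the critical point\<close>

lemma sum_shift_le:
  fixes g :: "nat \<Rightarrow> real"
  assumes "\<And>l. g l \<ge> 0" "K + b \<le> K' + a"
  shows "(\<Sum>l\<le>K. if a \<le> l then g (l - a + b) else 0) \<le> (\<Sum>l\<le>K'. g l)"
proof -
  have "(\<Sum>l\<le>K. if a \<le> l then g (l - a + b) else 0) = (\<Sum>l\<in>{a..K}. g (l - a + b))"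
    by (intro sum.mono_neutral_cong_right) auto
  also have "\<dots> = (\<Sum>l\<in>(\<lambda>l. l - a + b) ` {a..K}. g l)"
    by (subst sum.reindex) (auto simp: inj_on_def)
  also have "\<dots> \<le> (\<Sum>l\<le>K'. g l)"
    using assms by (intro sum_mono2) auto
  finally show ?thesis .
qed

lemma sum_le_at_one:
  fixes a :: "nat \<Rightarrow> real"
  assumes "\<And>x. x0 < x \<Longrightarrow> x < 1 \<Longrightarrow> (\<Sum>n\<le>N. a n * x ^ n) \<le> B" "x0 < 1"
  shows "(\<Sum>n\<le>N. a n) \<le> B"
proof -
  have "((\<lambda>x. \<Sum>n\<le>N. a n * x ^ n) \<longlongrightarrow> (\<Sum>n\<le>N. a n * 1 ^ n)) (at_left 1)"
    by (intro tendsto_intros)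
  moreover have "eventually (\<lambda>x. (\<Sum>n\<le>N. a n * x ^ n) \<le> B) (at_left 1)"
    using assms unfolding eventually_at_left_field by blast
  ultimately show ?thesis
    using tendsto_upperbound[of _ "\<Sum>n\<le>N. a n * 1 ^ n" "at_left (1::real)" B] by simp
qed

text \<open>
  The bound S on the support of src makes the source polynomial in both variables; irreducible
  is all that is needed of strong connectivity beyond the assumptions on the walk.
\<close>

locale critical_system = critical_walk +
  fixes S :: nat and src A :: "nat \<Rightarrow> nat \<Rightarrow> real"
  assumes src_nonneg: "src l n \<ge> 0"
    and src_zero: "l > S \<or> n > S \<Longrightarrow> src l n = 0"
    and A_rec: "A l n = src l n +
       (\<Sum>i\<in>I. if up i \<le> l \<and> dz i \<le> n then p i * A (l - up i + dn i) (n - dz i) else 0)"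
    and irreducible: "\<exists>c>0. \<exists>k. \<forall>n. c * A l n \<le> A l' (n + k)"
    and nontrivial: "\<exists>l n. A l n \<noteq> 0"
begin

lemma A_nonneg: "A l n \<ge> 0"
proof (induction n arbitrary: l rule: less_induct)
  case (less n)
  show ?case
  proof (subst A_rec, intro add_nonneg_nonneg sum_nonneg src_nonneg)
    fix i assume i: "i \<in> I"
    show "0 \<le> (if up i \<le> l \<and> dz i \<le> n then p i * A (l - up i + dn i) (n - dz i) else 0)"
    proof (cases "dz i \<le> n")
      case True
      then have "n - dz i < n" using dz_pos[OF i] by simp
      then show ?thesis using less p_pos[OF i] by auto
    qed auto
  qed
qed

definition srctot where "srctot = (\<Sum>l\<le>S. \<Sum>n\<le>S. src l n)"

lemma srctot_ge: assumes "0 \<le> x" "x \<le> 1" shows "(\<Sum>l\<le>K. \<Sum>n\<le>N. src l n * x ^ n) \<le> srctot"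
proof -
  have "(\<Sum>l\<le>K. \<Sum>n\<le>N. src l n * x ^ n) \<le> (\<Sum>l\<le>K. \<Sum>n\<le>N. src l n)"
    using assms src_nonneg by (intro sum_mono mult_left_le power_le_one) auto
  also have "\<dots> \<le> (\<Sum>l\<le>max K S. \<Sum>n\<le>max N S. src l n)"
    using src_nonneg by (intro order_trans[OF sum_mono[OF sum_mono2] sum_mono2] sum_nonneg) auto
  also have "\<dots> = srctot"
  proof -
    have "(\<Sum>n\<le>max N S. src l n) = (\<Sum>n\<le>S. src l n)" for l
      using src_zero by (intro sum.mono_neutral_right) auto
    moreover have "(\<Sum>l\<le>max K S. \<Sum>n\<le>S. src l n) = srctot"
      unfolding srctot_def using src_zero by (intro sum.mono_neutral_right) auto
    ultimately show ?thesis by simp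
  qed
  finally show ?thesis .
qed

text \<open>The bound C = srctot / (1 - x) solves C = srctot + x C, and every step takes at least
  one unit of time and costs a factor x. The induction on N is over all K, because tracing a step
  back can raise the level by 2.\<close>

lemma A_double_sum_le:
  assumes x: "0 \<le> x" "x < 1"
  shows "(\<Sum>l\<le>K. \<Sum>n\<le>N. A l n * x ^ n) \<le> srctot / (1 - x)"
proof (induction N arbitrary: K rule: less_induct)
  case (less N)
  let ?C = "srctot / (1 - x)"
  have C0: "?C \<ge> 0" using srctot_ge[of x 0 0] x src_nonneg[of 0 0] by (simp add: order_trans[of 0 "src 0 0"])
  have step: "(\<Sum>l\<le>K. \<Sum>n\<le>N. if up i \<le> l \<and> dz i \<le> n then A (l - up i + dn i) (n - dz i) * x ^ n else 0) \<le> x * ?C"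
    if i: "i \<in> I" for i
  proof (cases "dz i \<le> N")
    case False
    then have "(\<Sum>l\<le>K. \<Sum>n\<le>N. if up i \<le> l \<and> dz i \<le> n then A (l - up i + dn i) (n - dz i) * x ^ n else 0) = 0"
      by (intro sum.neutral) auto
    then show ?thesis using mult_nonneg_nonneg[OF x(1) C0] by simp
  next
    case True
    have "(\<Sum>l\<le>K. \<Sum>n\<le>N. if up i \<le> l \<and> dz i \<le> n then A (l - up i + dn i) (n - dz i) * x ^ n else 0)
       = x ^ dz i * (\<Sum>l\<le>K. if up i \<le> l then \<Sum>n\<le>N. (if dz i \<le> n then A (l - up i + dn i) (n - dz i + 0) * x ^ (n - dz i + 0) else 0) else 0)"
      unfolding sum_distrib_left
      by (intro sum.cong refl) (auto simp: sum_distrib_left power_add[symmetric] intro!: sum.cong)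
    also have "\<dots> \<le> x ^ dz i * (\<Sum>l\<le>K. if up i \<le> l then \<Sum>n\<le>N - dz i. A (l - up i + dn i) n * x ^ n else 0)"
    proof (intro mult_left_mono sum_mono)
      fix l
      have "(\<Sum>n\<le>N. if dz i \<le> n then A (l - up i + dn i) (n - dz i + 0) * x ^ (n - dz i + 0) else 0)
          \<le> (\<Sum>n\<le>N - dz i. A (l - up i + dn i) n * x ^ n)"
        using A_nonneg x True by (intro sum_shift_le[where g = "\<lambda>n. A (l - up i + dn i) n * x ^ n"]) auto
      then show "(if up i \<le> l then \<Sum>n\<le>N. (if dz i \<le> n then A (l - up i + dn i) (n - dz i + 0) * x ^ (n - dz i + 0) else 0) else 0)
         \<le> (if up i \<le> l then \<Sum>n\<le>N - dz i. A (l - up i + dn i) n * x ^ n else 0)"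
        by (cases "up i \<le> l") (simp_all only: if_True if_False order_refl)
    qed (use x in auto)
    also have "\<dots> \<le> x ^ dz i * (\<Sum>l\<le>K + 2. \<Sum>n\<le>N - dz i. A l n * x ^ n)"
      using A_nonneg x dn_le[OF i]
      by (intro mult_left_mono sum_shift_le[where g = "\<lambda>l. \<Sum>n\<le>N - dz i. A l n * x ^ n"] sum_nonneg) auto
    also have "\<dots> \<le> x ^ 1 * ?C"
      using less[of "N - dz i" "K + 2"] True dz_pos[OF i] x C0 A_nonneg
      by (intro mult_mono power_decreasing sum_nonneg) auto
    finally show ?thesis by simp
  qed
  have "(\<Sum>l\<le>K. \<Sum>n\<le>N. A l n * x ^ n) = (\<Sum>l\<le>K. \<Sum>n\<le>N. src l n * x ^ n) +
      (\<Sum>i\<in>I. p i * (\<Sum>l\<le>K. \<Sum>n\<le>N. if up i \<le> l \<and> dz i \<le> n then A (l - up i + dn i) (n - dz i) * x ^ n else 0))"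
  proof -
    have "A l n * x ^ n = src l n * x ^ n +
       (\<Sum>i\<in>I. p i * (if up i \<le> l \<and> dz i \<le> n then A (l - up i + dn i) (n - dz i) * x ^ n else 0))" for l n
      by (subst A_rec) (auto simp: distrib_right sum_distrib_right intro!: sum.cong)
    then show ?thesis
      by (simp only: sum.distrib sum_distrib_left sum.swap[of _ I])
  qed
  also have "\<dots> \<le> srctot + (\<Sum>i\<in>I. p i * (x * ?C))"
    using step p_pos x by (intro add_mono srctot_ge sum_mono mult_left_mono) (auto intro: less_imp_le)
  also have "(\<Sum>i\<in>I. p i * (x * ?C)) = x * ?C" by (simp only: sum_distrib_right[symmetric] total mult_1)
  also have "srctot + x * ?C = ?C" using x by (simp add: field_simps)
  finally show ?case .
qed

lemma summable_A: assumes "0 \<le> x" "x < 1" shows "summable (\<lambda>n. A l n * x ^ n)"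
proof (rule bounded_imp_summable)
  show "(\<Sum>k\<le>n. A l k * x ^ k) \<le> srctot / (1 - x)" for n
  proof -
    have "(\<Sum>k\<le>n. A l k * x ^ k) \<le> (\<Sum>j\<le>l. \<Sum>k\<le>n. A j k * x ^ k)"
      using A_nonneg assms by (intro member_le_sum sum_nonneg) auto
    with A_double_sum_le[OF assms] show ?thesis by (meson order_trans)
  qed
qed (use A_nonneg assms in auto)

definition gf :: "nat \<Rightarrow> 'c \<Rightarrow> 'c::{real_normed_field,banach}" where
  "gf l z = suminf (\<lambda>n. of_real (A l n) * z ^ n)"

definition srcgf :: "'c \<Rightarrow> nat \<Rightarrow> 'c::{real_normed_field,banach}" where
  "srcgf z l = (\<Sum>n\<le>S. of_real (src l n) * z ^ n)"

lemma summable_norm_gf: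
  fixes z :: "'c::{real_normed_field,banach}"
  assumes "norm z < 1" shows "summable (\<lambda>n. norm (of_real (A l n) * z ^ n))"
  using summable_A[of "norm z" l] assms A_nonneg by (simp add: norm_mult norm_power)

lemma gf_sums:
  fixes z :: "'c::{real_normed_field,banach}"
  assumes "norm z < 1" shows "(\<lambda>n. of_real (A l n) * z ^ n) sums gf l z"
  unfolding gf_def using summable_norm_cancel[OF summable_norm_gf[OF assms]] by (rule summable_sums)

lemma norm_gf_le:
  fixes z :: "'c::{real_normed_field,banach}"
  assumes "norm z < 1" shows "norm (gf l z) \<le> gf l (norm z)"
proof -
  have "norm (gf l z) \<le> suminf (\<lambda>n. norm (of_real (A l n) * z ^ n))"
    unfolding gf_def by (rule summable_norm[OF summable_norm_gf[OF assms]])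
  then show ?thesis using A_nonneg by (simp add: gf_def norm_mult norm_power)
qed

lemma gf_nonneg: "0 \<le> x \<Longrightarrow> x < 1 \<Longrightarrow> 0 \<le> (gf l x :: real)"
  unfolding gf_def using summable_A A_nonneg by (intro suminf_nonneg) auto

lemma of_real_gf: "\<bar>x\<bar> < 1 \<Longrightarrow> gf l (of_real x :: complex) = of_real (gf l x)"
  using gf_sums[of x l] gf_sums[of "of_real x :: complex" l] sums_of_real[of _ "gf l x", where ?'a = complex]
  by (fastforce intro: sums_unique2)

lemma gf_sol:
  fixes z :: "'c::{real_normed_field,banach}"
  assumes z: "norm z < 1" shows "is_sol z (srcgf z) (\<lambda>l. gf l z)"
  unfolding is_sol_def
proof
  fix l
  have "(\<lambda>n. of_real (src l n) * z ^ n + (\<Sum>i\<in>I. if up i \<le> l then of_real (p i) * z ^ dz i *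
           (if dz i \<le> n then of_real (A (l - up i + dn i) (n - dz i)) * z ^ (n - dz i) else 0) else 0))
      sums (srcgf z l + (\<Sum>i\<in>I. if up i \<le> l then of_real (p i) * z ^ dz i * gf (l - up i + dn i) z else 0))"
  proof (intro sums_add sums_sum)
    show "(\<lambda>n. of_real (src l n) * z ^ n) sums srcgf z l"
      unfolding srcgf_def using src_zero by (intro sums_finite) auto
    fix i
    show "(\<lambda>n. if up i \<le> l then of_real (p i) * z ^ dz i *
           (if dz i \<le> n then of_real (A (l - up i + dn i) (n - dz i)) * z ^ (n - dz i) else 0) else 0)
          sums (if up i \<le> l then of_real (p i) * z ^ dz i * gf (l - up i + dn i) z else 0)"
      using sums_mult[OF sums_shift_if[OF gf_sums[OF z, of "l - up i + dn i"], of "dz i"], of "of_real (p i) * z ^ dz i"]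
      by (cases "up i \<le> l") auto
  qed
  moreover have "of_real (src l n) * z ^ n + (\<Sum>i\<in>I. if up i \<le> l then of_real (p i) * z ^ dz i *
           (if dz i \<le> n then of_real (A (l - up i + dn i) (n - dz i)) * z ^ (n - dz i) else 0) else 0)
     = of_real (A l n) * z ^ n" for n
  proof -
    have "of_real (A l n) * z ^ n = of_real (src l n) * z ^ n +
      (\<Sum>i\<in>I. of_real (if up i \<le> l \<and> dz i \<le> n then p i * A (l - up i + dn i) (n - dz i) else 0) * z ^ n)"
      by (subst A_rec) (simp only: of_real_add of_real_sum distrib_right sum_distrib_right)
    also have "(\<Sum>i\<in>I. of_real (if up i \<le> l \<and> dz i \<le> n then p i * A (l - up i + dn i) (n - dz i) else 0) * z ^ n)
       = (\<Sum>i\<in>I. if up i \<le> l then of_real (p i) * z ^ dz i *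
           (if dz i \<le> n then of_real (A (l - up i + dn i) (n - dz i)) * z ^ (n - dz i) else 0) else 0)"
    proof (intro sum.cong refl)
      fix i
      have "z ^ n = z ^ dz i * z ^ (n - dz i)" if "dz i \<le> n" using that by (simp add: power_add[symmetric])
      then show "of_real (if up i \<le> l \<and> dz i \<le> n then p i * A (l - up i + dn i) (n - dz i) else 0) * z ^ n
        = (if up i \<le> l then of_real (p i) * z ^ dz i *
           (if dz i \<le> n then of_real (A (l - up i + dn i) (n - dz i)) * z ^ (n - dz i) else 0) else 0)" by simp
    qed
    finally show ?thesis by simp
  qed
  ultimately show "gf l z = srcgf z l + (\<Sum>i\<in>I. if up i \<le> l then of_real (p i) * z ^ dz i * gf (l - up i + dn i) z else 0)"
    using gf_sums[OF z, of l] sums_unique2 by fastforce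
qed

lemma gf_sum_le:
  assumes x: "0 \<le> x" "x < 1" shows "(\<Sum>l\<le>K. gf l x) \<le> srctot / (1 - x)"
proof -
  have "(\<lambda>n. \<Sum>l\<le>K. A l n * x ^ n) sums (\<Sum>l\<le>K. gf l x)"
    using gf_sums[of x] x by (intro sums_sum) auto
  then have "(\<lambda>N. \<Sum>n\<le>N. \<Sum>l\<le>K. A l n * x ^ n) \<longlonglongrightarrow> (\<Sum>l\<le>K. gf l x)"
    by (simp add: sums_def_le)
  then show ?thesis
    by (rule LIMSEQ_le_const2) (use A_double_sum_le[OF x] in \<open>auto simp: sum.swap[of _ "{..K}"]\<close>)
qed

lemma summable_gf:
  fixes x :: real
  assumes x: "0 \<le> x" "x < 1" shows "summable (\<lambda>l. gf l x)"
  using gf_sum_le[OF x] gf_nonneg[OF x] by (intro bounded_imp_summable)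

lemma summable_norm_gf_index:
  fixes z :: "'c::{real_normed_field,banach}"
  assumes "norm z < 1" shows "summable (\<lambda>l. norm (gf l z))"
  by (rule summable_comparison_test'[OF summable_gf[of "norm z"], of 0])
     (use assms norm_gf_le[OF assms] in auto)

lemma srcgf_zero: "l > S \<Longrightarrow> srcgf z l = 0"
  by (simp add: srcgf_def src_zero)

lemma srcgf_sum_le: "0 \<le> x \<Longrightarrow> x \<le> 1 \<Longrightarrow> 0 \<le> u \<Longrightarrow> u \<le> 1 \<Longrightarrow> (\<Sum>l\<le>S. srcgf x l * u ^ l) \<le> (srctot :: real)"
proof -
  assume *: "0 \<le> x" "x \<le> 1" "0 \<le> u" "u \<le> 1"
  have "(\<Sum>l\<le>S. srcgf x l * u ^ l) \<le> (\<Sum>l\<le>S. srcgf x l)"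
    using * src_nonneg by (intro sum_mono mult_left_le power_le_one) (auto simp: srcgf_def intro!: sum_nonneg)
  also have "\<dots> \<le> srctot" using srctot_ge[of x S S] * by (simp add: srcgf_def)
  finally show ?thesis .
qed

text \<open>Kernel equation at u = 1: for 0 < x < 1 the kernel, \<open>b1\<close> and all series are
  nonnegative there, so \<open>gf 0 x\<close> times \<open>b0 x 1\<close> is at most the total
  source. The factor \<open>b0 x 1\<close> is at least \<beta>, the probability of a step with
  \<open>dn i > 0\<close>, which is positive since some step descends.\<close>

lemma A0_sum_le:
  obtains B where "\<And>N. (\<Sum>n\<le>N. A 0 n) \<le> B"
proof -
  define \<beta> where "\<beta> = 1 - (\<Sum>i\<in>I. if dn i = 0 then p i else 0)"
  obtain i0 where i0: "i0 \<in> I" "up i0 < dn i0" using descend by blast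
  have \<beta>: "\<beta> > 0"
  proof -
    have "\<beta> = (\<Sum>i\<in>I. if dn i = 0 then 0 else p i)"
      unfolding \<beta>_def total[symmetric] sum_subtractf[symmetric] by (intro sum.cong) auto
    also have "\<dots> > 0"
      by (rule sum_pos2[OF fin i0(1)]) (use i0 p_pos less_imp_le[OF p_pos] in auto)
    finally show ?thesis .
  qed
  have "gf 0 x * \<beta> \<le> srctot" if x: "0 < x" "x < 1" for x :: real
  proof -
    have px: "p i * x ^ dz i \<le> p i" if "i \<in> I" for i
      using p_pos[OF that] x by (intro mult_left_le power_le_one) auto
    have "summable (\<lambda>l. norm (gf l x * 1 ^ l))" using summable_norm_gf_index[of x] x by simp
    have nx: "norm x < 1" using x by simp
    from kernel_equation[OF gf_sol[OF nx] srcgf_zero \<open>summable (\<lambda>l. norm (gf l x * 1 ^ l))\<close>]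
    have E: "kern x 1 * suminf (\<lambda>l. gf (l + 2) x * 1 ^ l) = (\<Sum>l\<le>S. srcgf x l * 1 ^ l) - gf 0 x * b0 x 1 - gf 1 x * b1 x 1" by simp
    have "suminf (\<lambda>l. gf (l + 2) x * 1 ^ l) \<ge> 0"
      using summable_ignore_initial_segment[OF summable_gf[of x], of 2] gf_nonneg x by (intro suminf_nonneg) auto
    moreover have "kern x 1 \<ge> 0"
      unfolding kern_def using px total sum_mono[of I "\<lambda>i. p i * x ^ dz i" p] by simp
    ultimately have "kern x 1 * suminf (\<lambda>l. gf (l + 2) x * 1 ^ l) \<ge> 0" by (rule mult_nonneg_nonneg[rotated])
    moreover have "b1 x 1 \<ge> 0"
    proof -
      have "b1 x 1 = 1 - (\<Sum>i\<in>I. (if dn i = 0 then p i * x ^ dz i else 0) + (if dn i = 1 then p i * x ^ dz i else 0))"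
        by (simp add: b1_def sum.distrib cong: if_cong)
      moreover have "(\<Sum>i\<in>I. (if dn i = 0 then p i * x ^ dz i else 0) + (if dn i = 1 then p i * x ^ dz i else 0)) \<le> (\<Sum>i\<in>I. p i)"
        using px p_pos less_imp_le[OF p_pos] by (intro sum_mono) auto
      ultimately show ?thesis using total by simp
    qed
    then have "gf 1 x * b1 x 1 \<ge> 0" using gf_nonneg[of x 1] x by simp
    moreover have "(\<Sum>l\<le>S. srcgf x l * 1 ^ l) \<le> srctot" using srcgf_sum_le[of x 1] x by simp
    ultimately have "gf 0 x * b0 x 1 \<le> srctot" using E by linarith
    moreover have "\<beta> \<le> b0 x 1"
      unfolding \<beta>_def b0_def using px by (auto intro!: sum_mono)
    then have "gf 0 x * \<beta> \<le> gf 0 x * b0 x 1" using gf_nonneg[of x 0] x by (intro mult_left_mono) auto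
    ultimately show ?thesis by linarith
  qed
  then have g: "gf 0 x \<le> srctot / \<beta>" if "0 < x" "x < 1" for x
    using that \<beta> by (simp add: field_simps)
  show ?thesis
  proof (rule that[of "srctot / \<beta>"], rule sum_le_at_one)
    fix N and x :: real assume x: "0 < x" "x < 1"
    have "(\<Sum>n\<le>N. A 0 n * x ^ n) \<le> gf 0 x"
      unfolding gf_def using summable_A[of x 0] x A_nonneg by (simp, intro sum_le_suminf) auto
    then show "(\<Sum>n\<le>N. A 0 n * x ^ n) \<le> srctot / \<beta>" using g[OF x] by simp
  qed simp
qed

text \<open>Irreducibility transports the bound from level 0 to every level.\<close>

lemma summable_A1: "summable (A l)"
proof -
  obtain B where B: "\<And>N. (\<Sum>n\<le>N. A 0 n) \<le> B" by (rule A0_sum_le) (rule that)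
  obtain c k where c: "c > 0" "\<And>n. c * A l n \<le> A 0 (n + k)" using irreducible[of l 0] by blast
  have "summable (A 0)" using B A_nonneg by (intro bounded_imp_summable)
  then have "summable (\<lambda>n. A 0 (n + k) / c)" by (intro summable_divide summable_ignore_initial_segment)
  then show ?thesis
    by (rule summable_comparison_test'[of _ 0]) (use c A_nonneg in \<open>auto simp: field_simps\<close>)
qed

definition mass where "mass l = suminf (A l)"

lemma A_pos_exists: "\<exists>n. A l n > 0"
proof -
  obtain k n where kn: "A k n \<noteq> 0" using nontrivial by blast
  obtain c m where c: "c > 0" "\<And>n. c * A k n \<le> A l (n + m)" using irreducible[of k l] by blast
  have "0 < c * A k n" using c kn A_nonneg[of k n] by simp
  then show ?thesis using c(2)[of n] by (auto intro: less_le_trans)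
qed

lemma mass_pos: "mass l > 0"
proof -
  obtain n where "A l n > 0" using A_pos_exists by blast
  then show ?thesis unfolding mass_def using suminf_pos_iff[OF summable_A1] A_nonneg by blast
qed

lemma norm_gf_le_mass:
  fixes z :: "'c::{real_normed_field,banach}"
  assumes "norm z < 1" shows "norm (gf l z) \<le> mass l"
proof -
  have "gf l (norm z) \<le> mass l"
    unfolding gf_def mass_def
  proof (rule suminf_le[OF _ _ summable_A1])
    show "of_real (A l n) * norm z ^ n \<le> A l n" for n
      using assms A_nonneg by (simp add: mult_left_le power_le_one)
    show "summable (\<lambda>n. of_real (A l n) * norm z ^ n)" using summable_A[of "norm z" l] assms by simp
  qed
  with norm_gf_le[OF assms, of l] show ?thesis by simp
qed

lemma gf_tendsto_mass: "((\<lambda>x. gf l x) \<longlongrightarrow> mass l) (at_left (1::real))"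
proof -
  have "uniform_limit {0..1} (\<lambda>n x. \<Sum>k<n. A l k * x ^ k) (\<lambda>x. suminf (\<lambda>k. A l k * x ^ k)) sequentially"
    by (rule Weierstrass_m_test[OF _ summable_A1[of l]])
       (use A_nonneg in \<open>auto simp: abs_mult mult_left_le power_le_one\<close>)
  then have "continuous_on {0..1} (\<lambda>x. suminf (\<lambda>k. A l k * x ^ k))"
    by (rule uniform_limit_theorem[rotated]) (auto intro!: always_eventually continuous_intros)
  then have "((\<lambda>x. suminf (\<lambda>k. A l k * x ^ k)) \<longlongrightarrow> suminf (\<lambda>k. A l k * 1 ^ k)) (at 1 within {0..1})"
    unfolding continuous_on_def by (rule bspec) simp
  then have "((\<lambda>x. suminf (\<lambda>k. A l k * x ^ k)) \<longlongrightarrow> suminf (\<lambda>k. A l k * 1 ^ k)) (at_left 1)"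
    by (simp add: at_within_Icc_at_left)
  then show ?thesis by (simp add: gf_def mass_def)
qed

lemma mass_sol: "is_sol (1::real) (srcgf 1) mass"
  unfolding is_sol_def
proof
  fix l
  have "((\<lambda>x. gf l x - srcgf x l) \<longlongrightarrow> mass l - srcgf 1 l) (at_left (1::real))"
    unfolding srcgf_def by (intro tendsto_intros gf_tendsto_mass tendsto_eq_intros refl) auto
  moreover have "((\<lambda>x. gf l x - srcgf x l) \<longlongrightarrow> (\<Sum>i\<in>I. if up i \<le> l then of_real (p i) * 1 ^ dz i * mass (l - up i + dn i) else 0)) (at_left (1::real))"
  proof (rule Lim_transform_eventually)
    show "((\<lambda>x. \<Sum>i\<in>I. if up i \<le> l then of_real (p i) * x ^ dz i * gf (l - up i + dn i) x else 0) \<longlongrightarrow> (\<Sum>i\<in>I. if up i \<le> l then of_real (p i) * 1 ^ dz i * mass (l - up i + dn i) else 0)) (at_left (1::real))"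
    proof (intro tendsto_sum)
      fix i
      have "((\<lambda>x. of_real (p i) * x ^ dz i * gf (l - up i + dn i) x) \<longlongrightarrow> of_real (p i) * 1 ^ dz i * mass (l - up i + dn i)) (at_left (1::real))"
        by (intro tendsto_intros gf_tendsto_mass)
      then show "((\<lambda>x. if up i \<le> l then of_real (p i) * x ^ dz i * gf (l - up i + dn i) x else 0) \<longlongrightarrow> (if up i \<le> l then of_real (p i) * 1 ^ dz i * mass (l - up i + dn i) else 0)) (at_left (1::real))"
        by (cases "up i \<le> l") auto
    qed
    show "eventually (\<lambda>x. (\<Sum>i\<in>I. if up i \<le> l then of_real (p i) * x ^ dz i * gf (l - up i + dn i) x else 0) = gf l x - srcgf x l) (at_left (1::real))"
      unfolding eventually_at_left_field
    proof (intro exI[of _ 0] conjI allI impI)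
      fix x :: real assume "0 < x" "x < 1"
      then have "is_sol x (srcgf x) (\<lambda>l. gf l x)" by (intro gf_sol) auto
      then have "gf l x = srcgf x l + (\<Sum>i\<in>I. if up i \<le> l then of_real (p i) * x ^ dz i * gf (l - up i + dn i) x else 0)"
        unfolding is_sol_def by blast
      then show "(\<Sum>i\<in>I. if up i \<le> l then of_real (p i) * x ^ dz i * gf (l - up i + dn i) x else 0) = gf l x - srcgf x l" by simp
    qed simp
  qed
  ultimately have "mass l - srcgf 1 l = (\<Sum>i\<in>I. if up i \<le> l then of_real (p i) * 1 ^ dz i * mass (l - up i + dn i) else 0)"
    using tendsto_unique trivial_limit_at_left_real by blast
  then show "mass l = srcgf 1 l + (\<Sum>i\<in>I. if up i \<le> l then of_real (p i) * 1 ^ dz i * mass (l - up i + dn i) else 0)" by simp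
qed

text \<open>Alignment absorbs the factor \<zeta>^dz of a step into the change of level, so the
  twisted sequence solves the same walk at z. Thus the analysis at z = 1 applies at \<zeta>.\<close>

lemma twisted_sol:
  fixes z \<zeta> \<omega> :: complex
  assumes "norm z < 1" "norm \<zeta> = 1" "norm \<omega> = 1" and al: "\<And>i. i \<in> I \<Longrightarrow> \<zeta> ^ dz i * \<omega> ^ up i = \<omega> ^ dn i"
  shows "is_sol z (\<lambda>l. \<omega> ^ l * srcgf (\<zeta> * z) l) (\<lambda>l. \<omega> ^ l * gf l (\<zeta> * z))"
  unfolding is_sol_def
proof
  fix l
  have "norm (\<zeta> * z) < 1" using assms by (simp add: norm_mult)
  then have "gf l (\<zeta> * z) = srcgf (\<zeta> * z) l + (\<Sum>i\<in>I. if up i \<le> l then of_real (p i) * (\<zeta> * z) ^ dz i * gf (l - up i + dn i) (\<zeta> * z) else 0)"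
    using gf_sol[of "\<zeta> * z"] unfolding is_sol_def by blast
  then have "\<omega> ^ l * gf l (\<zeta> * z) = \<omega> ^ l * srcgf (\<zeta> * z) l + (\<Sum>i\<in>I. \<omega> ^ l * (if up i \<le> l then of_real (p i) * (\<zeta> * z) ^ dz i * gf (l - up i + dn i) (\<zeta> * z) else 0))"
    by (simp only: distrib_left sum_distrib_left)
  also have "(\<Sum>i\<in>I. \<omega> ^ l * (if up i \<le> l then of_real (p i) * (\<zeta> * z) ^ dz i * gf (l - up i + dn i) (\<zeta> * z) else 0))
     = (\<Sum>i\<in>I. if up i \<le> l then of_real (p i) * z ^ dz i * (\<omega> ^ (l - up i + dn i) * gf (l - up i + dn i) (\<zeta> * z)) else 0)"
  proof (intro sum.cong refl)
    fix i assume i: "i \<in> I"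
    have "\<omega> ^ l * \<zeta> ^ dz i = \<omega> ^ (l - up i + dn i)" if "up i \<le> l"
    proof -
      have "\<omega> ^ l * \<zeta> ^ dz i = \<omega> ^ (l - up i) * (\<zeta> ^ dz i * \<omega> ^ up i)"
        using that by (simp add: power_add[symmetric] mult.commute mult.left_commute)
      then show ?thesis by (simp add: al[OF i] power_add)
    qed
    then show "\<omega> ^ l * (if up i \<le> l then of_real (p i) * (\<zeta> * z) ^ dz i * gf (l - up i + dn i) (\<zeta> * z) else 0)
      = (if up i \<le> l then of_real (p i) * z ^ dz i * (\<omega> ^ (l - up i + dn i) * gf (l - up i + dn i) (\<zeta> * z)) else 0)"
      by (auto simp: power_mult_distrib mult_ac)
  qed
  finally show "\<omega> ^ l * gf l (\<zeta> * z) = \<omega> ^ l * srcgf (\<zeta> * z) l + (\<Sum>i\<in>I. if up i \<le> l then of_real (p i) * z ^ dz i * (\<omega> ^ (l - up i + dn i) * gf (l - up i + dn i) (\<zeta> * z)) else 0)" .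
qed

end

section \<open>The masses have no finite first moment\<close>

lemma exp_gt_add_one: "(y::real) > 0 \<Longrightarrow> 1 + y < exp y"
proof -
  assume y: "y > 0"
  have "1 + y < (1 + y / 2)\<^sup>2" using y by (simp add: power2_eq_square field_simps)
  also have "\<dots> \<le> (exp (y / 2))\<^sup>2" using y by (intro power_mono exp_ge_add_one_self) auto
  also have "\<dots> = exp y" by (simp add: power2_eq_square exp_add[symmetric])
  finally show ?thesis .
qed

lemma dist_one_of_real: "dist 1 (of_real w :: complex) = \<bar>1 - w\<bar>"
  using norm_of_real[of "1 - w", where ?'a = complex] by (simp add: dist_norm)

context critical_walk
begin

text \<open>In the variable ln u the step sum is convex with value 1 and slope 0 at u = 1; the
  strict inequality 1 + y < exp y, applied to a descending step, makes it exceed 1 for u <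
  1.\<close>

lemma kern_one_neg:
  assumes u: "0 < u" "u < (1::real)" shows "kern 1 u < 0"
proof -
  obtain i0 where i0: "i0 \<in> I" "up i0 < dn i0" using descend by blast
  define e where "e = (\<lambda>i. real (up i) - real (dn i))"
  have pw: "u ^ ex i = u\<^sup>2 * exp (e i * ln u)" if "i \<in> I" for i
  proof -
    have "u ^ ex i = exp (real (ex i) * ln u)" using u by (simp add: exp_of_nat_mult)
    also have "\<dots> = exp (real 2 * ln u + e i * ln u)"
    proof -
      have "real (ex i) = 2 + e i" using real_ex[OF that] by (simp add: e_def)
      then show ?thesis by (simp add: distrib_right)
    qed
    also have "\<dots> = u\<^sup>2 * exp (e i * ln u)" using u by (simp only: exp_add exp_of_nat_mult exp_ln)
    finally show ?thesis .
  qed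
  have "(\<Sum>i\<in>I. p i * (1 + e i * ln u)) < (\<Sum>i\<in>I. p i * exp (e i * ln u))"
  proof (rule sum_strict_mono_ex1[OF fin])
    show "\<forall>i\<in>I. p i * (1 + e i * ln u) \<le> p i * exp (e i * ln u)"
      using p_pos exp_ge_add_one_self by (auto intro!: mult_left_mono less_imp_le)
    have "e i0 * ln u > 0" using i0 u by (intro mult_neg_neg) (auto simp: e_def)
    then show "\<exists>i\<in>I. p i * (1 + e i * ln u) < p i * exp (e i * ln u)"
      using i0 p_pos exp_gt_add_one by (intro bexI[of _ i0] mult_strict_left_mono) auto
  qed
  moreover have "(\<Sum>i\<in>I. p i * (1 + e i * ln u)) = 1"
  proof -
    have "(\<Sum>i\<in>I. p i * (1 + e i * ln u)) = (\<Sum>i\<in>I. p i) + (\<Sum>i\<in>I. p i * e i) * ln u"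
      unfolding sum_distrib_right sum.distrib[symmetric] by (intro sum.cong refl) (simp add: algebra_simps)
    then show ?thesis using total drift by (simp add: e_def)
  qed
  ultimately have "u\<^sup>2 * 1 < u\<^sup>2 * (\<Sum>i\<in>I. p i * exp (e i * ln u))" using u by (intro mult_strict_left_mono) auto
  also have "\<dots> = (\<Sum>i\<in>I. p i * u ^ ex i)"
    unfolding sum_distrib_left by (intro sum.cong refl) (simp add: pw)
  finally show ?thesis by (simp add: kern_def)
qed

text \<open>The u-derivatives of \<open>b0\<close> and \<open>b1\<close> at z = u = 1. They also
  govern the derivatives along the branch, since z = 1 - s^2 is stationary at s = 0.\<close>

definition b0' where "b0' = - (\<Sum>i\<in>I. if dn i = 0 then p i * real (up i) else 0)"
definition b1' where "b1' = 1 - (\<Sum>i\<in>I. if dn i = 0 then p i * real (up i + 1) else 0)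
     - (\<Sum>i\<in>I. if dn i = 1 then p i * real (up i) else 0)"

lemma b0_along_branch:
  fixes U :: "complex \<Rightarrow> complex"
  assumes "U 0 = 1" "(U has_field_derivative U') (at 0)"
  shows "((\<lambda>s. b0 (1 - s\<^sup>2) (U s)) has_field_derivative of_real b0' * U') (at 0)"
    "((\<lambda>s. b1 (1 - s\<^sup>2) (U s)) has_field_derivative of_real b1' * U') (at 0)"
proof -
  have deriv_term: "((\<lambda>s. if P then of_real (p i) * (1 - s\<^sup>2) ^ dz i * U s ^ k else 0) has_field_derivative
      of_real (if P then p i * real k else 0) * U') (at 0)" for P i k
    using assms by (cases P) (auto intro!: derivative_eq_intros)
  show "((\<lambda>s. b0 (1 - s\<^sup>2) (U s)) has_field_derivative of_real b0' * U') (at 0)"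
  proof -
    have "((\<lambda>s. 1 - (\<Sum>i\<in>I. if dn i = 0 then of_real (p i) * (1 - s\<^sup>2) ^ dz i * U s ^ up i else 0)) has_field_derivative
       0 - (\<Sum>i\<in>I. of_real (if dn i = 0 then p i * real (up i) else 0) * U')) (at 0)"
      by (intro DERIV_diff DERIV_const DERIV_sum deriv_term)
    then show ?thesis by (simp only: b0_def b0'_def of_real_minus of_real_sum sum_distrib_right minus_mult_left[symmetric] diff_0)
  qed
  show "((\<lambda>s. b1 (1 - s\<^sup>2) (U s)) has_field_derivative of_real b1' * U') (at 0)"
  proof -
    have "((\<lambda>s. U s - (\<Sum>i\<in>I. if dn i = 0 then of_real (p i) * (1 - s\<^sup>2) ^ dz i * U s ^ (up i + 1) else 0)
        - (\<Sum>i\<in>I. if dn i = 1 then of_real (p i) * (1 - s\<^sup>2) ^ dz i * U s ^ up i else 0)) has_field_derivative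
       U' - (\<Sum>i\<in>I. of_real (if dn i = 0 then p i * real (up i + 1) else 0) * U')
        - (\<Sum>i\<in>I. of_real (if dn i = 1 then p i * real (up i) else 0) * U')) (at 0)"
      by (intro DERIV_diff assms(2) DERIV_sum deriv_term)
    then show ?thesis
      by (simp only: b1_def b1'_def of_real_diff of_real_1 of_real_sum left_diff_distrib sum_distrib_right mult_1)
  qed
qed

lemma b0_deriv_at_one:
  "((\<lambda>u::complex. b0 1 u) has_field_derivative of_real b0') (at 1)"
  "((\<lambda>u::complex. b1 1 u) has_field_derivative of_real b1') (at 1)"
proof -
  have deriv_term: "((\<lambda>u::complex. if P then of_real (p i) * 1 ^ dz i * u ^ k else 0) has_field_derivative
      of_real (if P then p i * real k else 0)) (at 1)" for P i k
    by (cases P) (auto intro!: derivative_eq_intros)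
  show "((\<lambda>u::complex. b0 1 u) has_field_derivative of_real b0') (at 1)"
  proof -
    have "((\<lambda>u::complex. 1 - (\<Sum>i\<in>I. if dn i = 0 then of_real (p i) * 1 ^ dz i * u ^ up i else 0)) has_field_derivative
       0 - (\<Sum>i\<in>I. of_real (if dn i = 0 then p i * real (up i) else 0))) (at 1)"
      by (intro DERIV_diff DERIV_const DERIV_sum deriv_term)
    then show ?thesis by (simp only: b0_def b0'_def of_real_minus of_real_sum) simp
  qed
  show "((\<lambda>u::complex. b1 1 u) has_field_derivative of_real b1') (at 1)"
  proof -
    have "((\<lambda>u::complex. u - (\<Sum>i\<in>I. if dn i = 0 then of_real (p i) * 1 ^ dz i * u ^ (up i + 1) else 0)
        - (\<Sum>i\<in>I. if dn i = 1 then of_real (p i) * 1 ^ dz i * u ^ up i else 0)) has_field_derivative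
       1 - (\<Sum>i\<in>I. of_real (if dn i = 0 then p i * real (up i + 1) else 0))
        - (\<Sum>i\<in>I. of_real (if dn i = 1 then p i * real (up i) else 0))) (at 1)"
      by (intro DERIV_diff DERIV_ident DERIV_sum deriv_term)
    then show ?thesis by (simp only: b1_def b1'_def of_real_diff of_real_1 of_real_sum)
  qed
qed

end

context critical_system
begin

text \<open>The kernel at z = 1 is negative for 0 < u < 1, so the kernel equation bounds the series
  of the levels l \<ge> 2 by the boundary values, uniformly for x near 1.\<close>

lemma mass_power_summable:
  assumes u: "0 < u" "u < (1::real)" shows "summable (\<lambda>l. mass l * u ^ l)"
proof -
  have kneg: "kern 1 u < 0" by (rule kern_one_neg[OF u])
  have "((\<lambda>x. kern x u) \<longlongrightarrow> kern 1 u) (at_left (1::real))"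
    unfolding kern_def by (intro tendsto_intros tendsto_eq_intros refl)
  then have "eventually (\<lambda>x. kern x u < kern 1 u / 2) (at_left 1)"
    using kneg by (intro order_tendstoD(2)) auto
  moreover have "eventually (\<lambda>x. x > 0 \<and> x < 1) (at_left (1::real))"
    unfolding eventually_at_left_field by (intro exI[of _ 0]) auto
  ultimately have ev: "eventually (\<lambda>x. kern x u < kern 1 u / 2 \<and> x > 0 \<and> x < 1) (at_left 1)"
    by eventually_elim auto
  \<comment> \<open>Near x = 1 the kernel is below half its negative limit; the numerator comes from
    \<open>b0 x u \<le> 1\<close> and \<open>b1 x u \<le> 1\<close> after dropping the nonnegative
    source.\<close>
  define B where "B = (mass 0 + mass 1) / (- kern 1 u / 2)"
  have bound: "(\<Sum>l\<le>K. gf (l + 2) x * u ^ l) \<le> B" if x: "kern x u < kern 1 u / 2" "0 < x" "x < 1" for K x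
  proof -
    have nx: "norm x < 1" using x by simp
    have "summable (\<lambda>l. norm (gf l x * u ^ l))"
    proof (rule summable_comparison_test'[OF summable_gf[of x], of 0])
      fix n show "norm (norm (gf n x * u ^ n)) \<le> gf n x"
        using gf_nonneg[of x n] x u by (simp add: abs_mult mult_left_le power_le_one)
    qed (use x in auto)
    note E = kernel_equation[OF gf_sol[OF nx] srcgf_zero this]
    let ?L = "suminf (\<lambda>l. gf (l + 2) x * u ^ l)"
    have sL: "summable (\<lambda>l. gf (l + 2) x * u ^ l)"
      using summable_norm_cancel[OF summable_coeff_shift[OF \<open>summable (\<lambda>l. norm (gf l x * u ^ l))\<close>]] .
    have part: "(\<Sum>l\<le>K. gf (l + 2) x * u ^ l) \<le> ?L"
      using sL gf_nonneg x u by (intro sum_le_suminf) auto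
    then have L0: "?L \<ge> 0" using gf_nonneg x u by (intro order_trans[OF sum_nonneg part]) auto
    have b: "b0 x u \<le> 1" "b1 x u \<le> 1"
    proof -
      have nn: "0 \<le> (\<Sum>i\<in>I. if P i then of_real (p i) * x ^ dz i * u ^ k i else 0)" for P k
        using p_pos x u by (intro sum_nonneg) (auto intro!: mult_nonneg_nonneg less_imp_le)
      show "b0 x u \<le> 1" unfolding b0_def using nn by simp
      show "b1 x u \<le> 1" unfolding b1_def
        using nn[of "\<lambda>i. dn i = 0" "\<lambda>i. up i + 1"] nn[of "\<lambda>i. dn i = 1" up] u by linarith
    qed
    have m: "gf 0 x \<le> mass 0" "gf 1 x \<le> mass 1" "0 \<le> gf 0 x" "0 \<le> gf 1 x"
      using norm_gf_le_mass[OF nx, of 0] norm_gf_le_mass[OF nx, of 1] gf_nonneg[of x 0] gf_nonneg[of x 1] x by auto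
    have \<sigma>0: "(\<Sum>l\<le>S. srcgf x l * u ^ l) \<ge> 0"
      using src_nonneg x u by (intro sum_nonneg) (auto simp: srcgf_def intro!: sum_nonneg mult_nonneg_nonneg)
    have "gf 0 x * b0 x u \<le> gf 0 x * 1" "gf 1 x * b1 x u \<le> gf 1 x * 1"
      using b m by (intro mult_left_mono; simp)+
    then have "- kern x u * ?L \<le> mass 0 + mass 1" using E \<sigma>0 m by simp
    moreover have "(- kern 1 u / 2) * ?L \<le> - kern x u * ?L" using x L0 by (intro mult_right_mono) auto
    ultimately have "(- kern 1 u / 2) * ?L \<le> mass 0 + mass 1" by linarith
    moreover have "0 < - kern 1 u / 2" using kneg by simp
    ultimately have "?L \<le> B" unfolding B_def by (simp only: pos_le_divide_eq mult.commute)
    with part show ?thesis by simp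
  qed
  have "(\<Sum>l\<le>K. mass (l + 2) * u ^ l) \<le> B" for K
  proof (rule tendsto_upperbound)
    show "((\<lambda>x. \<Sum>l\<le>K. gf (l + 2) x * u ^ l) \<longlongrightarrow> (\<Sum>l\<le>K. mass (l + 2) * u ^ l)) (at_left (1::real))"
      by (intro tendsto_intros gf_tendsto_mass)
    show "eventually (\<lambda>x. (\<Sum>l\<le>K. gf (l + 2) x * u ^ l) \<le> B) (at_left 1)"
      using ev by eventually_elim (use bound in auto)
  qed simp
  then have "summable (\<lambda>l. mass (l + 2) * u ^ l)"
    using mass_pos u by (intro bounded_imp_summable) (auto intro: less_imp_le)
  then have "summable (\<lambda>l. (mass (l + 2) * u ^ l) * u ^ 2)" by (rule summable_mult2)
  then have "summable (\<lambda>l. mass (l + 2) * u ^ (l + 2))" by (simp only: power_add mult.assoc)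
  then show ?thesis by (subst (asm) summable_iff_shift[of "\<lambda>l. mass l * u ^ l" 2])
qed

text \<open>The right-hand side of the kernel equation at z = 1.\<close>

definition crit_num :: "complex \<Rightarrow> complex" where
  "crit_num u = (\<Sum>l\<le>S. srcgf 1 l * u ^ l) - of_real (mass 0) * b0 1 u - of_real (mass 1) * b1 1 u"

lemma crit_num_eq:
  assumes u: "0 < u" "u < (1::real)"
  shows "kern 1 (of_real u) * of_real (suminf (\<lambda>l. mass (l + 2) * u ^ l)) = crit_num (of_real u)"
proof -
  have "summable (\<lambda>l. norm (mass l * u ^ l))"
    using mass_power_summable[OF u] mass_pos u by (simp add: abs_mult abs_of_pos)
  from kernel_equation[OF mass_sol srcgf_zero this]
  have E: "kern 1 u * suminf (\<lambda>l. mass (l + 2) * u ^ l) = (\<Sum>l\<le>S. srcgf 1 l * u ^ l) - mass 0 * b0 1 u - mass 1 * b1 1 u" .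
  have ifr: "of_real (if P then x else 0) = (if P then of_real x else 0 :: complex)" for P x by simp
  have 1: "of_real (kern 1 u) = (kern 1 (of_real u) :: complex)" by (simp add: kern_def)
  have 2: "of_real (b0 1 u) = (b0 1 (of_real u) :: complex)" by (simp add: b0_def ifr cong: if_cong)
  have 3: "of_real (b1 1 u) = (b1 1 (of_real u) :: complex)" by (simp add: b1_def ifr cong: if_cong)
  have 4: "of_real (\<Sum>l\<le>S. srcgf 1 l * u ^ l) = (\<Sum>l\<le>S. srcgf 1 l * of_real u ^ l :: complex)" by (simp add: srcgf_def)
  show ?thesis
    using arg_cong[OF E, of "of_real :: real \<Rightarrow> complex"] unfolding crit_num_def of_real_mult of_real_diff 1 2 3 4 .
qed

text \<open>
  The convex function l \<mapsto> max 0 (l - 2) is subharmonic for the killed walk and strictly so at 2.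
  Hence the masses, which satisfy the balance equation, cannot have a finite first moment.
\<close>

lemma first_moment_infinite: "\<not> summable (\<lambda>t. real t * mass (t + 2))"
proof
  assume sm: "summable (\<lambda>t. real t * mass (t + 2))"
  have m0: "mass l \<ge> 0" for l using mass_pos[of l] by simp
  have "summable (\<lambda>t. real (t + 2 - 2) * mass (t + 2))" using sm by simp
  then have sf: "summable (\<lambda>l. real (l - 2) * mass l)"
    by (subst (asm) summable_iff_shift[of "\<lambda>l. real (l - 2) * mass l" 2])
  have Tt: "suminf (\<lambda>l. real (l - 2) * mass l) = suminf (\<lambda>t. real t * mass (t + 2))"
    using suminf_split_initial_segment[OF sf, of 2] by (simp add: numeral_2_eq_2)
  \<comment> \<open>The test function at the landing level times the mass sent there by step i,
    without its weight.\<close>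
  define h where "h = (\<lambda>i l. real (l - 2) * (if up i \<le> l then mass (l - up i + dn i) else 0))"
  have msol: "mass l = srcgf 1 l + (\<Sum>i\<in>I. p i * (if up i \<le> l then mass (l - up i + dn i) else 0))" for l
  proof -
    have "mass l = srcgf 1 l + (\<Sum>i\<in>I. if up i \<le> l then of_real (p i) * 1 ^ dz i * mass (l - up i + dn i) else 0)"
      using mass_sol unfolding is_sol_def by blast
    then show ?thesis by (simp cong: if_cong) (intro sum.cong, auto)
  qed
  have src1: "0 \<le> (srcgf 1 l :: real)" for l using src_nonneg by (auto simp: srcgf_def intro!: sum_nonneg)
  have mge: "mass l \<ge> (\<Sum>i\<in>I. p i * (if up i \<le> l then mass (l - up i + dn i) else 0))" for l
    using msol[of l] src1[of l] by linarith
  have hn: "h i l \<ge> 0" for i l using m0 by (simp add: h_def)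
  have hs: "summable (h i)" if i: "i \<in> I" for i
  proof (rule summable_comparison_test'[OF summable_divide[OF sf, of "p i"], of 0])
    fix l
    have "p i * (if up i \<le> l then mass (l - up i + dn i) else 0) \<le> (\<Sum>i\<in>I. p i * (if up i \<le> l then mass (l - up i + dn i) else 0))"
      using m0 p_pos less_imp_le[OF p_pos] by (intro member_le_sum[OF i _ fin]) auto
    then have "real (l - 2) * (p i * (if up i \<le> l then mass (l - up i + dn i) else 0)) \<le> real (l - 2) * mass l"
      using mge[of l] by (intro mult_left_mono) linarith+
    then have "p i * h i l \<le> real (l - 2) * mass l" by (simp only: h_def mult.left_commute)
    then show "norm (h i l) \<le> real (l - 2) * mass l / p i"
      using hn p_pos[OF i] by (simp add: field_simps)
  qed
  have hsums: "(\<lambda>l. \<Sum>i\<in>I. p i * h i l) sums (\<Sum>i\<in>I. p i * suminf (h i))"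
    by (intro sums_sum sums_mult summable_sums hs)
  have "(\<Sum>i\<in>I. p i * h i l) \<le> real (l - 2) * mass l" for l
  proof -
    have "(\<Sum>i\<in>I. p i * h i l) = real (l - 2) * (\<Sum>i\<in>I. p i * (if up i \<le> l then mass (l - up i + dn i) else 0))"
      unfolding sum_distrib_left h_def by (intro sum.cong refl) (simp only: mult.left_commute)
    then show ?thesis using mge[of l] by (simp add: mult_left_mono)
  qed
  then have up_bd: "(\<Sum>i\<in>I. p i * suminf (h i)) \<le> suminf (\<lambda>l. real (l - 2) * mass l)"
    by (rule sums_le[OF _ hsums summable_sums[OF sf]])
  \<comment> \<open>Reindexing by the starting level t + 2, from which step i lands on t +
    \<open>ex i\<close>. Landing levels below \<open>ex i\<close> can only be reached from levels 0
    and 1; their contribution is dropped in \<open>hle\<close>.\<close>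
  have hshift: "h i (t + ex i) = real (t + ex i - 2) * mass (t + 2)" if "i \<in> I" for i t
  proof -
    have "up i \<le> t + ex i" "t + ex i - up i + dn i = t + 2" using dn_le[OF that] by (auto simp: ex_def)
    then show ?thesis by (simp add: h_def)
  qed
  have hss: "summable (\<lambda>t. h i (t + ex i))" if "i \<in> I" for i
    using hs[OF that] by (rule summable_ignore_initial_segment)
  have hle: "suminf (\<lambda>t. h i (t + ex i)) \<le> suminf (h i)" if "i \<in> I" for i
    using suminf_split_initial_segment[OF hs[OF that], of "ex i"] hn by (simp add: sum_nonneg)
  obtain i0 where i0: "i0 \<in> I" "dn i0 < up i0" using ascend by blast
  define \<epsilon> where "\<epsilon> = p i0 * mass 2"
  have eps: "\<epsilon> > 0" using p_pos[OF i0(1)] mass_pos by (simp add: \<epsilon>_def)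
  \<comment> \<open>By zero drift the mean of t + \<open>ex i\<close> - 2 is t; the truncated
    subtraction is the positive part and can only increase the mean. At t = 0 an ascending step
    contributes the strict gain \<open>p i0\<close>.\<close>
  have pt: "real t * mass (t + 2) + (if t = 0 then \<epsilon> else 0) \<le> (\<Sum>i\<in>I. p i * h i (t + ex i))" for t
  proof -
    have "real t + (if t = 0 then p i0 else 0) \<le> (\<Sum>i\<in>I. p i * real (t + ex i - 2))"
    proof (cases "t = 0")
      case False
      have "real t = (\<Sum>i\<in>I. p i * real t + p i * real (ex i) - 2 * p i)"
        unfolding sum.distrib sum_subtractf sum_p_ex sum_distrib_right[symmetric] sum_distrib_left[symmetric] total by simp
      also have "\<dots> = (\<Sum>i\<in>I. p i * (real t + real (ex i) - 2))" by (intro sum.cong) (auto simp: algebra_simps)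
      also have "\<dots> \<le> (\<Sum>i\<in>I. p i * real (t + ex i - 2))"
        using p_pos by (intro sum_mono mult_left_mono) (auto intro: less_imp_le)
      finally show ?thesis using False by simp
    next
      case True
      have "1 \<le> ex i0 - 2" using i0 dn_le[OF i0(1)] by (simp add: ex_def)
      then have "p i0 * 1 \<le> p i0 * real (ex i0 - 2)" using p_pos[OF i0(1)] by (intro mult_left_mono) auto
      also have "\<dots> \<le> (\<Sum>i\<in>I. p i * real (ex i - 2))"
        using p_pos less_imp_le[OF p_pos] by (intro member_le_sum[OF i0(1) _ fin]) auto
      finally show ?thesis using True by simp
    qed
    then have "(real t + (if t = 0 then p i0 else 0)) * mass (t + 2) \<le> (\<Sum>i\<in>I. p i * real (t + ex i - 2)) * mass (t + 2)"
      using m0 by (intro mult_right_mono) auto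
    also have "\<dots> = (\<Sum>i\<in>I. p i * h i (t + ex i))"
      unfolding sum_distrib_right by (intro sum.cong refl) (simp add: hshift)
    finally show ?thesis by (auto simp: \<epsilon>_def numeral_2_eq_2 algebra_simps split: if_splits)
  qed
  have s1: "(\<lambda>t. real t * mass (t + 2) + (if t = 0 then \<epsilon> else 0)) sums (suminf (\<lambda>t. real t * mass (t + 2)) + \<epsilon>)"
    using sums_add[OF summable_sums[OF sm] sums_single[of 0 "\<lambda>_. \<epsilon>"]] by simp
  have s2: "(\<lambda>t. \<Sum>i\<in>I. p i * h i (t + ex i)) sums (\<Sum>i\<in>I. p i * suminf (\<lambda>t. h i (t + ex i)))"
    by (intro sums_sum sums_mult summable_sums hss)
  have "suminf (\<lambda>t. real t * mass (t + 2)) + \<epsilon> \<le> (\<Sum>i\<in>I. p i * suminf (\<lambda>t. h i (t + ex i)))"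
    by (rule sums_le[OF pt s1 s2])
  also have "\<dots> \<le> (\<Sum>i\<in>I. p i * suminf (h i))"
    using hle p_pos by (intro sum_mono mult_left_mono) (auto intro: less_imp_le)
  finally show False using up_bd Tt eps by simp
qed

text \<open>At z = 1 the kernel has exactly a double zero at u = 1. If \<open>crit_num\<close> also
  vanished to second order there, the series of the masses would agree left of 1 with a function
  holomorphic at 1, hence be Lipschitz there; with nonnegative coefficients this bounds the first
  moment.\<close>

lemma crit_num_deriv_nonzero:
  assumes "crit_num 1 = 0" "(crit_num has_field_derivative D) (at 1)"
  shows "D \<noteq> 0"
proof
  assume D: "D = 0"
  have qh: "crit_num holomorphic_on UNIV"
    unfolding crit_num_def[abs_def] b0_def b1_def by (intro holomorphic_intros)
  define q1 where "q1 = (\<lambda>u. if u = 1 then deriv crit_num 1 else (crit_num u - crit_num 1) / (u - 1))"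
  have q1h: "q1 holomorphic_on UNIV" unfolding q1_def using qh by (intro pole_lemma_open) auto
  have q1: "crit_num u = (u - 1) * q1 u" for u using assms(1) by (simp add: q1_def)
  have q11: "q1 1 = 0" using DERIV_imp_deriv[OF assms(2)] D by (simp add: q1_def)
  define q2 where "q2 = (\<lambda>u. if u = 1 then deriv q1 1 else (q1 u - q1 1) / (u - 1))"
  have q2h: "q2 holomorphic_on UNIV" unfolding q2_def using q1h by (intro pole_lemma_open) auto
  have q2: "q1 u = (u - 1) * q2 u" for u using q11 by (simp add: q2_def)
  have kh: "(\<lambda>u. kern2 1 u 1 1) holomorphic_on UNIV" unfolding kern2_def by (intro holomorphic_intros)
  have "isCont (\<lambda>u. kern2 1 u 1 1) 1"
    using holomorphic_on_imp_continuous_on[OF kh] by (simp add: continuous_on_eq_continuous_at)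
  moreover have "kern2 1 1 1 1 \<noteq> 0" using kern2_1 var_pos by simp
  ultimately obtain e0 where e0: "e0 > 0" "\<And>u. dist 1 u < e0 \<Longrightarrow> kern2 1 u 1 1 \<noteq> 0"
    using continuous_at_avoid[of 1 "\<lambda>u. kern2 1 u 1 1" 0] by blast
  define e where "e = min (e0 / 2) (1/2)"
  have e: "e > 0" "e < e0" "e \<le> 1/2" using e0 by (auto simp: e_def)
  define G where "G = (\<lambda>u. q2 u / kern2 1 u 1 1)"
  have Gh: "G holomorphic_on ball 1 e0" unfolding G_def
    using e0 by (intro holomorphic_intros holomorphic_on_subset[OF q2h] holomorphic_on_subset[OF kh]) auto
  have "continuous_on (cball 1 e) (deriv G)"
    using holomorphic_on_imp_continuous_on[OF holomorphic_deriv[OF Gh open_ball]] e by (auto intro: continuous_on_subset)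
  then have "bounded (deriv G ` cball 1 e)" by (intro compact_imp_bounded compact_continuous_image) auto
  then obtain C where C: "\<And>u. u \<in> cball 1 e \<Longrightarrow> norm (deriv G u) \<le> C" unfolding bounded_iff by blast
  have lip: "norm (G u - G v) \<le> C * norm (u - v)" if "u \<in> cball 1 e" "v \<in> cball 1 e" for u v
  proof (rule field_differentiable_bound[of "cball 1 e" G "deriv G"])
    show "(G has_field_derivative deriv G z) (at z within cball 1 e)" if "z \<in> cball 1 e" for z
    proof -
      have "z \<in> ball 1 e0" using that e(2) by simp
      from holomorphic_derivI[OF Gh open_ball this] show ?thesis by (rule has_field_derivative_at_within)
    qed
  qed (use that C in auto)
  define L where "L = (\<lambda>u::real. suminf (\<lambda>l. mass (l + 2) * u ^ l))"
  have LG: "of_real (L u) = G (of_real u)" if u: "1 - e < u" "u < 1" for u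
  proof -
    have "u > 0" using u e by simp
    have nz: "kern2 1 (of_real u) 1 1 \<noteq> 0" using u e by (intro e0(2)) (auto simp: dist_one_of_real)
    have "(of_real u - 1)\<^sup>2 * (kern2 1 (of_real u) 1 1 * of_real (L u)) = (of_real u - 1)\<^sup>2 * q2 (of_real u)"
      using crit_num_eq[OF \<open>u > 0\<close> u(2)] unfolding kern_factor_critical q1 q2 L_def
      by (simp add: power2_eq_square mult.assoc)
    moreover have "(of_real u - 1 :: complex) \<noteq> 0" using u by (simp add: complex_eq_iff)
    ultimately have "kern2 1 (of_real u) 1 1 * of_real (L u) = q2 (of_real u)" by simp
    then show ?thesis using nz by (simp add: G_def nonzero_eq_divide_eq mult.commute)
  qed
  have C0: "C \<ge> 0" using order_trans[OF norm_ge_zero C[of 1]] e by simp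
  have Llip: "L v - L u \<le> C * (v - u)" if "1 - e < u" "u < v" "v < 1" for u v
  proof -
    have "G (of_real v) - G (of_real u) = of_real (L v - L u)"
      using LG[of u] LG[of v] that by simp
    then have "\<bar>L v - L u\<bar> = norm (G (of_real v) - G (of_real u))" by (simp only: norm_of_real)
    also have "\<dots> \<le> C * norm (of_real v - of_real u :: complex)"
      using that by (intro lip) (auto simp: dist_one_of_real)
    also have "norm (of_real v - of_real u :: complex) = v - u"
      using that norm_of_real[of "v - u", where ?'a = complex] by simp
    finally show ?thesis by linarith
  qed
  have m0: "mass l \<ge> 0" for l using mass_pos[of l] by simp
  have part: "(\<Sum>l\<le>K. mass (l + 2) * (v ^ l - u ^ l)) \<le> C * (v - u)" if uv: "1 - e < u" "u < v" "v < 1" for K u v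
  proof -
    have s: "summable (\<lambda>l. mass (l + 2) * w ^ l)" if "0 < w" "w < 1" for w :: real
    proof -
      have "summable (\<lambda>l. norm (mass l * w ^ l))"
        using mass_power_summable[OF that] mass_pos that by (simp add: abs_mult abs_of_pos)
      from summable_norm_cancel[OF summable_coeff_shift[OF this]] show ?thesis .
    qed
    have u0: "u > 0" using uv e by simp
    have "(\<lambda>l. mass (l + 2) * v ^ l - mass (l + 2) * u ^ l) sums (L v - L u)"
      unfolding L_def using uv u0 by (intro sums_diff summable_sums s) auto
    then have sd: "(\<lambda>l. mass (l + 2) * (v ^ l - u ^ l)) sums (L v - L u)" by (simp add: right_diff_distrib)
    have "(\<Sum>l\<le>K. mass (l + 2) * (v ^ l - u ^ l)) \<le> L v - L u"
      unfolding sums_unique[OF sd] using uv u0 m0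
      by (intro sum_le_suminf sums_summable[OF sd]) (auto intro!: mult_nonneg_nonneg power_mono)
    with Llip[OF uv] show ?thesis by simp
  qed
  \<comment> \<open>Letting v tend to 1 leaves (1 - u^l) / (1 - u), a geometric sum; the later limit
    of u to 1 turns it into l.\<close>
  have part1: "(\<Sum>l\<le>K. mass (l + 2) * (\<Sum>k<l. u ^ k)) \<le> C" if u: "1 - e < u" "u < 1" for K u
  proof -
    have "(\<Sum>l\<le>K. mass (l + 2) * (1 ^ l - u ^ l)) \<le> C * (1 - u)"
    proof (rule tendsto_le[of "at_left (1::real)" "\<lambda>v. C * (v - u)" _ "\<lambda>v. \<Sum>l\<le>K. mass (l + 2) * (v ^ l - u ^ l)"])
      show "((\<lambda>v. C * (v - u)) \<longlongrightarrow> C * (1 - u)) (at_left 1)" by (intro tendsto_intros)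
      show "((\<lambda>v. \<Sum>l\<le>K. mass (l + 2) * (v ^ l - u ^ l)) \<longlongrightarrow> (\<Sum>l\<le>K. mass (l + 2) * (1 ^ l - u ^ l))) (at_left 1)"
        by (intro tendsto_intros)
      show "\<forall>\<^sub>F v in at_left 1. (\<Sum>l\<le>K. mass (l + 2) * (v ^ l - u ^ l)) \<le> C * (v - u)"
        unfolding eventually_at_left_field using part u by (intro exI[of _ u]) auto
    qed simp
    moreover have "(\<Sum>l\<le>K. mass (l + 2) * (1 ^ l - u ^ l)) = (1 - u) * (\<Sum>l\<le>K. mass (l + 2) * (\<Sum>k<l. u ^ k))"
    proof -
      have "mass (l + 2) * (1 ^ l - u ^ l) = (1 - u) * (mass (l + 2) * (\<Sum>k<l. u ^ k))" for l
        using one_diff_power_eq[of u l] by simp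
      then show ?thesis by (simp only: sum_distrib_left)
    qed
    ultimately show ?thesis using u by (simp add: mult.commute)
  qed
  have "(\<Sum>l\<le>K. mass (l + 2) * (\<Sum>k<l. 1 ^ k)) \<le> C" for K
  proof (rule tendsto_upperbound)
    show "((\<lambda>u. \<Sum>l\<le>K. mass (l + 2) * (\<Sum>k<l. u ^ k)) \<longlongrightarrow> (\<Sum>l\<le>K. mass (l + 2) * (\<Sum>k<l. 1 ^ k))) (at_left (1::real))"
      by (intro tendsto_intros)
    show "\<forall>\<^sub>F u in at_left 1. (\<Sum>l\<le>K. mass (l + 2) * (\<Sum>k<l. u ^ k)) \<le> C"
      unfolding eventually_at_left_field using part1 e by (intro exI[of _ "1 - e"]) auto
  qed simp
  then have "(\<Sum>l\<le>K. real l * mass (l + 2)) \<le> C" for K by (simp add: mult.commute)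
  then have "summable (\<lambda>t. real t * mass (t + 2))" using m0 by (intro bounded_imp_summable) auto
  with first_moment_infinite show False by blast
qed

end

section \<open>The square root coefficient does not vanish\<close>

lemma holomorphic_eq_from_segment:
  fixes f g :: "complex \<Rightarrow> complex"
  assumes "f holomorphic_on D" "g holomorphic_on D" "open D" "connected D"
    and seg: "\<And>t. 0 < t \<Longrightarrow> t < e \<Longrightarrow> a + of_real t * b \<in> D \<and> f (a + of_real t * b) = g (a + of_real t * b)"
    and e: "e > 0" and b: "b \<noteq> 0" and z: "z \<in> D"
  shows "f z = g z"
proof -
  define T where "T = (\<lambda>t::real. a + of_real t * b) ` {0<..<e}"
  have "(\<lambda>z. f z - g z) z = 0"
  proof (rule analytic_continuation[of "\<lambda>z. f z - g z" D T "a + of_real (e/2) * b"])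
    show "(\<lambda>z. f z - g z) holomorphic_on D" using assms by (intro holomorphic_intros)
    show "T \<subseteq> D" using seg by (auto simp: T_def)
    show "a + of_real (e/2) * b \<in> D" using seg[of "e/2"] e by auto
    show "a + of_real (e/2) * b islimpt T"
    proof (rule islimptI)
      fix V assume V: "a + of_real (e/2) * b \<in> V" "open V"
      have "continuous_on UNIV (\<lambda>t::real. a + of_real t * b)" by (intro continuous_intros)
      then have "open ((\<lambda>t::real. a + of_real t * b) -` V)" using V(2) by (intro open_vimage)
      moreover have "e/2 \<in> (\<lambda>t::real. a + of_real t * b) -` V" using V(1) by simp
      ultimately have "\<exists>\<delta>>0. \<forall>t. dist t (e/2) < \<delta> \<longrightarrow> t \<in> (\<lambda>t::real. a + of_real t * b) -` V"
        unfolding open_dist by blast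
      then obtain \<delta> where \<delta>: "\<delta> > 0" "\<And>t. dist t (e/2) < \<delta> \<Longrightarrow> a + of_real t * b \<in> V"
        by auto
      define t where "t = e/2 + min (\<delta>/2) (e/4)"
      have t: "0 < t" "t < e" "t \<noteq> e/2" "dist t (e/2) < \<delta>" using \<delta> e by (auto simp: t_def dist_real_def)
      have "a + of_real t * b \<noteq> a + of_real (e/2) * b" using t(3) b by (simp add: of_real_eq_iff del: of_real_divide)
      then show "\<exists>y\<in>T. y \<in> V \<and> y \<noteq> a + of_real (e/2) * b" using \<delta>(2)[OF t(4)] t by (auto simp: T_def)
    qed
  qed (use assms seg in \<open>auto simp: T_def\<close>)
  then show ?thesis by simp
qed

lemma holomorphic_csqrt_one_minus:
  assumes "\<Phi> holomorphic_on ball 0 r" "r > 0"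
  shows "(\<lambda>z. \<Phi> (csqrt (1 - z))) holomorphic_on (ball 1 (r\<^sup>2) \<inter> ball 0 1)"
proof -
  have re: "Re (1 - z) > 0" if "norm z < 1" for z using complex_Re_le_cmod[of z] that by simp
  have "(\<lambda>z. csqrt (1 - z)) holomorphic_on (ball 1 (r\<^sup>2) \<inter> ball 0 1)"
    by (intro holomorphic_intros) (use re in \<open>auto simp: complex_nonpos_Reals_iff dest!: leD\<close>)
  moreover have "(\<lambda>z. csqrt (1 - z)) ` (ball 1 (r\<^sup>2) \<inter> ball 0 1) \<subseteq> ball 0 r"
  proof safe
    fix z :: complex assume "z \<in> ball 1 (r\<^sup>2)"
    then have "norm (1 - z) < r\<^sup>2" by (simp add: dist_norm)
    then have "sqrt (norm (1 - z)) < r" using assms(2) real_sqrt_less_mono[of "norm (1 - z)" "r\<^sup>2"] by simp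
    then show "csqrt (1 - z) \<in> ball 0 r" by simp
  qed
  ultimately show ?thesis
    using holomorphic_on_compose_gen[of "\<lambda>z. csqrt (1 - z)" "ball 1 (r\<^sup>2) \<inter> ball 0 1" \<Phi> "ball 0 r"] assms(1)
    by (simp add: o_def)
qed

context critical_system
begin

lemma holomorphic_gf: "gf l holomorphic_on ball (0::complex) 1"
  by (rule power_series_holomorphic[where a = "\<lambda>n. of_real (A l n)"]) (use gf_sums in auto)

lemma holomorphic_srcgf: "(\<lambda>z::complex. srcgf z l) holomorphic_on UNIV"
  unfolding srcgf_def by (intro holomorphic_intros)

lemma branch_limit:
  fixes \<Phi> :: "complex \<Rightarrow> complex"
  assumes r: "r > 0" and \<Phi>: "\<Phi> holomorphic_on ball 0 r"
    and eq: "\<And>s. 0 < s \<Longrightarrow> s < r \<Longrightarrow> gf l (of_real (1 - s\<^sup>2)) = \<Phi> (of_real s)"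
  shows "\<Phi> 0 = of_real (mass l)"
proof -
  have "isCont \<Phi> 0" using \<Phi> r by (meson centre_in_ball continuous_on_eq_continuous_at holomorphic_on_imp_continuous_on open_ball)
  then have "((\<lambda>s. \<Phi> (of_real s)) \<longlongrightarrow> \<Phi> (of_real 0)) (at_right 0)"
    by (intro isCont_tendsto_compose[of _ \<Phi>] tendsto_intros) auto
  moreover have "((\<lambda>s. \<Phi> (of_real s)) \<longlongrightarrow> of_real (mass l)) (at_right (0::real))"
  proof (rule Lim_transform_eventually)
    have "filterlim (\<lambda>s::real. 1 - s\<^sup>2) (at_left 1) (at_right 0)"
      unfolding filterlim_at
      by (auto intro!: tendsto_eq_intros simp: eventually_at_right_field) (rule exI[of _ 1], auto)
    then have "((\<lambda>s. gf l (1 - s\<^sup>2)) \<longlongrightarrow> mass l) (at_right (0::real))"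
      using gf_tendsto_mass by (rule filterlim_compose[rotated])
    then show "((\<lambda>s. of_real (gf l (1 - s\<^sup>2)) :: complex) \<longlongrightarrow> of_real (mass l)) (at_right (0::real))"
      by (rule tendsto_of_real)
    show "\<forall>\<^sub>F s in at_right 0. of_real (gf l (1 - s\<^sup>2)) = \<Phi> (of_real s)"
      unfolding eventually_at_right_field
    proof (intro exI[of _ "min r 1"] conjI allI impI)
      fix s :: real assume s: "0 < s" "s < min r 1"
      then have "s\<^sup>2 < 1" "0 < s\<^sup>2" by (auto simp: power_less_one_iff abs_square_less_1)
      then have "\<bar>1 - s\<^sup>2\<bar> < 1" by simp
      then show "of_real (gf l (1 - s\<^sup>2)) = \<Phi> (of_real s)" using eq[of s] s of_real_gf[of "1 - s\<^sup>2" l] by simp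
    qed (use r in auto)
  qed
  ultimately show ?thesis using tendsto_unique trivial_limit_at_right_real of_real_0 by metis
qed

text \<open>The factor 1 - x^n increases with n, so the comparison of coefficients with a time shift
  K survives in the defects.\<close>

lemma mass_defect_le:
  assumes c: "c > 0" "\<And>n. c * A k n \<le> A j (n + K)" and x: "0 \<le> x" "x < (1::real)"
  shows "c * (mass k - gf k x) \<le> mass j - gf j x"
proof -
  have sm: "(\<lambda>n. A l n * (1 - x ^ n)) sums (mass l - gf l x)" for l
    using sums_diff[OF summable_sums[OF summable_A1[of l]] gf_sums[of x l]] x
    by (simp add: mass_def right_diff_distrib)
  have xp: "x ^ n \<le> 1" for n using x by (intro power_le_one) auto
  have "c * (mass k - gf k x) \<le> suminf (\<lambda>n. A j (n + K) * (1 - x ^ (n + K)))"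
  proof (rule sums_le[OF _ sums_mult[OF sm] summable_sums])
    fix n
    have "x ^ (n + K) \<le> x ^ n" using x by (intro power_decreasing) auto
    then have "c * A k n * (1 - x ^ n) \<le> A j (n + K) * (1 - x ^ (n + K))"
      using c xp A_nonneg by (intro mult_mono) auto
    then show "c * (A k n * (1 - x ^ n)) \<le> A j (n + K) * (1 - x ^ (n + K))" by (simp add: mult.assoc)
  next
    show "summable (\<lambda>n. A j (n + K) * (1 - x ^ (n + K)))"
      by (rule summable_ignore_initial_segment[OF sums_summable[OF sm]])
  qed
  also have "\<dots> \<le> mass j - gf j x"
    using suminf_split_initial_segment[OF sums_summable[OF sm[of j]], of K] sums_unique[OF sm[of j]] A_nonneg xp
    by (simp add: sum_nonneg)
  finally show ?thesis .
qed

text \<open>\<open>- deriv (\<Phi> l) 0\<close> is the limit of the defect at 1 - s^2 divided by s,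
  and by irreducibility the defect of level k is bounded by a multiple of that of level j. Hence a
  single vanishing derivative yields both, as the argument along the branch requires.\<close>

lemma branch_derivs_vanish_together:
  fixes \<Phi> :: "nat \<Rightarrow> complex \<Rightarrow> complex"
  assumes r: "r > 0" and \<Phi>: "\<Phi> j holomorphic_on ball 0 r" "\<Phi> k holomorphic_on ball 0 r"
    and eq: "\<And>s l. l = j \<or> l = k \<Longrightarrow> 0 < s \<Longrightarrow> s < r \<Longrightarrow> gf l (of_real (1 - s\<^sup>2)) = \<Phi> l (of_real s)"
    and z: "deriv (\<Phi> j) 0 = 0"
  shows "deriv (\<Phi> k) 0 = 0"
proof -
  obtain c K where c: "c > 0" "\<And>n. c * A k n \<le> A j (n + K)" using irreducible[of k j] by blast
  define q where "q = (\<lambda>l (s::real). (mass l - gf l (1 - s\<^sup>2)) / s)"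
  have lim: "((\<lambda>s. of_real (q l s)) \<longlongrightarrow> - deriv (\<Phi> l) 0) (at_right 0)" if l: "l = j \<or> l = k" for l
  proof -
    have hol: "\<Phi> l holomorphic_on ball 0 r" using \<Phi> l by auto
    have "(\<Phi> l has_field_derivative deriv (\<Phi> l) 0) (at 0)" using r by (intro holomorphic_derivI[OF hol]) auto
    then have "((\<lambda>h. (\<Phi> l (0 + h) - \<Phi> l 0) / h) \<longlongrightarrow> deriv (\<Phi> l) 0) (at 0)" unfolding DERIV_def .
    moreover have "filterlim of_real (at (0::complex)) (at_right (0::real))"
      unfolding filterlim_at by (auto intro!: tendsto_eq_intros simp: eventually_at_right_field) (rule exI[of _ 1], auto)
    ultimately have "((\<lambda>s::real. - ((\<Phi> l (0 + of_real s) - \<Phi> l 0) / of_real s)) \<longlongrightarrow> - deriv (\<Phi> l) 0) (at_right 0)"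
      by (intro tendsto_minus) (rule filterlim_compose)
    moreover have "\<forall>\<^sub>F s in at_right 0. - ((\<Phi> l (0 + of_real s) - \<Phi> l 0) / of_real s) = of_real (q l s)"
      unfolding eventually_at_right_field
    proof (intro exI[of _ "min r 1"] conjI allI impI)
      fix s :: real assume s: "0 < s" "s < min r 1"
      then have "s\<^sup>2 < 1" "0 < s\<^sup>2" by (auto simp: power_less_one_iff abs_square_less_1)
      then have "\<bar>1 - s\<^sup>2\<bar> < 1" by simp
      then have "\<Phi> l (of_real s) = of_real (gf l (1 - s\<^sup>2))" using eq[OF l, of s] s of_real_gf[of "1 - s\<^sup>2" l] by simp
      moreover have "\<Phi> l 0 = of_real (mass l)" using branch_limit[OF r hol eq[OF l]] by simp
      ultimately show "- ((\<Phi> l (0 + of_real s) - \<Phi> l 0) / of_real s) = of_real (q l s)"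
        by (simp add: q_def minus_divide_left)
    qed (use r in auto)
    ultimately show ?thesis by (rule Lim_transform_eventually)
  qed
  have "((\<lambda>s. norm (of_real (q j s) :: complex)) \<longlongrightarrow> norm (- deriv (\<Phi> j) 0)) (at_right 0)"
    by (intro tendsto_norm lim) auto
  then have qj: "((\<lambda>s. \<bar>q j s\<bar> / c) \<longlongrightarrow> 0 / c) (at_right 0)" using z by (intro tendsto_divide tendsto_const) (use c in auto)
  have "((\<lambda>s. of_real (q k s) :: complex) \<longlongrightarrow> 0) (at_right 0)"
  proof (rule Lim_null_comparison)
    show "((\<lambda>s. \<bar>q j s\<bar> / c) \<longlongrightarrow> 0) (at_right 0)" using qj by simp
    show "\<forall>\<^sub>F s in at_right 0. norm (of_real (q k s) :: complex) \<le> \<bar>q j s\<bar> / c"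
      unfolding eventually_at_right_field
    proof (intro exI[of _ 1] conjI allI impI)
      fix s :: real assume s: "0 < s" "s < 1"
      then have s2: "s\<^sup>2 < 1" "0 < s\<^sup>2" by (auto simp: power_less_one_iff abs_square_less_1)
      have le: "c * (mass k - gf k (1 - s\<^sup>2)) \<le> mass j - gf j (1 - s\<^sup>2)"
        using c s2 by (intro mass_defect_le[OF c]) auto
      have "norm (1 - s\<^sup>2) < 1" using s2 by simp
      then have nn: "0 \<le> mass k - gf k (1 - s\<^sup>2)" using norm_gf_le_mass[of "1 - s\<^sup>2" k] by simp
      have "c * q k s \<le> q j s" using le s unfolding q_def by (simp add: divide_right_mono)
      moreover have "0 \<le> q k s" using nn s by (simp add: q_def)
      moreover have "0 \<le> c * q k s" using c(1) \<open>0 \<le> q k s\<close> by simp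
      ultimately show "norm (of_real (q k s) :: complex) \<le> \<bar>q j s\<bar> / c"
        using c(1) by (simp add: field_simps)
    qed simp
  qed
  then show ?thesis using tendsto_unique[OF trivial_limit_at_right_real lim[of k]] by fastforce
qed

text \<open>The kernel equation along the root U(s) is an identity \<open>H s = 0\<close>. With both
  derivatives zero, the derivative of H at 0 is \<open>deriv U 0\<close> times the derivative of
  \<open>crit_num\<close> at 1, so the latter would vanish together with
  \<open>crit_num 1\<close>.\<close>

theorem sqrt_coeff_nonzero:
  fixes \<Phi> :: "nat \<Rightarrow> complex \<Rightarrow> complex"
  assumes r: "r > 0" and \<Phi>: "\<And>l. l < 2 \<Longrightarrow> \<Phi> l holomorphic_on ball 0 r"
    and eq: "\<And>s l. l < 2 \<Longrightarrow> 0 < s \<Longrightarrow> s < r \<Longrightarrow> gf l (of_real (1 - s\<^sup>2)) = \<Phi> l (of_real s)"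
    and l: "l < 2"
  shows "deriv (\<Phi> l) 0 \<noteq> 0"
proof
  assume "deriv (\<Phi> l) 0 = 0"
  then have z: "deriv (\<Phi> k) 0 = 0" if "k < 2" for k
    using that l by (intro branch_derivs_vanish_together[OF r \<Phi>[OF l] \<Phi>[OF that]] eq) auto
  obtain \<rho> r0 U where r0: "0 < r0" and U: "U holomorphic_on ball 0 r0" "U 0 = 1" "deriv U 0 \<noteq> 0"
    "\<And>s. s \<in> ball 0 r0 \<Longrightarrow> kern (1 - s\<^sup>2) (U s) = 0"
    "\<And>s. 0 < s \<Longrightarrow> s < r0 \<Longrightarrow> norm (U (of_real s)) < 1"
    by (rule critical_root_structure) (rule that)
  define r1 where "r1 = min r (min r0 1)"
  have r1: "r1 > 0" "r1 \<le> r" "r1 \<le> r0" "r1 \<le> 1" using r r0 by (auto simp: r1_def)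
  have Uh: "U holomorphic_on ball 0 r1" using U(1) by (rule holomorphic_on_subset) (use r1 in auto)
  have \<Phi>h: "\<Phi> l holomorphic_on ball 0 r1" if "l < 2" for l using \<Phi>[OF that] by (rule holomorphic_on_subset) (use r1 in auto)
  define H where "H = (\<lambda>s. (\<Sum>l\<le>S. srcgf (1 - s\<^sup>2) l * U s ^ l) - \<Phi> 0 s * b0 (1 - s\<^sup>2) (U s) - \<Phi> 1 s * b1 (1 - s\<^sup>2) (U s))"
  have Hh: "H holomorphic_on ball 0 r1"
    unfolding H_def b0_def b1_def srcgf_def by (intro holomorphic_intros Uh \<Phi>h) auto
  have Hs: "H (of_real s) = 0" if s: "0 < s" "s < r1" for s
  proof -
    have s2: "s\<^sup>2 < 1" "0 < s\<^sup>2" using s r1 by (auto simp: power_less_one_iff abs_square_less_1)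
    have zz: "1 - (of_real s)\<^sup>2 = (of_real (1 - s\<^sup>2) :: complex)" by simp
    have nz: "norm (1 - (of_real s)\<^sup>2 :: complex) < 1" unfolding zz norm_of_real using s2 by simp
    have u: "norm (U (of_real s)) < 1" "kern (1 - (of_real s)\<^sup>2) (U (of_real s)) = 0" using U(4)[of "of_real s"] U(5)[of s] s r1 by auto
    have "summable (\<lambda>l. norm (gf l (1 - (of_real s)\<^sup>2) * U (of_real s) ^ l))"
    proof (rule summable_comparison_test'[OF summable_norm_gf_index[OF nz], of 0])
      fix n :: nat
      have "norm (U (of_real s)) ^ n \<le> 1" using u(1) by (intro power_le_one) auto
      then show "norm (norm (gf n (1 - (of_real s)\<^sup>2) * U (of_real s) ^ n)) \<le> norm (gf n (1 - (of_real s)\<^sup>2) :: complex)"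
        by (simp add: norm_mult norm_power mult_left_le)
    qed
    from kernel_equation[OF gf_sol[OF nz] srcgf_zero this] u(2) eq[of 0 s] eq[of 1 s] s r1
    show ?thesis by (simp add: H_def)
  qed
  have H0: "H s = 0" if "s \<in> ball 0 r1" for s
  proof (rule holomorphic_eq_from_segment[of H "ball 0 r1" "\<lambda>_. 0" r1 0 1])
    show "0 + of_real t * 1 \<in> ball (0::complex) r1 \<and> H (0 + of_real t * 1) = 0" if "0 < t" "t < r1" for t
      using that Hs[of t] by simp
  qed (use Hh r1 that in auto)
  have "(H has_field_derivative 0) (at 0)"
  proof (rule has_field_derivative_transform_within_open[of "\<lambda>_. 0" 0 0 "ball 0 r1"])
    show "(\<lambda>_. 0) x = H x" if "x \<in> ball 0 r1" for x using H0[OF that] by simp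
  qed (use r1 in auto)
  moreover have "(H has_field_derivative ((\<Sum>l\<le>S. srcgf 1 l * of_nat l * deriv U 0)
     - (of_real (mass 0) * (of_real b0' * deriv U 0)) - (of_real (mass 1) * (of_real b1' * deriv U 0)))) (at 0)"
  proof -
    have dU: "(U has_field_derivative deriv U 0) (at 0)" using r0 by (intro holomorphic_derivI[OF U(1)]) auto
    have d\<Phi>: "(\<Phi> l has_field_derivative 0) (at 0)" if "l < 2" for l
      using holomorphic_derivI[OF \<Phi>[OF that] open_ball, of 0] r z[OF that] by simp
    have m: "\<Phi> l 0 = of_real (mass l)" if "l < 2" for l
      by (rule branch_limit[OF r \<Phi>[OF that] eq[OF that]])
    have dsrc: "((\<lambda>s. srcgf (1 - s\<^sup>2) l * U s ^ l) has_field_derivative srcgf 1 l * of_nat l * deriv U 0) (at 0)" for l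
    proof -
      have "((\<lambda>s::complex. srcgf (1 - s\<^sup>2) l) has_field_derivative 0) (at 0)"
      proof -
        have "((\<lambda>s::complex. \<Sum>n\<le>S. of_real (src l n) * (1 - s\<^sup>2) ^ n) has_field_derivative (\<Sum>n\<le>S. 0)) (at 0)"
          by (intro DERIV_sum) (auto intro!: derivative_eq_intros)
        then show ?thesis by (simp add: srcgf_def)
      qed
      then show ?thesis using dU U(2) by (auto intro!: derivative_eq_intros)
    qed
    have "(H has_field_derivative ((\<Sum>l\<le>S. srcgf 1 l * of_nat l * deriv U 0)
       - (0 * b0 (1 - 0\<^sup>2) (U 0) + (of_real b0' * deriv U 0) * \<Phi> 0 0)
       - (0 * b1 (1 - 0\<^sup>2) (U 0) + (of_real b1' * deriv U 0) * \<Phi> 1 0))) (at 0)"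
      unfolding H_def
      by (intro DERIV_diff DERIV_sum DERIV_mult dsrc b0_along_branch U(2) dU d\<Phi>) auto
    then show ?thesis using m by (simp add: mult_ac)
  qed
  ultimately have E: "(\<Sum>l\<le>S. srcgf 1 l * of_nat l * deriv U 0)
     - (of_real (mass 0) * (of_real b0' * deriv U 0)) - (of_real (mass 1) * (of_real b1' * deriv U 0)) = 0"
    using DERIV_unique by blast
  define D :: complex where "D = (\<Sum>l\<le>S. srcgf 1 l * of_nat l) - of_real (mass 0) * of_real b0' - of_real (mass 1) * of_real b1'"
  have "D * deriv U 0 = 0" using E by (simp add: D_def left_diff_distrib sum_distrib_right mult.assoc)
  then have "D = 0" using U(3) by simp
  moreover have "(crit_num has_field_derivative D) (at 1)"
  proof -
    have ds: "((\<lambda>u. srcgf 1 l * u ^ l) has_field_derivative srcgf 1 l * of_nat l) (at (1::complex))" for l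
      by (auto intro!: derivative_eq_intros)
    have "((\<lambda>u. crit_num u) has_field_derivative D) (at 1)"
      unfolding crit_num_def D_def
      by (intro DERIV_diff DERIV_sum ds DERIV_cmult b0_deriv_at_one)
    then show ?thesis by simp
  qed
  moreover have "crit_num 1 = 0"
  proof -
    have "\<Phi> l 0 = of_real (mass l)" if "l < 2" for l
      by (rule branch_limit[OF r \<Phi>[OF that] eq[OF that]])
    then show ?thesis using H0[of 0] r1 U(2) by (simp add: H_def crit_num_def)
  qed
  ultimately show False using crit_num_deriv_nonzero by blast
qed

end

section \<open>Local branches on the circle of convergence\<close>

context critical_system
begin

text \<open>Regular points are brought to the form of the singular ones by substituting s^2, so that
  every boundary point has an expansion in s; at the singular ones the twist by \<omega>^l reduces
  to z = 1.\<close>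

lemma boundary_branch_real:
  assumes \<zeta>: "norm \<zeta> = 1" and i: "l < 2"
  obtains r \<Phi> where "r > 0" "\<Phi> holomorphic_on ball 0 r"
    "\<And>s. 0 < s \<Longrightarrow> s < r \<Longrightarrow> gf l (\<zeta> * of_real (1 - s\<^sup>2)) = \<Phi> (of_real s)"
proof (cases "\<exists>\<omega>. norm \<omega> = 1 \<and> kern \<zeta> \<omega> = 0")
  case False
  obtain r \<Phi> where r: "r > 0" "\<Phi> holomorphic_on ball 0 r"
    "\<And>s. 0 < s \<Longrightarrow> s < r \<Longrightarrow> gf l (\<zeta> * of_real (1 - s)) = \<Phi> (of_real s)"
  proof (rule regular_boundary_point[of "\<lambda>z. srcgf z" "\<lambda>z l. gf l z" S l "mass l" \<zeta>])
  qed (use False \<zeta> i gf_sol summable_norm_gf_index srcgf_zero holomorphic_srcgf norm_gf_le_mass in auto)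
  have sq: "s\<^sup>2 < r" if "norm s < sqrt r" "s \<ge> 0" for s :: real
    using that real_less_rsqrt real_sqrt_less_iff[of "s\<^sup>2" r] by auto
  show ?thesis
  proof (rule that[of "sqrt r" "\<lambda>s. \<Phi> (s\<^sup>2)"])
    show "(\<lambda>s. \<Phi> (s\<^sup>2)) holomorphic_on ball 0 (sqrt r)"
    proof -
      have "(\<lambda>s::complex. s\<^sup>2) holomorphic_on ball 0 (sqrt r)" by (intro holomorphic_intros)
      moreover have "(\<lambda>s::complex. s\<^sup>2) ` ball 0 (sqrt r) \<subseteq> ball 0 r"
        using sq by (auto simp: norm_power)
      ultimately show ?thesis using holomorphic_on_compose_gen[OF _ r(2)] by (simp add: o_def)
    qed
    show "gf l (\<zeta> * of_real (1 - s\<^sup>2)) = \<Phi> ((of_real s)\<^sup>2)" if "0 < s" "s < sqrt r" for s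
      using r(3)[of "s\<^sup>2"] sq[of s] that by simp
  qed (use r in auto)
next
  case True
  then obtain \<omega> where \<omega>: "norm \<omega> = 1" "kern \<zeta> \<omega> = 0" by blast
  have al: "\<And>i. i \<in> I \<Longrightarrow> \<zeta> ^ dz i * \<omega> ^ up i = \<omega> ^ dn i" using aligned_steps[OF \<zeta> \<omega>] .
  have \<omega>0: "\<omega> \<noteq> 0" using \<omega> by auto
  obtain r \<Phi> where r: "r > 0" "\<Phi> holomorphic_on ball 0 r"
    "\<And>s. 0 < s \<Longrightarrow> s < r \<Longrightarrow> \<omega> ^ l * gf l (\<zeta> * of_real (1 - s\<^sup>2)) = \<Phi> (of_real s)"
  proof (rule singular_boundary_point[of "\<lambda>z l. \<omega> ^ l * srcgf (\<zeta> * z) l" "\<lambda>z l. \<omega> ^ l * gf l (\<zeta> * z)" S l "mass l"])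
    show "is_sol z (\<lambda>l. \<omega> ^ l * srcgf (\<zeta> * z) l) (\<lambda>l. \<omega> ^ l * gf l (\<zeta> * z))" if "norm z < 1" for z
      by (rule twisted_sol[OF that \<zeta> \<omega>(1) al])
    fix z :: complex assume z: "norm z < 1"
    then have "norm (\<zeta> * z) < 1" using \<zeta> by (simp add: norm_mult)
    then show "summable (\<lambda>l. norm (\<omega> ^ l * gf l (\<zeta> * z)))" "norm (\<omega> ^ l * gf l (\<zeta> * z)) \<le> mass l"
      using summable_norm_gf_index[of "\<zeta> * z"] norm_gf_le_mass[of "\<zeta> * z" l] \<omega> by (auto simp: norm_mult norm_power)
  next
    show "(\<lambda>z. \<omega> ^ l * srcgf (\<zeta> * z) l) holomorphic_on UNIV" for l
      unfolding srcgf_def by (intro holomorphic_intros)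
  qed (use i srcgf_zero in auto)
  show ?thesis
  proof (rule that[of r "\<lambda>s. \<Phi> s / \<omega> ^ l"])
    show "(\<lambda>s. \<Phi> s / \<omega> ^ l) holomorphic_on ball 0 r" using r \<omega>0 by (intro holomorphic_intros) auto
    show "gf l (\<zeta> * of_real (1 - s\<^sup>2)) = \<Phi> (of_real s) / \<omega> ^ l" if "0 < s" "s < r" for s
      using r(3)[OF that] \<omega>0 by (simp add: field_simps)
  qed (use r in auto)
qed

theorem boundary_branch:
  assumes \<zeta>: "norm \<zeta> = 1" and i: "l < 2"
  obtains r \<Phi> where "r > 0" "r \<le> 1" "\<Phi> holomorphic_on ball 0 r"
    "\<And>z. z \<in> ball 1 (r\<^sup>2) \<inter> ball 0 1 \<Longrightarrow> gf l (\<zeta> * z) = \<Phi> (csqrt (1 - z))"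
proof -
  obtain r0 \<Phi> where r0: "r0 > 0" "\<Phi> holomorphic_on ball 0 r0"
    "\<And>s. 0 < s \<Longrightarrow> s < r0 \<Longrightarrow> gf l (\<zeta> * of_real (1 - s\<^sup>2)) = \<Phi> (of_real s)"
    by (rule boundary_branch_real[OF assms]) (rule that)
  define r where "r = min r0 1"
  have r: "r > 0" "r \<le> r0" "r \<le> 1" using r0 by (auto simp: r_def)
  have h: "\<Phi> holomorphic_on ball 0 r" using r0(2) by (rule holomorphic_on_subset) (use r in auto)
  let ?D = "ball 1 (r\<^sup>2) \<inter> ball (0::complex) 1"
  have r2: "0 < r\<^sup>2" "r\<^sup>2 \<le> 1" using r by (auto simp: power_le_one)
  have "gf l (\<zeta> * z) = \<Phi> (csqrt (1 - z))" if z: "z \<in> ?D" for z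
  proof (rule holomorphic_eq_from_segment[of "\<lambda>z. gf l (\<zeta> * z)" ?D "\<lambda>z. \<Phi> (csqrt (1 - z))" "r\<^sup>2" 1 "-1"])
    have "(\<lambda>z. \<zeta> * z) holomorphic_on ?D" "(\<lambda>z. \<zeta> * z) ` ?D \<subseteq> ball 0 1"
      using \<zeta> by (auto intro!: holomorphic_intros simp: norm_mult)
    then show "(\<lambda>z. gf l (\<zeta> * z)) holomorphic_on ?D"
      using holomorphic_on_compose_gen[OF _ holomorphic_gf[of l]] by (simp add: o_def)
    show "(\<lambda>z. \<Phi> (csqrt (1 - z))) holomorphic_on ?D" by (rule holomorphic_csqrt_one_minus[OF h r(1)])
    show "connected ?D" by (intro convex_connected convex_Int convex_ball)
    fix t assume t: "0 < t" "t < r\<^sup>2"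
    have e: "1 + of_real t * - 1 = (of_real (1 - t) :: complex)" by simp
    have "1 + of_real t * - 1 \<in> ?D" unfolding e using t r2 by (auto simp: dist_one_of_real simp del: of_real_diff)
    moreover have "gf l (\<zeta> * of_real (1 - t)) = \<Phi> (csqrt (of_real t))"
    proof -
      have "sqrt t < r" using t r real_sqrt_less_mono[of t "r\<^sup>2"] by simp
      then show ?thesis using r0(3)[of "sqrt t"] t r by (simp add: csqrt_of_real_nonneg)
    qed
    ultimately show "1 + of_real t * - 1 \<in> ?D \<and> gf l (\<zeta> * (1 + of_real t * - 1)) = \<Phi> (csqrt (1 - (1 + of_real t * - 1)))"
      unfolding e by simp
  qed (use r2 z in auto)
  with that[of r \<Phi>] r h show ?thesis by blast
qed

text \<open>Alignment along a descending and an ascending step makes the singular points roots of unity.\<close>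

definition period where
  "period = (SOME d. d \<ge> 1 \<and> (\<forall>\<zeta> \<omega>::complex. norm \<zeta> = 1 \<longrightarrow> norm \<omega> = 1 \<longrightarrow> kern \<zeta> \<omega> = 0 \<longrightarrow> \<zeta> ^ d = 1))"

lemma period: "period \<ge> 1" "\<And>\<zeta> \<omega>::complex. norm \<zeta> = 1 \<Longrightarrow> norm \<omega> = 1 \<Longrightarrow> kern \<zeta> \<omega> = 0 \<Longrightarrow> \<zeta> ^ period = 1"
proof -
  obtain i where i: "i \<in> I" "up i < dn i" using descend by blast
  obtain k where k: "k \<in> I" "dn k < up k" using ascend by blast
  \<comment> \<open>Chosen so that \<omega> is eliminated between the relation of a descending and
    that of an ascending step. The order of every singular point divides d; a d-th root of unity
    that is regular does no harm, as it has a branch in s too.\<close>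
  define d where "d = dz i * (up k - dn k) + dz k * (dn i - up i)"
  have "\<zeta> ^ d = 1" if z: "norm \<zeta> = 1" "norm \<omega> = 1" "kern \<zeta> \<omega> = 0" for \<zeta> \<omega> :: complex
  proof -
    have w0: "\<omega> \<noteq> 0" using z by auto
    have "\<zeta> ^ dz i * \<omega> ^ up i = \<omega> ^ (dn i - up i) * \<omega> ^ up i"
      using aligned_steps[OF z i(1)] i(2) by (simp add: power_add[symmetric])
    then have 1: "\<zeta> ^ dz i = \<omega> ^ (dn i - up i)" using w0 by simp
    have "\<zeta> ^ dz k * \<omega> ^ (up k - dn k) * \<omega> ^ dn k = 1 * \<omega> ^ dn k"
      using aligned_steps[OF z k(1)] k(2) by (simp add: mult.assoc power_add[symmetric])
    then have 2: "\<zeta> ^ dz k * \<omega> ^ (up k - dn k) = 1" using w0 by simp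
    have "\<zeta> ^ d = (\<zeta> ^ dz i) ^ (up k - dn k) * (\<zeta> ^ dz k) ^ (dn i - up i)"
      by (simp add: d_def power_add power_mult)
    also have "(\<zeta> ^ dz i) ^ (up k - dn k) = (\<omega> ^ (up k - dn k)) ^ (dn i - up i)"
      unfolding 1 by (simp add: power_mult[symmetric] mult.commute)
    also have "(\<omega> ^ (up k - dn k)) ^ (dn i - up i) * (\<zeta> ^ dz k) ^ (dn i - up i) = 1"
      using 2 by (simp add: power_mult_distrib[symmetric] mult.commute)
    finally show ?thesis .
  qed
  moreover have "d \<ge> 1"
  proof -
    have "0 < dz i * (up k - dn k)" using dz_pos[OF i(1)] k(2) by simp
    then have "0 < d" unfolding d_def by (rule trans_less_add1)
    then show ?thesis by simp
  qed
  ultimately have "\<exists>d. d \<ge> 1 \<and> (\<forall>\<zeta> \<omega>::complex. norm \<zeta> = 1 \<longrightarrow> norm \<omega> = 1 \<longrightarrow> kern \<zeta> \<omega> = 0 \<longrightarrow> \<zeta> ^ d = 1)"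
    by blast
  from someI_ex[OF this] show "period \<ge> 1" "\<And>\<zeta> \<omega>::complex. norm \<zeta> = 1 \<Longrightarrow> norm \<omega> = 1 \<Longrightarrow> kern \<zeta> \<omega> = 0 \<Longrightarrow> \<zeta> ^ period = 1"
    unfolding period_def by blast+
qed

theorem boundary_regular:
  assumes \<zeta>: "norm \<zeta> = 1" "\<zeta> ^ period \<noteq> 1" and i: "l < 2"
  obtains r \<Psi> where "r > 0" "\<Psi> holomorphic_on ball \<zeta> r"
    "\<And>z. z \<in> ball \<zeta> r \<inter> ball 0 1 \<Longrightarrow> gf l z = \<Psi> z"
proof -
  have nz: "kern \<zeta> \<omega> \<noteq> 0" if "norm \<omega> = 1" for \<omega> using period(2)[OF \<zeta>(1) that] \<zeta>(2) by blast
  obtain r0 \<Phi> where r: "r0 > 0" "\<Phi> holomorphic_on ball 0 r0"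
    "\<And>s. 0 < s \<Longrightarrow> s < r0 \<Longrightarrow> gf l (\<zeta> * of_real (1 - s)) = \<Phi> (of_real s)"
  proof (rule regular_boundary_point[of "\<lambda>z. srcgf z" "\<lambda>z l. gf l z" S l "mass l" \<zeta>])
  qed (use nz \<zeta> i gf_sol summable_norm_gf_index srcgf_zero holomorphic_srcgf norm_gf_le_mass in auto)
  have \<zeta>0: "\<zeta> \<noteq> 0" using \<zeta> by auto
  define \<Psi> where "\<Psi> = (\<lambda>z. \<Phi> (1 - z / \<zeta>))"
  have \<Psi>: "\<Psi> holomorphic_on ball \<zeta> r0"
  proof -
    have "(\<lambda>z. 1 - z / \<zeta>) holomorphic_on ball \<zeta> r0" using \<zeta>0 by (intro holomorphic_intros) auto
    moreover have "(\<lambda>z. 1 - z / \<zeta>) ` ball \<zeta> r0 \<subseteq> ball 0 r0"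
    proof safe
      fix z assume "z \<in> ball \<zeta> r0"
      moreover have "1 - z / \<zeta> = (\<zeta> - z) / \<zeta>" using \<zeta>0 by (simp add: field_simps)
      ultimately show "1 - z / \<zeta> \<in> ball 0 r0" using \<zeta> by (simp add: dist_norm norm_divide)
    qed
    ultimately show ?thesis unfolding \<Psi>_def using holomorphic_on_compose_gen[OF _ r(2)] by (simp add: o_def)
  qed
  let ?D = "ball \<zeta> r0 \<inter> ball (0::complex) 1"
  have "gf l z = \<Psi> z" if z: "z \<in> ?D" for z
  proof (rule holomorphic_eq_from_segment[of "gf l" ?D \<Psi> "min r0 1" \<zeta> "- \<zeta>"])
    show "gf l holomorphic_on ?D" using holomorphic_gf by (rule holomorphic_on_subset) auto
    show "\<Psi> holomorphic_on ?D" using \<Psi> by (rule holomorphic_on_subset) auto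
    show "connected ?D" by (intro convex_connected convex_Int convex_ball)
    fix t assume t: "0 < t" "t < min r0 1"
    have e: "\<zeta> + of_real t * - \<zeta> = \<zeta> * of_real (1 - t)" by (simp add: algebra_simps)
    have "norm (\<zeta> * of_real (1 - t)) < 1" unfolding norm_mult norm_of_real \<zeta>(1) using t by simp
    moreover have "dist \<zeta> (\<zeta> + of_real t * - \<zeta>) < r0" using t \<zeta>(1) by (simp add: dist_norm norm_mult)
    moreover have "1 - \<zeta> * of_real (1 - t) / \<zeta> = of_real t" using \<zeta>0 by simp
    then have "\<Psi> (\<zeta> * of_real (1 - t)) = \<Phi> (of_real t)" unfolding \<Psi>_def by (rule arg_cong)
    then have "gf l (\<zeta> * of_real (1 - t)) = \<Psi> (\<zeta> * of_real (1 - t))" using r(3)[of t] t by simp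
    ultimately show "\<zeta> + of_real t * - \<zeta> \<in> ?D \<and> gf l (\<zeta> + of_real t * - \<zeta>) = \<Psi> (\<zeta> + of_real t * - \<zeta>)"
      unfolding e by simp
  qed (use r \<zeta>0 z in auto)
  with that r(1) \<Psi> show ?thesis by blast
qed

theorem sqrt_branch_at_one:
  obtains r \<Phi> where "r > 0" "r \<le> 1" "\<And>l. l < 2 \<Longrightarrow> \<Phi> l holomorphic_on ball 0 r"
    "\<And>l z. l < 2 \<Longrightarrow> z \<in> ball 1 (r\<^sup>2) \<inter> ball 0 1 \<Longrightarrow> gf l z = \<Phi> l (csqrt (1 - z))"
    "\<And>l. l < 2 \<Longrightarrow> deriv (\<Phi> l) 0 \<noteq> 0"
proof -
  have "\<forall>l. \<exists>r \<Phi>. l < 2 \<longrightarrow> r > 0 \<and> r \<le> 1 \<and> \<Phi> holomorphic_on ball 0 r \<and>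
     (\<forall>z. z \<in> ball 1 (r\<^sup>2) \<inter> ball 0 1 \<longrightarrow> gf l (1 * z) = \<Phi> (csqrt (1 - z)))"
    by (metis boundary_branch norm_one)
  then obtain R \<Phi> where R: "\<And>l. l < 2 \<Longrightarrow> R l > 0 \<and> R l \<le> (1::real) \<and> \<Phi> l holomorphic_on ball 0 (R l) \<and>
     (\<forall>z. z \<in> ball 1 ((R l)\<^sup>2) \<inter> ball 0 1 \<longrightarrow> gf l (1 * z) = \<Phi> l (csqrt (1 - z)))" by metis
  define r where "r = min (R 0) (R 1)"
  have r: "r > 0" "r \<le> 1" "\<And>l. l < 2 \<Longrightarrow> r \<le> R l" using R[of 0] R[of 1] by (auto simp: r_def less_2_cases_iff)
  have h: "\<Phi> l holomorphic_on ball 0 r" if "l < 2" for l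
    using R[OF that] r(3)[OF that] by (auto intro: holomorphic_on_subset)
  have e: "gf l z = \<Phi> l (csqrt (1 - z))" if l: "l < 2" and z: "z \<in> ball 1 (r\<^sup>2) \<inter> ball 0 1" for l z
  proof -
    have "r\<^sup>2 \<le> (R l)\<^sup>2" using r(1) r(3)[OF l] by (intro power_mono) auto
    then show ?thesis using R[OF l] z by auto
  qed
  have s: "gf l (of_real (1 - s\<^sup>2)) = \<Phi> l (of_real s)" if "l < 2" "0 < s" "s < r" for l s
  proof -
    have s2: "0 < s\<^sup>2" "s\<^sup>2 < r\<^sup>2" "r\<^sup>2 \<le> 1" using that r by (auto simp: power_strict_mono power_le_one)
    then have "of_real (1 - s\<^sup>2) \<in> ball 1 (r\<^sup>2) \<inter> ball (0::complex) 1"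
      by (auto simp: dist_one_of_real simp del: of_real_diff of_real_power)
    from e[OF that(1) this] show ?thesis using that by (simp add: csqrt_of_real_nonneg flip: of_real_power)
  qed
  show ?thesis
    by (rule that[OF r(1,2) h e]) (use sqrt_coeff_nonzero[OF r(1) h s] in auto)
qed

end

section \<open>Algebraicity\<close>

text \<open>Gaussian elimination without division: the equations are multiplied by the pivot, so the
  solution stays in the integral domain, which will be the polynomials in z.\<close>

lemma homogeneous_linear_system:
  fixes c :: "'r \<Rightarrow> 'k \<Rightarrow> 'a::idom"
  assumes "finite R" "finite K" "card R < card K"
  shows "\<exists>x. (\<exists>k\<in>K. x k \<noteq> 0) \<and> (\<forall>i\<in>R. (\<Sum>k\<in>K. c i k * x k) = 0)"
  using assms
proof (induction R arbitrary: K c rule: finite_induct)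
  case empty
  then obtain k where "k \<in> K" by fastforce
  then show ?case by (intro exI[of _ "\<lambda>_. 1"]) auto
next
  case (insert r R)
  show ?case
  proof (cases "\<forall>k\<in>K. c r k = 0")
    case True
    have "card R < card K" using insert by simp
    then obtain x where "\<exists>k\<in>K. x k \<noteq> 0" "\<forall>i\<in>R. (\<Sum>k\<in>K. c i k * x k) = 0" using insert.IH[OF insert.prems(1)] by blast
    then show ?thesis using True by (intro exI[of _ x]) auto
  next
    case False
    then obtain k0 where k0: "k0 \<in> K" "c r k0 \<noteq> 0" by blast
    let ?K = "K - {k0}"
    have "card R < card ?K" using insert k0 by simp
    then obtain y where y: "\<exists>k\<in>?K. y k \<noteq> 0" "\<forall>i\<in>R. (\<Sum>k\<in>?K. (c r k0 * c i k - c i k0 * c r k) * y k) = 0"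
      using insert.IH[of ?K "\<lambda>i k. c r k0 * c i k - c i k0 * c r k"] insert.prems(1) by blast
    define x where "x = (\<lambda>k. if k = k0 then - (\<Sum>k\<in>?K. c r k * y k) else c r k0 * y k)"
    have S: "(\<Sum>k\<in>K. c i k * x k) = - c i k0 * (\<Sum>k\<in>?K. c r k * y k) + c r k0 * (\<Sum>k\<in>?K. c i k * y k)" for i
    proof -
      have "(\<Sum>k\<in>K. c i k * x k) = c i k0 * x k0 + (\<Sum>k\<in>?K. c i k * x k)"
        using sum.remove[OF insert.prems(1) k0(1)] by simp
      also have "(\<Sum>k\<in>?K. c i k * x k) = c r k0 * (\<Sum>k\<in>?K. c i k * y k)"
        unfolding sum_distrib_left by (intro sum.cong) (auto simp: x_def mult_ac)
      finally show ?thesis by (simp add: x_def)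
    qed
    have "(\<Sum>k\<in>K. c i k * x k) = 0" if "i \<in> R" for i
    proof -
      have "(\<Sum>k\<in>?K. (c r k0 * c i k - c i k0 * c r k) * y k) = c r k0 * (\<Sum>k\<in>?K. c i k * y k) - c i k0 * (\<Sum>k\<in>?K. c r k * y k)"
        by (simp add: sum_distrib_left sum_subtractf left_diff_distrib mult.assoc)
      then show ?thesis using y(2) that S[of i] by auto
    qed
    moreover have "(\<Sum>k\<in>K. c r k * x k) = 0" unfolding S by simp
    moreover have "\<exists>k\<in>K. x k \<noteq> 0" using y(1) k0 by (auto simp: x_def)
    ultimately show ?thesis by (intro exI[of _ x]) auto
  qed
qed

text \<open>Up to powers of \<open>L\<close>, the functions on Z in the module spanned over the
  polynomials by the n^2 products of powers of u and v below n. Working with functions on Z permits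
  roots u and v that are selected pointwise.\<close>

definition alg_span :: "real set \<Rightarrow> real poly \<Rightarrow> nat \<Rightarrow> (real \<Rightarrow> real) \<Rightarrow> (real \<Rightarrow> real) \<Rightarrow> (real \<Rightarrow> real) \<Rightarrow> bool" where
  "alg_span Z L n u v g \<longleftrightarrow> (\<exists>N r. \<forall>z\<in>Z. poly L z ^ N * g z = (\<Sum>a<n. \<Sum>b<n. poly (r a b) z * u z ^ a * v z ^ b))"

lemma alg_span_commute: "alg_span Z L n u v g \<Longrightarrow> alg_span Z L n v u g"
  unfolding alg_span_def
proof (elim exE)
  fix N r assume "\<forall>z\<in>Z. poly L z ^ N * g z = (\<Sum>a<n. \<Sum>b<n. poly (r a b) z * u z ^ a * v z ^ b)"
  then have "\<forall>z\<in>Z. poly L z ^ N * g z = (\<Sum>b<n. \<Sum>a<n. poly (r a b) z * v z ^ b * u z ^ a)"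
    by (subst sum.swap) (simp add: mult_ac)
  then show "\<exists>N r. \<forall>z\<in>Z. poly L z ^ N * g z = (\<Sum>a<n. \<Sum>b<n. poly (r a b) z * v z ^ a * u z ^ b)"
    by (intro exI[of _ N] exI[of _ "\<lambda>a b. r b a"])
qed

lemma alg_span_1: "n \<ge> 1 \<Longrightarrow> alg_span Z L n u v (\<lambda>_. 1)"
  unfolding alg_span_def
proof (intro exI[of _ 0] exI[of _ "\<lambda>a b. if a = 0 \<and> b = 0 then 1 else 0"] ballI)
  fix z assume n: "n \<ge> 1"
  have "(\<Sum>a<n. \<Sum>b<n. poly (if a = 0 \<and> b = 0 then 1 else 0) z * u z ^ a * v z ^ b)
    = (\<Sum>a<n. if a = 0 then \<Sum>b<n. if b = 0 then 1 else 0 else 0)"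
  proof (intro sum.cong refl)
    fix a
    have "poly (if a = 0 \<and> b = 0 then 1 else 0) z * u z ^ a * v z ^ b = (if a = 0 then if b = 0 then 1 else 0 else 0)" for b
      by auto
    then show "(\<Sum>b<n. poly (if a = 0 \<and> b = 0 then 1 else 0) z * u z ^ a * v z ^ b) = (if a = 0 then \<Sum>b<n. if b = 0 then 1 else 0 else 0)"
      by simp
  qed
  also have "\<dots> = 1" using n by (simp add: sum.delta)
  finally show "poly L z ^ 0 * 1 = (\<Sum>a<n. \<Sum>b<n. poly (if a = 0 \<and> b = 0 then 1 else 0) z * u z ^ a * v z ^ b)" by simp
qed

lemma alg_span_add:
  assumes "alg_span Z L n u v g" "alg_span Z L n u v h"
  shows "alg_span Z L n u v (\<lambda>z. g z + h z)"
proof -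
  obtain N1 r1 N2 r2 where *: "\<And>z. z \<in> Z \<Longrightarrow> poly L z ^ N1 * g z = (\<Sum>a<n. \<Sum>b<n. poly (r1 a b) z * u z ^ a * v z ^ b)"
     "\<And>z. z \<in> Z \<Longrightarrow> poly L z ^ N2 * h z = (\<Sum>a<n. \<Sum>b<n. poly (r2 a b) z * u z ^ a * v z ^ b)"
    using assms unfolding alg_span_def by blast
  show ?thesis unfolding alg_span_def
  proof (intro exI[of _ "N1 + N2"] exI[of _ "\<lambda>a b. L ^ N2 * r1 a b + L ^ N1 * r2 a b"] ballI)
    fix z assume z: "z \<in> Z"
    have "poly L z ^ (N1 + N2) * (g z + h z) = poly L z ^ N2 * (poly L z ^ N1 * g z) + poly L z ^ N1 * (poly L z ^ N2 * h z)"
      by (simp add: power_add algebra_simps)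
    also have "\<dots> = (\<Sum>a<n. \<Sum>b<n. poly (L ^ N2 * r1 a b + L ^ N1 * r2 a b) z * u z ^ a * v z ^ b)"
      unfolding *[OF z] sum_distrib_left sum.distrib[symmetric] by (intro sum.cong refl) (simp add: algebra_simps)
    finally show "poly L z ^ (N1 + N2) * (g z + h z) = (\<Sum>a<n. \<Sum>b<n. poly (L ^ N2 * r1 a b + L ^ N1 * r2 a b) z * u z ^ a * v z ^ b)" .
  qed
qed

lemma alg_span_poly_mult:
  assumes "alg_span Z L n u v g" shows "alg_span Z L n u v (\<lambda>z. poly c z * g z)"
proof -
  obtain N r where *: "\<And>z. z \<in> Z \<Longrightarrow> poly L z ^ N * g z = (\<Sum>a<n. \<Sum>b<n. poly (r a b) z * u z ^ a * v z ^ b)"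
    using assms unfolding alg_span_def by blast
  have "poly L z ^ N * (poly c z * g z) = (\<Sum>a<n. \<Sum>b<n. poly (c * r a b) z * u z ^ a * v z ^ b)" if "z \<in> Z" for z
  proof -
    have "poly L z ^ N * (poly c z * g z) = poly c z * (poly L z ^ N * g z)" by simp
    also have "\<dots> = (\<Sum>a<n. \<Sum>b<n. poly (c * r a b) z * u z ^ a * v z ^ b)"
      unfolding *[OF that] sum_distrib_left by (intro sum.cong refl) simp
    finally show ?thesis .
  qed
  then show ?thesis unfolding alg_span_def by (intro exI[of _ N] exI[of _ "\<lambda>a b. c * r a b"]) blast
qed

text \<open>The equation of u reduces its n-th power to lower ones, at the cost of one factor k n.\<close>

lemma alg_span_mult_root:
  assumes g: "alg_span Z (k n) n u v g" and n: "n \<ge> 1"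
    and root: "\<And>z. z \<in> Z \<Longrightarrow> (\<Sum>q\<le>n. poly (k q) z * u z ^ q) = 0"
  shows "alg_span Z (k n) n u v (\<lambda>z. u z * g z)"
proof -
  obtain N r where *: "\<And>z. z \<in> Z \<Longrightarrow> poly (k n) z ^ N * g z = (\<Sum>a<n. \<Sum>b<n. poly (r a b) z * u z ^ a * v z ^ b)"
    using g unfolding alg_span_def by blast
  obtain m where m: "n = Suc m" using n by (cases n) auto
  define r' where "r' = (\<lambda>a b. (if a > 0 then k n * r (a - 1) b else 0) - r m b * k a)"
  have "poly (k n) z ^ Suc N * (u z * g z) = (\<Sum>a<n. \<Sum>b<n. poly (r' a b) z * u z ^ a * v z ^ b)" if z: "z \<in> Z" for z
  proof -
    have red: "poly (k n) z * u z ^ n = - (\<Sum>q<n. poly (k q) z * u z ^ q)"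
      using root[OF z] by (simp add: lessThan_Suc_atMost[symmetric] add_eq_0_iff)
    have inner: "poly (k n) z * (\<Sum>a<n. poly (r a b) z * u z ^ Suc a) = (\<Sum>a<n. poly (r' a b) z * u z ^ a)" for b
    proof -
      have "(\<Sum>a<n. poly (r a b) z * u z ^ Suc a) = (\<Sum>a<m. poly (r a b) z * u z ^ Suc a) + poly (r m b) z * u z ^ n"
        by (simp add: m)
      then have "poly (k n) z * (\<Sum>a<n. poly (r a b) z * u z ^ Suc a) =
          (\<Sum>a<m. poly (k n * r a b) z * u z ^ Suc a) + poly (r m b) z * (poly (k n) z * u z ^ n)"
        by (simp add: distrib_left sum_distrib_left mult_ac)
      also have "\<dots> = (\<Sum>a<m. poly (k n * r a b) z * u z ^ Suc a) - (\<Sum>a<n. poly (r m b * k a) z * u z ^ a)"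
        unfolding red by (simp add: sum_distrib_left mult_ac)
      also have "(\<Sum>a<m. poly (k n * r a b) z * u z ^ Suc a) = (\<Sum>a<n. poly (if a > 0 then k n * r (a - 1) b else 0) z * u z ^ a)"
        unfolding m by (subst sum.lessThan_Suc_shift) simp
      finally show ?thesis unfolding r'_def by (simp add: sum_subtractf left_diff_distrib)
    qed
    have "poly (k n) z ^ Suc N * (u z * g z) = poly (k n) z * u z * (poly (k n) z ^ N * g z)" by simp
    also have "\<dots> = poly (k n) z * (\<Sum>b<n. \<Sum>a<n. poly (r a b) z * u z ^ Suc a * v z ^ b)"
      unfolding *[OF z] by (subst sum.swap) (simp add: sum_distrib_left mult_ac)
    also have "\<dots> = (\<Sum>b<n. (poly (k n) z * (\<Sum>a<n. poly (r a b) z * u z ^ Suc a)) * v z ^ b)"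
      by (simp add: sum_distrib_left sum_distrib_right mult_ac)
    also have "\<dots> = (\<Sum>b<n. \<Sum>a<n. poly (r' a b) z * u z ^ a * v z ^ b)"
      unfolding inner by (simp add: sum_distrib_right)
    also have "\<dots> = (\<Sum>a<n. \<Sum>b<n. poly (r' a b) z * u z ^ a * v z ^ b)" by (rule sum.swap)
    finally show ?thesis .
  qed
  then show ?thesis unfolding alg_span_def by blast
qed

inductive gen_ring :: "(real \<Rightarrow> real) \<Rightarrow> (real \<Rightarrow> real) \<Rightarrow> (real \<Rightarrow> real) \<Rightarrow> bool" for u v where
  gen_poly: "gen_ring u v (\<lambda>z. poly c z)"
| gen_fst: "gen_ring u v u"
| gen_snd: "gen_ring u v v"
| gen_add: "gen_ring u v g \<Longrightarrow> gen_ring u v h \<Longrightarrow> gen_ring u v (\<lambda>z. g z + h z)"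
| gen_mult: "gen_ring u v g \<Longrightarrow> gen_ring u v h \<Longrightarrow> gen_ring u v (\<lambda>z. g z * h z)"

lemma gen_const: "gen_ring u v (\<lambda>z. c)"
  using gen_poly[of u v "[:c:]"] by simp

lemma gen_monom: "gen_ring u v (\<lambda>z. c * z ^ n)"
  using gen_poly[of u v "monom c n"] by (simp add: poly_monom)

lemma gen_diff: "gen_ring u v g \<Longrightarrow> gen_ring u v h \<Longrightarrow> gen_ring u v (\<lambda>z. g z - h z)"
  using gen_add[of u v g "\<lambda>z. (-1) * h z"] gen_mult[OF gen_const[of u v "-1"], of h] by simp

lemma gen_power: "gen_ring u v g \<Longrightarrow> gen_ring u v (\<lambda>z. g z ^ n)"
  by (induction n) (auto intro: gen_mult gen_const)

lemma gen_sum: "(\<And>i. i \<in> A \<Longrightarrow> gen_ring u v (g i)) \<Longrightarrow> gen_ring u v (\<lambda>z. \<Sum>i\<in>A. g i z)"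
  by (induction A rule: infinite_finite_induct) (auto intro: gen_add gen_const)

lemma gen_if: "gen_ring u v g \<Longrightarrow> gen_ring u v (\<lambda>z. if P then g z else 0)"
  by (cases P) (auto intro: gen_const)

lemma gen_ring_mult_alg_span:
  assumes n: "n \<ge> 1"
    and root: "\<And>z. z \<in> Z \<Longrightarrow> (\<Sum>q\<le>n. poly (k q) z * u z ^ q) = 0" "\<And>z. z \<in> Z \<Longrightarrow> (\<Sum>q\<le>n. poly (k q) z * v z ^ q) = 0"
    and g: "gen_ring u v g" and h: "alg_span Z (k n) n u v h"
  shows "alg_span Z (k n) n u v (\<lambda>z. g z * h z)"
  using g h
proof (induction arbitrary: h)
  case (gen_poly c)
  then show ?case by (rule alg_span_poly_mult)
next
  case gen_fst
  then show ?case by (rule alg_span_mult_root[OF _ n root(1)])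
next
  case gen_snd
  then show ?case by (intro alg_span_commute[OF alg_span_mult_root[OF alg_span_commute n root(2)]])
next
  case (gen_add g1 g2)
  have "alg_span Z (k n) n u v (\<lambda>z. g1 z * h z + g2 z * h z)" by (intro alg_span_add gen_add)
  then show ?case by (simp add: distrib_right)
next
  case (gen_mult g1 g2)
  have "alg_span Z (k n) n u v (\<lambda>z. g1 z * (g2 z * h z))" by (intro gen_mult)
  then show ?case by (simp add: mult.assoc)
qed

text \<open>For f = g / h the N + 1 products g^j h^(N - j) lie, up to powers of the leading
  coefficient, in a module spanned by N = n^2 elements, so they satisfy a linear relation over the
  polynomials; dividing by h^N gives the equation of f.\<close>

lemma algebraic_relation:
  fixes f :: "real \<Rightarrow> real"
  assumes n: "n \<ge> 1"
    and root: "\<And>z. z \<in> Z \<Longrightarrow> (\<Sum>q\<le>n. poly (k q) z * u z ^ q) = 0" "\<And>z. z \<in> Z \<Longrightarrow> (\<Sum>q\<le>n. poly (k q) z * v z ^ q) = 0"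
    and g: "gen_ring u v g" and h: "gen_ring u v h"
    and f: "\<And>z. z \<in> Z \<Longrightarrow> f z * h z = g z" and h0: "\<And>z. z \<in> Z \<Longrightarrow> h z \<noteq> 0"
  obtains N x where "\<exists>j\<le>N. x j \<noteq> (0 :: real poly)"
    "\<And>z. z \<in> Z \<Longrightarrow> poly (k n) z \<noteq> 0 \<Longrightarrow> (\<Sum>j\<le>N. poly (x j) z * f z ^ j) = 0"
proof -
  define N where "N = n * n"
  define G where "G = (\<lambda>j z. g z ^ j * h z ^ (N - j))"
  have span: "alg_span Z (k n) n u v (G j)" for j
  proof -
    have "gen_ring u v (G j)" unfolding G_def by (intro gen_mult gen_power g h)
    from gen_ring_mult_alg_span[OF n root this alg_span_1[OF n]] show ?thesis by simp
  qed
  have "\<forall>j. \<exists>Mr. \<forall>z\<in>Z. poly (k n) z ^ fst Mr * G j z = (\<Sum>a<n. \<Sum>b<n. poly (snd Mr a b) z * u z ^ a * v z ^ b)"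
  proof
    fix j
    obtain M r where "\<forall>z\<in>Z. poly (k n) z ^ M * G j z = (\<Sum>a<n. \<Sum>b<n. poly (r a b) z * u z ^ a * v z ^ b)"
      using span[of j] unfolding alg_span_def by blast
    then show "\<exists>Mr. \<forall>z\<in>Z. poly (k n) z ^ fst Mr * G j z = (\<Sum>a<n. \<Sum>b<n. poly (snd Mr a b) z * u z ^ a * v z ^ b)"
      by (intro exI[of _ "(M, r)"]) simp
  qed
  from choice[OF this] obtain Mr where
    Mr0: "\<forall>j. \<forall>z\<in>Z. poly (k n) z ^ fst (Mr j) * G j z = (\<Sum>a<n. \<Sum>b<n. poly (snd (Mr j) a b) z * u z ^ a * v z ^ b)" by blast
  define M where "M = (\<lambda>j. fst (Mr j))"
  define r where "r = (\<lambda>j. snd (Mr j))"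
  have Mr: "poly (k n) z ^ M j * G j z = (\<Sum>a<n. \<Sum>b<n. poly (r j a b) z * u z ^ a * v z ^ b)" if "z \<in> Z" for j z
    using Mr0 that by (simp add: M_def r_def)
  \<comment> \<open>A common exponent: the powers \<open>M j\<close> of the leading coefficient
    differ with j and are brought to the same value before elimination.\<close>
  define E where "E = (\<Sum>j\<le>N. M j)"
  have ME: "M j \<le> E" if "j \<le> N" for j unfolding E_def using that by (intro member_le_sum) auto
  have "card ({..<n} \<times> {..<n}) < card {..N}" by (simp add: N_def)
  then obtain x where x: "\<exists>j\<in>{..N}. x j \<noteq> 0"
     "\<forall>i\<in>{..<n} \<times> {..<n}. (\<Sum>j\<le>N. (k n ^ (E - M j) * r j (fst i) (snd i)) * x j) = 0"
    using homogeneous_linear_system[of "{..<n} \<times> {..<n}" "{..N}" "\<lambda>i j. k n ^ (E - M j) * r j (fst i) (snd i)"] by auto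
  show ?thesis
  proof (rule that[of N x])
    show "\<exists>j\<le>N. x j \<noteq> 0" using x(1) by auto
    fix z assume z: "z \<in> Z" "poly (k n) z \<noteq> 0"
    have "poly (k n) z ^ E * (\<Sum>j\<le>N. poly (x j) z * G j z)
       = (\<Sum>j\<le>N. poly (x j) z * poly (k n) z ^ (E - M j) * (poly (k n) z ^ M j * G j z))"
      unfolding sum_distrib_left
    proof (intro sum.cong refl)
      fix j assume "j \<in> {..N}"
      then have "poly (k n) z ^ E = poly (k n) z ^ (E - M j) * poly (k n) z ^ M j" using ME[of j] by (simp add: power_add[symmetric])
      then show "poly (k n) z ^ E * (poly (x j) z * G j z) = poly (x j) z * poly (k n) z ^ (E - M j) * (poly (k n) z ^ M j * G j z)" by simp
    qed
    also have "\<dots> = (\<Sum>j\<le>N. \<Sum>a<n. \<Sum>b<n. poly (k n ^ (E - M j) * r j a b * x j) z * (u z ^ a * v z ^ b))"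
      unfolding Mr[OF z(1)] sum_distrib_left by (intro sum.cong refl) (simp add: mult_ac)
    also have "\<dots> = (\<Sum>a<n. \<Sum>j\<le>N. \<Sum>b<n. poly (k n ^ (E - M j) * r j a b * x j) z * (u z ^ a * v z ^ b))" by (rule sum.swap)
    also have "\<dots> = (\<Sum>a<n. \<Sum>b<n. \<Sum>j\<le>N. poly (k n ^ (E - M j) * r j a b * x j) z * (u z ^ a * v z ^ b))"
      by (intro sum.cong refl sum.swap)
    also have "\<dots> = (\<Sum>a<n. \<Sum>b<n. poly (\<Sum>j\<le>N. k n ^ (E - M j) * r j a b * x j) z * (u z ^ a * v z ^ b))"
      by (simp add: poly_sum sum_distrib_right)
    also have "\<dots> = 0" using x(2) by (intro sum.neutral ballI) (auto simp del: poly_mult)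
    finally have "(\<Sum>j\<le>N. poly (x j) z * G j z) = 0" using z(2) by simp
    moreover have "(\<Sum>j\<le>N. poly (x j) z * G j z) = h z ^ N * (\<Sum>j\<le>N. poly (x j) z * f z ^ j)"
      unfolding sum_distrib_left
    proof (intro sum.cong refl)
      fix j assume "j \<in> {..N}"
      then have "h z ^ N = h z ^ j * h z ^ (N - j)" by (simp add: power_add[symmetric])
      then show "poly (x j) z * G j z = h z ^ N * (poly (x j) z * f z ^ j)"
        by (simp add: G_def f[OF z(1), symmetric] power_mult_distrib mult_ac)
    qed
    ultimately show "(\<Sum>j\<le>N. poly (x j) z * f z ^ j) = 0" using h0[OF z(1)] by simp
  qed
qed

section \<open>Small real roots of the kernel and the algebraic equation of the boundary
  series\<close>

context critical_system
begin

text \<open>Signs and the intermediate value theorem: the kernel is positive at 1 and -1,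
  nonpositive at 0 and negative at some point q between 0 and 1.\<close>

lemma small_roots:
  assumes z: "0 < z" "z < (1::real)"
  shows "\<exists>u. 0 < u \<and> u < 1 \<and> kern z u = 0" "\<exists>u. -1 < u \<and> u \<le> 0 \<and> kern z u = 0"
proof -
  have pz: "(\<Sum>i\<in>I. p i * z ^ dz i) < 1"
  proof -
    have "norm (\<Sum>i\<in>I. of_real (p i) * z ^ dz i * 1) \<le> norm z * 1"
      by (rule norm_step_sum_le) (use z in auto)
    then show ?thesis using z by simp
  qed
  have ct: "continuous_on A (\<lambda>u. kern z u)" for A unfolding kern_def by (intro continuous_intros)
  have k1: "kern z 1 > 0" using pz by (simp add: kern_def)
  have km1: "kern z (-1) > 0"
  proof -
    have "(\<Sum>i\<in>I. p i * z ^ dz i * (-1) ^ ex i) \<le> (\<Sum>i\<in>I. p i * z ^ dz i)"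
    proof (rule sum_mono)
      fix i assume i: "i \<in> I"
      have "0 \<le> p i * z ^ dz i" using p_pos[OF i] z by simp
      then show "p i * z ^ dz i * (-1) ^ ex i \<le> p i * z ^ dz i" by (cases "even (ex i)") auto
    qed
    then show ?thesis using pz by (simp add: kern_def)
  qed
  have nn: "p i * z ^ dz i * u ^ ex i \<ge> 0" if "i \<in> I" "u \<ge> 0" for i u using p_pos[OF that(1)] z that by simp
  obtain i where i: "i \<in> I" "up i < dn i" using descend by blast
  have ei: "ex i \<le> 1" using i by (simp add: ex_def)
  \<comment> \<open>At this point one descending step, whose exponent \<open>ex i\<close> is at most
    1, already contributes at least 2 q^2, more than the term u^2.\<close>
  define q where "q = p i * z ^ dz i / 2"
  have q: "0 < q" "q < 1"
  proof -
    show "0 < q" using p_pos[OF i(1)] z by (simp add: q_def)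
    have "p i * z ^ dz i \<le> (\<Sum>i\<in>I. p i * z ^ dz i)"
      using nn[of _ 1] by (intro member_le_sum[OF i(1) _ fin]) auto
    then show "q < 1" using pz by (simp add: q_def)
  qed
  have "kern z q < 0"
  proof -
    have "2 * q * q \<le> p i * z ^ dz i * q ^ ex i"
    proof -
      have "q ^ 1 \<le> q ^ ex i" using q ei by (intro power_decreasing) auto
      then have "2 * q * q ^ 1 \<le> 2 * q * q ^ ex i" using q by (intro mult_left_mono) auto
      moreover have "2 * q = p i * z ^ dz i" by (simp add: q_def)
      ultimately show ?thesis by simp
    qed
    also have "\<dots> \<le> (\<Sum>i\<in>I. p i * z ^ dz i * q ^ ex i)" using nn q by (intro member_le_sum[OF i(1) _ fin]) auto
    finally have le: "2 * q * q \<le> (\<Sum>i\<in>I. p i * z ^ dz i * q ^ ex i)" .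
    have "q * q > 0" using q by simp
    then have "q * q < 2 * q * q" by simp
    with le have "q * q < (\<Sum>i\<in>I. p i * z ^ dz i * q ^ ex i)" by (rule order_less_le_trans[rotated])
    then show ?thesis unfolding kern_def power2_eq_square by simp
  qed
  then have "\<exists>u\<ge>q. u \<le> 1 \<and> kern z u = 0" by (intro IVT' ct) (use k1 q in auto)
  then obtain u where u: "q \<le> u" "u \<le> 1" "kern z u = 0" by blast
  then have "u \<noteq> 1" using k1 by auto
  then show "\<exists>u. 0 < u \<and> u < 1 \<and> kern z u = 0" using u q by (intro exI[of _ u]) auto
  have "kern z 0 \<le> 0" unfolding kern_def using nn[of _ 0] by (simp add: sum_nonneg)
  then have "\<exists>v\<ge>-1. v \<le> 0 \<and> kern z v = 0" by (intro IVT2' ct) (use km1 in auto)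
  then obtain v where v: "-1 \<le> v" "v \<le> 0" "kern z v = 0" by blast
  then have "v \<noteq> -1" using km1 by auto
  then show "\<exists>u. -1 < u \<and> u \<le> 0 \<and> kern z u = 0" using v by (intro exI[of _ v]) auto
qed

definition root1 where "root1 z = (SOME u. 0 < u \<and> u < 1 \<and> kern z u = (0::real))"
definition root2 where "root2 z = (SOME u. -1 < u \<and> u \<le> 0 \<and> kern z u = (0::real))"

lemma root1: "0 < z \<Longrightarrow> z < 1 \<Longrightarrow> 0 < root1 z \<and> root1 z < 1 \<and> kern z (root1 z) = 0"
  unfolding root1_def by (rule someI_ex, rule small_roots(1))

lemma root2: "0 < z \<Longrightarrow> z < 1 \<Longrightarrow> -1 < root2 z \<and> root2 z \<le> 0 \<and> kern z (root2 z) = 0"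
  unfolding root2_def by (rule someI_ex, rule small_roots(2))

lemma root_equation:
  assumes z: "0 < z" "z < (1::real)" and u: "\<bar>u\<bar> \<le> 1" "kern z u = 0"
  shows "gf 0 z * b0 z u + gf 1 z * b1 z u = (\<Sum>l\<le>S. srcgf z l * u ^ l)"
proof -
  have nz: "norm z < 1" using z by simp
  have "summable (\<lambda>l. norm (gf l z * u ^ l))"
  proof (rule summable_comparison_test'[OF summable_norm_gf_index[OF nz], of 0])
    fix n :: nat
    have "\<bar>u\<bar> ^ n \<le> 1" using u(1) by (intro power_le_one) auto
    then show "norm (norm (gf n z * u ^ n)) \<le> norm (gf n z)"
      by (simp add: abs_mult power_abs mult_left_le)
  qed
  from kernel_equation[OF gf_sol[OF nz] srcgf_zero this] u(2) show ?thesis by (simp add: algebra_simps)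
qed

definition rdet where "rdet z = b0 z (root1 z) * b1 z (root2 z) - b0 z (root2 z) * b1 z (root1 z)"

text \<open>The determinant is v - u times a factor near 1, plus terms containing the differences of
  \<beta> and \<gamma> at the two roots, which are at most z C |u - v|. Thus |u - v| factors out of
  all estimates, and the bound on z makes 2 z + 3 z C less than 1.\<close>

lemma rdet_nonzero:
  assumes z: "0 < z" "z < 1 / (4 * (1 + (\<Sum>i\<in>I. p i * real (up i))))"
  shows "rdet z \<noteq> 0"
proof -
  define C where "C = (\<Sum>i\<in>I. p i * real (up i))"
  have C: "C \<ge> 0" unfolding C_def using less_imp_le[OF p_pos] by (intro sum_nonneg mult_nonneg_nonneg) auto
  have zC: "z * (4 * (1 + C)) < 1" using z C by (simp add: C_def pos_less_divide_eq)
  have z1: "z < 1"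
  proof -
    have "z * 1 \<le> z * (4 * (1 + C))" using z C by (intro mult_left_mono) auto
    then show ?thesis using zC by simp
  qed
  define u where "u = root1 z" define v where "v = root2 z"
  have uv: "0 < u" "u < 1" "-1 < v" "v \<le> 0" using root1[OF z(1) z1] root2[OF z(1) z1] by (auto simp: u_def v_def)
  define \<gamma> where "\<gamma> = (\<lambda>w. \<Sum>i\<in>I. if dn i = 1 then p i * z ^ dz i * w ^ up i else 0)"
  define \<beta> where "\<beta> = (\<lambda>w. \<Sum>i\<in>I. if dn i = 0 then p i * z ^ dz i * w ^ up i else 0)"
  have b: "b0 z w = 1 - \<beta> w" "b1 z w = w * (1 - \<beta> w) - \<gamma> w" for w
  proof -
    show "b0 z w = 1 - \<beta> w" by (simp add: b0_def \<beta>_def cong: if_cong)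
    have "w * \<beta> w = (\<Sum>i\<in>I. if dn i = 0 then p i * z ^ dz i * w ^ (up i + 1) else 0)"
      unfolding \<beta>_def sum_distrib_left by (intro sum.cong) auto
    then show "b1 z w = w * (1 - \<beta> w) - \<gamma> w" by (simp add: b1_def \<gamma>_def algebra_simps cong: if_cong)
  qed
  have zd: "z ^ dz i \<le> z" if "i \<in> I" for i
    using power_decreasing[of 1 "dz i" z] dz_pos[OF that] z z1 by simp
  have bnd: "\<bar>\<Sum>i\<in>I. if P i then p i * z ^ dz i * w ^ up i else 0\<bar> \<le> z" if "\<bar>w\<bar> \<le> 1" for P w
  proof -
    have "\<bar>\<Sum>i\<in>I. if P i then p i * z ^ dz i * w ^ up i else 0\<bar> \<le> (\<Sum>i\<in>I. p i * z)"
    proof (rule order_trans[OF sum_abs sum_mono])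
      fix i assume i: "i \<in> I"
      have "\<bar>w\<bar> ^ up i \<le> 1" using that by (intro power_le_one) auto
      then have "p i * z ^ dz i * \<bar>w\<bar> ^ up i \<le> p i * z * 1"
        using p_pos[OF i] zd[OF i] z by (intro mult_mono) auto
      then show "\<bar>if P i then p i * z ^ dz i * w ^ up i else 0\<bar> \<le> p i * z"
        using p_pos[OF i] z by (auto simp: abs_mult power_abs)
    qed
    then show ?thesis using total by (simp add: sum_distrib_right[symmetric])
  qed
  have pl: "\<bar>u ^ m - v ^ m\<bar> \<le> real m * \<bar>u - v\<bar>" for m
    using norm_power_diff[of u v m] uv by simp
  have lip: "\<bar>(\<Sum>i\<in>I. if P i then p i * z ^ dz i * u ^ up i else 0) - (\<Sum>i\<in>I. if P i then p i * z ^ dz i * v ^ up i else 0)\<bar> \<le> z * C * \<bar>u - v\<bar>" for P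
  proof -
    have "\<bar>\<Sum>i\<in>I. (if P i then p i * z ^ dz i * u ^ up i else 0) - (if P i then p i * z ^ dz i * v ^ up i else 0)\<bar>
       \<le> (\<Sum>i\<in>I. z * (p i * real (up i)) * \<bar>u - v\<bar>)"
    proof (rule order_trans[OF sum_abs sum_mono])
      fix i assume i: "i \<in> I"
      have "p i * z ^ dz i * \<bar>u ^ up i - v ^ up i\<bar> \<le> p i * z * (real (up i) * \<bar>u - v\<bar>)"
        using p_pos[OF i] zd[OF i] z pl by (intro mult_mono) auto
      then have *: "\<bar>p i * z ^ dz i * (u ^ up i - v ^ up i)\<bar> \<le> z * (p i * real (up i)) * \<bar>u - v\<bar>"
        using p_pos[OF i] z by (simp add: abs_mult mult_ac)
      have "0 \<le> z * (p i * real (up i)) * \<bar>u - v\<bar>" using p_pos[OF i] z by simp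
      with * show "\<bar>(if P i then p i * z ^ dz i * u ^ up i else 0) - (if P i then p i * z ^ dz i * v ^ up i else 0)\<bar> \<le> z * (p i * real (up i)) * \<bar>u - v\<bar>"
        by (auto simp: right_diff_distrib)
    qed
    then show ?thesis by (simp add: sum_subtractf C_def sum_distrib_left sum_distrib_right)
  qed
  have uvab: "\<bar>u\<bar> \<le> 1" "\<bar>v\<bar> \<le> 1" using uv by auto
  have \<beta>b: "\<bar>\<beta> u\<bar> \<le> z" "\<bar>\<beta> v\<bar> \<le> z" "\<bar>\<gamma> u\<bar> \<le> z" using bnd uvab unfolding \<beta>_def \<gamma>_def by auto
  have \<beta>l: "\<bar>\<beta> u - \<beta> v\<bar> \<le> z * C * \<bar>u - v\<bar>" "\<bar>\<gamma> u - \<gamma> v\<bar> \<le> z * C * \<bar>u - v\<bar>"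
    unfolding \<beta>_def \<gamma>_def by (rule lip)+
  have D: "rdet z = (1 - \<beta> u) * (1 - \<beta> v) * (v - u) + ((1 - \<beta> u) * (\<gamma> u - \<gamma> v) + \<gamma> u * (\<beta> u - \<beta> v))"
    unfolding rdet_def b u_def[symmetric] v_def[symmetric] by (simp add: algebra_simps)
  have d0: "\<bar>u - v\<bar> > 0" using uv by simp
  have "\<bar>(1 - \<beta> u) * (\<gamma> u - \<gamma> v) + \<gamma> u * (\<beta> u - \<beta> v)\<bar> \<le> 2 * (z * C * \<bar>u - v\<bar>) + 1 * (z * C * \<bar>u - v\<bar>)"
  proof (intro order_trans[OF abs_triangle_ineq] add_mono)
    show "\<bar>(1 - \<beta> u) * (\<gamma> u - \<gamma> v)\<bar> \<le> 2 * (z * C * \<bar>u - v\<bar>)"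
      unfolding abs_mult using \<beta>b \<beta>l(2) z1 by (intro mult_mono) auto
    show "\<bar>\<gamma> u * (\<beta> u - \<beta> v)\<bar> \<le> 1 * (z * C * \<bar>u - v\<bar>)"
      unfolding abs_mult using \<beta>b \<beta>l(1) z1 by (intro mult_mono) auto
  qed
  also have "\<dots> = 3 * z * C * \<bar>u - v\<bar>" by simp
  finally have up_b: "\<bar>(1 - \<beta> u) * (\<gamma> u - \<gamma> v) + \<gamma> u * (\<beta> u - \<beta> v)\<bar> \<le> 3 * z * C * \<bar>u - v\<bar>" .
  have "(1 - z) * (1 - z) \<le> (1 - \<beta> u) * (1 - \<beta> v)" using \<beta>b z1 by (intro mult_mono) auto
  then have "(1 - 2 * z) \<le> (1 - \<beta> u) * (1 - \<beta> v)" using mult_pos_pos[OF z(1) z(1)] by (simp add: algebra_simps)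
  then have "(1 - 2 * z) \<le> \<bar>(1 - \<beta> u) * (1 - \<beta> v)\<bar>" by (rule order_trans[OF _ abs_ge_self])
  then have "(1 - 2 * z) * \<bar>u - v\<bar> \<le> \<bar>(1 - \<beta> u) * (1 - \<beta> v) * (v - u)\<bar>"
    unfolding abs_mult[of "(1 - \<beta> u) * (1 - \<beta> v)"] abs_minus_commute[of v u] by (intro mult_right_mono) auto
  moreover have "3 * z * C * \<bar>u - v\<bar> < (1 - 2 * z) * \<bar>u - v\<bar>"
  proof (rule mult_strict_right_mono[OF _ d0])
    have "z * C \<ge> 0" using z C by simp
    then show "3 * z * C < 1 - 2 * z" using zC z by (simp add: algebra_simps)
  qed
  ultimately show ?thesis unfolding D using up_b by linarith
qed

theorem gf_algebraic_relation:
  assumes l: "l < 2"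
  obtains N x \<epsilon> where "\<epsilon> > 0" "\<epsilon> \<le> 1" "\<exists>j\<le>N. x j \<noteq> (0 :: real poly)"
    "\<And>z. 0 < z \<Longrightarrow> z < \<epsilon> \<Longrightarrow> (\<Sum>j\<le>N. poly (x j) z * gf l z ^ j) = 0"
proof -
  define C where "C = (\<Sum>i\<in>I. p i * real (up i))"
  have C: "C \<ge> 0" unfolding C_def using less_imp_le[OF p_pos] by (intro sum_nonneg mult_nonneg_nonneg) auto
  define \<epsilon> where "\<epsilon> = 1 / (4 * (1 + C))"
  have \<epsilon>: "0 < \<epsilon>" "\<epsilon> \<le> 1" using C by (auto simp: \<epsilon>_def)
  define Z where "Z = {0<..<\<epsilon>}"
  define n where "n = Max (ex ` I)"
  \<comment> \<open>The coefficients of the kernel as a polynomial in u. Since an ascending step has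
    \<open>ex i > 2\<close>, the term u^2 does not enter the leading coefficient \<open>k n\<close>,
    whose value at 1 is therefore negative.\<close>
  define k where "k = (\<lambda>q. (if q = 2 then 1 else 0) - (\<Sum>i\<in>I. if ex i = q then monom (p i) (dz i) else 0))"
  obtain i0 where i0: "i0 \<in> I" "dn i0 < up i0" using ascend by blast
  have exn: "ex i \<le> n" if "i \<in> I" for i unfolding n_def using fin that by (intro Max_ge) auto
  have n3: "n \<ge> 3" using exn[OF i0(1)] i0 dn_le[OF i0(1)] by (simp add: ex_def)
  have kern_poly: "(\<Sum>q\<le>n. poly (k q) z * u ^ q) = kern z u" for z u
  proof -
    have "(\<Sum>q\<le>n. poly (k q) z * u ^ q) = (\<Sum>q\<le>n. (if q = 2 then u ^ q else 0)) - (\<Sum>q\<le>n. \<Sum>i\<in>I. if ex i = q then p i * z ^ dz i * u ^ q else 0)"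
      unfolding sum_subtractf[symmetric]
    proof (intro sum.cong refl)
      fix q
      have "poly (\<Sum>i\<in>I. if ex i = q then monom (p i) (dz i) else 0) z = (\<Sum>i\<in>I. if ex i = q then p i * z ^ dz i else 0)"
        unfolding poly_sum by (intro sum.cong) (auto simp: poly_monom)
      moreover have "(\<Sum>i\<in>I. if ex i = q then p i * z ^ dz i else 0) * u ^ q = (\<Sum>i\<in>I. if ex i = q then p i * z ^ dz i * u ^ q else 0)"
        unfolding sum_distrib_right by (intro sum.cong) auto
      ultimately show "poly (k q) z * u ^ q = (if q = 2 then u ^ q else 0) - (\<Sum>i\<in>I. if ex i = q then p i * z ^ dz i * u ^ q else 0)"
        by (simp add: k_def left_diff_distrib)
    qed
    also have "(\<Sum>q\<le>n. \<Sum>i\<in>I. if ex i = q then p i * z ^ dz i * u ^ q else 0) = (\<Sum>i\<in>I. \<Sum>q\<le>n. if ex i = q then p i * z ^ dz i * u ^ q else 0)"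
      by (rule sum.swap)
    also have "\<dots> = (\<Sum>i\<in>I. p i * z ^ dz i * u ^ ex i)"
      using exn by (intro sum.cong refl) (simp add: sum.delta')
    also have "(\<Sum>q\<le>n. (if q = 2 then u ^ q else 0)) = u ^ 2" using n3 by (simp add: sum.delta)
    finally show ?thesis by (simp add: kern_def)
  qed
  have kn: "k n \<noteq> 0"
  proof
    assume "k n = 0"
    then have "poly (k n) 1 = 0" by simp
    then have "(\<Sum>i\<in>I. if ex i = n then p i else 0) = 0"
      using n3 by (simp add: k_def poly_sum if_distrib[of "\<lambda>x. poly x 1"] poly_monom cong: if_cong)
    moreover have "n \<in> ex ` I" unfolding n_def using fin i0(1) by (intro Max_in) auto
    then obtain i where i: "i \<in> I" "ex i = n" by auto
    have "(\<Sum>i\<in>I. if ex i = n then p i else 0) > 0"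
      by (rule sum_pos2[OF fin i(1)]) (use i p_pos less_imp_le[OF p_pos] in auto)
    ultimately show False by simp
  qed
  define num where "num = (\<lambda>z. if l = 0 then (\<Sum>l\<le>S. srcgf z l * root1 z ^ l) * b1 z (root2 z) - (\<Sum>l\<le>S. srcgf z l * root2 z ^ l) * b1 z (root1 z)
      else b0 z (root1 z) * (\<Sum>l\<le>S. srcgf z l * root2 z ^ l) - b0 z (root2 z) * (\<Sum>l\<le>S. srcgf z l * root1 z ^ l))"
  note gens = gen_diff gen_add gen_sum gen_if gen_mult gen_power gen_const gen_monom gen_fst gen_snd
  have gb: "gen_ring root1 root2 (\<lambda>z. b0 z (w z))" "gen_ring root1 root2 (\<lambda>z. b1 z (w z))"
     "gen_ring root1 root2 (\<lambda>z. \<Sum>l\<le>S. srcgf z l * w z ^ l)" if "gen_ring root1 root2 w" for w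
    unfolding b0_def b1_def srcgf_def of_real_eq_id id_def by (intro gens that)+
  have g1: "gen_ring root1 root2 rdet" unfolding rdet_def[abs_def] by (intro gens gb)
  have g2: "gen_ring root1 root2 num"
  proof (cases "l = 0")
    case True show ?thesis unfolding num_def if_P[OF True] by (intro gens gb)
  next
    case False show ?thesis unfolding num_def if_not_P[OF False] by (intro gens gb)
  qed
  have g3: "gf l z * rdet z = num z" if z: "z \<in> Z" for z
  proof -
    have z': "0 < z" "z < 1" using z \<epsilon> by (auto simp: Z_def)
    have e1: "gf 0 z * b0 z (root1 z) + gf 1 z * b1 z (root1 z) = (\<Sum>l\<le>S. srcgf z l * root1 z ^ l)"
      using root1[OF z'] by (intro root_equation[OF z']) auto
    have e2: "gf 0 z * b0 z (root2 z) + gf 1 z * b1 z (root2 z) = (\<Sum>l\<le>S. srcgf z l * root2 z ^ l)"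
      using root2[OF z'] by (intro root_equation[OF z']) auto
    have "l = 0 \<or> l = 1" using l by auto
    then show ?thesis unfolding num_def rdet_def e1[symmetric] e2[symmetric] by (auto simp: algebra_simps)
  qed
  have g4: "rdet z \<noteq> 0" if "z \<in> Z" for z
    using that by (intro rdet_nonzero) (auto simp: Z_def \<epsilon>_def C_def)
  have g5: "(\<Sum>q\<le>n. poly (k q) z * root1 z ^ q) = 0" "(\<Sum>q\<le>n. poly (k q) z * root2 z ^ q) = 0" if "z \<in> Z" for z
    unfolding kern_poly using root1[of z] root2[of z] that \<epsilon> by (auto simp: Z_def)
  obtain N x where Nx: "\<exists>j\<le>N. x j \<noteq> (0 :: real poly)"
    "\<And>z. z \<in> Z \<Longrightarrow> poly (k n) z \<noteq> 0 \<Longrightarrow> (\<Sum>j\<le>N. poly (x j) z * gf l z ^ j) = 0"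
  proof (rule algebraic_relation[where n = n and Z = Z and k = k and u = root1 and v = root2 and g = num and h = rdet and f = "\<lambda>z. gf l z"])
    show "n \<ge> 1" using n3 by simp
  qed (use g1 g2 g3 g4 g5 in \<open>assumption | blast\<close>)+
  \<comment> \<open>The relation is available only where the leading coefficient does not vanish;
    its finitely many zeros are avoided by staying close to 0.\<close>
  obtain \<delta> where \<delta>: "\<delta> > 0" "\<And>z. 0 < z \<Longrightarrow> z < \<delta> \<Longrightarrow> poly (k n) z \<noteq> 0"
  proof -
    define P where "P = {z. poly (k n) z = 0} \<inter> {0<..}"
    have fP: "finite P" unfolding P_def using poly_roots_finite[OF kn] by simp
    show ?thesis
    proof (rule that[of "Min (insert 1 P)"])
      show "Min (insert 1 P) > 0" using fP by (auto simp: P_def)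
      show "poly (k n) z \<noteq> 0" if "0 < z" "z < Min (insert 1 P)" for z
        using that fP by (auto simp: P_def)
    qed
  qed
  show ?thesis
  proof (rule that[of "min \<epsilon> \<delta>" N x])
    show "(\<Sum>j\<le>N. poly (x j) z * gf l z ^ j) = 0" if "0 < z" "z < min \<epsilon> \<delta>" for z
      using that Nx(2)[of z] \<delta>(2)[of z] by (auto simp: Z_def)
  qed (use \<epsilon> \<delta> Nx in auto)
qed

end

section \<open>Transfer of square root singularities\<close>

text \<open>As 1 / n^2 \<le> 1 / (n - 1) - 1 / n, the sequence x n - C / (n - 1) increases and x n +
  C / (n - 1) decreases, and both tend to L.\<close>

lemma real_sequence_rate:
  fixes x :: "nat \<Rightarrow> real"
  assumes "x \<longlonglongrightarrow> L" "C \<ge> 0" "\<And>n. n \<ge> N \<Longrightarrow> \<bar>x (Suc n) - x n\<bar> \<le> C / (real n)\<^sup>2" "N \<ge> 2" "n \<ge> N"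
  shows "\<bar>x n - L\<bar> \<le> C / (real n - 1)"
proof -
  have tel: "C / (real m)\<^sup>2 \<le> C / (real m - 1) - C / real m" if "m \<ge> 2" for m
  proof -
    have "1 / (real m)\<^sup>2 \<le> 1 / (real m - 1) - 1 / real m"
      using that by (simp add: field_simps power2_eq_square)
    from mult_left_mono[OF this assms(2)] show ?thesis by (simp add: right_diff_distrib)
  qed
  have c0: "(\<lambda>m. C / (real m - 1)) \<longlonglongrightarrow> 0" by real_asymp
  have "x n - C / (real n - 1) \<le> L"
  proof (rule incseq_le[of "\<lambda>k. x (k + n) - C / (real (k + n) - 1)" L 0, simplified])
    show "incseq (\<lambda>k. x (k + n) - C / (real k + real n - 1))"
    proof (rule incseq_SucI)
      fix k
      have "- (C / (real (k + n))\<^sup>2) \<le> x (Suc (k + n)) - x (k + n)" using assms(3)[of "k + n"] assms(5) by (simp add: abs_le_iff)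
      then show "x (k + n) - C / (real k + real n - 1) \<le> x (Suc k + n) - C / (real (Suc k) + real n - 1)"
        using tel[of "k + n"] assms(4,5) by simp
    qed
    have "(\<lambda>k. x (k + n) - C / (real (k + n) - 1)) \<longlonglongrightarrow> L - 0"
      using LIMSEQ_ignore_initial_segment[OF tendsto_diff[OF assms(1) c0], of n] by simp
    then show "(\<lambda>k. x (k + n) - C / (real k + real n - 1)) \<longlonglongrightarrow> L" by simp
  qed
  moreover have "L \<le> x n + C / (real n - 1)"
  proof (rule decseq_ge[of "\<lambda>k. x (k + n) + C / (real (k + n) - 1)" L 0, simplified])
    show "decseq (\<lambda>k. x (k + n) + C / (real k + real n - 1))"
    proof (rule decseq_SucI)
      fix k
      have "x (Suc (k + n)) - x (k + n) \<le> C / (real (k + n))\<^sup>2" using assms(3)[of "k + n"] assms(5) by (simp add: abs_le_iff)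
      then show "x (Suc k + n) + C / (real (Suc k) + real n - 1) \<le> x (k + n) + C / (real k + real n - 1)"
        using tel[of "k + n"] assms(4,5) by simp
    qed
    have "(\<lambda>k. x (k + n) + C / (real (k + n) - 1)) \<longlonglongrightarrow> L + 0"
      using LIMSEQ_ignore_initial_segment[OF tendsto_add[OF assms(1) c0], of n] by simp
    then show "(\<lambda>k. x (k + n) + C / (real k + real n - 1)) \<longlonglongrightarrow> L" by simp
  qed
  ultimately show ?thesis by (simp add: abs_le_iff)
qed

lemma gbinomial_bigo:
  fixes a :: real
  shows "(\<lambda>n. a gchoose n) \<in> O(\<lambda>n. real n powr (- a - 1))"
proof -
  let ?g = "\<lambda>n. (a gchoose n) / ((-1)^n / exp ((a+1) * of_real (ln (real n))))"
  have "?g \<longlonglongrightarrow> inverse (Gamma (- a))" by (rule gbinomial_asymptotic)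
  then have "?g \<in> O(\<lambda>_. 1)" by (intro bigoI_tendsto[where c = "inverse (Gamma (- a))"]) auto
  then have "(\<lambda>n. ?g n * ((-1)^n * real n powr (- a - 1))) \<in> O(\<lambda>n. 1 * ((-1)^n * real n powr (- a - 1)))"
    by (intro landau_o.big.mult) auto
  also have "(\<lambda>n. 1 * ((-1)^n * real n powr (- a - 1))) \<in> O(\<lambda>n. real n powr (- a - 1))"
    by (intro bigoI[of _ 1]) (auto simp: abs_mult)
  finally have 1: "(\<lambda>n. ?g n * ((-1)^n * real n powr (- a - 1))) \<in> O(\<lambda>n. real n powr (- a - 1))" .
  have "\<forall>\<^sub>F n in at_top. ?g n * ((-1)^n * real n powr (- a - 1)) = (a gchoose n)"
    using eventually_gt_at_top[of 0]
  proof eventually_elim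
    case (elim n)
    have "real n powr (- a - 1) = 1 / exp ((a + 1) * ln (real n))"
      using elim by (simp add: powr_def exp_minus[symmetric] inverse_eq_divide[symmetric] algebra_simps)
    moreover have "((-1::real) ^ n) * (-1) ^ n = 1" by (simp add: power_mult_distrib[symmetric])
    ultimately show ?case by (simp add: field_simps)
  qed
  from landau_o.big.in_cong[OF this] 1 show ?thesis by simp
qed

text \<open>The coefficient of z^n in (1 - z)^(1/2).\<close>

definition sqrt_coeff :: "nat \<Rightarrow> real" where
  "sqrt_coeff n = (-1) ^ n * ((1/2) gchoose n)"

lemma sqrt_coeff_limit: "(\<lambda>n. sqrt_coeff n * real n powr (3/2)) \<longlonglongrightarrow> - 1 / (2 * sqrt pi)"
proof -
  have "Gamma (- (1/2) :: real) = - 2 * sqrt pi"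
  proof -
    have "Gamma (- (1/2) + 1 :: real) = - (1/2) * Gamma (- (1/2))"
    proof (rule Gamma_plus1, rule notI)
      assume "- (1/2) \<in> (\<int>\<^sub>\<le>\<^sub>0 :: real set)"
      then obtain n where "- (1/2) = real_of_int n" by (auto elim!: nonpos_Ints_cases)
      then have "real_of_int (2 * n + 1) = 0" by simp
      then have "2 * n + 1 = 0" by (simp only: of_int_eq_0_iff)
      then show False by presburger
    qed
    then show ?thesis using Gamma_one_half_real by simp
  qed
  then have "(\<lambda>n. ((1/2) gchoose n) / ((-1)^n / exp ((1/2+1) * of_real (ln (real n))))) \<longlonglongrightarrow> (- 1 / (2 * sqrt pi) :: real)"
    using gbinomial_asymptotic[of "1/2 :: real"] by (simp add: inverse_eq_divide)
  then show ?thesis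
  proof (rule Lim_transform_eventually)
    show "\<forall>\<^sub>F n in at_top. ((1/2) gchoose n) / ((-1)^n / exp ((1/2+1) * of_real (ln (real n)))) = sqrt_coeff n * real n powr (3/2)"
      using eventually_gt_at_top[of 0]
    proof eventually_elim
      case (elim n)
      have "(1::real) / (-1) ^ n = (-1) ^ n" by (cases "even n") auto
      then show ?case using elim by (simp add: sqrt_coeff_def powr_def field_simps)
    qed
  qed
qed

text \<open>The error term comes from the recurrence: consecutive values of the sequence scaled by
  n^(3/2) differ by O(1 / n^2), which \<open>real_sequence_rate\<close> sums to O(1 / n).\<close>

lemma sqrt_coeff_asymptotic:
  "(\<lambda>n. sqrt_coeff n * real n powr (3/2) / (- 1 / (2 * sqrt pi)) - 1) \<in> O(\<lambda>n. 1 / real n)"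
proof -
  define x where "x = (\<lambda>n. sqrt_coeff n * real n powr (3/2))"
  define L where "L = - 1 / (2 * sqrt pi)"
  have xL: "x \<longlonglongrightarrow> L" using sqrt_coeff_limit by (simp add: x_def L_def)
  have rec: "sqrt_coeff (Suc n) = sqrt_coeff n * ((real n - 1/2) / (real n + 1))" for n
    by (simp add: sqrt_coeff_def gbinomial_Suc_rec field_simps gbinomial_mult_1)
  obtain B where B: "\<And>n. \<bar>x n\<bar> \<le> B" using convergent_imp_Bseq[OF convergentI[OF xL]] by (auto simp: Bseq_def)
  have "(\<lambda>n. (real n - 1/2) / (real n + 1) * ((real n + 1) / real n) powr (3/2) - 1) \<in> O(\<lambda>n. 1 / (real n)\<^sup>2)"
    by real_asymp
  then obtain C0 where "C0 > 0" "\<forall>\<^sub>F n in at_top. norm ((real n - 1/2) / (real n + 1) * ((real n + 1) / real n) powr (3/2) - 1) \<le> C0 * norm (1 / (real n)\<^sup>2)"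
    by (elim landau_o.bigE)
  then obtain N0 where C0: "C0 > 0" "\<And>n. n \<ge> N0 \<Longrightarrow> \<bar>(real n - 1/2) / (real n + 1) * ((real n + 1) / real n) powr (3/2) - 1\<bar> \<le> C0 / (real n)\<^sup>2"
    unfolding eventually_at_top_linorder by auto
  define N where "N = max N0 2"
  have B0: "B \<ge> 0" using B[of 0] by simp
  have diff: "\<bar>x (Suc n) - x n\<bar> \<le> (B * C0) / (real n)\<^sup>2" if "n \<ge> N" for n
  proof -
    have n: "n \<ge> N0" "n > 0" using that by (auto simp: N_def)
    have "real (Suc n) powr (3/2) = ((real n + 1) / real n) powr (3/2) * real n powr (3/2)"
      using n by (subst powr_mult[symmetric]) (auto simp: add.commute)
    then have "x (Suc n) - x n = x n * ((real n - 1/2) / (real n + 1) * ((real n + 1) / real n) powr (3/2) - 1)"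
      by (simp add: x_def rec algebra_simps)
    then have "\<bar>x (Suc n) - x n\<bar> = \<bar>x n\<bar> * \<bar>(real n - 1/2) / (real n + 1) * ((real n + 1) / real n) powr (3/2) - 1\<bar>"
      by (simp only: abs_mult)
    also have "\<dots> \<le> B * (C0 / (real n)\<^sup>2)" using B C0(2)[OF n(1)] B0 by (intro mult_mono) auto
    finally show ?thesis by simp
  qed
  have "\<bar>x n - L\<bar> \<le> B * C0 / (real n - 1)" if "n \<ge> N" for n
    by (rule real_sequence_rate[of x L "B * C0" N n]) (use xL diff that B0 C0 in \<open>auto simp: N_def\<close>)
  then have "(\<lambda>n. x n - L) \<in> O(\<lambda>n. 1 / (real n - 1))"
    by (intro bigoI[of _ "B * C0"]) (auto simp: eventually_at_top_linorder N_def intro!: exI[of _ N])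
  also have "(\<lambda>n. 1 / (real n - 1)) \<in> O(\<lambda>n. 1 / real n)" by real_asymp
  finally have 1: "(\<lambda>n. x n - L) \<in> O(\<lambda>n. 1 / real n)" .
  have eq: "(\<lambda>n. x n / L - 1) = (\<lambda>n. (1 / L) * (x n - L))" by (intro ext) (simp add: L_def field_simps)
  have "(\<lambda>n. (1 / L) * (x n - L)) \<in> O(\<lambda>n. 1 / real n)"
    using 1 by (subst landau_o.big.cmult_in_iff) (auto simp: L_def)
  then show ?thesis unfolding eq[symmetric] by (simp only: x_def L_def)
qed

lemma fps_nth_le_of_bounded:
  fixes H :: "complex fps"
  assumes "fps_conv_radius H \<ge> 1" "\<And>z. norm z < 1 \<Longrightarrow> norm (eval_fps H z) \<le> B"
  shows "norm (fps_nth H n) \<le> B"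
proof -
  have "norm (fps_nth H n) * r ^ n \<le> B" if r: "0 < r" "r < 1" for r
  proof -
    have sub: "cball (0::complex) r \<subseteq> eball 0 (fps_conv_radius H)"
    proof
      fix x :: complex assume "x \<in> cball 0 r"
      then have "ereal (norm x) < 1" using r by simp
      from less_le_trans[OF this assms(1)] show "x \<in> eball 0 (fps_conv_radius H)" by simp
    qed
    have hol: "eval_fps H holomorphic_on cball 0 r" using sub by (intro holomorphic_intros)
    have N1: "norm ((deriv ^^ n) (eval_fps H) 0) \<le> fact n * B / r ^ n"
    proof (rule Cauchy_inequality)
      show "eval_fps H holomorphic_on ball 0 r" using hol by (rule holomorphic_on_subset) auto
      show "continuous_on (cball 0 r) (eval_fps H)" using hol by (rule holomorphic_on_imp_continuous_on)
    qed (use r assms(2) in auto)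
    have "fps_nth H n = (deriv ^^ n) (eval_fps H) 0 / fact n"
      using assms(1) by (intro fps_nth_conv_deriv) (auto intro: less_le_trans[of _ 1])
    then have N2: "norm (fps_nth H n) = norm ((deriv ^^ n) (eval_fps H) 0) / fact n" by (simp add: norm_divide)
    have "norm (fps_nth H n) \<le> (fact n * B / r ^ n) / fact n" unfolding N2 using N1 by (intro divide_right_mono) auto
    then show ?thesis using r by (simp add: field_simps)
  qed
  moreover have "((\<lambda>r. norm (fps_nth H n) * r ^ n) \<longlongrightarrow> norm (fps_nth H n) * 1 ^ n) (at_left (1::real))"
    by (intro tendsto_intros)
  moreover have "\<forall>\<^sub>F r in at_left 1. norm (fps_nth H n) * r ^ n \<le> B"
    unfolding eventually_at_left_field using calculation(1) by (intro exI[of _ 0]) auto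
  ultimately show ?thesis
    using tendsto_upperbound[of _ "norm (fps_nth H n) * 1 ^ n" "at_left (1::real)" B] by simp
qed

text \<open>A third derivative bounded on the whole disc gives coefficients O(n^(-3)), below the
  required error n^(-5/2). The condition is local and looks at the open disc only, so it can be
  checked at each point of the closed disc and assembled by compactness.\<close>

definition bounded_d3_near :: "(complex \<Rightarrow> complex) \<Rightarrow> complex \<Rightarrow> bool" where
  "bounded_d3_near f x \<longleftrightarrow> (\<exists>r>0. \<exists>B. \<forall>z \<in> ball x r \<inter> ball 0 1. norm ((deriv ^^ 3) f z) \<le> B)"

lemma bounded_d3_nearI:
  "r > 0 \<Longrightarrow> (\<And>z. z \<in> ball x r \<inter> ball 0 1 \<Longrightarrow> norm ((deriv ^^ 3) f z) \<le> B) \<Longrightarrow> bounded_d3_near f x"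
  unfolding bounded_d3_near_def by blast

lemma bounded_d3_near_holomorphic:
  assumes "f holomorphic_on ball x r" "r > 0" shows "bounded_d3_near f x"
proof -
  have "continuous_on (cball x (r/2)) ((deriv ^^ 3) f)"
    by (rule continuous_on_subset[OF holomorphic_on_imp_continuous_on[OF holomorphic_higher_deriv[OF assms(1) open_ball]]])
       (use assms(2) in auto)
  then have "bounded ((deriv ^^ 3) f ` cball x (r/2))" by (intro compact_imp_bounded compact_continuous_image) auto
  then obtain B where "\<And>z. z \<in> cball x (r/2) \<Longrightarrow> norm ((deriv ^^ 3) f z) \<le> B" unfolding bounded_iff by blast
  then show ?thesis using assms(2) by (intro bounded_d3_nearI[of "r/2" x f B]) auto
qed

lemma bounded_d3_near_cong:
  assumes "bounded_d3_near g x" "r > 0" "\<And>z. z \<in> ball x r \<inter> ball 0 1 \<Longrightarrow> f z = g z"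
  shows "bounded_d3_near f x"
proof -
  obtain r' B where r': "r' > 0" "\<And>z. z \<in> ball x r' \<inter> ball 0 1 \<Longrightarrow> norm ((deriv ^^ 3) g z) \<le> B"
    using assms(1) unfolding bounded_d3_near_def by blast
  have "(deriv ^^ 3) f z = (deriv ^^ 3) g z" if z: "z \<in> ball x r \<inter> ball 0 1" for z
  proof (rule higher_deriv_cong_ev[OF _ refl])
    have "\<forall>\<^sub>F y in nhds z. y \<in> ball x r \<inter> ball 0 1" using z by (intro eventually_nhds_in_open open_Int) auto
    then show "\<forall>\<^sub>F y in nhds z. f y = g y" by eventually_elim (use assms(3) in auto)
  qed
  then show ?thesis using r' assms(2) by (intro bounded_d3_nearI[of "min r r'" x f B]) auto
qed

lemma bounded_d3_near_add:
  assumes "bounded_d3_near f x" "bounded_d3_near g x" "f holomorphic_on ball 0 1" "g holomorphic_on ball 0 1"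
  shows "bounded_d3_near (\<lambda>z. f z + g z) x"
proof -
  obtain r1 B1 r2 B2 where r: "r1 > 0" "\<And>z. z \<in> ball x r1 \<inter> ball 0 1 \<Longrightarrow> norm ((deriv ^^ 3) f z) \<le> B1"
      "r2 > 0" "\<And>z. z \<in> ball x r2 \<inter> ball 0 1 \<Longrightarrow> norm ((deriv ^^ 3) g z) \<le> B2"
    using assms(1,2) unfolding bounded_d3_near_def by metis
  have "norm ((deriv ^^ 3) (\<lambda>z. f z + g z) z) \<le> B1 + B2" if z: "z \<in> ball x (min r1 r2) \<inter> ball 0 1" for z
  proof -
    have "(deriv ^^ 3) (\<lambda>z. f z + g z) z = (deriv ^^ 3) f z + (deriv ^^ 3) g z"
      using z by (intro higher_deriv_add[OF assms(3,4)]) auto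
    also have "norm \<dots> \<le> B1 + B2" using r z by (intro norm_triangle_le add_mono) auto
    finally show ?thesis .
  qed
  then show ?thesis using r by (intro bounded_d3_nearI[of "min r1 r2" x _ "B1 + B2"]) auto
qed

lemma bounded_d3_near_sum:
  assumes "finite A" "\<And>a. a \<in> A \<Longrightarrow> bounded_d3_near (f a) x" "\<And>a. a \<in> A \<Longrightarrow> f a holomorphic_on ball 0 1"
  shows "bounded_d3_near (\<lambda>z. \<Sum>a\<in>A. f a z) x"
  using assms
proof (induction A rule: finite_induct)
  case empty
  then show ?case by (auto intro: bounded_d3_near_holomorphic[of _ _ 1])
next
  case (insert a A)
  have "bounded_d3_near (\<lambda>z. f a z + (\<Sum>a\<in>A. f a z)) x"
    using insert by (intro bounded_d3_near_add holomorphic_intros) auto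
  then show ?case using insert by simp
qed

lemma bounded_d3_near_global:
  assumes "\<And>x. x \<in> cball 0 1 \<Longrightarrow> bounded_d3_near f x"
  obtains B where "\<And>z. norm z < 1 \<Longrightarrow> norm ((deriv ^^ 3) f z) \<le> B"
proof -
  obtain r B where rB: "\<And>x. x \<in> cball 0 1 \<Longrightarrow> r x > 0 \<and> (\<forall>z \<in> ball x (r x) \<inter> ball 0 1. norm ((deriv ^^ 3) f z) \<le> B x)"
    using assms unfolding bounded_d3_near_def by metis
  have "cball (0::complex) 1 \<subseteq> (\<Union>x\<in>cball 0 1. ball x (r x))" using rB by force
  then obtain X where X: "X \<subseteq> cball 0 1" "finite X" "cball (0::complex) 1 \<subseteq> (\<Union>x\<in>X. ball x (r x))"
    using compactE_image[of "cball (0::complex) 1" "cball 0 1" "\<lambda>x. ball x (r x)"] by auto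
  show ?thesis
  proof (rule that)
    fix z :: complex assume z: "norm z < 1"
    then obtain x where x: "x \<in> X" "z \<in> ball x (r x)" using X(3) by force
    then have "norm ((deriv ^^ 3) f z) \<le> B x" using rB[of x] X(1) z by auto
    also have "\<dots> \<le> \<bar>B x\<bar>" by simp
    also have "\<dots> \<le> (\<Sum>x\<in>X. \<bar>B x\<bar>)" using X x by (intro member_le_sum) auto
    finally show "norm ((deriv ^^ 3) f z) \<le> (\<Sum>x\<in>X. \<bar>B x\<bar>)" .
  qed
qed

lemma csqrt_power_deriv:
  fixes \<Psi> :: "complex \<Rightarrow> complex"
  assumes \<Psi>: "\<Psi> holomorphic_on ball 0 r" and z: "norm z < 1" "norm (csqrt (1 - z / \<zeta>)) < r" and \<zeta>: "norm \<zeta> = 1"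
  shows "((\<lambda>z. csqrt (1 - z / \<zeta>) ^ (k + 2) * \<Psi> (csqrt (1 - z / \<zeta>))) has_field_derivative
     csqrt (1 - z / \<zeta>) ^ k * (- (of_nat (k + 2) * \<Psi> (csqrt (1 - z / \<zeta>)) + csqrt (1 - z / \<zeta>) * deriv \<Psi> (csqrt (1 - z / \<zeta>))) / (2 * \<zeta>))) (at z)"
proof -
  have \<zeta>0: "\<zeta> \<noteq> 0" using \<zeta> by auto
  let ?w = "1 - z / \<zeta>" let ?s = "csqrt ?w"
  have "norm (z / \<zeta>) < 1" using z \<zeta> by (simp add: norm_divide)
  then have re: "Re ?w > 0" using complex_Re_le_cmod[of "z / \<zeta>"] by simp
  then have w: "?w \<notin> \<real>\<^sub>\<le>\<^sub>0" by (auto simp: complex_nonpos_Reals_iff)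
  have s0: "?s \<noteq> 0" using re by auto
  have ds: "((\<lambda>z. csqrt (1 - z / \<zeta>)) has_field_derivative inverse (2 * ?s) * (- 1 / \<zeta>)) (at z)"
    by (rule DERIV_chain2[where f = csqrt and g = "\<lambda>z. 1 - z / \<zeta>", OF has_field_derivative_csqrt[OF w]]) (use \<zeta>0 in \<open>auto intro!: derivative_eq_intros\<close>)
  have d\<Psi>: "(\<Psi> has_field_derivative deriv \<Psi> ?s) (at ?s)" using z(2) by (intro holomorphic_derivI[OF \<Psi>]) auto
  have dp: "((\<lambda>s. s ^ (k + 2) * \<Psi> s) has_field_derivative of_nat (k + 2) * ?s ^ (k + 1) * \<Psi> ?s + deriv \<Psi> ?s * ?s ^ (k + 2)) (at ?s)"
    by (rule DERIV_mult[OF DERIV_cong[OF DERIV_power[OF DERIV_ident]] d\<Psi>]) simp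
  have "((\<lambda>z. csqrt (1 - z / \<zeta>) ^ (k + 2) * \<Psi> (csqrt (1 - z / \<zeta>))) has_field_derivative
     (of_nat (k + 2) * ?s ^ (k + 1) * \<Psi> ?s + deriv \<Psi> ?s * ?s ^ (k + 2)) * (inverse (2 * ?s) * (- 1 / \<zeta>))) (at z)"
    by (rule DERIV_chain2[OF dp ds])
  also have "(of_nat (k + 2) * ?s ^ (k + 1) * \<Psi> ?s + deriv \<Psi> ?s * ?s ^ (k + 2)) * (inverse (2 * ?s) * (- 1 / \<zeta>))
      = ?s ^ k * (- (of_nat (k + 2) * \<Psi> ?s + ?s * deriv \<Psi> ?s) / (2 * \<zeta>))"
    using s0 \<zeta>0 by (simp add: field_simps)
  finally show ?thesis .
qed

text \<open>Every derivative in z lowers the power of the square root by 2 and keeps a holomorphic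
  cofactor; after three of them s^7 has become s.\<close>

lemma bounded_d3_near_csqrt:
  fixes \<Psi> :: "complex \<Rightarrow> complex"
  assumes \<Psi>: "\<Psi> holomorphic_on ball 0 r" and r: "r > 0" and \<zeta>: "norm \<zeta> = 1"
  shows "bounded_d3_near (\<lambda>z. csqrt (1 - z / \<zeta>) ^ 7 * \<Psi> (csqrt (1 - z / \<zeta>))) \<zeta>"
proof -
  have \<zeta>0: "\<zeta> \<noteq> 0" using \<zeta> by auto
  define T where "T = (\<lambda>k \<Psi> s. - (of_nat (k + 2) * \<Psi> s + s * deriv \<Psi> s) / (2 * \<zeta>) :: complex)"
  have T: "T k \<Psi> holomorphic_on ball 0 r" if "\<Psi> holomorphic_on ball 0 r" for k \<Psi>
    unfolding T_def using that \<zeta>0 by (intro holomorphic_intros) auto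
  define D where "D = ball \<zeta> (r\<^sup>2) \<inter> ball 0 1"
  have Do: "open D" unfolding D_def by (intro open_Int open_ball)
  have Dz: "norm z < 1 \<and> norm (csqrt (1 - z / \<zeta>)) < r" if "z \<in> D" for z
  proof -
    have "1 - z / \<zeta> = (\<zeta> - z) / \<zeta>" using \<zeta>0 by (simp add: field_simps)
    then have "norm (1 - z / \<zeta>) < r\<^sup>2" using that \<zeta> by (simp add: D_def dist_norm norm_divide)
    then have "sqrt (norm (1 - z / \<zeta>)) < r" using r real_sqrt_less_mono[of "norm (1 - z / \<zeta>)" "r\<^sup>2"] by simp
    then show ?thesis using that by (simp add: D_def)
  qed
  define G where "G = (\<lambda>k \<Psi> z. csqrt (1 - z / \<zeta>) ^ k * \<Psi> (csqrt (1 - z / \<zeta>)))"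
  have der: "deriv (G (k + 2) \<Psi>) z = G k (T k \<Psi>) z" if "\<Psi> holomorphic_on ball 0 r" "z \<in> D" for k \<Psi> z
    unfolding G_def T_def using csqrt_power_deriv[OF that(1), of z \<zeta> k] Dz[OF that(2)] \<zeta> by (intro DERIV_imp_deriv) auto
  have cong: "deriv f z = deriv g z" if "\<And>z. z \<in> D \<Longrightarrow> f z = g z" "z \<in> D" for f g :: "complex \<Rightarrow> complex" and z
  proof (rule deriv_cong_ev[OF _ refl])
    have "\<forall>\<^sub>F y in nhds z. y \<in> D" using that(2) Do by (intro eventually_nhds_in_open)
    then show "\<forall>\<^sub>F y in nhds z. f y = g y" by eventually_elim (use that in auto)
  qed
  define \<Psi>1 where "\<Psi>1 = T 5 \<Psi>" define \<Psi>2 where "\<Psi>2 = T 3 \<Psi>1" define \<Psi>3 where "\<Psi>3 = T 1 \<Psi>2"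
  have h: "\<Psi>1 holomorphic_on ball 0 r" "\<Psi>2 holomorphic_on ball 0 r" "\<Psi>3 holomorphic_on ball 0 r"
    using T[OF \<Psi>] T T unfolding \<Psi>1_def \<Psi>2_def \<Psi>3_def by blast+
  have 1: "deriv (G 7 \<Psi>) z = G 5 \<Psi>1 z" if "z \<in> D" for z using der[OF \<Psi> that, of 5] by (simp add: \<Psi>1_def)
  have 2: "deriv (deriv (G 7 \<Psi>)) z = G 3 \<Psi>2 z" if "z \<in> D" for z
    using cong[OF 1 that] der[OF h(1) that, of 3] by (simp add: \<Psi>2_def)
  have 3: "deriv (deriv (deriv (G 7 \<Psi>))) z = G 1 \<Psi>3 z" if "z \<in> D" for z
    using cong[OF 2 that] der[OF h(2) that, of 1] by (simp add: \<Psi>3_def numeral_3_eq_3)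
  have "continuous_on (cball 0 (r/2)) \<Psi>3"
    by (rule continuous_on_subset[OF holomorphic_on_imp_continuous_on[OF h(3)]]) (use r in auto)
  then have "bounded (\<Psi>3 ` cball 0 (r/2))" by (intro compact_imp_bounded compact_continuous_image) auto
  then obtain B where B: "\<And>s. s \<in> cball 0 (r/2) \<Longrightarrow> norm (\<Psi>3 s) \<le> B" unfolding bounded_iff by blast
  have "norm ((deriv ^^ 3) (G 7 \<Psi>) z) \<le> r/2 * B" if z: "z \<in> ball \<zeta> ((r/2)\<^sup>2) \<inter> ball 0 1" for z
  proof -
    have "1 - z / \<zeta> = (\<zeta> - z) / \<zeta>" using \<zeta>0 by (simp add: field_simps)
    then have "norm (1 - z / \<zeta>) < (r/2)\<^sup>2" using z \<zeta> by (simp add: dist_norm norm_divide)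
    then have s: "norm (csqrt (1 - z / \<zeta>)) < r/2" using r real_sqrt_less_mono[of "norm (1 - z / \<zeta>)" "(r/2)\<^sup>2"] by (simp add: real_sqrt_divide)
    have "(r/2)\<^sup>2 \<le> r\<^sup>2" using r by (intro power_mono) auto
    then have "z \<in> D" using z by (auto simp: D_def)
    have "(deriv ^^ 3) (G 7 \<Psi>) z = G 1 \<Psi>3 z" using 3[OF \<open>z \<in> D\<close>] by (simp add: numeral_3_eq_3)
    also have "norm \<dots> = norm (csqrt (1 - z / \<zeta>)) * norm (\<Psi>3 (csqrt (1 - z / \<zeta>)))" by (simp add: G_def norm_mult)
    also have "\<dots> \<le> r/2 * B" using s B[of "csqrt (1 - z / \<zeta>)"] r by (intro mult_mono) auto
    finally show ?thesis .
  qed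
  then show ?thesis unfolding G_def using r by (intro bounded_d3_nearI[of "(r/2)\<^sup>2" \<zeta> _ "r/2 * B"]) auto
qed

lemma taylor_split:
  fixes \<Phi> :: "complex \<Rightarrow> complex"
  assumes "\<Phi> holomorphic_on ball 0 r"
  obtains \<phi> \<Psi> where "\<Psi> holomorphic_on ball 0 r" "\<And>s. s \<in> ball 0 r \<Longrightarrow> \<Phi> s = (\<Sum>k<n. \<phi> k * s ^ k) + s ^ n * \<Psi> s"
proof -
  have "\<exists>\<phi> \<Psi>. \<Psi> holomorphic_on ball 0 r \<and> (\<forall>s\<in>ball 0 r. \<Phi> s = (\<Sum>k<n. \<phi> k * s ^ k) + s ^ n * \<Psi> s)"
  proof (induction n)
    case 0 then show ?case using assms by auto
  next
    case (Suc n)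
    then obtain \<phi> \<Psi> where I: "\<Psi> holomorphic_on ball 0 r" "\<And>s. s \<in> ball 0 r \<Longrightarrow> \<Phi> s = (\<Sum>k<n. \<phi> k * s ^ k) + s ^ n * \<Psi> s" by blast
    have "(\<lambda>s. \<Psi> s - \<Psi> 0) holomorphic_on ball 0 r" using I(1) by (intro holomorphic_intros)
    then obtain h where h: "h holomorphic_on ball 0 r" "\<And>s. s \<in> ball 0 r \<Longrightarrow> \<Psi> s - \<Psi> 0 = s * h s"
      using holomorphic_divide_by_zero[of "\<lambda>s. \<Psi> s - \<Psi> 0" r] by auto
    have "\<Phi> s = (\<Sum>k<Suc n. (\<phi>(n := \<Psi> 0)) k * s ^ k) + s ^ Suc n * h s" if "s \<in> ball 0 r" for s
    proof -
      have "\<Psi> s = \<Psi> 0 + s * h s" using h(2)[OF that] by (simp add: algebra_simps)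
      then show ?thesis using I(2)[OF that] by (simp add: algebra_simps)
    qed
    then show ?case using h(1) by blast
  qed
  then show ?thesis using that by blast
qed

lemma csqrt_power_sums:
  fixes x :: complex
  assumes "norm x < 1"
  shows "(\<lambda>n. of_real ((real k / 2) gchoose n) * (- x) ^ n) sums (csqrt (1 - x) ^ k)"
proof -
  have nz: "1 - x \<noteq> 0" using assms by auto
  have "(\<lambda>n. (of_real (real k / 2) gchoose n) * (- x) ^ n) sums ((1 + - x) powr of_real (real k / 2))"
    using assms by (intro gen_binomial_complex) simp
  also have "(1 + - x) powr of_real (real k / 2) = csqrt (1 - x) ^ k"
    using nz by (simp add: csqrt_conv_powr powr_def exp_of_nat_mult[symmetric])
  also have "(\<lambda>n. (of_real (real k / 2) gchoose n) * (- x) ^ n) = (\<lambda>n. of_real ((real k / 2) gchoose n) * (- x) ^ n)"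
    by (simp add: gbinomial_prod_rev)
  finally show ?thesis .
qed

text \<open>The half-plane where Re (1 - z / \<zeta>) > 0 contains the closed disc except \<zeta>,
  and there 1 - z / \<zeta> avoids the cut of the principal root.\<close>

lemma holomorphic_csqrt_unit:
  assumes "norm \<zeta> = 1" shows "(\<lambda>z. csqrt (1 - z / \<zeta>) ^ k) holomorphic_on ball 0 1"
    and "norm x \<le> 1 \<Longrightarrow> x \<noteq> \<zeta> \<Longrightarrow> \<exists>r>0. (\<lambda>z. csqrt (1 - z / \<zeta>) ^ k) holomorphic_on ball x r"
proof -
  have \<zeta>0: "\<zeta> \<noteq> 0" using assms by auto
  have gen: "(\<lambda>z. csqrt (1 - z / \<zeta>) ^ k) holomorphic_on {z. Re (1 - z / \<zeta>) > 0}"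
    using \<zeta>0 by (intro holomorphic_intros) (auto simp: complex_nonpos_Reals_iff)
  have "ball 0 1 \<subseteq> {z. Re (1 - z / \<zeta>) > 0}"
  proof
    fix z :: complex assume "z \<in> ball 0 1"
    then have "norm (z / \<zeta>) < 1" using assms by (simp add: norm_divide)
    then show "z \<in> {z. Re (1 - z / \<zeta>) > 0}" using complex_Re_le_cmod[of "z / \<zeta>"] by simp
  qed
  with gen show "(\<lambda>z. csqrt (1 - z / \<zeta>) ^ k) holomorphic_on ball 0 1" by (rule holomorphic_on_subset)
  assume x: "norm x \<le> 1" "x \<noteq> \<zeta>"
  have n: "norm (x / \<zeta>) \<le> 1" using assms x by (simp add: norm_divide)
  have "Re (x / \<zeta>) \<noteq> 1"
  proof
    assume re: "Re (x / \<zeta>) = 1"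
    have "(Re (x / \<zeta>))\<^sup>2 + (Im (x / \<zeta>))\<^sup>2 \<le> 1" unfolding cmod_power2[symmetric] using n by (simp add: power_le_one)
    then have "Im (x / \<zeta>) = 0" unfolding re by simp
    then have "x / \<zeta> = 1" using re by (simp add: complex_eq_iff)
    then show False using x \<zeta>0 by simp
  qed
  then have "x \<in> {z. Re (1 - z / \<zeta>) > 0}" using complex_Re_le_cmod[of "x / \<zeta>"] n by simp
  moreover have "open {z. Re (1 - z / \<zeta>) > 0}" using \<zeta>0 by (intro open_Collect_less continuous_intros) auto
  ultimately obtain r where "r > 0" "ball x r \<subseteq> {z. Re (1 - z / \<zeta>) > 0}" by (meson open_contains_ball)
  then show "\<exists>r>0. (\<lambda>z. csqrt (1 - z / \<zeta>) ^ k) holomorphic_on ball x r"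
    using holomorphic_on_subset[OF gen] by blast
qed

text \<open>
  Subtracting the terms of odd order at most 5 of the local expansions at the singular points
  leaves a function with bounded third derivative, whose coefficients are O(n^(-3)).
\<close>

theorem sqrt_transfer:
  fixes f :: "complex \<Rightarrow> complex" and c :: "nat \<Rightarrow> complex" and \<Phi> :: "complex \<Rightarrow> complex \<Rightarrow> complex" and r :: "complex \<Rightarrow> real"
  assumes sums: "\<And>z. norm z < 1 \<Longrightarrow> (\<lambda>n. c n * z ^ n) sums f z" and d: "d \<ge> 1"
    and sing: "\<And>\<zeta>. \<zeta> ^ d = 1 \<Longrightarrow> r \<zeta> > 0 \<and> \<Phi> \<zeta> holomorphic_on ball 0 (r \<zeta>)"
      "\<And>\<zeta> z. \<zeta> ^ d = 1 \<Longrightarrow> z \<in> ball 1 ((r \<zeta>)\<^sup>2) \<inter> ball 0 1 \<Longrightarrow> f (\<zeta> * z) = \<Phi> \<zeta> (csqrt (1 - z))"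
    and reg: "\<And>\<zeta>. norm \<zeta> = 1 \<Longrightarrow> \<zeta> ^ d \<noteq> 1 \<Longrightarrow> \<exists>r>0. \<exists>\<Psi>. \<Psi> holomorphic_on ball \<zeta> r \<and> (\<forall>z\<in>ball \<zeta> r \<inter> ball 0 1. f z = \<Psi> z)"
  shows "(\<lambda>n. c n - (\<Sum>\<zeta> | \<zeta> ^ d = 1. deriv (\<Phi> \<zeta>) 0 * inverse \<zeta> ^ n) * of_real (sqrt_coeff n)) \<in> O(\<lambda>n. real n powr (-5/2))"
proof -
  define Z where "Z = {\<zeta>::complex. \<zeta> ^ d = 1}"
  have Zfin: "finite Z" unfolding Z_def using d by (intro finite_roots_unity) auto
  have Zn: "norm \<zeta> = 1" if "\<zeta> \<in> Z" for \<zeta>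
  proof -
    have "norm (\<zeta> ^ d) = norm (1 :: complex)" using that by (simp only: Z_def mem_Collect_eq)
    then have "norm \<zeta> ^ d = 1 ^ d" by (simp only: norm_power norm_one power_one)
    then show ?thesis using d by (intro power_eq_imp_eq_base[of "norm \<zeta>" d 1]) auto
  qed
  have "\<forall>\<zeta>. \<exists>\<phi> \<Psi>. \<zeta> \<in> Z \<longrightarrow> \<Psi> holomorphic_on ball 0 (r \<zeta>) \<and> (\<forall>s\<in>ball 0 (r \<zeta>). \<Phi> \<zeta> s = (\<Sum>k<7. \<phi> k * s ^ k) + s ^ 7 * \<Psi> s)"
  proof
    fix \<zeta>
    show "\<exists>\<phi> \<Psi>. \<zeta> \<in> Z \<longrightarrow> \<Psi> holomorphic_on ball 0 (r \<zeta>) \<and> (\<forall>s\<in>ball 0 (r \<zeta>). \<Phi> \<zeta> s = (\<Sum>k<7. \<phi> k * s ^ k) + s ^ 7 * \<Psi> s)"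
    proof (cases "\<zeta> \<in> Z")
      case True
      then have "\<Phi> \<zeta> holomorphic_on ball 0 (r \<zeta>)" using sing(1)[of \<zeta>] by (simp add: Z_def)
      then obtain \<phi> \<Psi> where "\<Psi> holomorphic_on ball 0 (r \<zeta>)" "\<And>s. s \<in> ball 0 (r \<zeta>) \<Longrightarrow> \<Phi> \<zeta> s = (\<Sum>k<7. \<phi> k * s ^ k) + s ^ 7 * \<Psi> s"
        by (rule taylor_split[where n = 7]) (rule that)
      then show ?thesis by blast
    qed simp
  qed
  then obtain \<phi> \<Psi> where T: "\<And>\<zeta>. \<zeta> \<in> Z \<Longrightarrow> \<Psi> \<zeta> holomorphic_on ball 0 (r \<zeta>)"
    "\<And>\<zeta> s. \<zeta> \<in> Z \<Longrightarrow> s \<in> ball 0 (r \<zeta>) \<Longrightarrow> \<Phi> \<zeta> s = (\<Sum>k<7. \<phi> \<zeta> k * s ^ k) + s ^ 7 * \<Psi> \<zeta> s" by metis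
  have rp: "r \<zeta> > 0" if "\<zeta> \<in> Z" for \<zeta> using sing(1)[of \<zeta>] that by (simp add: Z_def)
  have \<phi>1: "\<phi> \<zeta> 1 = deriv (\<Phi> \<zeta>) 0" if \<zeta>: "\<zeta> \<in> Z" for \<zeta>
  proof -
    have "(\<Psi> \<zeta> has_field_derivative deriv (\<Psi> \<zeta>) 0) (at 0)" using rp[OF \<zeta>] by (intro holomorphic_derivI[OF T(1)[OF \<zeta>]]) auto
    then have "((\<lambda>s. (\<Sum>k<7. \<phi> \<zeta> k * s ^ k) + s ^ 7 * \<Psi> \<zeta> s) has_field_derivative \<phi> \<zeta> 1) (at 0)"
      by (auto intro!: derivative_eq_intros simp: eval_nat_numeral)
    then have "(\<Phi> \<zeta> has_field_derivative \<phi> \<zeta> 1) (at 0)"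
      by (rule has_field_derivative_transform_within_open[of _ _ _ "ball 0 (r \<zeta>)"]) (use T(2)[OF \<zeta>] rp[OF \<zeta>] in auto)
    then show ?thesis by (rule DERIV_imp_deriv[symmetric])
  qed
  define O3 where "O3 = {1, 3, 5::nat}"
  define t where "t = (\<lambda>(\<zeta>, k) z. - \<phi> \<zeta> k * csqrt (1 - z / \<zeta>) ^ k)"
  define R where "R = (\<lambda>z. f z + (\<Sum>a\<in>Z \<times> O3. t a z))"
  have fin: "finite (Z \<times> O3)" using Zfin by (simp add: O3_def)
  have fh: "f holomorphic_on ball 0 1"
    by (rule power_series_holomorphic[where a = c]) (use sums in auto)
  have th: "t a holomorphic_on ball 0 1" if "a \<in> Z \<times> O3" for a
  proof -
    obtain \<zeta> k where a: "a = (\<zeta>, k)" by (cases a)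
    have "norm \<zeta> = 1" using that Zn a by auto
    then show ?thesis unfolding t_def a prod.case by (intro holomorphic_intros holomorphic_csqrt_unit)
  qed
  have tb: "bounded_d3_near (t (\<zeta>, k)) x" if zx: "\<zeta> \<in> Z" "norm x \<le> 1" "x \<noteq> \<zeta>" for \<zeta> k x
  proof -
    obtain e where "e > 0" "(\<lambda>z. csqrt (1 - z / \<zeta>) ^ k) holomorphic_on ball x e"
      using holomorphic_csqrt_unit(2)[OF Zn[OF zx(1)] zx(2,3), of k] by blast
    then show ?thesis
      by (intro bounded_d3_near_holomorphic[of _ x e]) (auto simp: t_def intro!: holomorphic_intros)
  qed
  have bd: "bounded_d3_near R x" if x: "x \<in> cball 0 1" for x
  proof (cases "x \<in> Z")
    case False
    have "bounded_d3_near f x"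
    proof (cases "norm x < 1")
      case True
      have "ball x (1 - norm x) \<subseteq> ball 0 1"
      proof
        fix z assume "z \<in> ball x (1 - norm x)"
        then show "z \<in> ball 0 1" using norm_triangle_sub[of z x] by (simp add: dist_norm norm_minus_commute)
      qed
      with fh have "f holomorphic_on ball x (1 - norm x)" by (rule holomorphic_on_subset)
      then show ?thesis by (rule bounded_d3_near_holomorphic) (use True in simp)
    next
      case False
      then have "norm x = 1" using x by simp
      moreover have "x ^ d \<noteq> 1" using \<open>x \<notin> Z\<close> by (simp add: Z_def)
      ultimately obtain e \<Psi> where e: "e > 0" "\<Psi> holomorphic_on ball x e" "\<forall>z\<in>ball x e \<inter> ball 0 1. f z = \<Psi> z" using reg by blast
      show ?thesis by (rule bounded_d3_near_cong[OF bounded_d3_near_holomorphic[OF e(2,1)] e(1)]) (use e(3) in auto)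
    qed
    moreover have "bounded_d3_near (t a) x" if "a \<in> Z \<times> O3" for a
      using that False x tb[of "fst a" x "snd a"] by (cases a) auto
    then have "bounded_d3_near (\<lambda>z. \<Sum>a\<in>Z \<times> O3. t a z) x"
      using fin th by (intro bounded_d3_near_sum)
    ultimately show ?thesis unfolding R_def using fh th by (intro bounded_d3_near_add holomorphic_intros) auto
  next
    case True
    \<comment> \<open>Even powers of the root are powers of 1 - z / x, so this part of the expansion
      at x is a polynomial. The odd terms at x are cancelled by \<open>t\<close>, and the terms of
      \<open>t\<close> at the other singular points are regular at x.\<close>
    define even where "even = (\<lambda>z. \<phi> x 0 + \<phi> x 2 * (1 - z / x) + \<phi> x 4 * (1 - z / x) ^ 2 + \<phi> x 6 * (1 - z / x) ^ 3)"
    define H where "H = (\<lambda>z. csqrt (1 - z / x) ^ 7 * \<Psi> x (csqrt (1 - z / x)))"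
    define rest where "rest = (\<lambda>z. \<Sum>a\<in>(Z - {x}) \<times> O3. t a z)"
    have x0: "x \<noteq> 0" "norm x = 1" using Zn[OF True] by auto
    have eh: "even holomorphic_on A" for A unfolding even_def using x0 by (intro holomorphic_intros) auto
    have eb: "bounded_d3_near even x" by (rule bounded_d3_near_holomorphic[OF eh[of "ball x 1"]]) simp
    have Hb: "bounded_d3_near H x" unfolding H_def by (rule bounded_d3_near_csqrt[OF T(1)[OF True] rp[OF True] x0(2)])
    have "bounded_d3_near (t a) x" if "a \<in> (Z - {x}) \<times> O3" for a
      using that x tb[of "fst a" x "snd a"] by (cases a) auto
    then have rb: "bounded_d3_near rest x"
      unfolding rest_def using fin th by (intro bounded_d3_near_sum) (auto intro: finite_subset[OF _ fin])
    have rh: "rest holomorphic_on ball 0 1" unfolding rest_def using th by (intro holomorphic_intros) auto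
    have id: "R z = even z + (H z + rest z)" if z: "z \<in> ball x ((r x)\<^sup>2) \<inter> ball 0 1" for z
    proof -
      have e: "1 - z / x = (x - z) / x" using x0 by (simp add: field_simps)
      have "norm (1 - z / x) < (r x)\<^sup>2" unfolding e using z x0 by (simp add: dist_norm norm_divide)
      then have s: "csqrt (1 - z / x) \<in> ball 0 (r x)"
        using rp[OF True] real_sqrt_less_mono[of "norm (1 - z / x)" "(r x)\<^sup>2"] by simp
      have "z / x \<in> ball 1 ((r x)\<^sup>2) \<inter> ball 0 1"
        using \<open>norm (1 - z / x) < (r x)\<^sup>2\<close> z x0 by (simp add: dist_norm norm_divide)
      then have "f (x * (z / x)) = \<Phi> x (csqrt (1 - z / x))" using sing(2)[of x "z / x"] True by (simp add: Z_def)
      then have fz: "f z = (\<Sum>k<7. \<phi> x k * csqrt (1 - z / x) ^ k) + H z"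
        using T(2)[OF True s] x0 by (simp add: H_def)
      have "(\<Sum>k<7. a k * s ^ k) = a 0 + a 2 * s\<^sup>2 + a 4 * (s\<^sup>2) ^ 2 + a 6 * (s\<^sup>2) ^ 3 + (\<Sum>k\<in>O3. a k * s ^ k)"
        for a :: "nat \<Rightarrow> complex" and s by (simp add: eval_nat_numeral O3_def algebra_simps)
      from this[of "\<phi> x" "csqrt (1 - z / x)"]
      have "(\<Sum>k<7. \<phi> x k * csqrt (1 - z / x) ^ k) = even z + (\<Sum>k\<in>O3. \<phi> x k * csqrt (1 - z / x) ^ k)"
        by (simp only: power2_csqrt even_def)
      also have "(\<Sum>k\<in>O3. \<phi> x k * csqrt (1 - z / x) ^ k) = - (\<Sum>a\<in>{x} \<times> O3. t a z)"
        by (simp add: O3_def t_def)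
      finally have "f z = even z - (\<Sum>a\<in>{x} \<times> O3. t a z) + H z" using fz by simp
      moreover have "(\<Sum>a\<in>Z \<times> O3. t a z) = (\<Sum>a\<in>{x} \<times> O3. t a z) + rest z"
      proof -
        have "Z \<times> O3 = {x} \<times> O3 \<union> (Z - {x}) \<times> O3" using True by auto
        then show ?thesis unfolding rest_def using fin
          by (simp only:) (rule sum.union_disjoint, auto intro: finite_subset[OF _ fin] simp: O3_def Zfin)
      qed
      ultimately show ?thesis by (simp add: R_def)
    qed
    have Hh: "H holomorphic_on ball x ((r x)\<^sup>2) \<inter> ball 0 1"
    proof -
      have "H = (\<lambda>z. R z - even z - rest z)" if False using that by simp
      have "(\<lambda>z. R z - even z - rest z) holomorphic_on ball x ((r x)\<^sup>2) \<inter> ball 0 1"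
        unfolding R_def using fh th rh
        by (intro holomorphic_intros eh) (auto intro: holomorphic_on_subset)
      then show ?thesis by (rule holomorphic_transform) (use id in auto)
    qed
    show ?thesis
    proof -
      obtain r1 B1 where 1: "r1 > 0" "\<And>z. z \<in> ball x r1 \<inter> ball 0 1 \<Longrightarrow> norm ((deriv ^^ 3) even z) \<le> B1"
        using eb unfolding bounded_d3_near_def by blast
      obtain r2 B2 where 2: "r2 > 0" "\<And>z. z \<in> ball x r2 \<inter> ball 0 1 \<Longrightarrow> norm ((deriv ^^ 3) H z) \<le> B2"
        using Hb unfolding bounded_d3_near_def by blast
      obtain r3 B3 where 3: "r3 > 0" "\<And>z. z \<in> ball x r3 \<inter> ball 0 1 \<Longrightarrow> norm ((deriv ^^ 3) rest z) \<le> B3"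
        using rb unfolding bounded_d3_near_def by blast
      let ?D = "ball x ((r x)\<^sup>2) \<inter> ball 0 1"
      have Do: "open ?D" by (intro open_Int open_ball)
      define q where "q = min (min r1 r2) (min r3 ((r x)\<^sup>2))"
      have q: "q > 0" "q \<le> r1" "q \<le> r2" "q \<le> r3" "q \<le> (r x)\<^sup>2" using 1 2 3 rp[OF True] by (auto simp: q_def)
      have "norm ((deriv ^^ 3) R z) \<le> B1 + (B2 + B3)" if z: "z \<in> ball x q \<inter> ball 0 1" for z
      proof -
        have zD: "z \<in> ?D" using z q by auto
        have "(deriv ^^ 3) R z = (deriv ^^ 3) (\<lambda>z. even z + (H z + rest z)) z"
        proof (rule higher_deriv_cong_ev[OF _ refl])
          have "\<forall>\<^sub>F y in nhds z. y \<in> ?D" using zD Do by (intro eventually_nhds_in_open)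
          then show "\<forall>\<^sub>F y in nhds z. R y = even y + (H y + rest y)" by eventually_elim (use id in auto)
        qed
        also have "\<dots> = (deriv ^^ 3) even z + (deriv ^^ 3) (\<lambda>z. H z + rest z) z"
          using rh Hh by (intro higher_deriv_add[OF eh _ Do zD] holomorphic_intros) (auto intro: holomorphic_on_subset)
        also have "(deriv ^^ 3) (\<lambda>z. H z + rest z) z = (deriv ^^ 3) H z + (deriv ^^ 3) rest z"
          by (rule higher_deriv_add[OF Hh _ Do zD]) (use rh in \<open>auto intro: holomorphic_on_subset\<close>)
        also have "norm ((deriv ^^ 3) even z + ((deriv ^^ 3) H z + (deriv ^^ 3) rest z)) \<le> B1 + (B2 + B3)"
          using 1 2 3 z q by (intro norm_triangle_le add_mono) auto
        finally show ?thesis .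
      qed
      then show ?thesis using q(1) by (intro bounded_d3_nearI[of q x R "B1 + (B2 + B3)"]) auto
    qed
  qed
  obtain B where B: "\<And>z. norm z < 1 \<Longrightarrow> norm ((deriv ^^ 3) R z) \<le> B"
    by (rule bounded_d3_near_global[OF bd]) auto
  define \<rho> where "\<rho> = (\<lambda>n. c n - (\<Sum>\<zeta>\<in>Z. \<Sum>k\<in>O3. \<phi> \<zeta> k * of_real ((real k / 2) gchoose n) * (- inverse \<zeta>) ^ n))"
  have Rs: "(\<lambda>n. \<rho> n * z ^ n) sums R z" if z: "norm z < 1" for z
  proof -
    have "(\<lambda>n. c n * z ^ n + (\<Sum>a\<in>Z \<times> O3. - \<phi> (fst a) (snd a) * (of_real ((real (snd a) / 2) gchoose n) * (- (z / fst a)) ^ n))) sums (f z + (\<Sum>a\<in>Z \<times> O3. t a z))"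
    proof (intro sums_add sums[OF z] sums_sum)
      fix a assume "a \<in> Z \<times> O3"
      then obtain \<zeta> k where a: "a = (\<zeta>, k)" "\<zeta> \<in> Z" by auto
      have "norm (z / \<zeta>) < 1" using z Zn[OF a(2)] by (simp add: norm_divide)
      from sums_mult[OF csqrt_power_sums[OF this, of k], of "- \<phi> \<zeta> k"]
      show "(\<lambda>n. - \<phi> (fst a) (snd a) * (of_real ((real (snd a) / 2) gchoose n) * (- (z / fst a)) ^ n)) sums t a z"
        by (simp add: a t_def)
    qed
    moreover have "c n * z ^ n + (\<Sum>a\<in>Z \<times> O3. - \<phi> (fst a) (snd a) * (of_real ((real (snd a) / 2) gchoose n) * (- (z / fst a)) ^ n)) = \<rho> n * z ^ n" for n
    proof -
      have "(- (z / \<zeta>)) ^ n = (- inverse \<zeta>) ^ n * z ^ n" for \<zeta>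
        by (simp add: divide_inverse power_mult_distrib[symmetric] mult.commute)
      then have "(\<Sum>a\<in>Z \<times> O3. - \<phi> (fst a) (snd a) * (of_real ((real (snd a) / 2) gchoose n) * (- (z / fst a)) ^ n))
        = (\<Sum>a\<in>Z \<times> O3. - (\<phi> (fst a) (snd a) * of_real ((real (snd a) / 2) gchoose n) * (- inverse (fst a)) ^ n)) * z ^ n"
        unfolding sum_distrib_right by (intro sum.cong refl) (simp add: mult_ac)
      then show ?thesis unfolding \<rho>_def sum.cartesian_product
        by (simp add: sum_negf case_prod_beta' left_diff_distrib)
    qed
    ultimately show ?thesis by (simp add: R_def)
  qed
  define G where "G = Abs_fps \<rho>"
  have Grad: "fps_conv_radius G \<ge> 1"
    unfolding fps_conv_radius_def G_def fps_nth_Abs_fps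
  proof (rule conv_radius_geI_ex')
    fix x :: real assume "0 < x" "ereal x < 1"
    then show "summable (\<lambda>n. \<rho> n * of_real x ^ n)" using Rs[of "of_real x"] by (auto simp: sums_iff)
  qed
  have GR: "eval_fps G z = R z" if "norm z < 1" for z
    using Rs[OF that] by (simp add: eval_fps_def G_def sums_iff)
  \<comment> \<open>The bound on the third derivative bounds its coefficients, and these are (n + 1)
    (n + 2) (n + 3) times the coefficient of index n + 3 of \<open>G\<close>.\<close>
  define G3 where "G3 = fps_deriv (fps_deriv (fps_deriv G))"
  have rad: "fps_conv_radius (fps_deriv H) \<ge> 1" if "fps_conv_radius H \<ge> 1" for H :: "complex fps"
    using that fps_conv_radius_deriv[of H] by (rule order_trans)
  have G3rad: "fps_conv_radius G3 \<ge> 1" unfolding G3_def by (intro rad Grad)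
  have inr: "ereal (norm z) < fps_conv_radius H" if "norm z < 1" "fps_conv_radius H \<ge> 1" for z :: complex and H :: "complex fps"
    using less_le_trans[of "ereal (norm z)" 1 "fps_conv_radius H"] that by simp
  have ed: "deriv h z = eval_fps (fps_deriv H) z" if "\<And>z. norm z < 1 \<Longrightarrow> h z = eval_fps H z" "fps_conv_radius H \<ge> 1" "norm z < 1"
    for h :: "complex \<Rightarrow> complex" and H and z :: complex
  proof -
    have "deriv h z = deriv (eval_fps H) z"
    proof (rule deriv_cong_ev[OF _ refl])
      have "\<forall>\<^sub>F y in nhds z. y \<in> ball 0 1" using that(3) by (intro eventually_nhds_in_open) auto
      then show "\<forall>\<^sub>F y in nhds z. h y = eval_fps H y" by eventually_elim (use that(1) in auto)
    qed
    then show ?thesis using eval_fps_deriv[OF inr[OF that(3,2)]] by simp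
  qed
  have d1: "deriv R z = eval_fps (fps_deriv G) z" if "norm z < 1" for z
    by (rule ed[OF _ Grad that]) (simp add: GR)
  have d2: "deriv (deriv R) z = eval_fps (fps_deriv (fps_deriv G)) z" if "norm z < 1" for z
    by (rule ed[OF d1 rad[OF Grad] that])
  have d3: "deriv (deriv (deriv R)) z = eval_fps G3 z" if "norm z < 1" for z
    unfolding G3_def by (rule ed[OF d2 rad[OF rad[OF Grad]] that])
  have "norm (eval_fps G3 z) \<le> B" if "norm z < 1" for z
    using B[OF that] d3[OF that] by (simp add: numeral_3_eq_3)
  then have G3b: "norm (fps_nth G3 n) \<le> B" for n by (intro fps_nth_le_of_bounded[OF G3rad])
  have G3n: "fps_nth G3 n = of_nat ((n + 1) * (n + 2) * (n + 3)) * \<rho> (n + 3)" for n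
    by (simp add: G3_def G_def fps_deriv_def algebra_simps eval_nat_numeral)
  have \<rho>b: "norm (\<rho> (n + 3)) * ((real n + 1) * (real n + 2) * (real n + 3)) \<le> B" for n
  proof -
    have "norm (fps_nth G3 n) = ((real n + 1) * (real n + 2) * (real n + 3)) * norm (\<rho> (n + 3))"
      unfolding G3n norm_mult norm_of_nat by (simp only: of_nat_mult of_nat_add of_nat_1 of_nat_numeral)
    then show ?thesis using G3b[of n] by (simp add: mult.commute)
  qed
  have \<rho>O: "\<rho> \<in> O(\<lambda>n. real n powr (-5/2))"
  proof -
    have "\<rho> \<in> O(\<lambda>n. complex_of_real (1 / ((real n - 2) * (real n - 1) * real n)))"
    proof (intro bigoI[of _ B], unfold eventually_at_top_linorder, intro exI[of _ 3] allI impI)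
      fix n :: nat assume n: "n \<ge> 3"
      then obtain m where m: "n = m + 3" using le_Suc_ex by (metis add.commute)
      have "norm (\<rho> n) * ((real n - 2) * (real n - 1) * real n) \<le> B" using \<rho>b[of m] by (simp add: m add.commute)
      moreover have pos: "(real n - 2) * (real n - 1) * real n > 0" using n by simp
      ultimately have "norm (\<rho> n) \<le> B / ((real n - 2) * (real n - 1) * real n)" by (simp add: pos_le_divide_eq)
      then show "norm (\<rho> n) \<le> B * norm (complex_of_real (1 / ((real n - 2) * (real n - 1) * real n)))"
        unfolding norm_of_real using pos by (simp add: abs_of_pos)
    qed
    also have "(\<lambda>n. 1 / ((real n - 2) * (real n - 1) * real n)) \<in> O(\<lambda>n. real n powr (-5/2))" by real_asymp
    then have "(\<lambda>n. complex_of_real (1 / ((real n - 2) * (real n - 1) * real n))) \<in> O(\<lambda>n. complex_of_real (real n powr (-5/2)))"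
      by (simp only: landau_o.big.of_real_iff)
    finally show ?thesis .
  qed
  \<comment> \<open>The subtracted terms with exponents 3/2 and 5/2 have coefficients O(n^(-5/2))
    themselves, so only the term of exponent 1/2 remains in the conclusion.\<close>
  have hi: "(\<lambda>n. \<phi> \<zeta> k * of_real ((real k / 2) gchoose n) * (- inverse \<zeta>) ^ n) \<in> O(\<lambda>n. real n powr (-5/2))"
    if "\<zeta> \<in> Z" "k \<in> {3, 5}" for \<zeta> k
  proof -
    have "(\<lambda>n. (real k / 2) gchoose n) \<in> O(\<lambda>n. real n powr (- (real k / 2) - 1))" by (rule gbinomial_bigo)
    also have "(\<lambda>n. real n powr (- (real k / 2) - 1)) \<in> O(\<lambda>n. real n powr (-5/2))"
      using that(2) by (intro bigoI[of _ 1]) (auto simp: eventually_at_top_linorder intro!: exI[of _ 1] powr_mono)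
    finally have "(\<lambda>n. of_real ((real k / 2) gchoose n) :: complex) \<in> O(\<lambda>n. real n powr (-5/2))"
      by (rule landau_o.big.of_real_iff[THEN iffD2])
    note G = this
    have B1: "(\<lambda>n. \<phi> \<zeta> k * (- inverse \<zeta>) ^ n) \<in> O(\<lambda>n. 1)"
      by (intro bigoI[of _ "norm (\<phi> \<zeta> k)"]) (auto simp: norm_mult norm_power norm_inverse Zn[OF that(1)])
    have "(\<lambda>n. (\<phi> \<zeta> k * (- inverse \<zeta>) ^ n) * of_real ((real k / 2) gchoose n)) \<in> O(\<lambda>n. 1 * complex_of_real (real n powr (-5/2)))"
      by (rule landau_o.big.mult[OF B1 G])
    then show ?thesis by (simp add: mult_ac)
  qed
  have "(\<lambda>n. \<rho> n + (\<Sum>\<zeta>\<in>Z. \<Sum>k\<in>{3,5}. \<phi> \<zeta> k * of_real ((real k / 2) gchoose n) * (- inverse \<zeta>) ^ n)) \<in> O(\<lambda>n. real n powr (-5/2))"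
    by (intro sum_in_bigo(1) \<rho>O big_sum_in_bigo hi) auto
  also have "(\<lambda>n. \<rho> n + (\<Sum>\<zeta>\<in>Z. \<Sum>k\<in>{3,5}. \<phi> \<zeta> k * of_real ((real k / 2) gchoose n) * (- inverse \<zeta>) ^ n))
     = (\<lambda>n. c n - (\<Sum>\<zeta>\<in>Z. deriv (\<Phi> \<zeta>) 0 * inverse \<zeta> ^ n) * of_real (sqrt_coeff n))"
  proof
    fix n
    have "(\<Sum>k\<in>O3. \<phi> \<zeta> k * of_real ((real k / 2) gchoose n) * (- inverse \<zeta>) ^ n) =
      deriv (\<Phi> \<zeta>) 0 * inverse \<zeta> ^ n * of_real (sqrt_coeff n) + (\<Sum>k\<in>{3,5}. \<phi> \<zeta> k * of_real ((real k / 2) gchoose n) * (- inverse \<zeta>) ^ n)" if "\<zeta> \<in> Z" for \<zeta>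
    proof -
      have "(- inverse \<zeta>) ^ n = (-1) ^ n * inverse \<zeta> ^ n" by (rule power_minus)
      then show ?thesis using \<phi>1[OF that] by (simp add: O3_def sqrt_coeff_def mult_ac)
    qed
    then have "(\<Sum>\<zeta>\<in>Z. \<Sum>k\<in>O3. \<phi> \<zeta> k * of_real ((real k / 2) gchoose n) * (- inverse \<zeta>) ^ n) =
       (\<Sum>\<zeta>\<in>Z. deriv (\<Phi> \<zeta>) 0 * inverse \<zeta> ^ n) * of_real (sqrt_coeff n) + (\<Sum>\<zeta>\<in>Z. \<Sum>k\<in>{3,5}. \<phi> \<zeta> k * of_real ((real k / 2) gchoose n) * (- inverse \<zeta>) ^ n)"
      unfolding sum_distrib_right sum.distrib[symmetric] by (intro sum.cong refl)
    then show "\<rho> n + (\<Sum>\<zeta>\<in>Z. \<Sum>k\<in>{3,5}. \<phi> \<zeta> k * of_real ((real k / 2) gchoose n) * (- inverse \<zeta>) ^ n)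
      = c n - (\<Sum>\<zeta>\<in>Z. deriv (\<Phi> \<zeta>) 0 * inverse \<zeta> ^ n) * of_real (sqrt_coeff n)"
      by (simp add: \<rho>_def)
  qed
  finally show ?thesis by (simp add: Z_def)
qed

section \<open>Singularity and asymptotics of the boundary series\<close>

lemma fps_conv_radius_complex_fps: "fps_conv_radius (complex_fps f) = fps_conv_radius f"
  by (simp add: fps_conv_radius_def complex_fps_def conv_radius_def)

lemma poly_map_poly_of_real: "poly (map_poly of_real p) (of_real x :: complex) = of_real (poly p x)"
  by (induction p) (auto simp: map_poly_pCons)

lemma bigo_residue_filterI:
  assumes "f \<in> O(g)" "\<And>n. n mod d = j \<Longrightarrow> f' n = f n"
  shows "f' \<in> O[residue_filter d j](g)"
proof -
  have "f \<in> O[residue_filter d j](g)"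
    using assms(1) by (rule landau_o.big.filter_mono[rotated]) (simp add: residue_filter_def)
  moreover have "eventually (\<lambda>n. f' n = f n) (residue_filter d j)"
    using assms(2) by (simp add: residue_filter_def eventually_inf_principal)
  ultimately show ?thesis by (simp cong: landau_o.big.in_cong)
qed

text \<open>By the identity theorem a relation on a real segment extends to a disc around 0, and a
  power series whose sum vanishes near 0 is zero as a formal series.\<close>

lemma algebraic_fpsI:
  fixes f :: "complex fps"
  assumes y: "\<exists>j\<le>N. y j \<noteq> (0 :: complex poly)" and r: "r > 0" "fps_conv_radius f \<ge> ereal r"
    and seg: "\<And>t. 0 < t \<Longrightarrow> t < \<delta> \<Longrightarrow> (\<Sum>j\<le>N. poly (y j) (of_real t) * eval_fps f (of_real t) ^ j) = 0" and \<delta>: "\<delta> > 0"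
  shows "algebraic_fps f"
proof -
  define G where "G = (\<lambda>n. \<Sum>j<n. fps_of_poly (y j) * f ^ j)"
  have cr1: "fps_conv_radius (fps_of_poly (y j) * f ^ j) \<ge> ereal r" for j
  proof -
    have "ereal r \<le> min (fps_conv_radius (fps_of_poly (y j))) (fps_conv_radius (f ^ j))"
      using r(2) fps_conv_radius_power[of f j] by auto
    then show ?thesis using fps_conv_radius_mult[of "fps_of_poly (y j)" "f ^ j"] by (rule order_trans)
  qed
  have crG: "fps_conv_radius (G n) \<ge> ereal r" for n
  proof (induction n)
    case (Suc n)
    have "ereal r \<le> min (fps_conv_radius (G n)) (fps_conv_radius (fps_of_poly (y n) * f ^ n))" using Suc cr1 by simp
    also have "\<dots> \<le> fps_conv_radius (G (Suc n))" unfolding G_def sum.lessThan_Suc by (rule fps_conv_radius_add)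
    finally show ?case .
  qed (simp add: G_def)
  have evG: "eval_fps (G n) z = (\<Sum>j<n. poly (y j) z * eval_fps f z ^ j)" if "norm z < r" for n z
  proof (induction n)
    case (Suc n)
    have z: "ereal (norm z) < fps_conv_radius g" if "fps_conv_radius g \<ge> ereal r" for g :: "complex fps"
      using \<open>norm z < r\<close> that by (metis ereal_less_ereal_Ex less_ereal.simps(1) order_less_le_trans)
    have "eval_fps (G (Suc n)) z = eval_fps (G n) z + eval_fps (fps_of_poly (y n) * f ^ n) z"
      unfolding G_def sum.lessThan_Suc by (rule eval_fps_add) (use z crG cr1 in \<open>auto simp: G_def\<close>)
    also have "eval_fps (fps_of_poly (y n) * f ^ n) z = poly (y n) z * eval_fps f z ^ n"
      using z[OF r(2)] z[OF order_trans[OF r(2) fps_conv_radius_power]] by (simp add: eval_fps_mult eval_fps_power)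
    finally show ?case using Suc by simp
  qed (simp add: G_def)
  have zero: "eval_fps (G (Suc N)) z = 0" if z: "z \<in> ball 0 r" for z
  proof (rule holomorphic_eq_from_segment[where f = "eval_fps (G (Suc N))" and g = "\<lambda>_. 0" and a = 0 and b = 1 and D = "ball 0 r" and e = "min r \<delta>"])
    show "eval_fps (G (Suc N)) holomorphic_on ball 0 r"
    proof (intro holomorphic_on_eval_fps subsetI)
      fix x :: complex assume "x \<in> ball 0 r"
      then have "ereal (norm x) < ereal r" by simp
      also have "\<dots> \<le> fps_conv_radius (G (Suc N))" by (rule crG)
      finally show "x \<in> eball 0 (fps_conv_radius (G (Suc N)))" by (simp add: in_eball_iff)
    qed
    show "0 + complex_of_real t * 1 \<in> ball 0 r \<and> eval_fps (G (Suc N)) (0 + complex_of_real t * 1) = 0" if "0 < t" "t < min r \<delta>" for t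
      using that seg[of t] by (simp add: evG lessThan_Suc_atMost)
  qed (use r \<delta> z in auto)
  have "G (Suc N) = 0"
  proof (rule eval_fps_eqD)
    show "fps_conv_radius (G (Suc N)) > 0" using crG[of "Suc N"] r(1) by (meson ereal_less(2) less_le_trans)
    show "eventually (\<lambda>z. eval_fps (G (Suc N)) z = eval_fps 0 z) (nhds 0)"
      using zero eventually_nhds_in_open[of "ball 0 r" "0 :: complex"] r(1) by (auto elim!: eventually_mono)
  qed simp
  define P where "P = (\<Sum>j\<le>N. monom (y j) j)"
  have cP: "coeff P i = (if i \<le> N then y i else 0)" for i by (simp add: P_def coeff_sum if_distrib cong: if_cong)
  have "poly (map_poly fps_of_poly P) f = (\<Sum>i\<le>degree (map_poly fps_of_poly P). fps_of_poly (coeff P i) * f ^ i)"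
    by (simp add: poly_altdef coeff_map_poly)
  also have "\<dots> = (\<Sum>i\<le>N. fps_of_poly (y i) * f ^ i)"
  proof (rule sum.mono_neutral_cong)
    show "fps_of_poly (coeff P i) * f ^ i = 0" if "i \<in> {..degree (map_poly fps_of_poly P)} - {..N}" for i using that by (simp add: cP)
    show "fps_of_poly (y i) * f ^ i = 0" if "i \<in> {..N} - {..degree (map_poly fps_of_poly P)}" for i
    proof -
      have "coeff (map_poly fps_of_poly P) i = 0" using that by (intro coeff_eq_0) auto
      then show ?thesis using that by (simp add: coeff_map_poly cP)
    qed
  qed (auto simp: cP)
  also have "\<dots> = 0" using \<open>G (Suc N) = 0\<close> by (simp add: G_def lessThan_Suc_atMost)
  finally have "poly (map_poly fps_of_poly P) f = 0" .
  moreover have "P \<noteq> 0" using y cP by (metis coeff_0)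
  ultimately show ?thesis unfolding algebraic_fps_def by blast
qed

context critical_system
begin

section \<open>Undoing the rescaling: F(z) is \<kappa> times the series of level l at z / z0\<close>

context
  fixes F :: "real fps" and z0 \<kappa> :: real and l :: nat
  assumes z0: "z0 > 0" and \<kappa>: "\<kappa> > 0" and l: "l < 2" and F: "\<And>n. fps_nth F n = \<kappa> * A l n / z0 ^ n"
begin

lemma eval_complex_fps_gf:
  fixes z :: complex
  assumes "norm z < z0" shows "eval_fps (complex_fps F) z = of_real \<kappa> * gf l (z / z0)"
proof -
  have "norm (z / z0) < 1" using assms z0 by (simp add: norm_divide)
  from sums_mult[OF gf_sums[OF this, of l], of "of_real \<kappa>"]
  have "(\<lambda>n. fps_nth (complex_fps F) n * z ^ n) sums (\<kappa> * gf l (z / z0))"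
    by (simp add: complex_fps_def F power_divide mult_ac)
  then show ?thesis unfolding eval_fps_def by (simp add: sums_iff)
qed

text \<open>If F were holomorphic at z0, then as a function of s with z = z0 (1 - s^2) it would have
  derivative 0 at s = 0, whereas the branch there has the nonzero derivative \<kappa> times
  \<open>deriv (\<Phi> l) 0\<close>.\<close>

lemma fps_conv_radius_gf: "fps_conv_radius F = ereal z0"
proof (rule antisym)
  have "(\<lambda>n. fps_nth F n * z0 ^ n) = (\<lambda>n. \<kappa> * A l n)" using z0 by (auto simp: F)
  then have "summable (\<lambda>n. fps_nth F n * z0 ^ n)" using summable_A1[of l] by (simp add: summable_mult)
  then show "fps_conv_radius F \<ge> ereal z0" using conv_radius_geI z0 unfolding fps_conv_radius_def by fastforce
  show "fps_conv_radius F \<le> ereal z0"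
  proof (rule ccontr)
    assume "\<not> fps_conv_radius F \<le> ereal z0"
    then have gt: "ereal z0 < fps_conv_radius (complex_fps F)" by (simp add: fps_conv_radius_complex_fps)
    obtain r \<Phi> where r: "r > 0" "r \<le> 1" "\<And>l. l < 2 \<Longrightarrow> \<Phi> l holomorphic_on ball 0 r"
      "\<And>l z. l < 2 \<Longrightarrow> z \<in> ball 1 (r\<^sup>2) \<inter> ball 0 1 \<Longrightarrow> gf l z = \<Phi> l (csqrt (1 - z))"
      "\<And>l. l < 2 \<Longrightarrow> deriv (\<Phi> l) 0 \<noteq> 0"
      by (rule sqrt_branch_at_one) (rule that)
    define g where "g = (\<lambda>s::complex. eval_fps (complex_fps F) (of_real z0 * (1 - s\<^sup>2)))"
    define V where "V = eball (0::complex) (fps_conv_radius (complex_fps F))"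
    have "open V" "of_real z0 * (1 - 0\<^sup>2) \<in> V" using gt z0 by (auto simp: V_def in_eball_iff)
    moreover have "continuous_on UNIV (\<lambda>s. complex_of_real z0 * (1 - s\<^sup>2))" by (intro continuous_intros)
    ultimately have "open ((\<lambda>s. complex_of_real z0 * (1 - s\<^sup>2)) -` V)" "0 \<in> (\<lambda>s. complex_of_real z0 * (1 - s\<^sup>2)) -` V"
      by (auto intro: open_vimage)
    then obtain e where e: "e > 0" "ball 0 e \<subseteq> (\<lambda>s. complex_of_real z0 * (1 - s\<^sup>2)) -` V" by (metis openE)
    define R where "R = min e r"
    have R: "R > 0" "R \<le> e" "R \<le> r" using e r by (auto simp: R_def)
    have dg: "(g has_field_derivative 0) (at 0)"
    proof -
      have "eval_fps (complex_fps F) holomorphic_on V" by (intro holomorphic_on_eval_fps) (simp add: V_def)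
      from holomorphic_derivI[OF this \<open>open V\<close> \<open>of_real z0 * (1 - 0\<^sup>2) \<in> V\<close>]
      obtain D where "(eval_fps (complex_fps F) has_field_derivative D) (at (of_real z0 * (1 - 0\<^sup>2)))" by blast
      then have "((\<lambda>s::complex. eval_fps (complex_fps F) (of_real z0 * (1 - s\<^sup>2))) has_field_derivative D * (z0 * (- (2 * 0)))) (at 0)"
        by (intro DERIV_chain2[where f = "eval_fps (complex_fps F)" and g = "\<lambda>s::complex. of_real z0 * (1 - s\<^sup>2)"]) (auto intro!: derivative_eq_intros)
      then show ?thesis by (simp add: g_def)
    qed
    have eq: "g s = of_real \<kappa> * \<Phi> l s" if "s \<in> ball 0 R" for s
    proof (rule holomorphic_eq_from_segment[where f = g and g = "\<lambda>s. of_real \<kappa> * \<Phi> l s" and a = 0 and b = 1 and D = "ball 0 R" and e = R])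
      show "g holomorphic_on ball 0 R"
      proof -
        have 1: "(\<lambda>s. complex_of_real z0 * (1 - s\<^sup>2)) holomorphic_on ball 0 R" by (intro holomorphic_intros)
        have 2: "eval_fps (complex_fps F) holomorphic_on V" by (intro holomorphic_on_eval_fps) (simp add: V_def)
        have 3: "(\<lambda>s. complex_of_real z0 * (1 - s\<^sup>2)) ` ball 0 R \<subseteq> V" using e(2) subset_ball[OF R(2), of 0] by blast
        show ?thesis using holomorphic_on_compose_gen[OF 1 2 3] by (simp add: g_def o_def)
      qed
      show "(\<lambda>s. complex_of_real \<kappa> * \<Phi> l s) holomorphic_on ball 0 R"
        using holomorphic_on_subset[OF r(3)[OF l] subset_ball[OF R(3)]] by (intro holomorphic_intros)
      show "0 + complex_of_real t * 1 \<in> ball 0 R \<and> g (0 + complex_of_real t * 1) = \<kappa> * \<Phi> l (0 + complex_of_real t * 1)" if t: "0 < t" "t < R" for t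
      proof -
        have t1: "t\<^sup>2 < r\<^sup>2" "t\<^sup>2 < 1" "t\<^sup>2 > 0"
        proof -
          show "t\<^sup>2 < r\<^sup>2" using t R by (intro power_strict_mono) auto
          also have "r\<^sup>2 \<le> 1" using r by (simp add: power_le_one)
          finally show "t\<^sup>2 < 1" .
          show "t\<^sup>2 > 0" using t by simp
        qed
        define w where "w = complex_of_real (1 - t\<^sup>2)"
        have nw: "norm w < 1" unfolding w_def norm_of_real using t1 by simp
        have "dist 1 w = t\<^sup>2" unfolding w_def dist_norm using norm_of_real[of "t\<^sup>2", where ?'a = complex] by simp
        then have "w \<in> ball 1 (r\<^sup>2) \<inter> ball 0 1" using t1 nw by simp
        from r(4)[OF l this] have "gf l w = \<Phi> l (csqrt (1 - w))" .
        moreover have "csqrt (1 - w) = of_real t" using t unfolding w_def by (simp add: csqrt_of_real_nonneg flip: of_real_power)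
        moreover have "g (of_real t) = \<kappa> * gf l w"
        proof -
          have "norm (z0 * w) < z0" using nw z0 by (simp add: norm_mult)
          from eval_complex_fps_gf[OF this] show ?thesis using z0 by (simp add: g_def w_def)
        qed
        ultimately show ?thesis using t by simp
      qed
    qed (use R that in auto)
    have "(\<Phi> l has_field_derivative deriv (\<Phi> l) 0) (at 0)"
      using r(1) holomorphic_derivI[OF r(3)[OF l]] by simp
    then have "((\<lambda>s. \<kappa> * \<Phi> l s) has_field_derivative \<kappa> * deriv (\<Phi> l) 0) (at 0)" by (rule DERIV_cmult)
    then have "(g has_field_derivative \<kappa> * deriv (\<Phi> l) 0) (at 0)"
      by (rule has_field_derivative_transform_within_open[where S = "ball 0 R"]) (use R eq in auto)
    from DERIV_unique[OF this dg] show False using r(5)[OF l] \<kappa> by simp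
  qed
qed

lemma sqrt_singularity_gf: "sqrt_singularity (complex_fps F) (of_real z0)"
proof -
  have cr: "fps_conv_radius (complex_fps F) = ereal z0" by (simp add: fps_conv_radius_complex_fps fps_conv_radius_gf)
  have alg: "algebraic_fps (complex_fps F)"
  proof -
    obtain N x \<epsilon> where x: "\<epsilon> > 0" "\<epsilon> \<le> 1" "\<exists>j\<le>N. x j \<noteq> (0 :: real poly)"
      "\<And>z. 0 < z \<Longrightarrow> z < \<epsilon> \<Longrightarrow> (\<Sum>j\<le>N. poly (x j) z * gf l z ^ j) = 0"
      by (rule gf_algebraic_relation[OF l]) (rule that)
    \<comment> \<open>The relation for \<open>gf l\<close> with z replaced by z / z0 and the factor
      \<kappa> divided out of the powers.\<close>
    define y where "y = (\<lambda>j. map_poly complex_of_real (smult (1 / \<kappa> ^ j) (x j \<circ>\<^sub>p [:0, 1 / z0:])))"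
    have py: "poly (y j) (of_real t) = of_real (poly (x j) (t / z0) / \<kappa> ^ j)" for j t
      unfolding y_def poly_map_poly_of_real by (simp add: poly_pcompose)
    show ?thesis
    proof (rule algebraic_fpsI[where r = z0 and \<delta> = "z0 * \<epsilon>" and N = N and y = y])
      obtain j where j: "j \<le> N" "x j \<noteq> 0" using x(3) by blast
      have "x j \<circ>\<^sub>p [:0, 1 / z0:] \<noteq> 0" using j z0 by (subst pcompose_eq_0_iff) auto
      then have "y j \<noteq> 0" using \<kappa> by (simp add: y_def map_poly_eq_0_iff)
      then show "\<exists>j\<le>N. y j \<noteq> 0" using j by blast
      show "(\<Sum>j\<le>N. poly (y j) (of_real t) * eval_fps (complex_fps F) (of_real t) ^ j) = 0" if t: "0 < t" "t < z0 * \<epsilon>" for t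
      proof -
        have t': "0 < t / z0" "t / z0 < \<epsilon>" using t z0 by (auto simp: field_simps)
        have "t / z0 < 1" using t' x(2) by simp
        then have "norm (complex_of_real t) < z0" using t z0 by (simp add: field_simps)
        from eval_complex_fps_gf[OF this] have "eval_fps (complex_fps F) (of_real t) = of_real (\<kappa> * gf l (t / z0))"
          using of_real_gf[of "t / z0" l] \<open>t / z0 < 1\<close> t' by (simp flip: of_real_divide)
        then have "(\<Sum>j\<le>N. poly (y j) (of_real t) * eval_fps (complex_fps F) (of_real t) ^ j)
            = of_real (\<Sum>j\<le>N. poly (x j) (t / z0) * gf l (t / z0) ^ j)"
          unfolding py of_real_sum using \<kappa> by (intro sum.cong refl) (simp add: power_mult_distrib)
        then show ?thesis using x(4)[OF t'] by simp
      qed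
    qed (use z0 x cr in auto)
  qed
  obtain r \<Phi> where r: "r > 0" "r \<le> 1" "\<And>l. l < 2 \<Longrightarrow> \<Phi> l holomorphic_on ball 0 r"
    "\<And>l z. l < 2 \<Longrightarrow> z \<in> ball 1 (r\<^sup>2) \<inter> ball 0 1 \<Longrightarrow> gf l z = \<Phi> l (csqrt (1 - z))"
    "\<And>l. l < 2 \<Longrightarrow> deriv (\<Phi> l) 0 \<noteq> 0"
    by (rule sqrt_branch_at_one) (rule that)
  \<comment> \<open>Since q^2 = - z0, multiplying \<open>csqrt (1 - z / z0)\<close> by q gives a
    square root of z - z0; dividing the k-th Taylor coefficient of the branch by q^k in
    \<open>a\<close> compensates for this.\<close>
  define q where "q = \<i> * complex_of_real (sqrt z0)"
  have q: "q \<noteq> 0" "q\<^sup>2 = - of_real z0" using z0 by (auto simp: q_def power_mult_distrib simp flip: of_real_power)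
  define s where "s = (\<lambda>z::complex. q * csqrt (1 - z / z0))"
  define a where "a = (\<lambda>k. \<kappa> * ((deriv ^^ k) (\<Phi> l) 0 / fact k) / q ^ k)"
  define D where "D = ball (complex_of_real z0) (z0 * r\<^sup>2) \<inter> eball 0 (fps_conv_radius (complex_fps F))"
  have D: "z / z0 \<in> ball 1 (r\<^sup>2)" "norm (z / z0) < 1" "norm z < z0" if "z \<in> D" for z :: complex
  proof -
    show n: "norm z < z0" using that by (simp add: D_def cr in_eball_iff)
    then show "norm (z / z0) < 1" using z0 by (simp add: norm_divide)
    have "1 - z / z0 = (z0 - z) / z0" using z0 by (simp add: field_simps)
    then have "dist 1 (z / z0) = dist (of_real z0) z / z0" using z0 by (simp add: dist_norm norm_divide)
    moreover have "dist (of_real z0) z < z0 * r\<^sup>2" using that by (simp add: D_def)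
    ultimately show "z / z0 \<in> ball 1 (r\<^sup>2)" using z0 by (simp add: pos_divide_less_eq mult.commute)
  qed
  have cont: "continuous_on D s"
  proof -
    have "1 - z / z0 \<notin> \<real>\<^sub>\<le>\<^sub>0" if "z \<in> D" for z :: complex
    proof -
      have "Re (z / z0) < 1" using D(2)[OF that] complex_Re_le_cmod[of "z / z0"] by linarith
      then show ?thesis by (auto simp: complex_nonpos_Reals_iff)
    qed
    then have "(\<lambda>z. 1 - z / z0) ` D \<subseteq> - \<real>\<^sub>\<le>\<^sub>0" by blast
    moreover have "continuous_on (- \<real>\<^sub>\<le>\<^sub>0) csqrt" by (intro holomorphic_on_imp_continuous_on holomorphic_on_csqrt)
    moreover have "continuous_on D (\<lambda>z. 1 - z / z0)" using z0 by (intro continuous_intros) auto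
    ultimately have "continuous_on D (\<lambda>z. csqrt (1 - z / z0))" by (rule continuous_on_compose2[rotated 2])
    then show ?thesis unfolding s_def by (intro continuous_intros)
  qed
  have sq: "s z ^ 2 = z - z0" for z :: complex
    unfolding s_def power_mult_distrib q power2_csqrt using z0 by (simp add: field_simps)
  have ser: "(\<lambda>k. a k * s z ^ k) sums eval_fps (complex_fps F) z" if z: "z \<in> D" for z
  proof -
    have "norm (csqrt (1 - z / z0)) < r"
    proof (rule power2_less_imp_less)
      have "(norm (csqrt (1 - z / z0)))\<^sup>2 = norm (1 - z / z0)" by (simp flip: norm_power)
      also have "\<dots> < r\<^sup>2" using D(1)[OF z] by (simp add: dist_norm)
      finally show "(norm (csqrt (1 - z / z0)))\<^sup>2 < r\<^sup>2" .
    qed (use r in auto)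
    then have "csqrt (1 - z / z0) \<in> ball 0 r" by simp
    from sums_mult[OF holomorphic_power_series[OF r(3)[OF l] this], of "of_real \<kappa>"]
    have "(\<lambda>k. a k * s z ^ k) sums (\<kappa> * \<Phi> l (csqrt (1 - z / z0)))"
      using q(1) by (simp add: a_def s_def power_mult_distrib mult_ac)
    also have "\<Phi> l (csqrt (1 - z / z0)) = gf l (z / z0)" using r(4)[OF l] D[OF z] by simp
    also have "\<kappa> * gf l (z / z0) = eval_fps (complex_fps F) z" using eval_complex_fps_gf[OF D(3)[OF z]] by simp
    finally show ?thesis .
  qed
  have a1: "a 1 \<noteq> 0" using \<kappa> q(1) r(5)[OF l] by (simp add: a_def)
  have "\<exists>(a :: nat \<Rightarrow> complex) s r. r > 0 \<and> a 1 \<noteq> 0 \<and>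
        (let D = ball (complex_of_real z0) r \<inter> eball 0 (fps_conv_radius (complex_fps F))
         in continuous_on D s \<and>
            (\<forall>z\<in>D. s z ^ 2 = z - z0 \<and> (\<lambda>k. a k * s z ^ k) sums eval_fps (complex_fps F) z))"
    unfolding Let_def
    by (intro exI[of _ a] exI[of _ s] exI[of _ "z0 * r\<^sup>2"] conjI ballI sq)
      (use z0 r(1) a1 cont ser in \<open>auto simp: D_def\<close>)
  then show ?thesis unfolding sqrt_singularity_def using alg cr z0 by simp
qed

text \<open>The transfer gives the main term \<open>C n\<close> times \<open>sqrt_coeff n\<close>,
  where C depends only on n mod d. J consists of the residues j with
  \<open>Re (C j) \<noteq> 0\<close>, and there c j = \<kappa> Re (C j) L, with L the constant in
  the asymptotics of \<open>sqrt_coeff\<close>.\<close>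

theorem coeff_asymptotics: "periodic_coeff_asymptotics (fps_nth F) z0"
proof -
  define d where "d = period"
  have d: "d \<ge> 1" using period(1) by (simp add: d_def)
  have "\<forall>\<zeta>. \<exists>r \<Phi>. \<zeta> ^ d = 1 \<longrightarrow> (r > 0 \<and> \<Phi> holomorphic_on ball 0 r \<and> (\<zeta> = 1 \<longrightarrow> deriv \<Phi> 0 \<noteq> 0)
      \<and> (\<forall>z\<in>ball 1 (r\<^sup>2) \<inter> ball 0 1. gf l (\<zeta> * z) = \<Phi> (csqrt (1 - z))))"
  proof
    fix \<zeta> :: complex
    show "\<exists>r \<Phi>. \<zeta> ^ d = 1 \<longrightarrow> (r > 0 \<and> \<Phi> holomorphic_on ball 0 r \<and> (\<zeta> = 1 \<longrightarrow> deriv \<Phi> 0 \<noteq> 0)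
      \<and> (\<forall>z\<in>ball 1 (r\<^sup>2) \<inter> ball 0 1. gf l (\<zeta> * z) = \<Phi> (csqrt (1 - z))))"
    proof (cases "\<zeta> ^ d = 1")
      case True
      have n1: "norm \<zeta> = 1"
      proof -
        have "norm \<zeta> ^ d = 1" using True by (metis norm_one norm_power)
        then show ?thesis using d by (intro power_eq_imp_eq_base[of "norm \<zeta>" d 1]) auto
      qed
      show ?thesis
      proof (cases "\<zeta> = 1")
        case True
        obtain r \<Phi> where r: "r > 0" "r \<le> 1" "\<And>l. l < 2 \<Longrightarrow> \<Phi> l holomorphic_on ball 0 r"
          "\<And>l z. l < 2 \<Longrightarrow> z \<in> ball 1 (r\<^sup>2) \<inter> ball 0 1 \<Longrightarrow> gf l z = \<Phi> l (csqrt (1 - z))"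
          "\<And>l. l < 2 \<Longrightarrow> deriv (\<Phi> l) 0 \<noteq> 0"
          by (rule sqrt_branch_at_one) (rule that)
        show ?thesis
          by (intro exI[of _ r] exI[of _ "\<Phi> l"] impI conjI ballI) (use r l True in simp_all)
      next
        case False
        obtain r \<Phi> where r: "r > 0" "r \<le> 1" "\<Phi> holomorphic_on ball 0 r"
          "\<And>z. z \<in> ball 1 (r\<^sup>2) \<inter> ball 0 1 \<Longrightarrow> gf l (\<zeta> * z) = \<Phi> (csqrt (1 - z))"
          by (rule boundary_branch[OF n1 l]) (rule that)
        show ?thesis
          by (intro exI[of _ r] exI[of _ \<Phi>] impI conjI ballI) (use r False in simp_all)
      qed
    qed simp
  qed
  then obtain r \<Phi> where r: "\<And>\<zeta>. \<zeta> ^ d = 1 \<Longrightarrow> r \<zeta> > 0 \<and> \<Phi> \<zeta> holomorphic_on ball 0 (r \<zeta>)"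
    "\<And>\<zeta> z. \<zeta> ^ d = 1 \<Longrightarrow> z \<in> ball 1 ((r \<zeta>)\<^sup>2) \<inter> ball 0 1 \<Longrightarrow> gf l (\<zeta> * z) = \<Phi> \<zeta> (csqrt (1 - z))"
    "deriv (\<Phi> (1::complex)) 0 \<noteq> 0"
    unfolding choice_iff by force
  define C where "C = (\<lambda>n. \<Sum>\<zeta> | \<zeta> ^ d = 1. deriv (\<Phi> \<zeta>) 0 * inverse \<zeta> ^ n)"
  have trans: "(\<lambda>n. of_real (A l n) - C n * of_real (sqrt_coeff n)) \<in> O(\<lambda>n. complex_of_real (real n powr (-5/2)))"
    unfolding C_def
  proof (rule sqrt_transfer[where r = r])
    show "(\<lambda>n. of_real (A l n) * z ^ n) sums gf l z" if "norm z < 1" for z :: complex by (rule gf_sums[OF that])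
    show "\<exists>r>0. \<exists>\<Psi>. \<Psi> holomorphic_on ball \<zeta> r \<and> (\<forall>z\<in>ball \<zeta> r \<inter> ball 0 1. gf l z = \<Psi> z)"
      if \<zeta>: "norm \<zeta> = 1" "\<zeta> ^ d \<noteq> 1" for \<zeta>
    proof -
      obtain r \<Psi> where "r > 0" "\<Psi> holomorphic_on ball \<zeta> r" "\<And>z. z \<in> ball \<zeta> r \<inter> ball 0 1 \<Longrightarrow> gf l z = \<Psi> z"
        by (rule boundary_regular[OF \<zeta>(1) \<zeta>(2)[unfolded d_def] l]) (rule that)
      then show ?thesis by blast
    qed
  qed (use d r in auto)
  have Cper: "C (n + d * k) = C n" for n k
    unfolding C_def by (intro sum.cong refl) (simp add: power_add power_mult power_inverse)
  have Cmod: "C n = C (n mod d)" for n using Cper[of "n mod d" "n div d"] by simp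
  define L where "L = - 1 / (2 * sqrt pi)"
  have L: "L < 0" by (simp add: L_def)
  define \<delta> where "\<delta> = (\<lambda>n. sqrt_coeff n * real n powr (3/2) / L - 1)"
  have \<delta>: "\<delta> \<in> O(\<lambda>n. 1 / real n)" using sqrt_coeff_asymptotic by (simp add: \<delta>_def L_def)
  define E where "E = (\<lambda>n. A l n - Re (C n) * sqrt_coeff n)"
  have E: "E \<in> O(\<lambda>n. real n powr (-5/2))"
  proof -
    have "E \<in> O(\<lambda>n. norm (of_real (A l n) - C n * of_real (sqrt_coeff n)))"
    proof (intro bigoI[of _ 1] always_eventually allI)
      fix n
      have "E n = Re (of_real (A l n) - C n * of_real (sqrt_coeff n))" by (simp add: E_def)
      then show "norm (E n) \<le> 1 * norm (norm (of_real (A l n) - C n * of_real (sqrt_coeff n)))"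
        by (simp only: real_norm_def abs_norm_cancel mult_1 abs_Re_le_cmod)
    qed
    also have "(\<lambda>n. norm (of_real (A l n) - C n * of_real (sqrt_coeff n))) \<in> O(\<lambda>n. norm (complex_of_real (real n powr (-5/2))))"
      using trans by (simp only: landau_o.big.norm_iff)
    finally show ?thesis by simp
  qed
  have E32: "(\<lambda>n. E n * real n powr (3/2)) \<in> O(\<lambda>n. 1 / real n)"
  proof -
    have "(\<lambda>n. E n * real n powr (3/2)) \<in> O(\<lambda>n. real n powr (-5/2) * real n powr (3/2))"
      by (intro landau_o.big.mult E) simp
    also have "(\<lambda>n. real n powr (-5/2) * real n powr (3/2)) \<in> O(\<lambda>n. 1 / real n)" by real_asymp
    finally show ?thesis .
  qed
  have lim: "(\<lambda>n. of_real (A l n * real n powr (3/2)) - C n * of_real L) \<longlonglongrightarrow> 0"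
  proof -
    have t1: "(\<lambda>n. (of_real (A l n) - C n * of_real (sqrt_coeff n)) * of_real (real n powr (3/2))) \<longlonglongrightarrow> 0"
    proof -
      have "(\<lambda>n. (of_real (A l n) - C n * of_real (sqrt_coeff n)) * of_real (real n powr (3/2))) \<in> O(\<lambda>n. complex_of_real (real n powr (-5/2)) * of_real (real n powr (3/2)))"
        by (intro landau_o.big.mult trans) simp
      also have "(\<lambda>n. complex_of_real (real n powr (-5/2)) * of_real (real n powr (3/2))) = (\<lambda>n. complex_of_real (real n powr (-5/2) * real n powr (3/2)))" by simp
      also have "\<dots> \<in> o(\<lambda>n. complex_of_real 1)"
        unfolding landau_o.small.of_real_iff by real_asymp
      finally show ?thesis by (auto dest: smalloD_tendsto)
    qed
    have t2: "(\<lambda>n. C n * of_real (L * \<delta> n)) \<longlonglongrightarrow> 0"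
    proof -
      have "C \<in> O(\<lambda>_. 1)"
      proof (intro bigoI[of _ "\<Sum>j<d. norm (C j)"] always_eventually allI)
        fix n
        have "norm (C (n mod d)) \<le> (\<Sum>j<d. norm (C j))" using d by (intro member_le_sum) auto
        then show "norm (C n) \<le> (\<Sum>j<d. norm (C j)) * norm (1::complex)" using Cmod[of n] by simp
      qed
      moreover have "(\<lambda>n. L * \<delta> n) \<in> o(\<lambda>n. 1)"
      proof -
        have "(\<lambda>n. L * \<delta> n) \<in> O(\<lambda>n. 1 / real n)" using \<delta> L by simp
        also have "(\<lambda>n. 1 / real n) \<in> o(\<lambda>n. 1)" by real_asymp
        finally show ?thesis .
      qed
      then have "(\<lambda>n. of_real (L * \<delta> n)) \<in> o(\<lambda>n. complex_of_real 1)" by (rule landau_o.small.of_real_iff[THEN iffD2])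
      ultimately have "(\<lambda>n. C n * of_real (L * \<delta> n)) \<in> o(\<lambda>n. 1 * complex_of_real 1)" by (rule landau_o.big_small_mult)
      then show ?thesis by (auto dest: smalloD_tendsto)
    qed
    have *: "(of_real (A l n) - C n * of_real (sqrt_coeff n)) * of_real (real n powr (3/2)) + C n * of_real (L * \<delta> n)
       = of_real (A l n * real n powr (3/2)) - C n * of_real L" for n
    proof -
      have "L * \<delta> n = sqrt_coeff n * real n powr (3/2) - L" using L by (simp add: \<delta>_def field_simps)
      then show ?thesis by (simp only: of_real_diff of_real_mult) (simp add: algebra_simps)
    qed
    show ?thesis using tendsto_add[OF t1 t2] unfolding * by simp
  qed
  have class_lim: "(\<lambda>k. complex_of_real (A l (j + d * k) * real (j + d * k) powr (3/2))) \<longlonglongrightarrow> C j * of_real L" for j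
  proof -
    have "filterlim (\<lambda>k. j + d * k) sequentially sequentially"
      using d by (intro filterlim_subseq) (auto simp: strict_mono_def)
    from filterlim_compose[OF lim this] have "(\<lambda>k. complex_of_real (A l (j + d * k) * real (j + d * k) powr (3/2)) - C j * of_real L) \<longlonglongrightarrow> 0"
      by (simp only: Cper)
    then show ?thesis by (simp add: LIM_zero_iff del: of_real_mult)
  qed
  \<comment> \<open>Along a residue class the nonnegative numbers A l n times n^(3/2) converge to
    \<open>C j\<close> times L, so this limit is real and nonnegative.\<close>
  have Creal: "Im (C j) = 0" "Re (C j) * L \<ge> 0" for j
  proof -
    have "(\<lambda>k::nat. 0) \<longlonglongrightarrow> Im (C j * of_real L)" using tendsto_Im[OF class_lim[of j]] by simp
    then have "Im (C j * of_real L) = 0" by (simp add: LIMSEQ_const_iff)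
    then show "Im (C j) = 0" using L by simp
    have "(\<lambda>k. A l (j + d * k) * real (j + d * k) powr (3/2)) \<longlonglongrightarrow> Re (C j * of_real L)" using tendsto_Re[OF class_lim[of j]] by simp
    then have "0 \<le> Re (C j * of_real L)" by (rule LIMSEQ_le_const) (auto intro!: mult_nonneg_nonneg A_nonneg)
    then show "Re (C j) * L \<ge> 0" by simp
  qed
  define J where "J = {j. j < d \<and> Re (C j) \<noteq> 0}"
  \<comment> \<open>Summing C over all residues kills every d-th root of unity except 1, whose term
    \<open>deriv (\<Phi> 1) 0\<close> is nonzero.\<close>
  have Jne: "J \<noteq> {}"
  proof
    assume "J = {}"
    then have C0: "C j = 0" if "j < d" for j using that Creal(1)[of j] by (auto simp: J_def complex_eq_iff)
    have "(\<Sum>j<d. inverse \<zeta> ^ j) = (if \<zeta> = 1 then of_nat d else 0)" if "\<zeta> ^ d = 1" for \<zeta> :: complex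
    proof (cases "\<zeta> = 1")
      case False
      then have "inverse \<zeta> \<noteq> 1" by simp
      then show ?thesis using False that sum_gp_strict[of "inverse \<zeta>" d] by (simp add: power_inverse)
    qed simp
    then have "(\<Sum>j<d. C j) = (\<Sum>\<zeta> | \<zeta> ^ d = 1. deriv (\<Phi> \<zeta>) 0 * (if \<zeta> = 1 then of_nat d else 0))"
      unfolding C_def by (subst sum.swap) (auto simp: sum_distrib_left[symmetric] intro!: sum.cong)
    also have "\<dots> = deriv (\<Phi> 1) 0 * of_nat d"
      using finite_roots_unity[of d, where ?'a = complex] d by (simp add: if_distrib cong: if_cong)
    finally show False using r(3) d C0 by simp
  qed
  define c where "c = (\<lambda>j. \<kappa> * (Re (C j) * L))"
  define \<epsilon> where "\<epsilon> = (\<lambda>j n. A l n * real n powr (3/2) / (Re (C j) * L) - 1)"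
  have zpow: "z0 powi (- int n) = 1 / z0 ^ n" for n by (simp add: power_int_minus field_simps)
  have main: "c j > 0 \<and> (\<exists>\<epsilon>. \<epsilon> \<in> O[residue_filter d j](\<lambda>n. 1 / real n) \<and>
      (\<forall>\<^sub>F n in residue_filter d j. fps_nth F n = c j * real n powr (-3/2) * z0 powi (- int n) * (1 + \<epsilon> n)))" if j: "j \<in> J" for j
  proof (intro conjI exI[of _ "\<epsilon> j"])
    have RL: "Re (C j) * L > 0" using Creal(2)[of j] j L by (simp add: J_def less_le)
    have nz: "Re (C j) \<noteq> 0" "L \<noteq> 0" using j L by (auto simp: J_def)
    show "c j > 0" using \<kappa> RL by (simp add: c_def)
    show "\<epsilon> j \<in> O[residue_filter d j](\<lambda>n. 1 / real n)"
    proof (rule bigo_residue_filterI)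
      show "(\<lambda>n. \<delta> n + E n * real n powr (3/2) / (Re (C j) * L)) \<in> O(\<lambda>n. 1 / real n)"
      proof (intro sum_in_bigo \<delta>)
        show "(\<lambda>n. E n * real n powr (3/2) / (Re (C j) * L)) \<in> O(\<lambda>n. 1 / real n)"
          using E32 RL by (subst landau_o.big.cdiv_in_iff') auto
      qed
      show "\<epsilon> j n = \<delta> n + E n * real n powr (3/2) / (Re (C j) * L)" if "n mod d = j" for n
      proof -
        have "C n = C j" using Cmod[of n] that by simp
        then have "A l n = Re (C j) * sqrt_coeff n + E n" by (simp add: E_def)
        then show ?thesis using nz by (simp add: \<epsilon>_def \<delta>_def field_simps)
      qed
    qed
    have "fps_nth F n = c j * real n powr (-3/2) * z0 powi (- int n) * (1 + \<epsilon> j n)" if "n \<ge> 1" for n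
    proof -
      have p: "real n powr (-3/2) * real n powr (3/2) = 1" using that by (simp flip: powr_add)
      have "c j * real n powr (-3/2) * z0 powi (- int n) * (1 + \<epsilon> j n) = \<kappa> * (real n powr (-3/2) * real n powr (3/2)) * A l n / z0 ^ n"
        using nz by (simp add: c_def \<epsilon>_def zpow)
      then show ?thesis unfolding p by (simp add: F)
    qed
    then have "\<forall>\<^sub>F n in sequentially. fps_nth F n = c j * real n powr (-3/2) * z0 powi (- int n) * (1 + \<epsilon> j n)"
      by (rule eventually_sequentiallyI[of 1])
    then show "\<forall>\<^sub>F n in residue_filter d j. fps_nth F n = c j * real n powr (-3/2) * z0 powi (- int n) * (1 + \<epsilon> j n)"
      by (rule filter_leD[rotated]) (simp add: residue_filter_def)
  qed
  \<comment> \<open>For a residue outside J the real part of C vanishes, and only the error term E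
    is left.\<close>
  have rest: "fps_nth F \<in> O[residue_filter d j](\<lambda>n. real n powr (-5/2) * z0 powi (- int n))" if j: "j \<in> {0..<d} - J" for j
  proof (rule bigo_residue_filterI)
    have "(\<lambda>n. \<kappa> * E n * z0 powi (- int n)) \<in> O(\<lambda>n. real n powr (-5/2) * z0 powi (- int n))"
      using E \<kappa> by (intro landau_o.big.mult) simp_all
    then show "(\<lambda>n. \<kappa> * E n * z0 powi (- int n)) \<in> O(\<lambda>n. real n powr (-5/2) * z0 powi (- int n))" .
    show "fps_nth F n = \<kappa> * E n * z0 powi (- int n)" if "n mod d = j" for n
    proof -
      have "Re (C n) = 0" using Cmod[of n] that j by (simp add: J_def)
      then show ?thesis by (simp add: F E_def zpow)
    qed
  qed
  show ?thesis unfolding periodic_coeff_asymptotics_def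
    by (intro exI[of _ d] exI[of _ J] exI[of _ c] conjI ballI main disjI2 rest) (use d Jne in \<open>auto simp: J_def\<close>)
qed

end
end

section \<open>From the catalytic equation to the critical walk\<close>

text \<open>\<open>Suc i\<close> counts the outer factor z of the equation. The operators Delta and
  Delta2 read the unknown 1 and 2 levels higher, which as a step of the walk is a descent by b + 2
  c.\<close>

fun step_length up_step down_step alpha_degree :: "nat \<times> nat \<times> nat \<times> nat \<times> nat \<Rightarrow> nat" where
  "step_length (i, j, a, b, c) = Suc i"
| "up_step (i, j, a, b, c) = j"
| "down_step (i, j, a, b, c) = b + 2 * c"
| "alpha_degree (i, j, a, b, c) = a + b + c"

definition steps :: "poly5 \<Rightarrow> (nat \<times> nat \<times> nat \<times> nat \<times> nat) set" where
  "steps Q = {m \<in> Poly_Mapping.keys Q. alpha_degree m = 1}"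

text \<open>For Q linear in the alphas the monomials summed here are exactly those free of the
  alphas.\<close>

definition source :: "poly5 \<Rightarrow> nat \<Rightarrow> nat \<Rightarrow> real" where
  "source Q l n = (\<Sum>m \<in> Poly_Mapping.keys Q - steps Q. if up_step m = l \<and> step_length m = n then Poly_Mapping.lookup Q m else 0)"

lemma finite_steps: "finite (steps Q)" by (simp add: steps_def)

lemma step_length_pos: "step_length m \<ge> 1" by (cases m) auto

lemma down_step_le: "m \<in> steps Q \<Longrightarrow> down_step m \<le> 2" by (cases m) (auto simp: steps_def)

text \<open>Stated over a general ring, for it serves twice: for the actual series in z, and for the
  generic series that defines the dependency graph.\<close>

lemma catalytic_rhs_nth:
  assumes "linear_in_alphas Q"
  shows "fps_nth (catalytic_rhs h z Q M) l =
    (\<Sum>m\<in>Poly_Mapping.keys Q. z * (h (Poly_Mapping.lookup Q m) * z ^ (step_length m - 1)) *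
      (if m \<in> steps Q then if up_step m \<le> l then fps_nth M (l - up_step m + down_step m) else 0 else if up_step m = l then 1 else 0))"
proof -
  have "fps_nth (case m of (i, j, a, b, c) \<Rightarrow> fps_const (h (Poly_Mapping.lookup Q (i, j, a, b, c)) * z ^ i) * fps_X ^ j *
        M ^ a * fps_shift 1 M ^ b * fps_shift 2 M ^ c) l = (h (Poly_Mapping.lookup Q m) * z ^ (step_length m - 1)) *
      (if m \<in> steps Q then if up_step m \<le> l then fps_nth M (l - up_step m + down_step m) else 0 else if up_step m = l then 1 else 0)"
    if m: "m \<in> Poly_Mapping.keys Q" for m
  proof -
    obtain i j a b c where mm: "m = (i, j, a, b, c)" by (cases m)
    define N where "N = M ^ a * fps_shift 1 M ^ b * fps_shift 2 M ^ c"
    have "a + b + c \<le> 1" using assms m by (auto simp: linear_in_alphas_def mm)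
    then consider "a = 0" "b = 0" "c = 0" | "a = 1" "b = 0" "c = 0" | "a = 0" "b = 1" "c = 0" | "a = 0" "b = 0" "c = 1"
      by linarith
    then have N: "fps_nth N k = (if m \<in> steps Q then fps_nth M (k + down_step m) else if k = 0 then 1 else 0)" for k
      by cases (use m in \<open>simp_all add: N_def mm steps_def\<close>)
    have "fps_nth (fps_const (h (Poly_Mapping.lookup Q m) * z ^ i) * fps_X ^ j * N) l
        = (h (Poly_Mapping.lookup Q m) * z ^ i) * (if l < j then 0 else fps_nth N (l - j))"
      by (simp only: mult.assoc fps_mult_left_const_nth fps_X_power_mult_nth)
    moreover have "(if l < j then 0 else fps_nth N (l - j)) = (if m \<in> steps Q then if up_step m \<le> l then fps_nth M (l - up_step m + down_step m) else 0 else if up_step m = l then 1 else 0)"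
      unfolding N by (auto simp: mm)
    moreover have "(case m of (i, j, a, b, c) \<Rightarrow> fps_const (h (Poly_Mapping.lookup Q (i, j, a, b, c)) * z ^ i) * fps_X ^ j *
        M ^ a * fps_shift 1 M ^ b * fps_shift 2 M ^ c) = fps_const (h (Poly_Mapping.lookup Q m) * z ^ i) * fps_X ^ j * N"
      by (simp add: mm N_def mult.assoc)
    ultimately show ?thesis by (simp add: mm)
  qed
  then show ?thesis
    unfolding catalytic_rhs_def fps_mult_left_const_nth fps_sum_nth sum_distrib_left mult.assoc[of z] by (intro sum.cong refl arg_cong[of _ _ "(*) z"])
qed

lemma coeff_recurrence:
  assumes lin: "linear_in_alphas Q" and sol: "solves_catalytic Q M"
  defines "B \<equiv> \<lambda>l n. fps_nth (fps_nth M l) n"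
  shows "B l n = source Q l n + (\<Sum>m\<in>steps Q. if up_step m \<le> l \<and> step_length m \<le> n
     then Poly_Mapping.lookup Q m * B (l - up_step m + down_step m) (n - step_length m) else 0)"
proof -
  have mono: "fps_nth (fps_X * (fps_const r * fps_X ^ (step_length m - 1)) * g) n = (if step_length m \<le> n then r * fps_nth g (n - step_length m) else 0)"
    for r m and g :: "real fps"
  proof -
    obtain k where k: "step_length m = Suc k" using step_length_pos[of m] by (cases "step_length m") auto
    have "fps_X * (fps_const r * fps_X ^ (step_length m - 1)) * g = fps_const r * (fps_X ^ step_length m * g)"
      by (simp only: k power_Suc diff_Suc_1 mult_ac)
    then show ?thesis by (simp only: fps_mult_left_const_nth fps_X_power_mult_nth) auto
  qed
  let ?t = "\<lambda>m. fps_nth (fps_X * (fps_const (Poly_Mapping.lookup Q m) * fps_X ^ (step_length m - 1)) *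
      (if m \<in> steps Q then if up_step m \<le> l then fps_nth M (l - up_step m + down_step m) else 0 else if up_step m = l then 1 else 0)) n"
  have "B l n = fps_nth (fps_nth (catalytic_rhs fps_const fps_X Q M) l) n"
    using sol unfolding B_def solves_catalytic_def by simp
  also have "\<dots> = (\<Sum>m\<in>Poly_Mapping.keys Q. ?t m)" unfolding catalytic_rhs_nth[OF lin] fps_sum_nth ..
  also have "\<dots> = (\<Sum>m\<in>Poly_Mapping.keys Q - steps Q. ?t m) + (\<Sum>m\<in>steps Q. ?t m)"
    by (rule sum.subset_diff) (auto simp: steps_def)
  also have "(\<Sum>m\<in>Poly_Mapping.keys Q - steps Q. ?t m) = source Q l n"
    unfolding source_def mono by (intro sum.cong refl) auto
  also have "(\<Sum>m\<in>steps Q. ?t m) = (\<Sum>m\<in>steps Q. if up_step m \<le> l \<and> step_length m \<le> n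
     then Poly_Mapping.lookup Q m * B (l - up_step m + down_step m) (n - step_length m) else 0)"
    unfolding mono by (intro sum.cong refl) (auto simp: B_def)
  finally show ?thesis .
qed

section \<open>From the dependency graph to the steps of the walk\<close>

lemma mpoly_const_mult: "mpoly_const f * mpoly_const g = mpoly_const (f * g)"
  by (simp add: mpoly_const_def Poly_Mapping.mult_single)

lemma mpoly_const_power: "mpoly_const f ^ n = mpoly_const (f ^ n)"
  by (induction n) (simp_all add: mpoly_const_mult, simp add: mpoly_const_def)

lemma partial_deriv_nonzero:
  assumes "partial_deriv i p \<noteq> 0" shows "\<exists>m\<in>Poly_Mapping.keys p. Poly_Mapping.lookup m i \<noteq> 0"
proof (rule ccontr)
  assume "\<not> ?thesis"
  then have "partial_deriv i p = 0" unfolding partial_deriv_def by (intro sum.neutral) simp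
  with assms show False by simp
qed

text \<open>A nonzero derivative needs a monomial containing the i-th unknown. Source terms
  contribute constants only, and a step contributes the single unknown at its starting level;
  cancellation in the sum could only remove monomials.\<close>

lemma dependency_step:
  assumes lin: "linear_in_alphas Q" and e: "(i, l) \<in> dependency_graph Q"
  obtains m where "m \<in> steps Q" "up_step m \<le> l" "i = l - up_step m + down_step m"
proof -
  define t where "t = (\<lambda>m. if m \<in> steps Q then if up_step m \<le> l then unknown (l - up_step m + down_step m) else 0 else if up_step m = l then 1 else 0)"
  define k where "k = (\<lambda>m. fps_X * (fps_const (Poly_Mapping.lookup Q m) * fps_X ^ (step_length m - 1)))"
  have "system_rhs Q l = (\<Sum>m\<in>Poly_Mapping.keys Q. mpoly_const (k m) * t m)"
    unfolding system_rhs_def catalytic_rhs_nth[OF lin] mpoly_const_power mpoly_const_mult fps_nth_Abs_fps t_def k_def ..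
  moreover have "partial_deriv i (system_rhs Q l) \<noteq> 0" using e by (simp add: dependency_graph_def)
  then obtain w where w: "w \<in> Poly_Mapping.keys (system_rhs Q l)" "Poly_Mapping.lookup w i \<noteq> 0" using partial_deriv_nonzero by blast
  ultimately obtain m where m: "m \<in> Poly_Mapping.keys Q" "w \<in> Poly_Mapping.keys (mpoly_const (k m) * t m)"
    using Poly_Mapping.keys_sum[of "\<lambda>m. mpoly_const (k m) * t m" "Poly_Mapping.keys Q"] by fastforce
  have "m \<in> steps Q \<and> up_step m \<le> l"
  proof (rule ccontr)
    assume "\<not> (m \<in> steps Q \<and> up_step m \<le> l)"
    then have "t m = 0 \<or> t m = 1" by (auto simp: t_def)
    then have "w = 0" using m(2) by (auto simp: mpoly_const_def split: if_splits)
    with w(2) show False by simp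
  qed
  moreover from this have "mpoly_const (k m) * t m = Poly_Mapping.single (Poly_Mapping.single (l - up_step m + down_step m) 1) (k m)"
    by (simp add: t_def mpoly_const_def unknown_def Poly_Mapping.mult_single)
  then have "w = Poly_Mapping.single (l - up_step m + down_step m) 1" using m(2) by (simp split: if_splits)
  then have "i = l - up_step m + down_step m" using w(2) by (simp add: lookup_single when_def split: if_splits)
  ultimately show ?thesis using that by blast
qed

text \<open>With u = exp t the step sum f z t is a sum of exponentials in t. An ascending and a
  descending step confine t and z, so there is a largest z with f z t \<le> 1 for some t. Then f z
  \<ge> 1 throughout with equality at t, and the vanishing derivative at this minimum is the zero
  drift.\<close>

lemma critical_point:
  fixes q :: "'i \<Rightarrow> real" and dz up dn :: "'i \<Rightarrow> nat"
  assumes fin: "finite I" and q: "\<And>i. i \<in> I \<Longrightarrow> q i > 0" and dz: "\<And>i. i \<in> I \<Longrightarrow> dz i \<ge> 1"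
    and asc: "\<exists>i\<in>I. dn i < up i" and desc: "\<exists>i\<in>I. up i < dn i"
  obtains z u :: real where "z > 0" "u > 0" "(\<Sum>i\<in>I. q i * z ^ dz i * u ^ up i / u ^ dn i) = 1"
    "(\<Sum>i\<in>I. (q i * z ^ dz i * u ^ up i / u ^ dn i) * (real (up i) - real (dn i))) = 0"
proof -
  define e where "e = (\<lambda>i. real (up i) - real (dn i))"
  define f where "f = (\<lambda>z t. \<Sum>i\<in>I. q i * z ^ dz i * exp (e i * t))"
  obtain a b where a: "a \<in> I" "dn a < up a" and b: "b \<in> I" "up b < dn b" using asc desc by blast
  have ea: "e a \<ge> 1" "e b \<le> -1" using a b by (auto simp: e_def)
  \<comment> \<open>Small enough that f z1 0 \<le> 1, so K is not empty; as a positive lower bound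
    for z it also keeps the bounds on t finite.\<close>
  define z1 where "z1 = 1 / (1 + (\<Sum>i\<in>I. q i))"
  have sq: "(\<Sum>i\<in>I. q i) \<ge> 0" using q by (intro sum_nonneg) (auto intro: less_imp_le)
  have z1: "0 < z1" "z1 \<le> 1" using sq by (auto simp: z1_def)
  have ge: "q i * z ^ dz i * exp (e i * t) \<le> f z t" if "i \<in> I" "z \<ge> 0" for i z t
    unfolding f_def using that q less_imp_le by (intro member_le_sum fin) (auto intro!: mult_nonneg_nonneg)
  have f1: "f z1 0 \<le> 1"
  proof -
    have "f z1 0 \<le> (\<Sum>i\<in>I. q i * z1)" unfolding f_def
    proof (rule sum_mono)
      fix i assume i: "i \<in> I"
      have "z1 ^ dz i \<le> z1 ^ 1" using z1 dz[OF i] by (intro power_decreasing) auto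
      then show "q i * z1 ^ dz i * exp (e i * 0) \<le> q i * z1" using q[OF i] by simp
    qed
    also have "\<dots> = (\<Sum>i\<in>I. q i) * z1" by (simp add: sum_distrib_right)
    also have "\<dots> \<le> 1" using sq by (simp add: z1_def)
    finally show ?thesis .
  qed
  define K where "K = {x. z1 \<le> fst x \<and> f (fst x) (snd x) \<le> 1}"
  have zb: "z \<le> 1 + 1 / q i" if "i \<in> I" "z \<ge> 0" "q i * z ^ dz i \<le> 1" for i z
  proof (cases "z \<le> 1")
    case False
    have "q i * z ^ 1 \<le> q i * z ^ dz i" using q[OF that(1)] dz[OF that(1)] False by (intro mult_left_mono power_increasing) auto
    then have "q i * z \<le> 1" using that(3) by simp
    then have "z \<le> 1 / q i" using q[OF that(1)] by (simp add: field_simps)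
    then show ?thesis by simp
  qed (use q[OF that(1)] in \<open>simp add: add_increasing2\<close>)
  have tb: "s \<le> 1 / (q i * z1 ^ dz i)" if i: "i \<in> I" and z: "z1 \<le> z" "q i * z ^ dz i * exp c \<le> 1" "s \<ge> 0 \<Longrightarrow> s \<le> c" for i z c s
  proof (cases "s \<ge> 0")
    case True
    have "s \<le> exp c" using z(3)[OF True] exp_ge_add_one_self[of c] by linarith
    then have "q i * z1 ^ dz i * s \<le> q i * z ^ dz i * exp c" using q[OF i] z1 z True by (intro mult_mono power_mono) auto
    then have "q i * z1 ^ dz i * s \<le> 1" using z(2) by simp
    then show ?thesis using q[OF i] z1 by (simp add: field_simps)
  next
    case False
    then have "s \<le> 0" by simp
    also have "0 \<le> 1 / (q i * z1 ^ dz i)" using q[OF i] z1 by simp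
    finally show ?thesis .
  qed
  have "bounded K"
  proof (rule bounded_subset)
    show "bounded ({0..(1 + 1 / q a) + (1 + 1 / q b)} \<times> {- (1 / (q b * z1 ^ dz b))..1 / (q a * z1 ^ dz a)})"
      by (intro bounded_Times bounded_closed_interval)
    show "K \<subseteq> {0..(1 + 1 / q a) + (1 + 1 / q b)} \<times> {- (1 / (q b * z1 ^ dz b))..1 / (q a * z1 ^ dz a)}"
    proof
      fix x assume "x \<in> K"
      then obtain z t where x: "x = (z, t)" "z1 \<le> z" "f z t \<le> 1" by (cases x) (auto simp: K_def)
      have z0: "z \<ge> 0" using z1 x by simp
      have A: "q a * z ^ dz a * exp (e a * t) \<le> 1" "q b * z ^ dz b * exp (e b * t) \<le> 1"
        using ge[OF a(1) z0, of t] ge[OF b(1) z0, of t] x(3) by auto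
      have "t \<le> 1 / (q a * z1 ^ dz a)"
      proof (rule tb[OF a(1) x(2) A(1)])
        show "t \<le> e a * t" if "t \<ge> 0" using mult_right_mono[OF ea(1) that] by simp
      qed
      moreover have "- t \<le> 1 / (q b * z1 ^ dz b)"
      proof (rule tb[OF b(1) x(2) A(2)])
        show "- t \<le> e b * t" if "- t \<ge> 0"
        proof -
          have "- e b \<ge> 1" using ea by simp
          from mult_right_mono[OF this that] show ?thesis by simp
        qed
      qed
      moreover have "z \<le> (1 + 1 / q a) + (1 + 1 / q b)"
      proof (cases "t \<ge> 0")
        case True
        have "q a * z ^ dz a * 1 \<le> q a * z ^ dz a * exp (e a * t)" using True ea q[OF a(1)] z0 by (intro mult_left_mono) auto
        then have "z \<le> 1 + 1 / q a" using A(1) z0 by (intro zb a) auto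
        moreover have "1 / q b > 0" using q[OF b(1)] by simp
        ultimately show ?thesis by linarith
      next
        case False
        then have "e b * t \<ge> 0" using ea by (intro mult_nonpos_nonpos) auto
        then have "q b * z ^ dz b * 1 \<le> q b * z ^ dz b * exp (e b * t)" using q[OF b(1)] z0 by (intro mult_left_mono) auto
        then have "z \<le> 1 + 1 / q b" using A(2) z0 by (intro zb b) auto
        moreover have "1 / q a > 0" using q[OF a(1)] by simp
        ultimately show ?thesis by linarith
      qed
      ultimately show "x \<in> {0..(1 + 1 / q a) + (1 + 1 / q b)} \<times> {- (1 / (q b * z1 ^ dz b))..1 / (q a * z1 ^ dz a)}"
        using x(1) z0 by auto
    qed
  qed
  moreover have "closed K" unfolding K_def f_def
    by (intro closed_Collect_conj closed_Collect_le continuous_intros)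
  ultimately have "compact K" by (simp add: compact_eq_bounded_closed)
  moreover have "(z1, 0) \<in> K" using f1 by (simp add: K_def)
  ultimately obtain x where x: "x \<in> K" "\<And>y. y \<in> K \<Longrightarrow> fst y \<le> fst x"
    using continuous_attains_sup[of K fst] continuous_on_fst[OF continuous_on_id, of K] by blast
  define z where "z = fst x" define t where "t = snd x"
  have zt: "z1 \<le> z" "f z t \<le> 1" using x(1) by (auto simp: K_def z_def t_def)
  have z0: "z > 0" using z1 zt by simp
  \<comment> \<open>If f z s < 1 for some s, continuity in z would put a larger z into K.\<close>
  have ge1: "f z s \<ge> 1" for s
  proof (rule ccontr)
    assume "\<not> f z s \<ge> 1"
    then have lt: "f z s < 1" by simp
    have "isCont (\<lambda>y. f y s) z" unfolding f_def by (intro continuous_intros)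
    then have "((\<lambda>y. f y s) \<longlongrightarrow> f z s) (at_right z)" unfolding isCont_def by (rule filterlim_mono) (auto simp: at_le)
    from order_tendstoD(2)[OF this lt] have "\<forall>\<^sub>F y in at_right z. f y s < 1" .
    moreover have "\<forall>\<^sub>F y in at_right z. z < y" by (simp add: eventually_at_right_less)
    ultimately have "\<forall>\<^sub>F y in at_right z. f y s < 1 \<and> z < y" by (rule eventually_conj)
    then obtain y where y: "f y s < 1" "z < y" using eventually_happens'[OF trivial_limit_at_right_real] by blast
    then have "(y, s) \<in> K" using zt by (simp add: K_def)
    from x(2)[OF this] y show False by (simp add: z_def)
  qed
  have f_eq: "f z t = 1" using zt(2) ge1[of t] by simp
  have der: "((\<lambda>s. f z s) has_field_derivative (\<Sum>i\<in>I. q i * z ^ dz i * (exp (e i * t) * e i))) (at t)"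
    unfolding f_def by (auto intro!: derivative_eq_intros sum.cong simp: mult_ac)
  have d0: "(\<Sum>i\<in>I. q i * z ^ dz i * (exp (e i * t) * e i)) = 0"
    by (rule DERIV_local_min[OF der, of 1]) (use ge1 f_eq in auto)
  have ex: "exp (e i * t) = exp t ^ up i / exp t ^ dn i" for i
    by (simp add: e_def left_diff_distrib exp_diff exp_of_nat_mult)
  show ?thesis
  proof (rule that[of z "exp t"])
    show "(\<Sum>i\<in>I. q i * z ^ dz i * exp t ^ up i / exp t ^ dn i) = 1"
      using f_eq unfolding f_def ex by simp
    show "(\<Sum>i\<in>I. (q i * z ^ dz i * exp t ^ up i / exp t ^ dn i) * (real (up i) - real (dn i))) = 0"
      using d0 unfolding ex by (simp add: e_def mult_ac)
  qed (use z0 in auto)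
qed

text \<open>Every reflexive and transitive relation that the steps respect holds along paths. Under
  strong connectivity it holds between all levels; this refutes one-sided motion and a common
  period, and it compares the coefficients of any two levels.\<close>

lemma dependency_invariant:
  assumes lin: "linear_in_alphas Q" and path: "(i, l) \<in> (dependency_graph Q)\<^sup>*"
    and refl: "\<And>i. P i i" and trans: "\<And>i j l. P i j \<Longrightarrow> P j l \<Longrightarrow> P i l"
    and step: "\<And>m l. m \<in> steps Q \<Longrightarrow> up_step m \<le> l \<Longrightarrow> P (l - up_step m + down_step m) l"
  shows "P i l"
  using path
proof (induction rule: rtrancl_induct)
  case (step j l)
  obtain m where m: "m \<in> steps Q" "up_step m \<le> l" "j = l - up_step m + down_step m"
    by (rule dependency_step[OF lin step(2)]) (rule that)
  then have "P j l" using assms(5)[OF m(1,2)] by simp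
  with step.IH show ?case by (rule trans)
qed (rule refl)

context
  fixes Q :: poly5 and M :: "real fps fps"
  assumes nonneg: "nonneg_coeffs Q" and lin: "linear_in_alphas Q" and sol: "solves_catalytic Q M"
    and nz: "M \<noteq> 0" and conn: "strongly_connected_system Q"
begin

abbreviation (input) "weight m \<equiv> Poly_Mapping.lookup Q m"

lemma conn_invariant:
  assumes "\<And>i. P i i" "\<And>i j l. P i j \<Longrightarrow> P j l \<Longrightarrow> P i l"
    "\<And>m l. m \<in> steps Q \<Longrightarrow> up_step m \<le> l \<Longrightarrow> P (l - up_step m + down_step m) l"
  shows "P i l"
  by (rule dependency_invariant[OF lin _ assms]) (use conn in \<open>auto simp: strongly_connected_system_def\<close>)

lemma weight_pos: "m \<in> steps Q \<Longrightarrow> weight m > 0"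
  using nonneg[unfolded nonneg_coeffs_def, rule_format, of m] by (simp add: steps_def in_keys_iff less_le)

lemma steps_ascend: "\<exists>m\<in>steps Q. down_step m < up_step m"
proof (rule ccontr)
  assume "\<not> ?thesis"
  then have *: "up_step m \<le> down_step m" if "m \<in> steps Q" for m using that by auto
  have "(1::nat) \<le> 0"
    by (rule conn_invariant[where P = "\<lambda>i l. l \<le> i"]) (use * in \<open>fastforce+\<close>)
  then show False by simp
qed

lemma steps_descend: "\<exists>m\<in>steps Q. up_step m < down_step m"
proof (rule ccontr)
  assume "\<not> ?thesis"
  then have *: "down_step m \<le> up_step m" if "m \<in> steps Q" for m using that by auto
  have "(1::nat) \<le> 0"
    by (rule conn_invariant[where P = "\<lambda>i l. i \<le> l"]) (use * in \<open>fastforce+\<close>)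
  then show False by simp
qed

lemma steps_aperiodic:
  fixes w :: complex
  assumes "\<And>m. m \<in> steps Q \<Longrightarrow> w ^ up_step m = w ^ down_step m"
  shows "w = 1"
proof -
  have "w ^ 1 = w ^ 0"
  proof (rule conn_invariant[where P = "\<lambda>i l. w ^ i = w ^ l"])
    fix m l assume m: "m \<in> steps Q" "up_step m \<le> l"
    have "w ^ (l - up_step m + down_step m) = w ^ (l - up_step m) * w ^ up_step m" using assms[OF m(1)] by (simp add: power_add)
    also have "\<dots> = w ^ l" using m(2) by (simp flip: power_add)
    finally show "w ^ (l - up_step m + down_step m) = w ^ l" .
  qed auto
  then show ?thesis by simp
qed

abbreviation (input) "mcoeff l n \<equiv> fps_nth (fps_nth M l) n"

lemma source_nonneg: "source Q l n \<ge> 0"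
  unfolding source_def using nonneg by (intro sum_nonneg) (auto simp: nonneg_coeffs_def)

lemma mcoeff_nonneg: "mcoeff l n \<ge> 0"
proof (induction n arbitrary: l rule: less_induct)
  case (less n)
  show ?case
  proof (subst coeff_recurrence[OF lin sol], intro add_nonneg_nonneg sum_nonneg source_nonneg)
    fix m assume m: "m \<in> steps Q"
    show "0 \<le> (if up_step m \<le> l \<and> step_length m \<le> n then weight m * mcoeff (l - up_step m + down_step m) (n - step_length m) else 0)"
      using less[of "n - step_length m"] weight_pos[OF m] step_length_pos[of m] by auto
  qed
qed

lemma mcoeff_comparison: "\<exists>c>0. \<exists>k. \<forall>n. c * mcoeff i n \<le> mcoeff l (n + k)"
proof (rule conn_invariant[where P = "\<lambda>i l. \<exists>c>0. \<exists>k. \<forall>n. c * mcoeff i n \<le> mcoeff l (n + k)"])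
  show "\<exists>c>0. \<exists>k. \<forall>n. c * mcoeff i n \<le> mcoeff i (n + k)" for i by (intro exI[of _ 1] conjI exI[of _ "0 :: nat"] allI) auto
next
  fix i j l assume "\<exists>c>0. \<exists>k. \<forall>n. c * mcoeff i n \<le> mcoeff j (n + k)" "\<exists>c>0. \<exists>k. \<forall>n. c * mcoeff j n \<le> mcoeff l (n + k)"
  then obtain c k c' k' where c: "c > 0" "c' > 0" "\<And>n. c * mcoeff i n \<le> mcoeff j (n + k)" "\<And>n. c' * mcoeff j n \<le> mcoeff l (n + k')" by blast
  show "\<exists>c>0. \<exists>k. \<forall>n. c * mcoeff i n \<le> mcoeff l (n + k)"
  proof (intro exI[of _ "c' * c"] exI[of _ "k + k'"] conjI allI)
    fix n
    have "c' * (c * mcoeff i n) \<le> c' * mcoeff j (n + k)" using c by (intro mult_left_mono) auto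
    also have "\<dots> \<le> mcoeff l (n + k + k')" by (rule c(4))
    finally show "c' * c * mcoeff i n \<le> mcoeff l (n + (k + k'))" by (simp add: mult.assoc add.assoc)
  qed (use c in simp)
next
  fix m l assume m: "m \<in> steps Q" "up_step m \<le> l"
  show "\<exists>c>0. \<exists>k. \<forall>n. c * mcoeff (l - up_step m + down_step m) n \<le> mcoeff l (n + k)"
  proof (intro exI[of _ "weight m"] exI[of _ "step_length m"] conjI allI weight_pos m)
    fix n
    define t where "t = (\<lambda>m'. if up_step m' \<le> l \<and> step_length m' \<le> n + step_length m
      then weight m' * mcoeff (l - up_step m' + down_step m') (n + step_length m - step_length m') else 0)"
    have "t m \<le> (\<Sum>m'\<in>steps Q. t m')"
    proof (rule member_le_sum[OF m(1) _ finite_steps])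
      show "0 \<le> t m'" if "m' \<in> steps Q - {m}" for m'
        using that weight_pos[of m'] mcoeff_nonneg by (simp add: t_def)
    qed
    also have "\<dots> \<le> mcoeff l (n + step_length m)"
      unfolding coeff_recurrence[OF lin sol, of l "n + step_length m"] t_def using source_nonneg by simp
    finally show "weight m * mcoeff (l - up_step m + down_step m) n \<le> mcoeff l (n + step_length m)" using m(2) by (simp add: t_def)
  qed
qed

theorem catalytic_square_root:
  "\<exists>z0::real. z0 > 0 \<and> (\<forall>l<2. fps_conv_radius (fps_nth M l) = ereal z0 \<and>
     sqrt_singularity (complex_fps (fps_nth M l)) (complex_of_real z0) \<and>
     periodic_coeff_asymptotics (fps_nth (fps_nth M l)) z0)"
proof -
  obtain z \<tau> :: real where zt: "z > 0" "\<tau> > 0"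
    "(\<Sum>m\<in>steps Q. weight m * z ^ step_length m * \<tau> ^ up_step m / \<tau> ^ down_step m) = 1"
    "(\<Sum>m\<in>steps Q. (weight m * z ^ step_length m * \<tau> ^ up_step m / \<tau> ^ down_step m) * (real (up_step m) - real (down_step m))) = 0"
    by (rule critical_point[of "steps Q" weight step_length down_step up_step, OF finite_steps weight_pos step_length_pos steps_ascend steps_descend])
      (assumption, rule that)
  define p where "p = (\<lambda>m. weight m * z ^ step_length m * \<tau> ^ up_step m / \<tau> ^ down_step m)"
  define A where "A = (\<lambda>l n. mcoeff l n * z ^ n * \<tau> ^ l)"
  define src where "src = (\<lambda>l n. source Q l n * z ^ n * \<tau> ^ l)"
  \<comment> \<open>A crude common bound: the sum over all monomials dominates each single
    degree.\<close>
  define S where "S = (\<Sum>m\<in>Poly_Mapping.keys Q. up_step m + step_length m)"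
  have S: "up_step m \<le> S" "step_length m \<le> S" if "m \<in> Poly_Mapping.keys Q" for m
    using member_le_sum[of m "Poly_Mapping.keys Q" "\<lambda>m. up_step m + step_length m"] that by (auto simp: S_def)
  interpret critical_system "steps Q" p step_length up_step down_step S src A
  proof
    show "finite (steps Q)" by (rule finite_steps)
    show "p m > 0" if "m \<in> steps Q" for m using weight_pos[OF that] zt by (simp add: p_def)
    show "step_length m \<ge> 1" for m by (rule step_length_pos)
    show "down_step m \<le> 2" if "m \<in> steps Q" for m using that by (rule down_step_le)
    show "(\<Sum>m\<in>steps Q. p m) = 1" "(\<Sum>m\<in>steps Q. p m * (real (up_step m) - real (down_step m))) = 0"
      using zt by (simp_all add: p_def)
    show "\<exists>m\<in>steps Q. up_step m < down_step m" "\<exists>m\<in>steps Q. down_step m < up_step m"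
      by (fact steps_descend, fact steps_ascend)
    show "w = 1" if "norm w = 1" "\<And>m. m \<in> steps Q \<Longrightarrow> w ^ up_step m = w ^ down_step m" for w :: complex
      using that(2) by (rule steps_aperiodic)
    show "src l n \<ge> 0" for l n using source_nonneg zt by (simp add: src_def)
    show "src l n = 0" if "S < l \<or> S < n" for l n
    proof -
      have "source Q l n = 0" unfolding source_def
        by (intro sum.neutral ballI) (use S that in \<open>force dest: leD\<close>)
      then show ?thesis by (simp add: src_def)
    qed
    show "A l n = src l n + (\<Sum>m\<in>steps Q. if up_step m \<le> l \<and> step_length m \<le> n
        then p m * A (l - up_step m + down_step m) (n - step_length m) else 0)" for l n
    proof -
      have "weight m * mcoeff (l - up_step m + down_step m) (n - step_length m) * z ^ n * \<tau> ^ l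
          = p m * A (l - up_step m + down_step m) (n - step_length m)" if "up_step m \<le> l" "step_length m \<le> n" for m
      proof -
        have "z ^ n = z ^ step_length m * z ^ (n - step_length m)" "\<tau> ^ l = \<tau> ^ up_step m * \<tau> ^ (l - up_step m)"
          using that by (simp_all flip: power_add)
        then show ?thesis using zt by (simp add: p_def A_def power_add)
      qed
      then show ?thesis
        unfolding A_def coeff_recurrence[OF lin sol, of l n] src_def distrib_right sum_distrib_right
        by (intro arg_cong2[of _ _ _ _ "(+)"] refl sum.cong) (auto simp: A_def)
    qed
    show "\<exists>c>0. \<exists>k. \<forall>n. c * A l n \<le> A l' (n + k)" for l l'
    proof -
      obtain c k where c: "c > 0" "\<And>n. c * mcoeff l n \<le> mcoeff l' (n + k)" using mcoeff_comparison[of l l'] by blast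
      show ?thesis
      proof (intro exI[of _ "c * z ^ k * \<tau> ^ l' / \<tau> ^ l"] exI[of _ k] conjI allI)
        fix n
        have "c * mcoeff l n * (z ^ (n + k) * \<tau> ^ l') \<le> mcoeff l' (n + k) * (z ^ (n + k) * \<tau> ^ l')"
          using c zt by (intro mult_right_mono) auto
        then show "c * z ^ k * \<tau> ^ l' / \<tau> ^ l * A l n \<le> A l' (n + k)" using zt by (simp add: A_def power_add mult_ac)
      qed (use c zt in simp)
    qed
    obtain l where "fps_nth M l \<noteq> 0" using nz by (auto simp: fps_eq_iff[of M])
    then obtain n where "mcoeff l n \<noteq> 0" by (auto simp: fps_eq_iff[of "fps_nth M l"])
    then show "\<exists>l n. A l n \<noteq> 0" using zt by (intro exI[of _ l] exI[of _ n]) (simp add: A_def)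
  qed
  \<comment> \<open>The rescaling is undone with \<kappa> = 1 / \<tau>^l, which depends on the
    level, and with the critical z as common radius.\<close>
  have coeff: "fps_nth (fps_nth M l) n = 1 / \<tau> ^ l * A l n / z ^ n" for l n using zt by (simp add: A_def)
  have \<kappa>: "1 / \<tau> ^ l > 0" for l using zt by simp
  show ?thesis
    using fps_conv_radius_gf[OF zt(1) \<kappa> _ coeff] sqrt_singularity_gf[OF zt(1) \<kappa> _ coeff] coeff_asymptotics[OF zt(1) \<kappa> _ coeff] zt(1)
    by blast
qed

end

text \<open>The hypothesis \<open>M \<noteq> 0\<close> excludes a Q without a part free of the
  alphas, whose solution 0 has infinite radius of convergence.\<close>

theorem theorem1:
  fixes Q :: poly5 and M :: "real fps fps"
  assumes "nonneg_coeffs Q"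
    and "linear_in_alphas Q"
    and "solves_catalytic Q M"
    and "M \<noteq> 0"
    and "strongly_connected_system Q"
  shows "\<exists>z0::real. z0 > 0 \<and>
           fps_conv_radius (fps_nth M 0) = ereal z0 \<and>
           fps_conv_radius (fps_nth M 1) = ereal z0 \<and>
           sqrt_singularity (complex_fps (fps_nth M 0)) (complex_of_real z0) \<and>
           sqrt_singularity (complex_fps (fps_nth M 1)) (complex_of_real z0) \<and>
           periodic_coeff_asymptotics (fps_nth (fps_nth M 0)) z0 \<and>
           periodic_coeff_asymptotics (fps_nth (fps_nth M 1)) z0"
proof -
  obtain z0 :: real where "z0 > 0" and *: "\<And>l. l < 2 \<Longrightarrow> fps_conv_radius (fps_nth M l) = ereal z0 \<and>
     sqrt_singularity (complex_fps (fps_nth M l)) (complex_of_real z0) \<and>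
     periodic_coeff_asymptotics (fps_nth (fps_nth M l)) z0"
    using catalytic_square_root[OF assms] by blast
  then show ?thesis using *[of 0] *[of 1] by auto
qed

end
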